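(* Let $D\subset\mathbb R^d$, $d\ge 1$, be a bounded domain with $C^{2,\alpha}$-boundary ($\alpha\in(0,1]$), let $\mu$ be a probability measure on $D$, and let $V>0$ on $\bar D$. Let $L=\frac12\nabla\cdot a\nabla+b\cdot\nabla$ with formal adjoint $\tilde L=\frac12\nabla\cdot a\nabla-b\cdot\nabla-\nabla\cdot b$, where $a(x)$ is (symmetric) positive definite for each $x\in\bar D$. For $\epsilon>0$ let $D^\epsilon=\{x\in D:\mathrm{dist}(x,\partial D)<\epsilon\}$. Assume that for some $\epsilon>0$ the restriction of $\mu$ to $D^\epsilon$ possesses a density, also denoted $\mu$: $\mu(dx)|_{D^\epsilon}=\mu(x)\,dx$. Assume that for some integer $k\ge0$ the following hold. (1) If $k$ is even, $\mu\in C^k(\overline{D^\epsilon})$; if $k$ is odd, $\mu\in C^{k+1}(\overline{D^\epsilon})$. (2) If $k\ge1$, then $\frac{d^\beta\mu}{dx^\beta}\equiv0$ on $\partial D$ for all multi-indices $\beta$ with $|\beta|\le k-1$; and (for $k\ge0$) $\frac{d^\beta\mu}{dx^\beta}\not\equiv0$ on $\partial D$ for some $\beta$ with $|\beta|=k$. (3) $V\in C^{2,\alpha}(\bar D)$ if $k=0,2$; $V\in C^k(\bar D)$ if $k\ge4$ is even; $V\in C^{k+1}(\bar D)$ if $k$ is odd. (4) $a_{i,j},b_i\in C^{1,\alpha}(\bar D)$ if $k=0,1,2$; $a_{i,j},b_i\in C^{k-1}(\bar D)$ if $k\ge4$ is even; $a_{i,j},b_i\in C^k(\bar D)$ if $k\ge3$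 is odd. Let $n$ denote the inward unit normal to $D$ at $\partial D$ and $\sigma$ Lebesgue (surface) measure on $\partial D$. Let $f:\partial D\to\mathbb R$ be continuous and, for $\delta>0$, let $\phi_{\delta,\mu,V}$ denote the solution of the Dirichlet problem $$\delta L\phi+V\Big(\int_D\phi\,d\mu-\phi\Big)=0\ \text{ in } D,\qquad \phi=f\ \text{ on }\partial D.$$ Then for every $x\in D$ the limit $\lim_{\delta\to0}\phi_{\delta,\mu,V}(x)$ exists and equals a constant $\phi_{0,\mu,V}(f)$ independent of $x\in D$, given as follows. If $k$ is even, $$\phi_{0,\mu,V}(f)=\frac{\int_{\partial D}f\sqrt{n\cdot an}\;V^{-\frac{k+1}2}\,\tilde L^{\frac k2}\mu\,d\sigma}{\int_{\partial D}\sqrt{n\cdot an}\;V^{-\frac{k+1}2}\,\tilde L^{\frac k2}\mu\,d\sigma}.$$ If $k$ is odd, $$\phi_{0,\mu,V}(f)=\frac{\int_{\partial D}f\,V^{-\frac{k+1}2}\,a\nabla(\tilde L^{\frac{k-1}2}\mu)\cdot n\,d\sigma}{\int_{\partial D}V^{-\frac{k+1}2}\,a\nabla(\tilde L^{\frac{k-1}2}\mu)\cdot n\,d\sigma}.$$ In particular, if $k=0$, $$\phi_{0,\mu,V}(f)=\frac{\int_{\partial D}f\sqrt{n\cdot an}\,\frac{\mu}{\sqrt V}\,d\sigma}{\int_{\partial D}\sqrt{n\cdot an}\,\frac{\mu}{\sqrt V}\,d\sigma},$$ and if $k=1$, $$\phi_{0,\mu,V}(f)=\frac{\int_{\partial D}f\,V^{-1}a\nabla\mu\cdot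 n\,d\sigma}{\int_{\partial D}V^{-1}a\nabla\mu\cdot n\,d\sigma}.$$
   Context: Here $a=\{a_{i,j}\}_{i,j=1}^d$ and $b=\{b_i\}_{i=1}^d$; $\nabla\cdot a\nabla u=\sum_{i,j}\partial_i(a_{i,j}\partial_j u)$, and $\tilde L v=\frac12\nabla\cdot a\nabla v-b\cdot\nabla v-(\nabla\cdot b)v$. $\tilde L^m$ is the $m$-fold iterate of $\tilde L$ ($\tilde L^0$ is the identity), and $n\cdot an=\sum_{i,j}n_ia_{i,j}n_j$. On $\partial D$, the values of $\mu$ and its derivatives are those of the continuous extensions from $D^\epsilon$ to $\overline{D^\epsilon}$. When $d=1$, $\sigma$ is counting measure on the two-point set $\partial D$. Probabilistically, $\phi_{\delta,\mu,V}(x)=E_x f(X(\tau_D))$, where $X(t)$ is the Markov process that diffuses in $D$ according to $\delta L$, is stopped at $\partial D$ (at the exit time $\tau_D$), and while running jumps at spatially dependent rate $V$ to a new point with distribution $\mu$, repeating this behavior independently after each jump. *)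

theory Defs
  imports "HOL-Analysis.Analysis" "HOL-Probability.Probability"
begin

text \<open>
  Partial derivatives. A multi-index derivative of order \<open>m\<close> is represented by a list of \<open>m\<close>
  coordinate directions; the order of the list is immaterial for functions of class \<open>C\<^sup>m\<close>.
\<close>

definition partial :: "'n::finite \<Rightarrow> (real^'n \<Rightarrow> real) \<Rightarrow> real^'n \<Rightarrow> real" where
  "partial i g x = frechet_derivative g (at x) (axis i 1)"

definition partials :: "'n::finite list \<Rightarrow> (real^'n \<Rightarrow> real) \<Rightarrow> real^'n \<Rightarrow> real" where
  "partials is g = foldr partial is g"

text \<open>
  For open \<open>S\<close>: the classes \<open>C\<^sup>m(S)\<close>, \<open>C\<^sup>m\<close> on the closure of \<open>S\<close> (all derivatives of order at most
  \<open>m\<close> extend continuously from \<open>S\<close> to its closure, the function itself being its own extension), and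
  \<open>C\<^bsup>m,\<alpha>\<^esup>\<close> on the closure of \<open>S\<close> (in addition the derivatives of order \<open>m\<close> are uniformly
  \<open>\<alpha>\<close>-Hoelder continuous). Only values on the closure of \<open>S\<close> matter.
\<close>

definition Ck_on :: "nat \<Rightarrow> (real^'n::finite) set \<Rightarrow> (real^'n \<Rightarrow> real) \<Rightarrow> bool" where
  "Ck_on m S g \<longleftrightarrow>
     (\<forall>is. length is < m \<longrightarrow> (\<forall>x\<in>S. partials is g differentiable (at x))) \<and>
     (\<forall>is. length is \<le> m \<longrightarrow> continuous_on S (partials is g))"

definition Ck_closure :: "nat \<Rightarrow> (real^'n::finite) set \<Rightarrow> (real^'n \<Rightarrow> real) \<Rightarrow> bool" where
  "Ck_closure m S g \<longleftrightarrow>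
     Ck_on m S g \<and> continuous_on (closure S) g \<and>
     (\<forall>is. length is \<le> m \<longrightarrow>
        (\<exists>h. continuous_on (closure S) h \<and> (\<forall>x\<in>S. h x = partials is g x)))"

definition Ck_holder_closure ::
    "nat \<Rightarrow> real \<Rightarrow> (real^'n::finite) set \<Rightarrow> (real^'n \<Rightarrow> real) \<Rightarrow> bool" where
  "Ck_holder_closure m \<alpha> S g \<longleftrightarrow>
     Ck_closure m S g \<and>
     (\<forall>is. length is = m \<longrightarrow>
        (\<exists>C. \<forall>x\<in>S. \<forall>y\<in>S. \<bar>partials is g x - partials is g y\<bar> \<le> C * dist x y powr \<alpha>))"

definition boundary_value ::
    "(real^'n::finite) set \<Rightarrow> (real^'n \<Rightarrow> real) \<Rightarrow> real^'n \<Rightarrow> real" where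
  "boundary_value S g x = Lim (at x within S) g"

text \<open>
  Near each boundary point \<open>D\<close> is, up to relabelling and reorienting the coordinate axes, the region
  above the graph of a \<open>C\<^bsup>m,\<alpha>\<^esup>\<close> function \<open>\<gamma>\<close> of the remaining coordinates. A function of the
  remaining coordinates is a function on the whole space which does not depend on coordinate \<open>i\<close>;
  in dimension one it is a constant.
\<close>

definition Ck_holder_boundary :: "nat \<Rightarrow> real \<Rightarrow> (real^'n::finite) set \<Rightarrow> bool" where
  "Ck_holder_boundary m \<alpha> D \<longleftrightarrow>
     (\<forall>z\<in>frontier D. \<exists>r>0. \<exists>i. \<exists>s\<in>{-1, 1::real}. \<exists>\<gamma>.
        (\<forall>x t. \<gamma> (x + t *\<^sub>R axis i 1) = \<gamma> x) \<and>
        Ck_holder_closure m \<alpha> (ball z r) \<gamma> \<and>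
        D \<inter> ball z r = {x \<in> ball z r. s * x $ i > \<gamma> x})"

text \<open>
  Tangent vectors of the boundary are velocities of curves in it. In dimension one such curves have
  velocity zero, so the orthogonality condition is void there.
\<close>

definition inward_unit_normal :: "(real^'n::finite) set \<Rightarrow> real^'n \<Rightarrow> real^'n \<Rightarrow> bool" where
  "inward_unit_normal D x \<nu> \<longleftrightarrow>
     norm \<nu> = 1 \<and>
     (\<forall>c v. c 0 = x \<and> (\<forall>t::real. c t \<in> frontier D) \<and> (c has_vector_derivative v) (at 0)
        \<longrightarrow> \<nu> \<bullet> v = 0) \<and>
     (\<forall>\<^sub>F t in at_right (0::real). x + t *\<^sub>R \<nu> \<in> D)"

text \<open>
  The \<open>s\<close>-dimensional Hausdorff measure, normalised to agree with Lebesgue measure on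
  \<open>s\<close>-dimensional planes; for \<open>s = 0\<close> every nonempty covering set contributes 1 and the result is
  counting measure. The set function below is a metric outer measure, hence countably additive on
  the Borel sets, as \<^const>\<open>measure_of\<close> requires.
\<close>

definition hausdorff_outer :: "nat \<Rightarrow> 'a::metric_space set \<Rightarrow> ennreal" where
  "hausdorff_outer s A =
     (SUP r\<in>{0::real<..}.
        INF C\<in>{C::nat \<Rightarrow> 'a set. A \<subseteq> (\<Union>i. C i) \<and> (\<forall>i. bounded (C i) \<and> diameter (C i) \<le> r)}.
          (\<Sum>i. if C i = {} then 0
                else ennreal (unit_ball_vol (real s) * (diameter (C i) / 2) ^ s)))"

definition hausdorff_measure :: "nat \<Rightarrow> 'a::metric_space measure" where
  "hausdorff_measure s = measure_of UNIV (sets borel) (hausdorff_outer s)"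

definition boundary_integral :: "(real^'n::finite) set \<Rightarrow> (real^'n \<Rightarrow> real) \<Rightarrow> real" where
  "boundary_integral D g = (LINT x:frontier D|hausdorff_measure (CARD('n) - 1). g x)"

definition boundary_collar :: "(real^'n::finite) set \<Rightarrow> real \<Rightarrow> (real^'n) set" where
  "boundary_collar D \<epsilon> = {x \<in> D. infdist x (frontier D) < \<epsilon>}"

definition div_grad ::
    "(real^'n::finite \<Rightarrow> real^'n^'n) \<Rightarrow> (real^'n \<Rightarrow> real) \<Rightarrow> real^'n \<Rightarrow> real" where
  "div_grad a u x = (\<Sum>i\<in>UNIV. \<Sum>j\<in>UNIV. partial i (\<lambda>y. a y $ i $ j * partial j u y) x)"

definition diffusion_op ::
    "(real^'n::finite \<Rightarrow> real^'n^'n) \<Rightarrow> (real^'n \<Rightarrow> real^'n) \<Rightarrow> (real^'n \<Rightarrow> real) \<Rightarrow> real^'n \<Rightarrow> real" where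
  "diffusion_op a b u x = 1/2 * div_grad a u x + (\<Sum>i\<in>UNIV. b x $ i * partial i u x)"

definition adjoint_op ::
    "(real^'n::finite \<Rightarrow> real^'n^'n) \<Rightarrow> (real^'n \<Rightarrow> real^'n) \<Rightarrow> (real^'n \<Rightarrow> real) \<Rightarrow> real^'n \<Rightarrow> real" where
  "adjoint_op a b v x =
     1/2 * div_grad a v x - (\<Sum>i\<in>UNIV. b x $ i * partial i v x)
       - (\<Sum>i\<in>UNIV. partial i (\<lambda>y. b y $ i) x) * v x"

definition boundary_gradient ::
    "(real^'n::finite) set \<Rightarrow> (real^'n \<Rightarrow> real) \<Rightarrow> real^'n \<Rightarrow> real^'n" where
  "boundary_gradient S g x = (\<chi> i. boundary_value S (partial i g) x)"

text \<open>
  Classical solutions of the nonlocal Dirichlet problem; \<open>M\<close> is a probability measure whose space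
  is \<open>D\<close>.
\<close>

definition dirichlet_solution ::
    "(real^'n::finite) set \<Rightarrow> (real^'n \<Rightarrow> real^'n^'n) \<Rightarrow> (real^'n \<Rightarrow> real^'n) \<Rightarrow> (real^'n \<Rightarrow> real) \<Rightarrow>
     (real^'n) measure \<Rightarrow> (real^'n \<Rightarrow> real) \<Rightarrow> real \<Rightarrow> (real^'n \<Rightarrow> real) \<Rightarrow> bool" where
  "dirichlet_solution D a b V M f \<delta> \<phi> \<longleftrightarrow>
     Ck_on 2 D \<phi> \<and> continuous_on (closure D) \<phi> \<and>
     (\<forall>x\<in>D. \<delta> * diffusion_op a b \<phi> x + V x * ((LINT y|M. \<phi> y) - \<phi> x) = 0) \<and>
     (\<forall>x\<in>frontier D. \<phi> x = f x)"

end

theory Submission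
  imports Defs
begin

text \<open>
  Put \<open>h = \<surd>\<delta>\<close> and let \<open>m\<close> be the \<open>M\<close>-mean of the solution \<open>\<phi>\<close>. Then \<open>U = (\<phi> - m) / (1 + \<bar>m\<bar>)\<close> solves
  the local equation \<open>h\<^sup>2 L U = V U\<close>, its boundary values form a bounded equicontinuous family, and its
  integral against \<open>M\<close> vanishes. By comparison with explicit barriers \<open>U\<close> decays like
  \<open>exp (- \<tau> dist(x, \<partial>D) / h)\<close>, and after rescaling at a boundary point \<open>p\<close> it converges to the
  half-space profile \<open>U(p) exp (- \<kappa> n \<bullet> X)\<close> with \<open>\<kappa>\<^sup>2 (n \<bullet> a n) = 2 V\<close>. Since \<open>\<mu>\<close> vanishes to order \<open>k\<close>
  at the boundary, its derivatives of order \<open>k\<close> there are \<open>\<theta>\<close> times products of components of \<open>n\<close>, and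
  Fubini along the lines transversal to the boundary gives
  \<open>h\<^bsup>-(k+1)\<^esup> \<integral> U d\<mu> - \<integral>\<^bsub>\<partial>D\<^esub> U \<theta> \<kappa>\<^bsup>-(k+1)\<^esup> d\<sigma> \<longlonglongrightarrow> 0\<close> (up to a constant factor). As the left integral is
  zero, \<open>m\<close> converges to the \<open>\<theta> \<kappa>\<^bsup>-(k+1)\<^esup>\<close>-weighted mean of \<open>f\<close>, and so does \<open>\<phi>\<close> in the interior.
  Each application of the adjoint multiplies \<open>\<theta>\<close> by \<open>(n \<bullet> a n) / 2\<close>, which turns the weight into the
  stated ones.
\<close>

section \<open>Partial derivatives\<close>


text \<open>No a priori bound on the mean \<open>m\<close> is used. Dividing by 1 plus its modulus
  keeps the boundary data bounded and equicontinuous whatever \<open>m\<close> does, and control of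
  \<open>m\<close> comes out only at the end: \<open>(F - m W) / (1 + |m|)\<close> with
  \<open>W > 0\<close> can tend to 0 only if \<open>m\<close> tends to \<open>F / W\<close>. Here
  \<open>W\<close> is the integral of the weight. It is positive because
  \<open>\<mu> \<ge> 0\<close> forces \<open>\<theta> \<ge> 0\<close> and some derivative of order
  \<open>k\<close> survives on the boundary. Solutions are classical inside and merely continuous up
  to the boundary, so every estimate on them is a comparison with an explicit supersolution; no
  derivative of a solution at the boundary appears. The surface measure is defined by diameters of
  covering sets, and its exact normalisation on hyperplanes is the isodiametric inequality. But the
  limit is a quotient of two surface integrals, in which a common factor cancels. It suffices that
  on all hyperplanes Hausdorff measure is the same positive multiple of Lebesgue measure, and this
  follows from invariance under isometries with finiteness and positivity on balls.\<close>

definition gradient :: "(real^'n::finite \<Rightarrow> real) \<Rightarrow> real^'n \<Rightarrow> real^'n" where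
  "gradient g x = (\<chi> i. partial i g x)"

lemma partial_eqI: "(g has_derivative g') (at x) \<Longrightarrow> partial i g x = g' (axis i 1)"
  by (metis frechet_derivative_at partial_def)

lemma gradient_nth [simp]: "gradient g x $ i = partial i g x"
  by (simp add: gradient_def)

lemma has_derivative_gradient:
  fixes g :: "real^'n::finite \<Rightarrow> real"
  assumes "g differentiable (at x)"
  shows "(g has_derivative (\<lambda>v. gradient g x \<bullet> v)) (at x)"
proof -
  have d: "(g has_derivative frechet_derivative g (at x)) (at x)"
    using assms frechet_derivative_works by blast
  then interpret bounded_linear "frechet_derivative g (at x)"
    by (rule has_derivative_bounded_linear)
  have "frechet_derivative g (at x) v = gradient g x \<bullet> v" for v
  proof -
    have "frechet_derivative g (at x) v = frechet_derivative g (at x) (\<Sum>i\<in>UNIV. v $ i *\<^sub>R axis i 1)"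
      using basis_expansion[of v] by (simp add: scalar_mult_eq_scaleR)
    also have "\<dots> = (\<Sum>i\<in>UNIV. v $ i * partial i g x)"
      by (simp add: sum scaleR partial_def)
    finally show ?thesis
      by (simp add: inner_vec_def mult.commute)
  qed
  then have "frechet_derivative g (at x) = (\<lambda>v. gradient g x \<bullet> v)"
    by (rule ext)
  then show ?thesis
    using d by simp
qed

lemma has_real_derivative_along:
  fixes g :: "real^'n::finite \<Rightarrow> real"
  assumes "g differentiable (at (x + t *\<^sub>R v))"
  shows "((\<lambda>t. g (x + t *\<^sub>R v)) has_real_derivative gradient g (x + t *\<^sub>R v) \<bullet> v) (at t)"
proof -
  have "((\<lambda>t. x + t *\<^sub>R v) has_derivative (\<lambda>h. h *\<^sub>R v)) (at t)"
    by (auto intro!: derivative_eq_intros)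
  from has_derivative_compose[OF this has_derivative_gradient[OF assms]]
  show ?thesis
    by (rule has_derivative_imp_has_field_derivative) (simp add: algebra_simps)
qed

lemma gradient_axis [simp]: "gradient g x \<bullet> axis i c = c * partial i g x"
  by (simp add: inner_axis)

lemma partial_cong_open:
  assumes "open S" "x \<in> S" "\<And>y. y \<in> S \<Longrightarrow> f y = g y"
  shows "partial i f x = partial i g x"
  unfolding partial_def
proof (cases "f differentiable (at x)")
  case True
  then show "frechet_derivative f (at x) (axis i 1) = frechet_derivative g (at x) (axis i 1)"
    using frechet_derivative_transform_within_open[of f x S g] assms by auto
next
  case False
  \<comment> \<open>Without differentiability \<open>frechet_derivative\<close> is an unspecified
    choice; equal sets of candidates still give equal choices.\<close>
  have "(f has_derivative h) (at x) \<longleftrightarrow> (g has_derivative h) (at x)" for h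
    using has_derivative_transform_within_open[of f h x UNIV S g]
      has_derivative_transform_within_open[of g h x UNIV S f] assms by auto
  then show "frechet_derivative f (at x) (axis i 1) = frechet_derivative g (at x) (axis i 1)"
    by (simp add: frechet_derivative_def)
qed

lemma partials_Nil [simp]: "partials [] g = g"
  and partials_Cons: "partials (i # is) g = partial i (partials is g)"
  and partials_append: "partials (is @ js) g = partials is (partials js g)"
  by (simp_all add: partials_def)

lemma partials_cong_open:
  assumes "open S" "\<And>y. y \<in> S \<Longrightarrow> f y = g y" "x \<in> S"
  shows "partials is f x = partials is g x"
  using assms(3)
proof (induction "is" arbitrary: x)
  case Nil then show ?case using assms by simp
next
  case (Cons i "is")
  then show ?case
    unfolding partials_Cons by (intro partial_cong_open[OF assms(1)]) auto
qed

lemma differentiable_cong_open: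
  assumes "open S" "x \<in> S" "\<And>y. y \<in> S \<Longrightarrow> f y = g y" "f differentiable (at x)"
  shows "g differentiable (at x)"
proof -
  obtain D where "(f has_derivative D) (at x)"
    using assms(4) by (auto simp: differentiable_def)
  from has_derivative_transform_within_open[OF this assms(1,2,3)] show ?thesis
    by (auto simp: differentiable_def)
qed

lemma partial_add:
  assumes "f differentiable (at x)" "g differentiable (at x)"
  shows "partial i (\<lambda>y. f y + g y) x = partial i f x + partial i g x"
  using partial_eqI[OF has_derivative_add[OF assms[THEN has_derivative_gradient]]] by simp

lemma partial_cmult:
  assumes "f differentiable (at x)"
  shows "partial i (\<lambda>y. c * f y) x = c * partial i f x"
  using partial_eqI[OF has_derivative_mult_right[OF assms[THEN has_derivative_gradient]]] by simp

lemma partial_mult: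
  assumes "f differentiable (at x)" "g differentiable (at x)"
  shows "partial i (\<lambda>y. f y * g y) x = partial i f x * g x + f x * partial i g x"
  using partial_eqI[OF has_derivative_mult[OF assms[THEN has_derivative_gradient]]] by simp

lemma partial_const [simp]: "partial i (\<lambda>y. c) x = 0"
  using partial_eqI[OF has_derivative_const] by blast

text \<open>Pointwise existence of the second derivatives is what the maximum principle uses, and it
  passes to sums and multiples, from which all barriers are built.\<close>

definition twice_diff_on :: "(real^'n::finite) set \<Rightarrow> (real^'n \<Rightarrow> real) \<Rightarrow> bool" where
  "twice_diff_on S g \<longleftrightarrow>
     (\<forall>x\<in>S. g differentiable (at x) \<and> (\<forall>j. partial j g differentiable (at x)))"

lemma Ck_on_mono: "Ck_on m S g \<Longrightarrow> l \<le> m \<Longrightarrow> T \<subseteq> S \<Longrightarrow> Ck_on l T g"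
  unfolding Ck_on_def
proof (intro conjI allI impI)
  assume *: "(\<forall>is. length is < m \<longrightarrow> (\<forall>x\<in>S. partials is g differentiable (at x))) \<and>
     (\<forall>is. length is \<le> m \<longrightarrow> continuous_on S (partials is g))" and "l \<le> m" "T \<subseteq> S"
  show "\<forall>x\<in>T. partials is g differentiable (at x)" if "length is < l" for "is"
    using *[THEN conjunct1, rule_format, of "is"] that \<open>l \<le> m\<close> \<open>T \<subseteq> S\<close> by auto
  show "continuous_on T (partials is g)" if "length is \<le> l" for "is"
    using *[THEN conjunct2, rule_format, of "is"] that \<open>l \<le> m\<close> \<open>T \<subseteq> S\<close>
    by (auto intro: continuous_on_subset)
qed

lemma twice_diff_on_Ck: "Ck_on 2 S g \<Longrightarrow> twice_diff_on S g"
  unfolding twice_diff_on_def Ck_on_def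
proof (intro ballI conjI allI)
  fix x j assume *: "(\<forall>is. length is < 2 \<longrightarrow> (\<forall>x\<in>S. partials is g differentiable (at x))) \<and>
     (\<forall>is. length is \<le> 2 \<longrightarrow> continuous_on S (partials is g))" and x: "x \<in> S"
  have "partials [] g differentiable (at x)" "partials [j] g differentiable (at x)"
    by (rule *[THEN conjunct1, rule_format, OF _ x], simp)+
  then show "g differentiable (at x)" "partial j g differentiable (at x)"
    by (simp_all add: partials_def)
qed

lemma twice_diff_on_subset: "twice_diff_on S g \<Longrightarrow> T \<subseteq> S \<Longrightarrow> twice_diff_on T g"
  by (auto simp: twice_diff_on_def)

lemma twice_diff_on_add:
  assumes "open S" "twice_diff_on S f" "twice_diff_on S g"
  shows "twice_diff_on S (\<lambda>x. f x + g x)"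
  unfolding twice_diff_on_def
proof (intro ballI conjI allI)
  fix x j assume x: "x \<in> S"
  show "(\<lambda>x. f x + g x) differentiable (at x)"
    using assms x by (simp add: twice_diff_on_def)
  have "(\<lambda>y. partial j f y + partial j g y) differentiable (at x)"
    using assms x by (simp add: twice_diff_on_def)
  then show "partial j (\<lambda>x. f x + g x) differentiable (at x)"
    by (rule differentiable_cong_open[OF assms(1) x, rotated])
      (use assms in \<open>auto simp: partial_add twice_diff_on_def\<close>)
qed

lemma twice_diff_on_cmult:
  assumes "open S" "twice_diff_on S f"
  shows "twice_diff_on S (\<lambda>x. c * f x)"
  unfolding twice_diff_on_def
proof (intro ballI conjI allI)
  fix x j assume x: "x \<in> S"
  show "(\<lambda>x. c * f x) differentiable (at x)"
    using assms x by (simp add: twice_diff_on_def)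
  have "(\<lambda>y. c * partial j f y) differentiable (at x)"
    using assms x by (simp add: twice_diff_on_def)
  then show "partial j (\<lambda>x. c * f x) differentiable (at x)"
    by (rule differentiable_cong_open[OF assms(1) x, rotated])
      (use assms in \<open>auto simp: partial_cmult twice_diff_on_def\<close>)
qed

text \<open>The generator with the derivatives of the coefficients moved into the drift
  \<open>\<beta>\<close>: its value at a point involves \<open>a\<close> and \<open>\<beta>\<close>
  at that point only, as the maximum principle requires.\<close>

definition nondiv_op ::
    "(real^'n::finite \<Rightarrow> real^'n^'n) \<Rightarrow> (real^'n \<Rightarrow> real^'n) \<Rightarrow> (real^'n \<Rightarrow> real) \<Rightarrow> real^'n \<Rightarrow> real" where
  "nondiv_op a \<beta> u x =
     1/2 * (\<Sum>i\<in>UNIV. \<Sum>j\<in>UNIV. a x $ i $ j * partial i (partial j u) x) + \<beta> x \<bullet> gradient u x"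

lemma nondiv_op_add:
  assumes "open S" "x \<in> S" "twice_diff_on S f" "twice_diff_on S g"
  shows "nondiv_op a \<beta> (\<lambda>x. f x + g x) x = nondiv_op a \<beta> f x + nondiv_op a \<beta> g x"
proof -
  have 1: "gradient (\<lambda>x. f x + g x) x = gradient f x + gradient g x"
    using assms by (simp add: vec_eq_iff partial_add twice_diff_on_def)
  have 2: "partial i (partial j (\<lambda>x. f x + g x)) x
      = partial i (partial j f) x + partial i (partial j g) x" for i j
  proof -
    have "partial i (partial j (\<lambda>x. f x + g x)) x = partial i (\<lambda>x. partial j f x + partial j g x) x"
      using assms by (intro partial_cong_open[OF assms(1,2)]) (auto simp: partial_add twice_diff_on_def)
    then show ?thesis
      using assms by (simp add: partial_add twice_diff_on_def)
  qed
  show ?thesis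
    unfolding nondiv_op_def 1 2 by (simp add: algebra_simps sum.distrib inner_add_right)
qed

lemma nondiv_op_cmult:
  assumes "open S" "x \<in> S" "twice_diff_on S f"
  shows "nondiv_op a \<beta> (\<lambda>x. c * f x) x = c * nondiv_op a \<beta> f x"
proof -
  have 1: "gradient (\<lambda>x. c * f x) x = c *\<^sub>R gradient f x"
    using assms by (simp add: vec_eq_iff partial_cmult twice_diff_on_def)
  have 2: "partial i (partial j (\<lambda>x. c * f x)) x = c * partial i (partial j f) x" for i j
  proof -
    have "partial i (partial j (\<lambda>x. c * f x)) x = partial i (\<lambda>x. c * partial j f x) x"
      using assms by (intro partial_cong_open[OF assms(1,2)]) (auto simp: partial_cmult twice_diff_on_def)
    then show ?thesis
      using assms by (simp add: partial_cmult twice_diff_on_def)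
  qed
  show ?thesis
    unfolding nondiv_op_def 1 2 by (simp add: algebra_simps sum_distrib_left)
qed

lemma nondiv_op_const: "nondiv_op a \<beta> (\<lambda>x. c) x = 0"
proof -
  have "partial j (\<lambda>x. c) = (\<lambda>x. 0)" for j :: 'a
    by (simp add: fun_eq_iff)
  moreover have "gradient (\<lambda>x::real^'a. c) x = 0"
    by (simp add: vec_eq_iff)
  ultimately show ?thesis by (simp add: nondiv_op_def)
qed

lemma twice_diff_on_const: "twice_diff_on S (\<lambda>x. c)"
proof -
  have "partial j (\<lambda>x. c) = (\<lambda>x. 0)" for j :: 'a by (simp add: fun_eq_iff)
  then show ?thesis by (simp add: twice_diff_on_def)
qed

lemma diffusion_op_nondiv:
  assumes "open S" "x \<in> S" "twice_diff_on S u"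
    and "\<And>i j y. y \<in> S \<Longrightarrow> (\<lambda>y. a y $ i $ j) differentiable (at y)"
  shows "diffusion_op a b u x =
    nondiv_op a (\<lambda>x. b x + (\<chi> j. 1/2 * (\<Sum>i\<in>UNIV. partial i (\<lambda>y. a y $ i $ j) x))) u x"
proof -
  have "partial i (\<lambda>y. a y $ i $ j * partial j u y) x
      = partial i (\<lambda>y. a y $ i $ j) x * partial j u x + a x $ i $ j * partial i (partial j u) x" for i j
    using assms by (intro partial_mult) (auto simp: twice_diff_on_def)
  then have "div_grad a u x = (\<Sum>i\<in>UNIV. \<Sum>j\<in>UNIV. partial i (\<lambda>y. a y $ i $ j) x * partial j u x)
      + (\<Sum>i\<in>UNIV. \<Sum>j\<in>UNIV. a x $ i $ j * partial i (partial j u) x)"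
    by (simp add: div_grad_def sum.distrib)
  also have "(\<Sum>i\<in>UNIV. \<Sum>j\<in>UNIV. partial i (\<lambda>y. a y $ i $ j) x * partial j u x)
     = (\<Sum>j\<in>UNIV. (\<Sum>i\<in>UNIV. partial i (\<lambda>y. a y $ i $ j) x) * partial j u x)"
    by (subst sum.swap) (simp add: sum_distrib_right)
  finally show ?thesis
    unfolding diffusion_op_def nondiv_op_def
    by (simp add: inner_vec_def algebra_simps sum.distrib sum_divide_distrib sum_distrib_left)
qed

text \<open>All barriers are sums of functions of one linear coordinate; on these the operator
  becomes an ordinary differential expression in \<open>F\<close>.\<close>

lemma ridge_function:
  fixes w y :: "real^'n::finite"
  assumes F: "\<And>t. (F has_real_derivative F' t) (at t)"
    and F': "\<And>t. (F' has_real_derivative F'' t) (at t)"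
  shows twice_diff_on_ridge: "twice_diff_on S (\<lambda>x. F (w \<bullet> (x - y)))"
    and nondiv_op_ridge: "nondiv_op a \<beta> (\<lambda>x. F (w \<bullet> (x - y))) x =
      1/2 * (w \<bullet> (a x *v w)) * F'' (w \<bullet> (x - y)) + (\<beta> x \<bullet> w) * F' (w \<bullet> (x - y))"
proof -
  have *: "((\<lambda>x. G (w \<bullet> (x - y))) has_derivative (\<lambda>v. G' (w \<bullet> (x - y)) * (w \<bullet> v))) (at x)"
    if "\<And>t. (G has_real_derivative G' t) (at t)" for G G' :: "real \<Rightarrow> real" and x
  proof -
    have "((\<lambda>x. w \<bullet> (x - y)) has_derivative (\<lambda>v. w \<bullet> v)) (at x)"
      by (auto intro!: derivative_eq_intros)
    from has_derivative_compose[OF this that[unfolded has_field_derivative_def]]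
    show ?thesis .
  qed
  have p: "partial j (\<lambda>x. F (w \<bullet> (x - y))) = (\<lambda>x. F' (w \<bullet> (x - y)) * w $ j)" for j
    using partial_eqI[OF *[OF F]] by (simp add: fun_eq_iff inner_axis)
  have d: "((\<lambda>x. F' (w \<bullet> (x - y)) * w $ j) has_derivative
      (\<lambda>v. F'' (w \<bullet> (x - y)) * (w \<bullet> v) * w $ j)) (at x)" for j x
    by (intro has_derivative_mult_left *[OF F'])
  have pp: "partial i (\<lambda>x. F' (w \<bullet> (x - y)) * w $ j) x = F'' (w \<bullet> (x - y)) * w $ i * w $ j" for i j x
    using partial_eqI[OF d] by (simp add: inner_axis)
  show "twice_diff_on S (\<lambda>x. F (w \<bullet> (x - y)))"
    unfolding twice_diff_on_def p
    using *[OF F] d by (auto simp: differentiable_def)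
  have g: "gradient (\<lambda>x. F (w \<bullet> (x - y))) x = F' (w \<bullet> (x - y)) *\<^sub>R w"
    by (simp add: vec_eq_iff p)
  have "(\<Sum>i\<in>UNIV. \<Sum>j\<in>UNIV. a x $ i $ j * (F'' (w \<bullet> (x - y)) * w $ i * w $ j))
      = (w \<bullet> (a x *v w)) * F'' (w \<bullet> (x - y))"
    by (simp add: inner_vec_def matrix_vector_mult_def sum_distrib_left sum_distrib_right algebra_simps)
  then show "nondiv_op a \<beta> (\<lambda>x. F (w \<bullet> (x - y))) x =
      1/2 * (w \<bullet> (a x *v w)) * F'' (w \<bullet> (x - y)) + (\<beta> x \<bullet> w) * F' (w \<bullet> (x - y))"
    unfolding nondiv_op_def g p pp by simp
qed

section \<open>Symmetry of mixed derivatives\<close>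

lemma second_difference_mvt:
  fixes G :: "real^'n::finite \<Rightarrow> real"
  assumes h: "0 < h" and sub: "cball x (2 * h) \<subseteq> S"
    and dG: "\<And>y. y \<in> S \<Longrightarrow> G differentiable (at y)"
    and dp: "\<And>y. y \<in> S \<Longrightarrow> partial i G differentiable (at y)"
  obtains \<xi> where "\<xi> \<in> cball x (2 * h)"
    "G (x + h *\<^sub>R axis i 1 + h *\<^sub>R axis j 1) - G (x + h *\<^sub>R axis i 1) - G (x + h *\<^sub>R axis j 1) + G x
      = h * h * partial j (partial i G) \<xi>"
proof -
  let ?e = "axis i (1::real)" and ?f = "axis j (1::real)"
  have inb: "x + s *\<^sub>R ?e + t *\<^sub>R ?f \<in> cball x (2 * h)" if "0 \<le> s" "s \<le> h" "0 \<le> t" "t \<le> h" for s t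
  proof -
    have "norm (s *\<^sub>R ?e + t *\<^sub>R ?f) \<le> norm (s *\<^sub>R ?e) + norm (t *\<^sub>R ?f)"
      by (rule norm_triangle_ineq)
    also have "\<dots> \<le> 2 * h" using that by simp
    finally show ?thesis by (metis (no_types, lifting) add.assoc add_diff_cancel_left' dist_commute dist_norm mem_cball)
  qed
  let ?q = "\<lambda>s. G (x + h *\<^sub>R ?f + s *\<^sub>R ?e) - G (x + s *\<^sub>R ?e)"
  have dq: "(?q has_real_derivative partial i G (x + h *\<^sub>R ?f + s *\<^sub>R ?e) - partial i G (x + s *\<^sub>R ?e)) (at s)"
    if "0 \<le> s" "s \<le> h" for s
  proof -
    have "x + s *\<^sub>R ?e + h *\<^sub>R ?f \<in> S" "x + s *\<^sub>R ?e \<in> S"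
      using inb[of s h] inb[of s 0] that h sub by (simp_all add: subset_iff)
    then have "x + h *\<^sub>R ?f + s *\<^sub>R ?e \<in> S" "x + s *\<^sub>R ?e \<in> S"
      by (simp_all only: add.assoc add.commute[of "h *\<^sub>R ?f"])
    from DERIV_diff[OF has_real_derivative_along[OF dG[OF this(1)]] has_real_derivative_along[OF dG[OF this(2)]]]
    show ?thesis by simp
  qed
  obtain s where s: "0 < s" "s < h"
    "?q h - ?q 0 = (h - 0) * (partial i G (x + h *\<^sub>R ?f + s *\<^sub>R ?e) - partial i G (x + s *\<^sub>R ?e))"
    using MVT2[OF h dq] by blast
  have dr: "((\<lambda>t. partial i G (x + s *\<^sub>R ?e + t *\<^sub>R ?f)) has_real_derivative
      partial j (partial i G) (x + s *\<^sub>R ?e + t *\<^sub>R ?f)) (at t)" if "0 \<le> t" "t \<le> h" for t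
  proof -
    have "x + s *\<^sub>R ?e + t *\<^sub>R ?f \<in> S" using inb[of s t] that s sub by auto
    from has_real_derivative_along[OF dp[OF this]] show ?thesis by simp
  qed
  obtain t where t: "0 < t" "t < h"
    "partial i G (x + s *\<^sub>R ?e + h *\<^sub>R ?f) - partial i G (x + s *\<^sub>R ?e + 0 *\<^sub>R ?f)
      = (h - 0) * partial j (partial i G) (x + s *\<^sub>R ?e + t *\<^sub>R ?f)"
    using MVT2[OF h dr] by blast
  have "G (x + h *\<^sub>R ?e + h *\<^sub>R ?f) - G (x + h *\<^sub>R ?e) - G (x + h *\<^sub>R ?f) + G x
      = h * h * partial j (partial i G) (x + s *\<^sub>R ?e + t *\<^sub>R ?f)"
    using s(3) t(3) by (simp add: add.assoc add.commute[of "h *\<^sub>R ?f"])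
  moreover have "x + s *\<^sub>R ?e + t *\<^sub>R ?f \<in> cball x (2 * h)"
    using inb[of s t] s(1,2) t(1,2) by linarith
  ultimately show thesis
    using that by blast
qed

text \<open>The second difference over a small square is symmetric in \<open>i\<close> and
  \<open>j\<close>. Hence the two mixed derivatives agree at some pair of points near
  \<open>x\<close>, and continuity carries the equality to \<open>x\<close>.\<close>

lemma partial_commute:
  fixes G :: "real^'n::finite \<Rightarrow> real"
  assumes "open S" "x \<in> S"
    and dG: "\<And>y. y \<in> S \<Longrightarrow> G differentiable (at y)"
    and di: "\<And>y. y \<in> S \<Longrightarrow> partial i G differentiable (at y)"
    and dj: "\<And>y. y \<in> S \<Longrightarrow> partial j G differentiable (at y)"
    and ci: "continuous_on S (partial j (partial i G))"
    and cj: "continuous_on S (partial i (partial j G))"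
  shows "partial i (partial j G) x = partial j (partial i G) x"
proof (rule ccontr)
  let ?A = "partial j (partial i G)" and ?B = "partial i (partial j G)"
  assume ne: "?B x \<noteq> ?A x"
  define \<eta> where "\<eta> = \<bar>?B x - ?A x\<bar> / 2"
  have \<eta>: "\<eta> > 0" using ne by (simp add: \<eta>_def)
  obtain r where r: "r > 0" "cball x r \<subseteq> S"
    using assms(1,2) open_contains_cball by blast
  have "isCont ?A x" "isCont ?B x"
    using assms(1,2) ci cj by (auto simp: continuous_on_eq_continuous_at)
  then have "\<exists>d>0. \<forall>y. dist y x < d \<longrightarrow> dist (?A y) (?A x) < \<eta>"
    "\<exists>d>0. \<forall>y. dist y x < d \<longrightarrow> dist (?B y) (?B x) < \<eta>"
    using \<eta> unfolding continuous_at_eps_delta by blast+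
  then obtain d1 d2 where d: "d1 > 0" "d2 > 0" "\<And>y. dist y x < d1 \<Longrightarrow> dist (?A y) (?A x) < \<eta>"
    "\<And>y. dist y x < d2 \<Longrightarrow> dist (?B y) (?B x) < \<eta>"
    by blast
  define h where "h = Min {r, d1, d2} / 4"
  have h: "h > 0" "2 * h \<le> r" "2 * h < d1" "2 * h < d2"
    using r d by (auto simp: h_def)
  have sub: "cball x (2 * h) \<subseteq> S" using r h by (auto simp: subset_iff)
  obtain \<xi> where 1: "\<xi> \<in> cball x (2 * h)"
    "G (x + h *\<^sub>R axis i 1 + h *\<^sub>R axis j 1) - G (x + h *\<^sub>R axis i 1) - G (x + h *\<^sub>R axis j 1) + G x
      = h * h * ?A \<xi>"
    using second_difference_mvt[OF h(1) sub dG di] by blast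
  obtain \<zeta> where 2: "\<zeta> \<in> cball x (2 * h)"
    "G (x + h *\<^sub>R axis j 1 + h *\<^sub>R axis i 1) - G (x + h *\<^sub>R axis j 1) - G (x + h *\<^sub>R axis i 1) + G x
      = h * h * ?B \<zeta>"
    using second_difference_mvt[OF h(1) sub dG dj] by blast
  have "h * h * ?A \<xi> = h * h * ?B \<zeta>"
    using 1(2) 2(2) by (simp add: algebra_simps)
  then have "?A \<xi> = ?B \<zeta>" using h by simp
  moreover have "dist (?A \<xi>) (?A x) < \<eta>" "dist (?B \<zeta>) (?B x) < \<eta>"
    using 1(1) 2(1) h by (auto intro!: d simp: dist_commute)
  ultimately have "\<bar>?B x - ?A x\<bar> < 2 * \<eta>"
    by (auto simp: dist_real_def abs_if split: if_splits)
  then show False by (simp add: \<eta>_def)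
qed

lemma Ck_on_partials:
  assumes "Ck_on (length is + m) S g"
  shows "Ck_on m S (partials is g)"
  unfolding Ck_on_def partials_append[symmetric]
proof (intro conjI allI impI)
  fix js :: "'a list"
  show "\<forall>x\<in>S. partials (js @ is) g differentiable at x" if "length js < m"
    using assms that unfolding Ck_on_def by simp
  show "continuous_on S (partials (js @ is) g)" if "length js \<le> m"
    using assms that unfolding Ck_on_def by simp
qed

text \<open>Multi-indices are lists, so the irrelevance of their order has to be proved: adjacent
  swaps move the outermost derivative to the innermost place.\<close>

lemma partials_rotate:
  fixes g :: "real^'n::finite \<Rightarrow> real"
  assumes "open S" "Ck_on m S g" "Suc (length is) \<le> m" "x \<in> S"
  shows "partials (i # is) g x = partials (is @ [i]) g x"
  using assms(3,4)
proof (induction "is" arbitrary: x)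
  case (Cons j "is")
  have C: "Ck_on 2 S (partials is g)"
    using Cons.prems by (intro Ck_on_partials Ck_on_mono[OF assms(2)]) auto
  then have t: "twice_diff_on S (partials is g)" by (rule twice_diff_on_Ck)
  have "length [i,j] \<le> 2" "length [j,i] \<le> 2" by auto
  with C have c: "continuous_on S (partials [i,j] (partials is g))"
     "continuous_on S (partials [j,i] (partials is g))"
    unfolding Ck_on_def by blast+
  have "partials (i # j # is) g x = partial i (partial j (partials is g)) x"
    by (simp add: partials_Cons)
  also have "\<dots> = partial j (partial i (partials is g)) x"
    using t c Cons.prems by (intro partial_commute[OF assms(1)]) (auto simp: twice_diff_on_def partials_Cons)
  also have "\<dots> = partial j (partials (is @ [i]) g) x"
    using Cons by (intro partial_cong_open[OF assms(1)]) (auto simp: partials_Cons)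
  finally show ?case by (simp add: partials_Cons)
qed simp

section \<open>Comparison principle and interior decay\<close>

lemma double_sum_insert:
  fixes f :: "'i \<Rightarrow> 'i \<Rightarrow> real"
  assumes "finite I" "p \<notin> I"
  shows "(\<Sum>i\<in>insert p I. \<Sum>j\<in>insert p I. f i j) =
    f p p + (\<Sum>j\<in>I. f p j) + (\<Sum>i\<in>I. f i p) + (\<Sum>i\<in>I. \<Sum>j\<in>I. f i j)"
  using assms by (simp add: sum.distrib)

text \<open>Induction on the index set: the Schur complement of a positive definite form is positive definite.\<close>

lemma trace_product_nonpos:
  fixes A H :: "'i \<Rightarrow> 'i \<Rightarrow> real"
  assumes "finite I"
    and sym: "\<And>i j. A i j = A j i"
    and pd: "\<And>c. (\<exists>i\<in>I. c i \<noteq> 0) \<Longrightarrow> 0 < (\<Sum>i\<in>I. \<Sum>j\<in>I. c i * c j * A i j)"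
    and nsd: "\<And>c. (\<Sum>i\<in>I. \<Sum>j\<in>I. c i * c j * H i j) \<le> 0"
  shows "(\<Sum>i\<in>I. \<Sum>j\<in>I. A i j * H i j) \<le> 0"
  using assms
proof (induction I arbitrary: A rule: finite_induct)
  case (insert p I)
  note fin = insert.hyps(1,2)
  have ne: "i \<noteq> p" if "i \<in> I" for i using that fin by auto
  have app: "0 < A p p"
  proof -
    have "0 < (\<Sum>i\<in>insert p I. \<Sum>j\<in>insert p I. (if i = p then 1 else 0) * (if j = p then 1 else 0) * A i j)"
      by (rule insert.prems(2)) auto
    then show ?thesis
      unfolding double_sum_insert[OF fin] using ne by (simp cong: sum.cong)
  qed
  define A' where "A' i j = A i j - A p i * A p j / A p p" for i j
  have "(\<Sum>i\<in>I. \<Sum>j\<in>I. A' i j * H i j) \<le> 0"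
  proof (rule insert.IH)
    show "A' i j = A' j i" for i j
      using insert.prems(1) by (simp add: A'_def mult.commute)
    show "0 < (\<Sum>i\<in>I. \<Sum>j\<in>I. c i * c j * A' i j)" if c: "\<exists>i\<in>I. c i \<noteq> 0" for c
    proof -
      define S where "S = (\<Sum>i\<in>I. c i * A p i)"
      \<comment> \<open>The value at \<open>p\<close> minimises the form of \<open>A\<close> over
        all extensions of \<open>c\<close>; the minimum is the form of the Schur complement at
        \<open>c\<close>.\<close>
      define c' where "c' = c(p := - S / A p p)"
      have c'I: "c' i = c i" if "i \<in> I" for i using ne[OF that] by (simp add: c'_def)
      have c'p: "c' p = - S / A p p" by (simp add: c'_def)
      have "0 < (\<Sum>i\<in>insert p I. \<Sum>j\<in>insert p I. c' i * c' j * A i j)"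
        using c c'I by (intro insert.prems(2)) auto
      also have "\<dots> = c' p * c' p * A p p + c' p * S + c' p * S + (\<Sum>i\<in>I. \<Sum>j\<in>I. c i * c j * A i j)"
      proof -
        have "(\<Sum>j\<in>I. c' p * c' j * A p j) = c' p * S"
          unfolding S_def sum_distrib_left by (intro sum.cong) (auto simp: c'I)
        moreover have "(\<Sum>i\<in>I. c' i * c' p * A i p) = c' p * S"
          unfolding S_def sum_distrib_left
          by (intro sum.cong) (auto simp: c'I insert.prems(1)[of _ p])
        moreover have "(\<Sum>i\<in>I. \<Sum>j\<in>I. c' i * c' j * A i j) = (\<Sum>i\<in>I. \<Sum>j\<in>I. c i * c j * A i j)"
          by (intro sum.cong) (auto simp: c'I)
        ultimately show ?thesis
          unfolding double_sum_insert[OF fin] by simp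
      qed
      also have "\<dots> = (\<Sum>i\<in>I. \<Sum>j\<in>I. c i * c j * A i j) - S * S / A p p"
        using app by (simp add: c'p field_simps)
      also have "S * S = (\<Sum>i\<in>I. \<Sum>j\<in>I. (c i * A p i) * (c j * A p j))"
        unfolding S_def by (rule sum_product)
      also have "(\<Sum>i\<in>I. \<Sum>j\<in>I. c i * c j * A i j) - (\<Sum>i\<in>I. \<Sum>j\<in>I. (c i * A p i) * (c j * A p j)) / A p p
          = (\<Sum>i\<in>I. \<Sum>j\<in>I. c i * c j * A' i j)"
        unfolding A'_def by (simp add: sum_divide_distrib right_diff_distrib sum_subtractf mult_ac)
      finally show ?thesis .
    qed
    show "(\<Sum>i\<in>I. \<Sum>j\<in>I. c i * c j * H i j) \<le> 0" for c
    proof -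
      let ?c = "c(p := 0)"
      have "(\<Sum>i\<in>insert p I. \<Sum>j\<in>insert p I. ?c i * ?c j * H i j) \<le> 0"
        by (rule insert.prems(3))
      moreover have "(\<Sum>i\<in>I. \<Sum>j\<in>I. ?c i * ?c j * H i j) = (\<Sum>i\<in>I. \<Sum>j\<in>I. c i * c j * H i j)"
        by (intro sum.cong) (auto dest: ne)
      ultimately show ?thesis
        unfolding double_sum_insert[OF fin] by simp
    qed
  qed
  \<comment> \<open>\<open>A - A'\<close> is the rank one matrix
    \<open>A p i * A p j / A p p\<close>, so its pairing with \<open>H\<close> is a value of the
    form of \<open>H\<close> divided by a positive number.\<close>
  moreover have "(\<Sum>i\<in>insert p I. \<Sum>j\<in>insert p I. A i j * H i j)
     = (\<Sum>i\<in>I. \<Sum>j\<in>I. A' i j * H i j)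
       + (\<Sum>i\<in>insert p I. \<Sum>j\<in>insert p I. A p i * A p j * H i j) / A p p"
  proof -
    have "(\<Sum>i\<in>insert p I. \<Sum>j\<in>insert p I. A i j * H i j)
       = (\<Sum>i\<in>insert p I. \<Sum>j\<in>insert p I. A' i j * H i j)
       + (\<Sum>i\<in>insert p I. \<Sum>j\<in>insert p I. A p i * A p j * H i j) / A p p"
      unfolding A'_def
      by (simp only: sum_divide_distrib sum.distrib[symmetric]) (simp add: algebra_simps)
    moreover have "A' p j = 0" "A' j p = 0" for j
      using app insert.prems(1)[of j p] by (auto simp: A'_def)
    ultimately show ?thesis
      by (simp add: double_sum_insert[OF fin])
  qed
  moreover have "(\<Sum>i\<in>insert p I. \<Sum>j\<in>insert p I. A p i * A p j * H i j) / A p p \<le> 0"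
    using insert.prems(3)[of "A p"] app by (simp add: divide_nonpos_pos)
  ultimately show ?case by linarith
qed simp

text \<open>The second derivatives need not be continuous. If the form were positive, the derivative
  of \<open>u\<close> along \<open>v\<close>, which is 0 at \<open>x\<close> and has the form as its
  own derivative, would be positive just after \<open>x\<close>, and the mean value theorem would
  give a larger value of \<open>u\<close>.\<close>

lemma interior_max_second_order:
  fixes u :: "real^'n::finite \<Rightarrow> real"
  assumes "open S" "x \<in> S" and u: "twice_diff_on S u" and mx: "\<And>y. y \<in> S \<Longrightarrow> u y \<le> u x"
  shows "gradient u x = 0"
    and "(\<Sum>i\<in>UNIV. \<Sum>j\<in>UNIV. v $ i * v $ j * partial i (partial j u) x) \<le> 0"
proof -
  have "(\<lambda>v. gradient u x \<bullet> v) = (\<lambda>v. 0)"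
    by (rule differential_zero_maxmin[OF assms(2,1) has_derivative_gradient])
      (use u assms(2) mx in \<open>auto simp: twice_diff_on_def\<close>)
  from fun_cong[OF this, of "gradient u x"] have "gradient u x \<bullet> gradient u x = 0" by simp
  then show g0: "gradient u x = 0" by simp
  let ?q = "\<Sum>i\<in>UNIV. \<Sum>j\<in>UNIV. v $ i * v $ j * partial i (partial j u) x"
  show "?q \<le> 0"
  proof (rule ccontr)
    assume "\<not> ?q \<le> 0"
    then have q: "?q > 0" by simp
    have "((\<lambda>t. x + t *\<^sub>R v) \<longlongrightarrow> x + 0 *\<^sub>R v) (at 0)"
      by (intro tendsto_intros)
    then have "\<forall>\<^sub>F t in at 0. x + t *\<^sub>R v \<in> S"
      using assms(1,2) by (auto simp: topological_tendstoD)
    then obtain e where e: "e > 0" "\<And>t. \<bar>t\<bar> < e \<Longrightarrow> t \<noteq> 0 \<Longrightarrow> x + t *\<^sub>R v \<in> S"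
      unfolding eventually_at by auto
    have inS: "x + t *\<^sub>R v \<in> S" if "\<bar>t\<bar> < e" for t
      using e(2)[OF that] assms(2) by (cases "t = 0") auto
    let ?g = "\<lambda>t. gradient u (x + t *\<^sub>R v) \<bullet> v"
    have du: "((\<lambda>t. u (x + t *\<^sub>R v)) has_real_derivative ?g t) (at t)" if "\<bar>t\<bar> < e" for t
      using u inS[OF that] by (intro has_real_derivative_along) (auto simp: twice_diff_on_def)
    have "((\<lambda>t. partial j u (x + t *\<^sub>R v)) has_real_derivative
        gradient (partial j u) (x + 0 *\<^sub>R v) \<bullet> v) (at 0)" for j
      using u assms(2) by (intro has_real_derivative_along) (auto simp: twice_diff_on_def)
    then have "((\<lambda>t. \<Sum>j\<in>UNIV. partial j u (x + t *\<^sub>R v) * v $ j) has_real_derivative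
        (\<Sum>j\<in>UNIV. (gradient (partial j u) x \<bullet> v) * v $ j)) (at 0)"
      by (intro DERIV_sum) (auto intro!: DERIV_cmult_right)
    moreover have "(\<Sum>j\<in>UNIV. (gradient (partial j u) x \<bullet> v) * v $ j) = ?q"
      by (subst sum.swap) (simp add: inner_vec_def sum_distrib_left sum_distrib_right mult_ac)
    moreover have "(\<lambda>t. \<Sum>j\<in>UNIV. partial j u (x + t *\<^sub>R v) * v $ j) = ?g"
      by (simp add: inner_vec_def fun_eq_iff)
    ultimately have "(?g has_real_derivative ?q) (at 0)" by simp
    from DERIV_pos_inc_right[OF this q] obtain d where d: "d > 0"
      "\<And>h. h > 0 \<Longrightarrow> h < d \<Longrightarrow> 0 < ?g h"
      using g0 by auto
    define h where "h = min d e / 2"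
    have h: "0 < h" "h < d" "h < e" using d(1) e(1) by (auto simp: h_def)
    obtain z where z: "0 < z" "z < h" "u (x + h *\<^sub>R v) - u (x + 0 *\<^sub>R v) = (h - 0) * ?g z"
    proof -
      have "((\<lambda>t. u (x + t *\<^sub>R v)) has_real_derivative ?g t) (at t)" if "0 \<le> t" "t \<le> h" for t
        using that h by (intro du) auto
      from MVT2[OF h(1) this] show thesis using that by blast
    qed
    have "h * ?g z > 0" using d(2)[of z] z h by (intro mult_pos_pos) auto
    then have "u (x + h *\<^sub>R v) > u x" using z by simp
    then show False using mx[OF inS[of h]] h by auto
  qed
qed

lemma quadratic_form_sum:
  "v \<bullet> (A *v v) = (\<Sum>i\<in>UNIV. \<Sum>j\<in>UNIV. v $ i * v $ j * A $ i $ j)"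
  by (simp add: inner_vec_def matrix_vector_mult_def sum_distrib_left mult_ac)

text \<open>A positive maximum is attained inside, where the gradient vanishes and the Hessian is
  negative semidefinite; paired with the positive definite \<open>a\<close> it makes the operator
  nonpositive, against \<open>pos\<close>.\<close>

lemma max_principle:
  fixes u :: "real^'n::finite \<Rightarrow> real"
  assumes W: "open W" "bounded W" and cont: "continuous_on (closure W) u" and u: "twice_diff_on W u"
    and pd: "\<And>x. x \<in> W \<Longrightarrow> transpose (a x) = a x \<and> (\<forall>v. v \<noteq> 0 \<longrightarrow> 0 < v \<bullet> (a x *v v))"
    and pos: "\<And>x. x \<in> W \<Longrightarrow> u x > 0 \<Longrightarrow> nondiv_op a \<beta> u x > 0"
    and bd: "\<And>x. x \<in> frontier W \<Longrightarrow> u x \<le> 0"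
    and x: "x \<in> W"
  shows "u x \<le> 0"
proof (rule ccontr)
  assume neg: "\<not> u x \<le> 0"
  have "compact (closure W)" "closure W \<noteq> {}"
    using W x closure_subset by (auto simp: compact_closure)
  from continuous_attains_sup[OF this cont] obtain z
    where z: "z \<in> closure W" "\<And>y. y \<in> closure W \<Longrightarrow> u y \<le> u z" by auto
  have uz: "u z > 0" using z(2)[of x] x neg closure_subset by force
  have zW: "z \<in> W" using z(1) uz bd[of z] W by (auto simp: frontier_def interior_open)
  have mx: "u y \<le> u z" if "y \<in> W" for y using z(2) that closure_subset by blast
  have so1: "gradient u z = 0"
    by (rule interior_max_second_order(1)[where u = u and x = z, OF W(1) zW u mx])
  have so2: "(\<Sum>i\<in>UNIV. \<Sum>j\<in>UNIV. v $ i * v $ j * partial i (partial j u) z) \<le> 0" for v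
    by (rule interior_max_second_order(2)[where u = u and x = z, OF W(1) zW u mx])
  have "(\<Sum>i\<in>UNIV. \<Sum>j\<in>UNIV. a z $ i $ j * partial i (partial j u) z) \<le> 0"
  proof (rule trace_product_nonpos[where A = "\<lambda>i j. a z $ i $ j" and H = "\<lambda>i j. partial i (partial j u) z"])
    show "a z $ i $ j = a z $ j $ i" for i j
      using pd[OF zW] by (metis transpose_def vec_lambda_beta)
    show "0 < (\<Sum>i\<in>UNIV. \<Sum>j\<in>UNIV. c i * c j * a z $ i $ j)" if "\<exists>i\<in>UNIV. c i \<noteq> 0" for c
    proof -
      have "(\<chi> i. c i) \<noteq> 0" using that by (auto simp: vec_eq_iff)
      then show ?thesis using pd[OF zW] quadratic_form_sum[of "\<chi> i. c i" "a z"] by auto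
    qed
    show "(\<Sum>i\<in>UNIV. \<Sum>j\<in>UNIV. c i * c j * partial i (partial j u) z) \<le> 0" for c
      using so2[of "\<chi> i. c i"] by simp
  qed auto
  then have "nondiv_op a \<beta> u z \<le> 0"
    by (simp add: nondiv_op_def so1)
  with pos[OF zW uz] show False by simp
qed

text \<open>The maximum principle for \<open>u - \<Psi>\<close>: wherever this difference is
  positive, the term with \<open>V > 0\<close> makes the operator on it strictly positive.\<close>

lemma comparison_principle:
  fixes u \<Psi> :: "real^'n::finite \<Rightarrow> real"
  assumes W: "open W" "bounded W"
    and cont: "continuous_on (closure W) u" "continuous_on (closure W) \<Psi>"
    and C2: "twice_diff_on W u" "twice_diff_on W \<Psi>"
    and pd: "\<And>x. x \<in> W \<Longrightarrow> transpose (a x) = a x \<and> (\<forall>v. v \<noteq> 0 \<longrightarrow> 0 < v \<bullet> (a x *v v))"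
    and V: "\<And>x. x \<in> W \<Longrightarrow> 0 < V x" and \<delta>: "\<delta> > 0"
    and sub: "\<And>x. x \<in> W \<Longrightarrow> V x * u x \<le> \<delta> * nondiv_op a \<beta> u x"
    and super: "\<And>x. x \<in> W \<Longrightarrow> \<delta> * nondiv_op a \<beta> \<Psi> x \<le> V x * \<Psi> x"
    and bd: "\<And>x. x \<in> frontier W \<Longrightarrow> u x \<le> \<Psi> x"
    and x: "x \<in> W"
  shows "u x \<le> \<Psi> x"
proof -
  have "u x + (-1) * \<Psi> x \<le> 0"
  proof (rule max_principle[OF W _ _ pd _ _ x])
    show "continuous_on (closure W) (\<lambda>x. u x + (-1) * \<Psi> x)"
      using cont by (intro continuous_intros)
    show "twice_diff_on W (\<lambda>x. u x + (-1) * \<Psi> x)"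
      using C2 W by (intro twice_diff_on_add twice_diff_on_cmult)
    show "0 < nondiv_op a \<beta> (\<lambda>x. u x + (-1) * \<Psi> x) x" if "x \<in> W" "0 < u x + (-1) * \<Psi> x" for x
    proof -
      have "\<delta> * nondiv_op a \<beta> (\<lambda>x. u x + (-1) * \<Psi> x) x
          = \<delta> * nondiv_op a \<beta> u x - \<delta> * nondiv_op a \<beta> \<Psi> x"
        using C2 W that
        by (subst nondiv_op_add[OF W(1)], simp, simp, intro twice_diff_on_cmult, simp, simp)
          (subst nondiv_op_cmult[OF W(1)], simp_all add: algebra_simps)
      moreover have "V x * \<Psi> x < V x * u x" using that V by simp
      ultimately have "0 < \<delta> * nondiv_op a \<beta> (\<lambda>x. u x + (-1) * \<Psi> x) x"
        using sub[OF that(1)] super[OF that(1)] by linarith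
      then show ?thesis using \<delta> by (simp add: zero_less_mult_iff)
    qed
  qed (use bd in auto)
  then show ?thesis by simp
qed

lemma twice_diff_on_sum:
  assumes "open S" "finite I" "\<And>k. k \<in> I \<Longrightarrow> twice_diff_on S (f k)"
  shows "twice_diff_on S (\<lambda>x. \<Sum>k\<in>I. f k x)"
  using assms(2,3) by (induction I rule: finite_induct)
    (auto intro!: twice_diff_on_add twice_diff_on_const assms(1))

lemma nondiv_op_sum:
  assumes "open S" "x \<in> S" "finite I" "\<And>k. k \<in> I \<Longrightarrow> twice_diff_on S (f k)"
  shows "nondiv_op a \<beta> (\<lambda>x. \<Sum>k\<in>I. f k x) x = (\<Sum>k\<in>I. nondiv_op a \<beta> (f k) x)"
  using assms(3,4)
proof (induction I rule: finite_induct)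
  case empty show ?case by (simp add: nondiv_op_const)
next
  case (insert k I)
  then have "nondiv_op a \<beta> (\<lambda>x. f k x + (\<Sum>k\<in>I. f k x)) x
      = nondiv_op a \<beta> (f k) x + nondiv_op a \<beta> (\<lambda>x. \<Sum>k\<in>I. f k x) x"
    by (intro nondiv_op_add[OF assms(1,2)] twice_diff_on_sum[OF assms(1)]) auto
  with insert show ?case by simp
qed

lemma axis_quadratic: "axis i 1 \<bullet> (A *v axis i (1::real)) = A $ i $ i"
  by (simp add: inner_axis' matrix_vector_mult_basis column_def)

lemma exp_abs_le_cosh: "exp \<bar>y\<bar> \<le> 2 * cosh (y::real)"
  by (cases "y \<ge> 0") (auto simp: cosh_field_def)

text \<open>The barrier is a multiple of the sum of the functions \<open>cosh (\<tau> (x - x0)\<^sub>i / h)\<close>.\<close>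

lemma interior_decay:
  fixes u :: "real^'n::finite \<Rightarrow> real"
  assumes \<rho>: "\<rho> > 0" and h: "h > 0" and tau: "\<tau> > 0"
    and cont: "continuous_on (cball x0 \<rho>) u" and u: "twice_diff_on (ball x0 \<rho>) u"
    and pd: "\<And>x. x \<in> ball x0 \<rho> \<Longrightarrow> transpose (a x) = a x \<and> (\<forall>v. v \<noteq> 0 \<longrightarrow> 0 < v \<bullet> (a x *v v))"
    and aB: "\<And>x i. x \<in> ball x0 \<rho> \<Longrightarrow> a x $ i $ i \<le> A"
    and bB: "\<And>x. x \<in> ball x0 \<rho> \<Longrightarrow> norm (\<beta> x) \<le> B"
    and V: "\<And>x. x \<in> ball x0 \<rho> \<Longrightarrow> Vm \<le> V x" "0 < Vm"
    and small: "A / 2 * \<tau>\<^sup>2 + h * B * \<tau> \<le> Vm"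
    and sub: "\<And>x. x \<in> ball x0 \<rho> \<Longrightarrow> V x * u x \<le> h\<^sup>2 * nondiv_op a \<beta> u x"
    and K: "\<And>x. x \<in> cball x0 \<rho> \<Longrightarrow> u x \<le> K" "0 \<le> K"
  shows "u x0 \<le> 2 * real CARD('n) * K * exp (- (\<tau> * \<rho> / (h * real CARD('n))))"
proof -
  let ?d = "real CARD('n)"
  let ?l = "\<tau> / h"
  let ?F = "\<lambda>t. cosh (?l * t)" and ?F' = "\<lambda>t. ?l * sinh (?l * t)" and ?F'' = "\<lambda>t. ?l * (?l * cosh (?l * t))"
  have dF: "(?F has_real_derivative ?F' t) (at t)" for t
    using h by (auto intro!: derivative_eq_intros)
  have dF': "(?F' has_real_derivative ?F'' t) (at t)" for t
    using h by (auto intro!: derivative_eq_intros)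
  let ?R = "\<lambda>i x. ?F (axis i 1 \<bullet> (x - x0))"
  have R2: "twice_diff_on S (?R i)" for S i by (rule twice_diff_on_ridge[OF dF dF'])
  \<comment> \<open>On the sphere some coordinate of \<open>x - x0\<close> has modulus at least
    \<open>\<rho> / d\<close>, \<open>d\<close> the dimension, so a single summand already lifts the
    barrier to \<open>K\<close> there.\<close>
  define C where "C = K / cosh (\<tau> * \<rho> / (h * ?d))"
  have C0: "C \<ge> 0" using K by (simp add: C_def)
  define \<Psi> where "\<Psi> x = C * (\<Sum>i\<in>UNIV. ?R i x)" for x
  let ?W = "ball x0 \<rho>"
  have clW: "closure ?W = cball x0 \<rho>" and frW: "frontier ?W = sphere x0 \<rho>"
    using \<rho> by (auto simp: frontier_ball)
  have "u x0 \<le> \<Psi> x0"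
  proof (rule comparison_principle[where W = ?W and \<delta> = "h\<^sup>2" and a = a and \<beta> = \<beta> and V = V])
    show "continuous_on (closure ?W) \<Psi>"
      unfolding \<Psi>_def by (intro continuous_intros continuous_on_compose2[OF _ _ subset_UNIV, of cosh]
        continuous_on_cosh) 
    show "twice_diff_on ?W \<Psi>"
      unfolding \<Psi>_def by (intro twice_diff_on_cmult twice_diff_on_sum R2) auto
    show "h\<^sup>2 * nondiv_op a \<beta> \<Psi> x \<le> V x * \<Psi> x" if x: "x \<in> ?W" for x
    proof -
      have eq: "nondiv_op a \<beta> \<Psi> x = C * (\<Sum>i\<in>UNIV. nondiv_op a \<beta> (?R i) x)"
        unfolding \<Psi>_def
        by (subst nondiv_op_cmult[OF open_ball x twice_diff_on_sum], simp, simp, rule R2)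
          (subst nondiv_op_sum[OF open_ball x], simp, rule R2, rule refl)
      have "h\<^sup>2 * nondiv_op a \<beta> (?R i) x \<le> V x * ?R i x" for i
      proof -
        let ?t = "axis i 1 \<bullet> (x - x0)"
        have "h\<^sup>2 * nondiv_op a \<beta> (?R i) x
          = a x $ i $ i / 2 * \<tau>\<^sup>2 * cosh (?l * ?t) + h * \<tau> * (\<beta> x $ i * sinh (?l * ?t))"
          unfolding nondiv_op_ridge[OF dF dF'] axis_quadratic
          using h by (simp add: power2_eq_square inner_axis field_simps)
        also have "\<dots> \<le> A / 2 * \<tau>\<^sup>2 * cosh (?l * ?t) + h * \<tau> * (B * cosh (?l * ?t))"
        proof (intro add_mono mult_right_mono mult_left_mono)
          \<comment> \<open>The drift produces a hyperbolic sine; dominating it by the hyperbolic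
            cosine lets \<open>small\<close> bound both terms by \<open>Vm\<close> times the
            barrier.\<close>
          have "\<bar>sinh (?l * ?t)\<bar> \<le> cosh (?l * ?t)"
            using sinh_le_cosh_real[of "\<bar>?l * ?t\<bar>"] by (simp only: sinh_real_abs cosh_real_abs)
          moreover have "\<bar>\<beta> x $ i\<bar> \<le> B"
            using component_le_norm_cart[of "\<beta> x" i] bB[OF x] by linarith
          ultimately have "\<bar>\<beta> x $ i * sinh (?l * ?t)\<bar> \<le> B * cosh (?l * ?t)"
            unfolding abs_mult by (intro mult_mono) auto
          then show "\<beta> x $ i * sinh (?l * ?t) \<le> B * cosh (?l * ?t)" by linarith
        qed (use aB[OF x] h tau in auto)
        also have "\<dots> = (A / 2 * \<tau>\<^sup>2 + h * B * \<tau>) * cosh (?l * ?t)" by (simp add: algebra_simps)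
        also have "\<dots> \<le> V x * cosh (?l * ?t)"
          using small V(1)[OF x] by (intro mult_right_mono) auto
        finally show ?thesis .
      qed
      then have "(\<Sum>i\<in>UNIV. h\<^sup>2 * nondiv_op a \<beta> (?R i) x) \<le> (\<Sum>i\<in>UNIV. V x * ?R i x)"
        by (intro sum_mono)
      then have "C * (h\<^sup>2 * (\<Sum>i\<in>UNIV. nondiv_op a \<beta> (?R i) x)) \<le> C * (V x * (\<Sum>i\<in>UNIV. ?R i x))"
        using C0 by (intro mult_left_mono) (simp_all add: sum_distrib_left)
      then show ?thesis unfolding eq \<Psi>_def by (simp add: mult_ac)
    qed
    show "u x \<le> \<Psi> x" if "x \<in> frontier ?W" for x
    proof -
      have nx: "norm (x - x0) = \<rho>" using that by (simp add: frW dist_norm norm_minus_commute)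
      have "\<exists>i. \<rho> / ?d \<le> \<bar>(x - x0) $ i\<bar>"
      proof (rule ccontr)
        assume "\<not> ?thesis"
        then have "(\<Sum>i\<in>UNIV. \<bar>(x - x0) $ i\<bar>) < (\<Sum>i\<in>(UNIV::'n set). \<rho> / ?d)"
          by (intro sum_strict_mono) (auto simp: not_le)
        then show False using norm_le_l1_cart[of "x - x0"] nx by simp
      qed
      then obtain i where i: "\<rho> / ?d \<le> \<bar>(x - x0) $ i\<bar>" by blast
      have "\<tau> * \<rho> / (h * ?d) = ?l * (\<rho> / ?d)" by simp
      also have "\<dots> \<le> ?l * \<bar>(x - x0) $ i\<bar>" using h tau i by (intro mult_left_mono) auto
      finally have "cosh (\<tau> * \<rho> / (h * ?d)) \<le> cosh (?l * \<bar>(x - x0) $ i\<bar>)"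
        using h tau \<rho> by (subst cosh_real_nonneg_le_iff) auto
      also have "?l * \<bar>(x - x0) $ i\<bar> = \<bar>?l * (x - x0) $ i\<bar>"
        using h tau by (simp add: abs_mult)
      finally have "cosh (\<tau> * \<rho> / (h * ?d)) \<le> ?R i x"
        unfolding cosh_real_abs by (simp add: inner_axis')
      also have "?R i x \<le> (\<Sum>i\<in>UNIV. ?R i x)"
        by (rule member_le_sum) auto
      finally have "C * cosh (\<tau> * \<rho> / (h * ?d)) \<le> \<Psi> x"
        unfolding \<Psi>_def using C0 by (intro mult_left_mono)
      moreover have "C * cosh (\<tau> * \<rho> / (h * ?d)) = K" by (simp add: C_def)
      ultimately show ?thesis using K(1)[of x] that by (simp add: frW)
    qed
    show "0 < V x" if "x \<in> ?W" for x using V(1)[OF that] V(2) by linarith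
  qed (use \<rho> h cont u pd sub clW in auto)
  also have "\<Psi> x0 = C * ?d" by (simp add: \<Psi>_def)
  also have "C \<le> 2 * K * exp (- (\<tau> * \<rho> / (h * ?d)))"
  proof -
    let ?y = "\<tau> * \<rho> / (h * ?d)"
    have "exp ?y \<le> 2 * cosh ?y" using exp_abs_le_cosh[of ?y] h tau \<rho> by simp
    then have "1 \<le> 2 * exp (- ?y) * cosh ?y" by (simp add: exp_minus field_simps)
    then have "K * 1 \<le> K * (2 * exp (- ?y) * cosh ?y)" using K by (intro mult_left_mono) auto
    then show ?thesis unfolding C_def by (subst pos_divide_le_eq) (auto simp: mult_ac)
  qed
  finally show ?thesis by (simp add: mult_ac mult_right_mono)
qed

section \<open>The boundary layer profile\<close>

text \<open>The setting of the blow-up at \<open>p\<close>. \<open>above\<close> and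
  \<open>flat\<close> say to first order that \<open>\<nu>\<close> is the inward normal;
  \<open>lim\<close> says that the exponential with rate \<open>\<kappa>\<close> solves the equation
  with coefficients frozen at \<open>p\<close>; \<open>equicont\<close> makes the boundary data
  constant in the blow-up, uniformly in \<open>j\<close>.\<close>

locale boundary_layer =
  fixes D :: "(real^'n::finite) set" and a :: "real^'n \<Rightarrow> real^'n^'n" and \<beta> :: "real^'n \<Rightarrow> real^'n"
    and V :: "real^'n \<Rightarrow> real" and p \<nu> :: "real^'n" and A B Vm K \<kappa> :: real
    and h :: "nat \<Rightarrow> real" and u :: "nat \<Rightarrow> real^'n \<Rightarrow> real"
  assumes D: "open D" "bounded D"
    and p: "p \<in> frontier D" and nu: "norm \<nu> = 1"
    and pd: "\<And>x. x \<in> D \<Longrightarrow> transpose (a x) = a x \<and> (\<forall>v. v \<noteq> 0 \<longrightarrow> 0 < v \<bullet> (a x *v v))"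
    and aB: "\<And>x i. x \<in> D \<Longrightarrow> a x $ i $ i \<le> A" "0 \<le> A"
    and bB: "\<And>x. x \<in> D \<Longrightarrow> norm (\<beta> x) \<le> B" "0 \<le> B"
    and Vm: "\<And>x. x \<in> D \<Longrightarrow> Vm \<le> V x" "0 < Vm"
    and lim: "((\<lambda>x. 1/2 * \<kappa>\<^sup>2 * (\<nu> \<bullet> (a x *v \<nu>)) - V x) \<longlongrightarrow> 0) (at p within D)"
    and kappa: "0 < \<kappa>"
    and above: "\<And>\<eta>. 0 < \<eta> \<Longrightarrow> \<exists>\<rho>>0. \<forall>x\<in>closure D. dist x p < \<rho> \<longrightarrow> - \<eta> * dist x p \<le> \<nu> \<bullet> (x - p)"
    and flat: "\<And>\<eta>. 0 < \<eta> \<Longrightarrow> \<exists>\<rho>>0. \<forall>x\<in>frontier D. dist x p < \<rho> \<longrightarrow> \<bar>\<nu> \<bullet> (x - p)\<bar> \<le> \<eta> * dist x p"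
    and h: "\<And>j. 0 < h j" "h \<longlonglongrightarrow> 0"
    and cont: "\<And>j. continuous_on (closure D) (u j)" and C2: "\<And>j. twice_diff_on D (u j)"
    and K: "\<And>j x. x \<in> closure D \<Longrightarrow> \<bar>u j x\<bar> \<le> K"
    and eq: "\<And>j x. x \<in> D \<Longrightarrow> (h j)\<^sup>2 * nondiv_op a \<beta> (u j) x = V x * u j x"
    and equicont: "\<And>\<eta>. 0 < \<eta> \<Longrightarrow> \<exists>\<rho>>0. \<forall>j. \<forall>x\<in>frontier D. dist x p < \<rho> \<longrightarrow> \<bar>u j x - u j p\<bar> \<le> \<eta>"
begin

lemma K0: "0 \<le> K"
  using K[of p 0] p by (force simp: frontier_def)

text \<open>In the ball of radius \<open>h R\<close> around \<open>p\<close>, the half-space profile \<open>exp (- \<kappa> \<nu> \<bullet> (x - p) / h)\<close> plus a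
  quadratic that dominates \<open>u\<close> on the sphere is a supersolution.\<close>

lemma upper_barrier:
  assumes \<eta>: "0 < \<eta>"
  shows "\<forall>\<^sub>F j in sequentially. p + h j *\<^sub>R X \<in> D \<longrightarrow> u j (p + h j *\<^sub>R X) \<le> u j p * exp (- \<kappa> * (\<nu> \<bullet> X)) + \<eta>"
proof -
  \<comment> \<open>The height which the quadratic has to reach on the sphere, where
    \<open>u\<close> is at most \<open>K\<close> and the profile term is at least
    \<open>- K * exp 1\<close>.\<close>
  define K' where "K' = K * (1 + exp 1)"
  have K'0: "0 \<le> K'" and KK': "K * exp 1 + K \<le> K'" using K0 by (auto simp: K'_def algebra_simps)
  \<comment> \<open>In the rescaled ball, \<open>h^2\<close> times the operator maps the quadratic
    \<open>q\<close> to at most \<open>d * A + 1\<close>, \<open>d\<close> the dimension; division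
    by \<open>Vm\<close> gives the constant that turns \<open>q + C0\<close> into a
    supersolution.\<close>
  define C0 where "C0 = (real CARD('n) * A + 1) / Vm"
  have C0: "0 \<le> C0" using aB Vm by (simp add: C0_def)
  define \<eta>' where "\<eta>' = \<eta> / 2"
  have \<eta>': "0 < \<eta>'" using \<eta> by (simp add: \<eta>'_def)
  \<comment> \<open>The quadratic enters with coefficient \<open>K' / R^2\<close>: a large radius
    makes its contribution at the fixed point \<open>X\<close> at most \<open>\<eta>'\<close>
    although it equals \<open>K'\<close> on the sphere.\<close>
  define R where "R = 1 + norm X + K' * ((norm X)\<^sup>2 + C0) / \<eta>'"
  have R: "1 \<le> R" "norm X < R" and RK: "K' * ((norm X)\<^sup>2 + C0) / R\<^sup>2 \<le> \<eta>'"
  proof -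
    have nn: "0 \<le> K' * ((norm X)\<^sup>2 + C0) / \<eta>'" using K'0 C0 \<eta>' by (intro divide_nonneg_pos) auto
    then show R1: "1 \<le> R" "norm X < R" by (auto simp: R_def)
    have "K' * ((norm X)\<^sup>2 + C0) = (K' * ((norm X)\<^sup>2 + C0) / \<eta>') * \<eta>'" using \<eta>' by simp
    also have "\<dots> \<le> R * \<eta>'" using \<eta>' by (intro mult_right_mono) (auto simp: R_def add_nonneg_nonneg)
    also have "\<dots> \<le> R\<^sup>2 * \<eta>'" using R1 \<eta>' by (intro mult_right_mono) (auto simp: power2_eq_square)
    finally show "K' * ((norm X)\<^sup>2 + C0) / R\<^sup>2 \<le> \<eta>'" using R1 by (subst pos_divide_le_eq) (auto simp: mult.commute)
  qed
  define \<epsilon> where "\<epsilon> = \<eta>' / (2 * (K + 1))"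
  have \<epsilon>: "0 < \<epsilon>" and K\<epsilon>: "K * \<epsilon> \<le> \<eta>' / 2"
    using \<eta>' K0 by (auto simp: \<epsilon>_def field_simps)
  have "isCont exp (0::real)" by simp
  then obtain \<tau> where \<tau>: "0 < \<tau>" "\<And>t::real. \<bar>t\<bar> \<le> \<tau> \<Longrightarrow> \<bar>exp t - 1\<bar> \<le> \<epsilon>"
  proof -
    assume ex: "\<And>\<tau>. 0 < \<tau> \<Longrightarrow> (\<And>t::real. \<bar>t\<bar> \<le> \<tau> \<Longrightarrow> \<bar>exp t - 1\<bar> \<le> \<epsilon>) \<Longrightarrow> thesis"
    from \<open>isCont exp (0::real)\<close> \<epsilon> obtain d where d: "d > 0" "\<And>t::real. dist t 0 < d \<Longrightarrow> dist (exp t) (exp 0) < \<epsilon>"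
      unfolding continuous_at_eps_delta by blast
    show thesis
    proof (rule ex[of "d/2"])
      show "\<bar>exp t - 1\<bar> \<le> \<epsilon>" if "\<bar>t\<bar> \<le> d / 2" for t
        using d(2)[of t] that d(1) by (simp add: dist_real_def)
    qed (use d in simp)
  qed
  \<comment> \<open>Within distance \<open>h R\<close> of \<open>p\<close> the domain falls below
    the tangent plane by at most \<open>h / \<kappa>\<close>, so the profile is at most
    \<open>exp 1\<close> there.\<close>
  obtain \<rho>1 where \<rho>1: "\<rho>1 > 0" "\<And>x. x \<in> closure D \<Longrightarrow> dist x p < \<rho>1 \<Longrightarrow> - (1 / (\<kappa> * R)) * dist x p \<le> \<nu> \<bullet> (x - p)"
    using above[of "1 / (\<kappa> * R)"] kappa R by auto
  \<comment> \<open>Boundary points within distance \<open>h R\<close> are so close to the tangent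
    plane that the exponent of the profile is at most \<open>\<tau>\<close>, and the profile is
    within \<open>\<epsilon>\<close> of 1.\<close>
  obtain \<rho>2 where \<rho>2: "\<rho>2 > 0" "\<And>x. x \<in> frontier D \<Longrightarrow> dist x p < \<rho>2 \<Longrightarrow> \<bar>\<nu> \<bullet> (x - p)\<bar> \<le> (\<tau> / (\<kappa> * R)) * dist x p"
    using flat[of "\<tau> / (\<kappa> * R)"] kappa R \<tau> by auto
  \<comment> \<open>The error from freezing the coefficients and the drift term are each at most
    \<open>\<epsilon>3\<close>; multiplied by the bound \<open>K * exp 1\<close> of the profile
    term, both together must be absorbed by \<open>Vm * \<eta>'\<close>.\<close>
  define \<epsilon>3 where "\<epsilon>3 = Vm * \<eta>' / (2 * (K + 1) * exp 1)"
  have \<epsilon>3: "0 < \<epsilon>3" using Vm \<eta>' K0 by (simp add: \<epsilon>3_def)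
  have K\<epsilon>3: "K * exp 1 * (2 * \<epsilon>3) \<le> Vm * \<eta>'"
  proof -
    have "K * exp 1 * (2 * \<epsilon>3) \<le> (K + 1) * exp 1 * (2 * \<epsilon>3)"
      using \<epsilon>3 by (intro mult_right_mono) auto
    also have "\<dots> = Vm * \<eta>'"
    proof -
      have "2 * (K + 1) * exp 1 \<noteq> 0" using K0 by simp
      then show ?thesis unfolding \<epsilon>3_def by (simp add: field_simps)
    qed
    finally show ?thesis by simp
  qed
  from tendstoD[OF lim \<epsilon>3] obtain \<rho>3 where \<rho>3: "\<rho>3 > 0"
    "\<And>x. x \<in> D \<Longrightarrow> x \<noteq> p \<Longrightarrow> dist x p < \<rho>3 \<Longrightarrow> \<bar>1/2 * \<kappa>\<^sup>2 * (\<nu> \<bullet> (a x *v \<nu>)) - V x\<bar> < \<epsilon>3"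
    unfolding eventually_at by (auto simp: dist_real_def)
  obtain \<rho>4 where \<rho>4: "\<rho>4 > 0" "\<And>j x. x \<in> frontier D \<Longrightarrow> dist x p < \<rho>4 \<Longrightarrow> \<bar>u j x - u j p\<bar> \<le> \<eta>' / 2"
    using equicont[of "\<eta>' / 2"] \<eta>' by auto
  have pD: "p \<notin> D" using p D by (simp add: frontier_def interior_open)
  \<comment> \<open>The first four bounds put the ball of radius \<open>h R\<close> inside the four
    neighbourhoods; the last two control the drift acting on the profile and on the
    quadratic.\<close>
  define h0 where "h0 = Min {\<rho>1 / (2 * R), \<rho>2 / (2 * R), \<rho>3 / (2 * R), \<rho>4 / (2 * R), \<epsilon>3 / (\<kappa> * B + 1), 1 / (2 * B * R + 1)}"
  have h0: "0 < h0" using \<rho>1 \<rho>2 \<rho>3 \<rho>4 R \<epsilon>3 kappa bB by (simp add: h0_def add_nonneg_pos)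
  have "\<forall>\<^sub>F j in sequentially. h j < h0" using order_tendstoD(2)[OF h(2) h0] .
  then show ?thesis
  proof (rule eventually_mono, intro impI)
    fix j assume hj: "h j < h0" and XD: "p + h j *\<^sub>R X \<in> D"
    let ?h = "h j"
    have hp: "0 < ?h" by (rule h)
    have hR: "?h * R < \<rho>1" "?h * R < \<rho>2" "?h * R < \<rho>3" "?h * R < \<rho>4"
      using hj R \<rho>1(1) \<rho>2(1) \<rho>3(1) \<rho>4(1) unfolding h0_def by (auto simp: field_simps)
    have "?h < \<epsilon>3 / (\<kappa> * B + 1)" "?h < 1 / (2 * B * R + 1)" using hj by (auto simp: h0_def)
    moreover have "0 < \<kappa> * B + 1" "0 < 2 * B * R + 1" using kappa bB R by (auto intro: add_nonneg_pos)
    ultimately have "?h * (\<kappa> * B + 1) < \<epsilon>3" "?h * (2 * B * R + 1) < 1" by (simp_all add: field_simps)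
    then have hB: "?h * \<kappa> * B \<le> \<epsilon>3" "2 * B * (?h * R) \<le> 1"
      using hp by (simp_all add: algebra_simps)
    let ?W = "D \<inter> ball p (?h * R)"
    let ?g = "u j p"
    have g: "\<bar>?g\<bar> \<le> K" using K[of p] p by (simp add: frontier_def)
    let ?E = "\<lambda>t. exp (- (\<kappa> / ?h) * t)" and ?E' = "\<lambda>t. - (\<kappa> / ?h) * exp (- (\<kappa> / ?h) * t)"
      and ?E'' = "\<lambda>t. (\<kappa> / ?h)\<^sup>2 * exp (- (\<kappa> / ?h) * t)"
    have dE: "(?E has_real_derivative ?E' t) (at t)" for t
      using hp by (auto intro!: derivative_eq_intros)
    have dE': "(?E' has_real_derivative ?E'' t) (at t)" for t
      using hp by (auto intro!: derivative_eq_intros simp: power2_eq_square)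
    define c where "c = 1 / ?h\<^sup>2"
    have hc: "?h\<^sup>2 * c = 1" using hp by (simp add: c_def)
    let ?Q = "\<lambda>t. c * t\<^sup>2" and ?Q' = "\<lambda>t. 2 * c * t" and ?Q'' = "\<lambda>t::real. 2 * c"
    have dQ: "(?Q has_real_derivative ?Q' t) (at t)" for t
      by (auto intro!: derivative_eq_intros)
    have dQ': "(?Q' has_real_derivative ?Q'' t) (at t)" for t
      by (auto intro!: derivative_eq_intros)
    define e where "e x = ?E (\<nu> \<bullet> (x - p))" for x
    define q where "q x = (\<Sum>i\<in>UNIV. ?Q (axis i 1 \<bullet> (x - p)))" for x :: "real^'n"
    have q_eq: "q x = (norm (x - p))\<^sup>2 / ?h\<^sup>2" for x
    proof -
      have "q x = c * (\<Sum>i\<in>UNIV. ((x - p) $ i)\<^sup>2)"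
        by (simp add: q_def inner_axis' sum_distrib_left)
      also have "(\<Sum>i\<in>UNIV. ((x - p) $ i)\<^sup>2) = (norm (x - p))\<^sup>2"
        unfolding power2_norm_eq_inner inner_vec_def by (simp add: power2_eq_square)
      finally show ?thesis by (simp add: c_def)
    qed
    define k where "k = K' / R\<^sup>2"
    have k0: "0 \<le> k" and kR: "k * R\<^sup>2 = K'" using K'0 R by (simp_all add: k_def)
    \<comment> \<open>Of the constants, \<open>\<eta>'\<close> absorbs the errors on the boundary
      and in the equation for the profile, and \<open>k * C0\<close> pays for the positive values of
      the operator on the quadratic.\<close>
    define \<Psi> where "\<Psi> x = (?g * e x + k * q x) + (\<eta>' + k * C0)" for x
    have e2: "twice_diff_on S e" for S unfolding e_def by (rule twice_diff_on_ridge[OF dE dE'])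
    have q2: "twice_diff_on S (\<lambda>x. ?Q (axis i 1 \<bullet> (x - p)))" for S i
      by (rule twice_diff_on_ridge[OF dQ dQ'])
    have Wo: "open ?W" using D by auto
    have qs2: "twice_diff_on ?W q" unfolding q_def by (intro twice_diff_on_sum q2 Wo) auto
    have e_le: "e x \<le> exp 1" if "x \<in> closure D" "dist x p \<le> ?h * R" for x
    proof -
      have "- (1 / (\<kappa> * R)) * dist x p \<le> \<nu> \<bullet> (x - p)" using that hR by (intro \<rho>1) auto
      moreover have "(1 / (\<kappa> * R)) * dist x p \<le> (1 / (\<kappa> * R)) * (?h * R)"
        using that kappa R by (intro mult_left_mono) auto
      moreover have "(1 / (\<kappa> * R)) * (?h * R) = ?h / \<kappa>" using R by simp
      ultimately have "- (?h / \<kappa>) \<le> \<nu> \<bullet> (x - p)" by linarith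
      then have "(\<kappa> / ?h) * (- (?h / \<kappa>)) \<le> (\<kappa> / ?h) * (\<nu> \<bullet> (x - p))"
        using kappa hp by (intro mult_left_mono) auto
      then show ?thesis using kappa hp by (simp add: e_def)
    qed
    have e_pos: "0 < e x" for x by (simp add: e_def)
    have fr: "frontier ?W \<subseteq> closure ?W \<inter> (frontier D \<union> sphere p (?h * R))"
      using frontier_Int[of D "ball p (?h * R)"] hp R by (auto simp: frontier_ball)
    have clW: "x \<in> closure D \<and> dist x p \<le> ?h * R" if "x \<in> closure ?W" for x
    proof -
      have "closure (ball p (?h * R)) = cball p (?h * R)" using hp R by (intro closure_ball) simp
      then show ?thesis
        using closure_mono[of ?W D] closure_mono[of ?W "ball p (?h * R)"] that by (auto simp: dist_commute)
    qed
    have "u j (p + ?h *\<^sub>R X) \<le> \<Psi> (p + ?h *\<^sub>R X)"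
    proof (rule comparison_principle[where W = ?W and \<delta> = "?h\<^sup>2" and a = a and \<beta> = \<beta> and V = V and u = "u j"])
      show "open ?W" "bounded ?W" using D by auto
      show "continuous_on (closure ?W) (u j)"
        by (rule continuous_on_subset[OF cont]) (use clW in blast)
      show "continuous_on (closure ?W) \<Psi>"
        unfolding \<Psi>_def e_def q_def by (intro continuous_intros)
      show "twice_diff_on ?W (u j)" by (rule twice_diff_on_subset[OF C2]) auto
      show "twice_diff_on ?W \<Psi>"
        unfolding \<Psi>_def
        by (intro twice_diff_on_add[OF Wo] twice_diff_on_cmult[OF Wo] twice_diff_on_const e2 qs2)
      show "transpose (a x) = a x \<and> (\<forall>v. v \<noteq> 0 \<longrightarrow> 0 < v \<bullet> (a x *v v))" if "x \<in> ?W" for x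
        using pd that by blast
      show "0 < V x" if "x \<in> ?W" for x using Vm(1)[of x] Vm(2) that by auto
      show "0 < ?h\<^sup>2" using hp by simp
      show "V x * u j x \<le> ?h\<^sup>2 * nondiv_op a \<beta> (u j) x" if "x \<in> ?W" for x
        using eq[of x j] that by simp
      show "p + ?h *\<^sub>R X \<in> ?W" using XD hp R by (simp add: dist_norm)
    next
      fix x assume x: "x \<in> frontier ?W"
      then have x': "x \<in> closure D" "dist x p \<le> ?h * R" "x \<in> frontier D \<or> dist x p = ?h * R"
    proof -
      have c: "x \<in> closure ?W" and d: "x \<in> frontier D \<or> x \<in> sphere p (?h * R)" using x fr by blast+
      show "x \<in> closure D" "dist x p \<le> ?h * R" using clW[OF c] by blast+
      show "x \<in> frontier D \<or> dist x p = ?h * R" using d by (simp add: dist_commute)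
    qed
      have cq: "0 \<le> k * (q x + C0)" using k0 C0 by (simp add: q_eq)
      have \<Psi>_eq: "\<Psi> x = ?g * e x + \<eta>' + k * (q x + C0)" by (simp add: \<Psi>_def algebra_simps)
      from x'(3) show "u j x \<le> \<Psi> x"
      proof
        assume xf: "x \<in> frontier D"
        have "dist x p < \<rho>4" using x'(2) hR by linarith
        from \<rho>4(2)[OF xf this, of j] have "u j x \<le> ?g + \<eta>' / 2" by linarith
        moreover have "?g - ?g * e x \<le> \<eta>' / 2"
        proof -
          have "\<bar>\<nu> \<bullet> (x - p)\<bar> \<le> (\<tau> / (\<kappa> * R)) * dist x p" using xf x'(2) hR by (intro \<rho>2) auto
          also have "\<dots> \<le> (\<tau> / (\<kappa> * R)) * (?h * R)" using x'(2) \<tau> kappa R by (intro mult_left_mono) auto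
          also have "\<dots> = \<tau> * ?h / \<kappa>" using R by simp
          finally have "(\<kappa> / ?h) * \<bar>\<nu> \<bullet> (x - p)\<bar> \<le> (\<kappa> / ?h) * (\<tau> * ?h / \<kappa>)"
            using kappa hp by (intro mult_left_mono) auto
          then have "\<bar>- (\<kappa> / ?h) * (\<nu> \<bullet> (x - p))\<bar> \<le> \<tau>" using kappa hp by (simp add: abs_mult)
          then have "\<bar>e x - 1\<bar> \<le> \<epsilon>" unfolding e_def by (rule \<tau>(2))
          then have "\<bar>?g\<bar> * \<bar>1 - e x\<bar> \<le> K * \<epsilon>" using g \<epsilon> by (intro mult_mono) auto
          then have "\<bar>?g * (1 - e x)\<bar> \<le> \<eta>' / 2" using K\<epsilon> by (simp only: abs_mult)
          then have "?g * (1 - e x) \<le> \<eta>' / 2" by (rule abs_le_D1)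
          then show ?thesis by (simp only: right_diff_distrib mult_1_right)
        qed
        ultimately show ?thesis using \<Psi>_eq cq by linarith
      next
        assume xs: "dist x p = ?h * R"
        have "q x = R\<^sup>2" using xs hp by (simp add: q_eq dist_norm power_mult_distrib)
        then have "k * (q x + C0) = K' + k * C0" by (simp add: distrib_left kR)
        moreover have "0 \<le> k * C0" using k0 C0 by simp
        moreover have "\<bar>?g\<bar> * e x \<le> K * exp 1"
          using g e_le[OF x'(1,2)] e_pos[of x] by (intro mult_mono) auto
        then have "- (?g * e x) \<le> K * exp 1"
          using e_pos[of x] by (metis abs_le_iff abs_mult abs_of_pos order_trans order_refl)
        moreover have "u j x \<le> K" using K[OF x'(1), of j] by linarith
        ultimately show ?thesis using \<Psi>_eq KK' \<eta>' by linarith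
      qed
    next
      fix x assume x: "x \<in> ?W"
      then have xD: "x \<in> D" "x \<in> closure D" "dist x p \<le> ?h * R" "dist x p < \<rho>3" "x \<noteq> p"
        using closure_subset hR pD by (auto simp: dist_commute)
      have Vx: "Vm \<le> V x" using Vm xD by auto
      have eop: "?h\<^sup>2 * nondiv_op a \<beta> e x = (1/2 * \<kappa>\<^sup>2 * (\<nu> \<bullet> (a x *v \<nu>)) - ?h * \<kappa> * (\<beta> x \<bullet> \<nu>)) * e x"
        unfolding e_def nondiv_op_ridge[OF dE dE'] using hp
        by (simp add: power_divide algebra_simps) (simp add: power2_eq_square)
      have qop: "?h\<^sup>2 * nondiv_op a \<beta> q x = (\<Sum>i\<in>UNIV. a x $ i $ i) + 2 * (\<beta> x \<bullet> (x - p))"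
      proof -
        have "nondiv_op a \<beta> q x = (\<Sum>i\<in>UNIV. nondiv_op a \<beta> (\<lambda>x. ?Q (axis i 1 \<bullet> (x - p))) x)"
          unfolding q_def by (rule nondiv_op_sum[OF Wo x _ q2]) simp
        also have "\<dots> = (\<Sum>i\<in>UNIV. 1/2 * (a x $ i $ i) * (2 * c) + \<beta> x $ i * (2 * c * (x - p) $ i))"
          unfolding nondiv_op_ridge[OF dQ dQ'] axis_quadratic by (simp add: inner_axis inner_axis')
        also have "\<dots> = c * (\<Sum>i\<in>UNIV. a x $ i $ i + 2 * (\<beta> x $ i * (x - p) $ i))"
          unfolding sum_distrib_left by (intro sum.cong) (auto simp: algebra_simps)
        finally have "?h\<^sup>2 * nondiv_op a \<beta> q x = (?h\<^sup>2 * c) * (\<Sum>i\<in>UNIV. a x $ i $ i + 2 * (\<beta> x $ i * (x - p) $ i))"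
          by (simp only: mult.assoc)
        also have "\<dots> = (\<Sum>i\<in>UNIV. a x $ i $ i + 2 * (\<beta> x $ i * (x - p) $ i))" by (simp only: hc mult_1)
        finally show ?thesis by (simp add: sum.distrib inner_vec_def sum_distrib_left)
      qed
      have "nondiv_op a \<beta> \<Psi> x = ?g * nondiv_op a \<beta> e x + k * nondiv_op a \<beta> q x"
      proof -
        have "nondiv_op a \<beta> \<Psi> x = nondiv_op a \<beta> (\<lambda>x. ?g * e x + k * q x) x + 0"
          unfolding \<Psi>_def
          by (subst nondiv_op_add[OF Wo x])
            (auto intro!: twice_diff_on_add[OF Wo] twice_diff_on_cmult[OF Wo] twice_diff_on_const e2 qs2 simp: nondiv_op_const)
        also have "nondiv_op a \<beta> (\<lambda>x. ?g * e x + k * q x) x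
            = ?g * nondiv_op a \<beta> e x + k * nondiv_op a \<beta> q x"
          by (subst nondiv_op_add[OF Wo x twice_diff_on_cmult[OF Wo e2] twice_diff_on_cmult[OF Wo qs2]])
            (simp only: nondiv_op_cmult[OF Wo x e2] nondiv_op_cmult[OF Wo x qs2])
        finally show ?thesis by simp
      qed
      then have lhs: "?h\<^sup>2 * nondiv_op a \<beta> \<Psi> x
          = ?g * (?h\<^sup>2 * nondiv_op a \<beta> e x) + k * (?h\<^sup>2 * nondiv_op a \<beta> q x)"
        by (simp add: algebra_simps)
      have "?g * (?h\<^sup>2 * nondiv_op a \<beta> e x) - V x * (?g * e x)
          = ?g * e x * ((1/2 * \<kappa>\<^sup>2 * (\<nu> \<bullet> (a x *v \<nu>)) - V x) - ?h * \<kappa> * (\<beta> x \<bullet> \<nu>))"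
        unfolding eop by (simp add: algebra_simps)
      also have "\<dots> \<le> K * exp 1 * (2 * \<epsilon>3)"
      proof -
        have "\<bar>\<beta> x \<bullet> \<nu>\<bar> \<le> B" using Cauchy_Schwarz_ineq2[of "\<beta> x" \<nu>] bB(1)[OF xD(1)] nu by simp
        then have "\<bar>?h * \<kappa> * (\<beta> x \<bullet> \<nu>)\<bar> \<le> ?h * \<kappa> * B"
          using hp kappa by (simp add: abs_mult)
        then have "\<bar>(1/2 * \<kappa>\<^sup>2 * (\<nu> \<bullet> (a x *v \<nu>)) - V x) - ?h * \<kappa> * (\<beta> x \<bullet> \<nu>)\<bar> \<le> 2 * \<epsilon>3"
          using \<rho>3(2)[OF xD(1,5,4)] hB(1) by linarith
        moreover have "\<bar>?g * e x\<bar> \<le> K * exp 1"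
          unfolding abs_mult using g e_le[OF xD(2,3)] e_pos[of x] by (intro mult_mono) auto
        ultimately have "\<bar>?g * e x * ((1/2 * \<kappa>\<^sup>2 * (\<nu> \<bullet> (a x *v \<nu>)) - V x) - ?h * \<kappa> * (\<beta> x \<bullet> \<nu>))\<bar> \<le> K * exp 1 * (2 * \<epsilon>3)"
          unfolding abs_mult[of "?g * e x"] using \<epsilon>3 K0 by (intro mult_mono) auto
        then show ?thesis by linarith
      qed
      also have "\<dots> \<le> V x * \<eta>'" using K\<epsilon>3 Vx \<eta>' by (meson less_imp_le mult_right_mono order_trans)
      finally have p1: "?g * (?h\<^sup>2 * nondiv_op a \<beta> e x) \<le> V x * (?g * e x) + V x * \<eta>'" by linarith
      have "?h\<^sup>2 * nondiv_op a \<beta> q x \<le> real CARD('n) * A + 1"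
      proof -
        have "(\<Sum>i\<in>UNIV. a x $ i $ i) \<le> real CARD('n) * A"
          using sum_bounded_above[of UNIV "\<lambda>i. a x $ i $ i" A] aB(1)[OF xD(1)] by simp
        moreover have "\<beta> x \<bullet> (x - p) \<le> B * (?h * R)"
        proof -
          have "\<beta> x \<bullet> (x - p) \<le> norm (\<beta> x) * norm (x - p)" by (rule norm_cauchy_schwarz)
          also have "\<dots> \<le> B * (?h * R)"
            using bB(1)[OF xD(1)] xD(3) bB(2) by (intro mult_mono) (auto simp: dist_norm)
          finally show ?thesis .
        qed
        ultimately show ?thesis unfolding qop using hB(2) by linarith
      qed
      also have "\<dots> = Vm * C0" using Vm by (simp add: C0_def)
      also have "\<dots> \<le> V x * (q x + C0)" using Vx Vm C0 by (intro mult_mono) (auto simp: q_eq)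
      finally have "k * (?h\<^sup>2 * nondiv_op a \<beta> q x) \<le> k * (V x * (q x + C0))"
        using k0 by (intro mult_left_mono) auto
      then show "?h\<^sup>2 * nondiv_op a \<beta> \<Psi> x \<le> V x * \<Psi> x"
        using p1 unfolding lhs by (simp add: \<Psi>_def algebra_simps)
    qed
    also have "\<Psi> (p + ?h *\<^sub>R X) = ?g * exp (- \<kappa> * (\<nu> \<bullet> X)) + \<eta>' + k * ((norm X)\<^sup>2 + C0)"
    proof -
      have "q (p + ?h *\<^sub>R X) = (norm X)\<^sup>2" using hp by (simp add: q_eq power_mult_distrib)
      moreover have "e (p + ?h *\<^sub>R X) = exp (- \<kappa> * (\<nu> \<bullet> X))" using hp by (simp add: e_def)
      ultimately show ?thesis by (simp add: \<Psi>_def distrib_left)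
    qed
    also have "\<dots> \<le> ?g * exp (- \<kappa> * (\<nu> \<bullet> X)) + \<eta>"
    proof -
      have "k * ((norm X)\<^sup>2 + C0) \<le> \<eta>'" using RK by (simp add: k_def)
      then show ?thesis unfolding \<eta>'_def by linarith
    qed
    finally show "u j (p + h j *\<^sub>R X) \<le> u j p * exp (- \<kappa> * (\<nu> \<bullet> X)) + \<eta>" .
  qed
qed

end

text \<open>The equation is linear and all bounds are symmetric, so the lower barrier is the upper
  one for the negated functions.\<close>

lemma (in boundary_layer) boundary_layer_uminus: "boundary_layer D a \<beta> V p \<nu> A B Vm K \<kappa> h (\<lambda>j x. - 1 * u j x)"
proof
  show "twice_diff_on D (\<lambda>x. - 1 * u j x)" for j by (rule twice_diff_on_cmult[OF D(1) C2])
  show "(h j)\<^sup>2 * nondiv_op a \<beta> (\<lambda>x. - 1 * u j x) x = V x * (- 1 * u j x)" if "x \<in> D" for j x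
    using eq[OF that, of j] nondiv_op_cmult[OF D(1) that C2, of a \<beta> "-1"] by (simp add: algebra_simps)
  show "continuous_on (closure D) (\<lambda>x. - 1 * u j x)" for j using cont[of j] by (intro continuous_intros)
  show "\<bar>- 1 * u j x\<bar> \<le> K" if "x \<in> closure D" for j x using K[OF that] by simp
  show "\<exists>\<rho>>0. \<forall>j. \<forall>x\<in>frontier D. dist x p < \<rho> \<longrightarrow> \<bar>- 1 * u j x - - 1 * u j p\<bar> \<le> \<eta>" if "0 < \<eta>" for \<eta>
    using equicont[OF that] by (simp add: abs_minus_commute)
qed (fact D p nu pd aB bB Vm lim kappa above flat h)+

lemma (in boundary_layer) profile_limit:
  assumes X: "\<forall>\<^sub>F j in sequentially. p + h j *\<^sub>R X \<in> D"
  shows "(\<lambda>j. u j (p + h j *\<^sub>R X) - u j p * exp (- \<kappa> * (\<nu> \<bullet> X))) \<longlonglongrightarrow> 0"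
proof (rule tendstoI)
  fix \<eta> :: real assume "0 < \<eta>"
  then have \<eta>: "0 < \<eta> / 2" by simp
  show "\<forall>\<^sub>F j in sequentially. dist (u j (p + h j *\<^sub>R X) - u j p * exp (- \<kappa> * (\<nu> \<bullet> X))) 0 < \<eta>"
    using upper_barrier[OF \<eta>, of X] boundary_layer.upper_barrier[OF boundary_layer_uminus \<eta>, of X] X
    by eventually_elim (use \<eta> in \<open>auto simp: dist_real_def abs_if\<close>)
qed

section \<open>Hausdorff measure\<close>

definition hausdorff_weight :: "nat \<Rightarrow> 'a::metric_space set \<Rightarrow> ennreal" where
  "hausdorff_weight s C = (if C = {} then 0 else ennreal (unit_ball_vol (real s) * (diameter C / 2) ^ s))"

definition fine_covers :: "real \<Rightarrow> 'a::metric_space set \<Rightarrow> (nat \<Rightarrow> 'a set) set" where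
  "fine_covers r A = {C. A \<subseteq> (\<Union>i. C i) \<and> (\<forall>i. bounded (C i) \<and> diameter (C i) \<le> r)}"

text \<open>The premeasure at scale \<open>r\<close> in Caratheodory's construction of metric outer
  measures. It grows as \<open>r\<close> decreases, so the supremum over \<open>r\<close> may be
  taken along \<open>1 / (n + 1)\<close>.\<close>

definition hausdorff_content :: "nat \<Rightarrow> real \<Rightarrow> 'a::metric_space set \<Rightarrow> ennreal" where
  "hausdorff_content s r A = (INF C\<in>fine_covers r A. \<Sum>i. hausdorff_weight s (C i))"

lemma hausdorff_outer_SUP: "hausdorff_outer s A = (SUP r\<in>{0<..}. hausdorff_content s r A)"
  unfolding hausdorff_outer_def hausdorff_content_def hausdorff_weight_def fine_covers_def ..

lemma hausdorff_content_antimono: "r \<le> r' \<Longrightarrow> hausdorff_content s r' A \<le> hausdorff_content s r A"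
  unfolding hausdorff_content_def fine_covers_def
  by (rule INF_superset_mono) (auto intro: order_trans)

lemma hausdorff_content_mono: "A \<subseteq> B \<Longrightarrow> hausdorff_content s r A \<le> hausdorff_content s r B"
  unfolding hausdorff_content_def fine_covers_def
  by (rule INF_superset_mono) auto

lemma hausdorff_outer_mono: "A \<subseteq> B \<Longrightarrow> hausdorff_outer s A \<le> hausdorff_outer s B"
  unfolding hausdorff_outer_SUP by (intro SUP_mono) (auto intro: hausdorff_content_mono)

lemma hausdorff_content_le_outer: "0 < r \<Longrightarrow> hausdorff_content s r A \<le> hausdorff_outer s A"
  unfolding hausdorff_outer_SUP by (rule SUP_upper) simp

lemma hausdorff_outer_sequence: "hausdorff_outer s A = (SUP n. hausdorff_content s (1 / real (Suc n)) A)"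
proof (rule antisym)
  show "hausdorff_outer s A \<le> (SUP n. hausdorff_content s (1 / real (Suc n)) A)"
    unfolding hausdorff_outer_SUP
  proof (rule SUP_mono)
    fix r :: real assume "r \<in> {0<..}"
    then obtain n where "1 / real (Suc n) < r" using nat_approx_posE[of r] by (auto simp: inverse_eq_divide)
    then show "\<exists>n\<in>UNIV. hausdorff_content s r A \<le> hausdorff_content s (1 / real (Suc n)) A"
      by (intro bexI[of _ n] hausdorff_content_antimono) auto
  qed
  show "(SUP n. hausdorff_content s (1 / real (Suc n)) A) \<le> hausdorff_outer s A"
    by (intro SUP_least hausdorff_content_le_outer) auto
qed

lemma incseq_hausdorff_content: "incseq (\<lambda>n. hausdorff_content s (1 / real (Suc n)) A)"
  by (intro monoI hausdorff_content_antimono) (simp add: field_simps)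

lemma hausdorff_content_empty: "0 \<le> r \<Longrightarrow> hausdorff_content s r ({} :: 'a::metric_space set) = 0"
proof -
  assume "0 \<le> r"
  then have "(\<lambda>_. {}) \<in> fine_covers r ({} :: 'a set)" by (auto simp: fine_covers_def)
  then have "hausdorff_content s r ({}::'a set) \<le> (\<Sum>i::nat. hausdorff_weight s ({}::'a set))"
    unfolding hausdorff_content_def by (rule INF_lower2) simp
  then show ?thesis by (simp add: hausdorff_weight_def)
qed

lemma hausdorff_outer_empty: "hausdorff_outer s {} = 0"
  unfolding hausdorff_outer_sequence by (simp add: hausdorff_content_empty)

lemma hausdorff_content_UN_le:
  "hausdorff_content s r (\<Union>n::nat. A n) \<le> (\<Sum>n. hausdorff_content s r (A n))"
proof (rule ennreal_le_epsilon)
  fix e :: real assume fin: "(\<Sum>n. hausdorff_content s r (A n)) < top" and e: "0 < e"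
  have "\<exists>C\<in>fine_covers r (A n). (\<Sum>i. hausdorff_weight s (C i)) < hausdorff_content s r (A n) + e * (1/2)^Suc n" for n
  proof -
    have "hausdorff_content s r (A n) < top" using fin by (auto simp: less_top dest!: ennreal_suminf_lessD)
    then have "hausdorff_content s r (A n) < hausdorff_content s r (A n) + e * (1/2)^Suc n"
      using e by (auto simp: less_top)
    then show ?thesis unfolding hausdorff_content_def[of s r "A n"] INF_less_iff .
  qed
  then obtain B where B: "\<And>n. B n \<in> fine_covers r (A n)"
    "\<And>n. (\<Sum>i. hausdorff_weight s (B n i)) < hausdorff_content s r (A n) + e * (1/2)^Suc n" by metis
  define C where "C = case_prod B o prod_decode"
  have "C \<in> fine_covers r (\<Union>n. A n)"
  proof -
    have "\<exists>i. x \<in> C i" if xA: "x \<in> A n" for x n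
    proof -
      have "A n \<subseteq> (\<Union>m. B n m)" using B(1)[of n] by (simp add: fine_covers_def)
      then obtain m where "x \<in> B n m" using xA by blast
      then show ?thesis by (intro exI[of _ "prod_encode (n, m)"]) (simp add: C_def)
    qed
    then show ?thesis using B(1) by (auto simp: fine_covers_def C_def split_def)
  qed
  then have "hausdorff_content s r (\<Union>n. A n) \<le> (\<Sum>i. hausdorff_weight s (C i))"
    unfolding hausdorff_content_def by (rule INF_lower)
  also have "\<dots> = (\<Sum>n. \<Sum>i. hausdorff_weight s (B n i))"
    unfolding C_def comp_def by (intro suminf_ennreal_2dimen) auto
  also have "\<dots> \<le> (\<Sum>n. hausdorff_content s r (A n) + e * (1/2) ^ Suc n)"
    by (intro suminf_le less_imp_le B(2)) auto
  also have "\<dots> = (\<Sum>n. hausdorff_content s r (A n)) + (\<Sum>n. ennreal e * ennreal ((1/2) ^ Suc n))"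
    using e by (subst suminf_add[symmetric]) (auto simp del: ennreal_suminf_cmult simp add: ennreal_mult[symmetric])
  also have "\<dots> = (\<Sum>n. hausdorff_content s r (A n)) + e"
    unfolding ennreal_suminf_cmult
    by (subst suminf_ennreal_eq[OF zero_le_power power_half_series]) auto
  finally show "hausdorff_content s r (\<Union>n. A n) \<le> (\<Sum>n. hausdorff_content s r (A n)) + e" .
qed

lemma hausdorff_outer_UN_le:
  "hausdorff_outer s (\<Union>n::nat. A n) \<le> (\<Sum>n. hausdorff_outer s (A n))"
proof -
  have "hausdorff_content s r (\<Union>n. A n) \<le> (\<Sum>n. hausdorff_outer s (A n))" if "r > 0" for r
    by (rule order_trans[OF hausdorff_content_UN_le])
      (rule suminf_le[OF hausdorff_content_le_outer[OF that]], simp_all)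
  then show ?thesis unfolding hausdorff_outer_SUP[of s "\<Union>n. A n"] by (intro SUP_least) auto
qed

lemma hausdorff_outer_Un_le: "hausdorff_outer s (A \<union> B) \<le> hausdorff_outer s A + hausdorff_outer s B"
proof -
  define C where "C n = (if n = 0 then A else if n = 1 then B else {})" for n :: nat
  have C: "C 0 = A" "C 1 = B" "\<And>n. n \<notin> {0, 1} \<Longrightarrow> C n = {}" by (simp_all add: C_def)
  have "A \<union> B \<subseteq> (\<Union>n. C n)" using C(1,2) by (metis UN_upper UNIV_I Un_least)
  then have "hausdorff_outer s (A \<union> B) \<le> hausdorff_outer s (\<Union>n. C n)"
    by (rule hausdorff_outer_mono)
  also have "\<dots> \<le> (\<Sum>n. hausdorff_outer s (C n))" by (rule hausdorff_outer_UN_le)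
  also have "\<dots> = (\<Sum>n\<in>{0,1}. hausdorff_outer s (C n))"
    by (rule suminf_finite) (use C(3) hausdorff_outer_empty in auto)
  finally show ?thesis using C by simp
qed

lemma hausdorff_weight_empty [simp]: "hausdorff_weight s {} = 0"
  by (simp add: hausdorff_weight_def)

text \<open>A set of diameter less than \<open>e\<close> cannot meet both \<open>A\<close> and
  \<open>B\<close>, so every sufficiently fine cover of the union splits into a cover of
  \<open>A\<close> and one of \<open>B\<close>.\<close>

lemma hausdorff_outer_separated:
  assumes e: "e > 0" and sep: "\<And>x y. x \<in> A \<Longrightarrow> y \<in> B \<Longrightarrow> e \<le> dist x y"
  shows "hausdorff_outer s (A \<union> B) = hausdorff_outer s A + hausdorff_outer s B"
proof (rule antisym)
  have *: "hausdorff_content s r A + hausdorff_content s r B \<le> hausdorff_content s r (A \<union> B)"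
    if r: "0 < r" "r < e" for r
    unfolding hausdorff_content_def[of s r "A \<union> B"]
  proof (rule INF_greatest)
    fix C assume C: "C \<in> fine_covers r (A \<union> B)"
    define CA where "CA i = (if C i \<inter> A = {} then {} else C i)" for i
    define CB where "CB i = (if C i \<inter> B = {} then {} else C i)" for i
    have "CA \<in> fine_covers r A" "CB \<in> fine_covers r B"
      using C r by (auto simp: fine_covers_def CA_def CB_def) blast+
    then have "hausdorff_content s r A + hausdorff_content s r B
        \<le> (\<Sum>i. hausdorff_weight s (CA i)) + (\<Sum>i. hausdorff_weight s (CB i))"
      unfolding hausdorff_content_def by (intro add_mono INF_lower)
    also have "\<dots> = (\<Sum>i. hausdorff_weight s (CA i) + hausdorff_weight s (CB i))"
      by (rule suminf_add) auto
    also have "\<dots> \<le> (\<Sum>i. hausdorff_weight s (C i))"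
    proof (intro suminf_le)
      fix i
      have "C i \<inter> A = {} \<or> C i \<inter> B = {}"
      proof (rule ccontr)
        assume "\<not> ?thesis"
        then obtain x y where "x \<in> C i" "x \<in> A" "y \<in> C i" "y \<in> B" by blast
        moreover have "bounded (C i)" "diameter (C i) \<le> r" using C by (auto simp: fine_covers_def)
        ultimately show False using diameter_bounded_bound[of "C i" x y] sep[of x y] r by auto
      qed
      then show "hausdorff_weight s (CA i) + hausdorff_weight s (CB i) \<le> hausdorff_weight s (C i)"
        by (auto simp: CA_def CB_def)
    qed auto
    finally show "hausdorff_content s r A + hausdorff_content s r B \<le> (\<Sum>i. hausdorff_weight s (C i))" .
  qed
  have "hausdorff_outer s A + hausdorff_outer s B
      = (SUP n. hausdorff_content s (1 / real (Suc n)) A + hausdorff_content s (1 / real (Suc n)) B)"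
    unfolding hausdorff_outer_sequence
    by (rule ennreal_SUP_add[symmetric]) (rule incseq_hausdorff_content)+
  also have "\<dots> \<le> hausdorff_outer s (A \<union> B)"
  proof (rule SUP_least)
    fix n
    define r where "r = min (1 / real (Suc n)) (e / 2)"
    have r: "0 < r" "r < e" "r \<le> 1 / real (Suc n)" using e by (auto simp: r_def)
    have "hausdorff_content s (1 / real (Suc n)) A + hausdorff_content s (1 / real (Suc n)) B
      \<le> hausdorff_content s r A + hausdorff_content s r B"
      by (intro add_mono hausdorff_content_antimono r)
    also have "\<dots> \<le> hausdorff_outer s (A \<union> B)"
      using *[OF r(1,2)] hausdorff_content_le_outer[OF r(1)] by (rule order_trans)
    finally show "hausdorff_content s (1 / real (Suc n)) A + hausdorff_content s (1 / real (Suc n)) B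
      \<le> hausdorff_outer s (A \<union> B)" .
  qed
  finally show "hausdorff_outer s A + hausdorff_outer s B \<le> hausdorff_outer s (A \<union> B)" .
qed (rule hausdorff_outer_Un_le)

text \<open>The layer in between keeps two layers of equal parity at positive distance, because the
  distance to \<open>F\<close> is 1-Lipschitz; additivity on separated sets then applies one layer
  at a time.\<close>

lemma hausdorff_outer_layers:
  fixes F X :: "'a::metric_space set" and j :: nat
  defines "R \<equiv> \<lambda>k. {x\<in>X. 1 / real (k + 2) < infdist x F \<and> infdist x F \<le> 1 / real (k + 1)}"
  shows "(\<Sum>k<N. hausdorff_outer s (R (2 * k + j))) = hausdorff_outer s (\<Union>k<N. R (2 * k + j))"
proof (induction N)
  case (Suc N)
  let ?e = "1 / real (2 * N + j) - 1 / real (2 * N + j + 1)"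
  have "hausdorff_outer s ((\<Union>k<N. R (2 * k + j)) \<union> R (2 * N + j))
      = hausdorff_outer s (\<Union>k<N. R (2 * k + j)) + hausdorff_outer s (R (2 * N + j))"
  \<comment> \<open>For \<open>N = 0\<close> the union is empty, and with \<open>j = 0\<close> the
    gap \<open>?e\<close> would involve a division by zero.\<close>
  proof (cases "N = 0")
    case False
    show ?thesis
    proof (rule hausdorff_outer_separated)
      have "1 / real (2 * N + j + 1) < 1 / real (2 * N + j)"
        using False by (intro divide_strict_left_mono) auto
      then show "?e > 0" by simp
      fix x y assume "x \<in> (\<Union>k<N. R (2 * k + j))" and y: "y \<in> R (2 * N + j)"
      then obtain k where k: "k < N" "x \<in> R (2 * k + j)" by blast
      have "real (2 * k + j + 2) \<le> real (2 * N + j)" using k(1) by simp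
      then have "1 / real (2 * N + j) \<le> 1 / real (2 * k + j + 2)"
        by (intro divide_left_mono) auto
      then have "1 / real (2 * N + j) < infdist x F" using k(2) by (simp add: R_def)
      moreover have "infdist y F \<le> 1 / real (2 * N + j + 1)" using y by (simp add: R_def)
      ultimately show "?e \<le> dist x y" using infdist_triangle_abs[of x F y] by linarith
    qed
  qed (simp add: hausdorff_outer_empty)
  then show ?case using Suc by (simp add: lessThan_Suc Un_commute)
qed (simp add: hausdorff_outer_empty)

text \<open>Caratheodory's criterion. The part of \<open>X\<close> at distance more than
  \<open>1 / (n + 1)\<close> from \<open>F\<close> is separated from \<open>F\<close>; what is
  missing of \<open>X - F\<close> is a tail of the layers, whose measures have a finite sum.\<close>

lemma hausdorff_outer_caratheodory_closed:
  fixes F X :: "'a::metric_space set"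
  assumes F: "closed F"
  shows "hausdorff_outer s (X \<inter> F) + hausdorff_outer s (X - F) = hausdorff_outer s X"
proof (rule antisym)
  let ?H = "hausdorff_outer s :: 'a set \<Rightarrow> ennreal"
  show "?H X \<le> ?H (X \<inter> F) + ?H (X - F)"
    using hausdorff_outer_Un_le[of s "X \<inter> F" "X - F"] by (simp add: Un_Diff_Int Un_commute Int_Diff_Un)
  show "?H (X \<inter> F) + ?H (X - F) \<le> ?H X"
  proof (cases "F = {} \<or> ?H X = top")
    case True
    then show ?thesis by (auto simp: hausdorff_outer_empty)
  next
    case False
    then have F0: "F \<noteq> {}" and fin: "?H X < top" by (auto simp: less_top)
    define R where "R k = {x\<in>X. 1 / real (k + 2) < infdist x F \<and> infdist x F \<le> 1 / real (k + 1)}" for k :: nat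
    define Z where "Z n = {x\<in>X. 1 / real (n + 1) < infdist x F}" for n :: nat
    have part: "(\<Sum>k<N. ?H (R (2 * k + j))) \<le> ?H X" for j N
      unfolding R_def using hausdorff_outer_layers[where s = s and X = X and F = F and j = j and N = N]
      by (auto intro!: hausdorff_outer_mono)
    \<comment> \<open>Layers of even index and layers of odd index each add up to at most the
      measure of \<open>X\<close>.\<close>
    have total: "(\<Sum>k. ?H (R k)) \<le> 2 * ?H X"
    proof (rule suminf_le_const)
      fix n
      have "(\<Sum>k<n. ?H (R k)) \<le> (\<Sum>k<2 * n. ?H (R k))"
        by (intro sum_mono2) auto
      also have "\<dots> = (\<Sum>k<n. ?H (R (2 * k + 0)) + ?H (R (2 * k + 1)))"
        by (induction n) (auto simp: algebra_simps)
      also have "\<dots> = (\<Sum>k<n. ?H (R (2 * k + 0))) + (\<Sum>k<n. ?H (R (2 * k + 1)))"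
        by (rule sum.distrib)
      also have "\<dots> \<le> 2 * ?H X"
        using add_mono[OF part[of 0 n] part[of 1 n]] by (simp only: mult_2)
      finally show "(\<Sum>k<n. ?H (R k)) \<le> 2 * ?H X" .
    qed auto
    have tfin: "(\<Sum>k. ?H (R k)) < top"
      using total fin by (auto simp: ennreal_mult_less_top intro: order_le_less_trans)
    \<comment> \<open>Adding the first \<open>n\<close> layers to both sides expresses that the tail
      is negligible without subtracting extended reals; the finite total is cancelled after the
      passage to the limit.\<close>
    have step: "?H (X \<inter> F) + ?H (X - F) + (\<Sum>k<n. ?H (R k)) \<le> ?H X + (\<Sum>k. ?H (R k))" for n
    proof -
      have "X - F \<subseteq> Z n \<union> (\<Union>k. R (k + n))"
      proof
        fix x assume x: "x \<in> X - F"
        then have p: "infdist x F > 0"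
          using F F0 infdist_pos_not_in_closed by blast
        show "x \<in> Z n \<union> (\<Union>k. R (k + n))"
        proof (cases "1 / real (n + 1) < infdist x F")
          case True then show ?thesis using x by (auto simp: Z_def)
        next
          case le: False
          define m where "m = (LEAST m. 1 / real (m + 2) < infdist x F)"
          obtain m0 where "1 / real (Suc m0) < infdist x F" using nat_approx_posE[OF p] by (auto simp: inverse_eq_divide)
          moreover have "1 / real (m0 + 2) \<le> 1 / real (Suc m0)" by (simp add: field_simps)
          ultimately have "1 / real (m0 + 2) < infdist x F" by linarith
          then have m: "1 / real (m + 2) < infdist x F" unfolding m_def by (rule LeastI)
          have mn: "n \<le> m"
          proof (rule ccontr)
            assume "\<not> n \<le> m"
            then have "1 / real (n + 1) \<le> 1 / real (m + 2)" by (intro divide_left_mono) auto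
            then show False using le m by linarith
          qed
          have "infdist x F \<le> 1 / real (m + 1)"
          proof (cases "m = n")
            case True then show ?thesis using le by simp
          next
            case False
            then have "m - 1 < m" using mn by auto
            then have "\<not> 1 / real (m - 1 + 2) < infdist x F" unfolding m_def by (rule not_less_Least)
            moreover have "m - 1 + 2 = m + 1" using False mn by auto
            ultimately show ?thesis by simp
          qed
          then have "x \<in> R m" using m x by (simp add: R_def)
          then have "x \<in> R ((m - n) + n)" using mn by simp
          then show ?thesis by blast
        qed
      qed
      then have "?H (X - F) \<le> ?H (Z n) + ?H (\<Union>k. R (k + n))"
        using hausdorff_outer_mono hausdorff_outer_Un_le order_trans by meson
      also have "\<dots> \<le> ?H (Z n) + (\<Sum>k. ?H (R (k + n)))"
        by (intro add_left_mono hausdorff_outer_UN_le)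
      finally have 1: "?H (X - F) \<le> ?H (Z n) + (\<Sum>k. ?H (R (k + n)))" .
      have "?H (X \<inter> F) + ?H (Z n) = ?H ((X \<inter> F) \<union> Z n)"
      proof (rule hausdorff_outer_separated[symmetric])
        show "0 < 1 / real (n + 1)" by simp
        show "1 / real (n + 1) \<le> dist x y" if "x \<in> X \<inter> F" "y \<in> Z n" for x y
          using that infdist_le[of x F y] by (auto simp: Z_def dist_commute)
      qed
      also have "\<dots> \<le> ?H X" by (rule hausdorff_outer_mono) (auto simp: Z_def)
      finally have 2: "?H (X \<inter> F) + ?H (Z n) \<le> ?H X" .
      have 3: "(\<Sum>k. ?H (R k)) = (\<Sum>k. ?H (R (k + n))) + (\<Sum>k<n. ?H (R k))"
        by (rule suminf_offset) auto
      have "?H (X \<inter> F) + ?H (X - F) + (\<Sum>k<n. ?H (R k))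
        \<le> ?H (X \<inter> F) + (?H (Z n) + (\<Sum>k. ?H (R (k + n)))) + (\<Sum>k<n. ?H (R k))"
        by (intro add_mono 1 order_refl)
      also have "\<dots> = (?H (X \<inter> F) + ?H (Z n)) + (\<Sum>k. ?H (R k))" unfolding 3 by (simp add: ac_simps)
      also have "\<dots> \<le> ?H X + (\<Sum>k. ?H (R k))" by (intro add_mono 2 order_refl)
      finally show ?thesis .
    qed
    have "(\<lambda>n. ?H (X \<inter> F) + ?H (X - F) + (\<Sum>k<n. ?H (R k))) \<longlonglongrightarrow> ?H (X \<inter> F) + ?H (X - F) + (\<Sum>k. ?H (R k))"
      by (intro tendsto_intros summable_LIMSEQ) auto
    from LIMSEQ_le_const2[OF this] step
    have "?H (X \<inter> F) + ?H (X - F) + (\<Sum>k. ?H (R k)) \<le> ?H X + (\<Sum>k. ?H (R k))" by blast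
    then show ?thesis using tfin by (simp add: ennreal_add_left_cancel_le add.commute less_top) auto
  qed
qed

text \<open>\<open>measure_of\<close> adopts the given set function only where it is countably
  additive. Caratheodory's theorem gives this on a sigma-algebra which contains the closed sets by
  the criterion above, hence the Borel sets.\<close>

lemma
  shows sets_hausdorff_measure [simp, measurable_cong]: "sets (hausdorff_measure s :: 'a::metric_space measure) = sets borel"
    and space_hausdorff_measure [simp]: "space (hausdorff_measure s :: 'a measure) = UNIV"
    and emeasure_hausdorff_measure: "A \<in> sets borel \<Longrightarrow> emeasure (hausdorff_measure s) A = hausdorff_outer s (A :: 'a set)"
proof -
  let ?H = "hausdorff_outer s :: 'a set \<Rightarrow> ennreal"
  have sb: "sigma_sets UNIV (sets borel :: 'a set set) = sets borel"
    by (metis sets.sigma_sets_eq space_borel)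
  show "sets (hausdorff_measure s :: 'a measure) = sets borel"
    unfolding hausdorff_measure_def by (simp add: sb)
  show "space (hausdorff_measure s :: 'a measure) = UNIV"
    unfolding hausdorff_measure_def by (simp add: space_measure_of_conv)
  have oms: "outer_measure_space (Pow UNIV) ?H"
    unfolding outer_measure_space_def positive_def increasing_def countably_subadditive_def
    by (simp add: hausdorff_outer_empty hausdorff_outer_mono hausdorff_outer_UN_le)
  have "sigma_algebra UNIV (Pow (UNIV :: 'a set))" by (rule sigma_algebra_Pow)
  then interpret P: sigma_algebra UNIV "Pow (UNIV :: 'a set)" .
  let ?L = "lambda_system UNIV (Pow UNIV) ?H"
  have ms: "measure_space UNIV ?L ?H" by (rule P.caratheodory_lemma[OF oms])
  have cl: "F \<in> ?L" if "closed F" for F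
    unfolding P.lambda_system_eq by (simp add: hausdorff_outer_caratheodory_closed[OF that])
  have "sigma_algebra UNIV ?L" using ms by (simp only: measure_space_def)
  then have "sigma_sets UNIV (Collect closed) \<subseteq> ?L"
    by (rule sigma_algebra.sigma_sets_subset) (use cl in blast)
  moreover have "sets borel = sigma_sets UNIV (Collect closed :: 'a set set)"
    unfolding borel_eq_closed by (rule sets_measure_of) simp
  ultimately have "sets borel \<subseteq> ?L" by (simp only:)
  then have ms': "measure_space UNIV (sets borel) ?H"
    by (rule measure_down[OF ms, rotated]) (metis sets.sigma_algebra_axioms space_borel)
  then show "emeasure (hausdorff_measure s) A = ?H A" if "A \<in> sets borel" for A
    unfolding hausdorff_measure_def using that ms'[unfolded measure_space_def]
    by (intro emeasure_measure_of_sigma) auto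
qed

section \<open>Lipschitz images, finiteness and positivity on hyperplanes\<close>

lemma hausdorff_content_lipschitz:
  fixes f :: "'a::real_normed_vector \<Rightarrow> 'b::real_normed_vector"
  assumes L: "0 < L" and r: "0 \<le> r" and f: "\<And>x y. x \<in> A \<Longrightarrow> y \<in> A \<Longrightarrow> dist (f x) (f y) \<le> L * dist x y"
  shows "hausdorff_content s (L * r) (f ` A) \<le> ennreal (L ^ s) * hausdorff_content s r A"
proof -
  let ?c = "ennreal (L ^ s)" and ?c' = "ennreal (inverse (L ^ s))"
  have cc: "?c' * ?c = 1" "?c * ?c' = 1"
    using L by (simp_all add: ennreal_mult[symmetric])
  \<comment> \<open>With the constant moved to the left side, the right side is a bare infimum and
    can be treated one cover at a time.\<close>
  have "?c' * hausdorff_content s (L * r) (f ` A) \<le> hausdorff_content s r A"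
    unfolding hausdorff_content_def[of s r]
  proof (rule INF_greatest)
    fix C assume C: "C \<in> fine_covers r A"
    have bd: "bounded (f ` (C i \<inter> A))" "diameter (f ` (C i \<inter> A)) \<le> L * diameter (C i)" for i
    proof -
      have Ci: "bounded (C i)" using C by (simp add: fine_covers_def)
      have d: "norm (x - y) \<le> L * diameter (C i)" if "x \<in> f ` (C i \<inter> A)" "y \<in> f ` (C i \<inter> A)" for x y
      proof -
        obtain x' y' where xy: "x = f x'" "y = f y'" "x' \<in> C i" "x' \<in> A" "y' \<in> C i" "y' \<in> A"
          using \<open>x \<in> _\<close> \<open>y \<in> _\<close> by blast
        have "norm (x - y) \<le> L * dist x' y'" using f[of x' y'] xy by (simp add: dist_norm)
        also have "\<dots> \<le> L * diameter (C i)"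
          using L diameter_bounded_bound[OF Ci xy(3,5)] by (intro mult_left_mono) auto
        finally show ?thesis .
      qed
      have D0: "0 \<le> L * diameter (C i)" using L diameter_ge_0[OF Ci] by simp
      show "diameter (f ` (C i \<inter> A)) \<le> L * diameter (C i)"
        using d D0 by (intro diameter_le) auto
      show "bounded (f ` (C i \<inter> A))"
        unfolding bounded_two_points using d by (auto simp: dist_norm)
    qed
    have "(\<lambda>i. f ` (C i \<inter> A)) \<in> fine_covers (L * r) (f ` A)"
    proof -
      have "L * diameter (C i) \<le> L * r" for i using C L by (auto simp: fine_covers_def)
      then have "diameter (f ` (C i \<inter> A)) \<le> L * r" for i using bd(2)[of i] by (rule order_trans[rotated])
      moreover have "f ` A \<subseteq> (\<Union>i. f ` (C i \<inter> A))"
      proof -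
        have "A \<subseteq> (\<Union>i. C i)" using C by (simp add: fine_covers_def)
        then show ?thesis by blast
      qed
      ultimately show ?thesis using bd(1) by (simp add: fine_covers_def)
    qed
    then have "hausdorff_content s (L * r) (f ` A) \<le> (\<Sum>i. hausdorff_weight s (f ` (C i \<inter> A)))"
      unfolding hausdorff_content_def by (rule INF_lower)
    also have "\<dots> \<le> (\<Sum>i. ?c * hausdorff_weight s (C i))"
    proof (intro suminf_le summableI)
      fix i
      show "hausdorff_weight s (f ` (C i \<inter> A)) \<le> ?c * hausdorff_weight s (C i)"
      proof (cases "C i \<inter> A = {}")
        case False
        have Ci: "bounded (C i)" using C by (simp add: fine_covers_def)
        have "unit_ball_vol (real s) * (diameter (f ` (C i \<inter> A)) / 2) ^ s
          \<le> unit_ball_vol (real s) * (L * diameter (C i) / 2) ^ s"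
          using bd[of i] diameter_ge_0[OF bd(1)[of i]] by (intro mult_left_mono power_mono divide_right_mono) auto
        also have "\<dots> = L ^ s * (unit_ball_vol (real s) * (diameter (C i) / 2) ^ s)"
          by (simp add: power_mult_distrib power_divide)
        finally have "ennreal (unit_ball_vol (real s) * (diameter (f ` (C i \<inter> A)) / 2) ^ s)
          \<le> ennreal (L ^ s * (unit_ball_vol (real s) * (diameter (C i) / 2) ^ s))"
          by (rule ennreal_leI)
        also have "\<dots> = ?c * ennreal (unit_ball_vol (real s) * (diameter (C i) / 2) ^ s)"
          using L diameter_ge_0[OF Ci] by (intro ennreal_mult) auto
        finally show ?thesis using False by (auto simp: hausdorff_weight_def)
      qed simp
    qed
    also have "\<dots> = ?c * (\<Sum>i. hausdorff_weight s (C i))" by simp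
    finally have "?c' * hausdorff_content s (L * r) (f ` A) \<le> ?c' * (?c * (\<Sum>i. hausdorff_weight s (C i)))"
      by (rule mult_left_mono) simp
    then show "?c' * hausdorff_content s (L * r) (f ` A) \<le> (\<Sum>i. hausdorff_weight s (C i))"
      by (simp add: mult.assoc[symmetric] cc)
  qed
  then have "?c * (?c' * hausdorff_content s (L * r) (f ` A)) \<le> ?c * hausdorff_content s r A"
    by (rule mult_left_mono) simp
  then show ?thesis by (simp add: mult.assoc[symmetric] cc)
qed

lemma hausdorff_outer_lipschitz:
  fixes f :: "'a::real_normed_vector \<Rightarrow> 'b::real_normed_vector"
  assumes L: "0 < L" and f: "\<And>x y. x \<in> A \<Longrightarrow> y \<in> A \<Longrightarrow> dist (f x) (f y) \<le> L * dist x y"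
  shows "hausdorff_outer s (f ` A) \<le> ennreal (L ^ s) * hausdorff_outer s A"
  unfolding hausdorff_outer_SUP[of s "f ` A"]
proof (rule SUP_least)
  fix r :: real assume "r \<in> {0<..}"
  then have r: "0 < r / L" "0 \<le> r / L" "L * (r / L) = r" using L by auto
  have "hausdorff_content s r (f ` A) \<le> ennreal (L ^ s) * hausdorff_content s (r / L) A"
    using hausdorff_content_lipschitz[OF L r(2) f, where s = s] unfolding r(3) .
  also have "\<dots> \<le> ennreal (L ^ s) * hausdorff_outer s A"
    by (intro mult_left_mono hausdorff_content_le_outer r) simp
  finally show "hausdorff_content s r (f ` A) \<le> ennreal (L ^ s) * hausdorff_outer s A" .
qed

lemma hausdorff_outer_isometry:
  fixes f :: "'a::real_normed_vector \<Rightarrow> 'b::real_normed_vector"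
  assumes f: "\<And>x y. dist (f x) (f y) = dist x y"
  shows "hausdorff_outer s (f ` A) = hausdorff_outer s A"
proof (rule antisym)
  show "hausdorff_outer s (f ` A) \<le> hausdorff_outer s A"
    using hausdorff_outer_lipschitz[of 1 A f s] by (simp add: f)
  have "inj f" by (rule injI) (metis f dist_eq_0_iff)
  then have "A = inv f ` f ` A" by simp
  moreover have "hausdorff_outer s (inv f ` f ` A) \<le> hausdorff_outer s (f ` A)"
  proof -
    have "dist (inv f x) (inv f y) \<le> 1 * dist x y" if "x \<in> f ` A" "y \<in> f ` A" for x y
      using that \<open>inj f\<close> by (auto simp: f)
    from hausdorff_outer_lipschitz[OF _ this, where s = s] show ?thesis by simp
  qed
  ultimately show "hausdorff_outer s A \<le> hausdorff_outer s (f ` A)" by simp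
qed

lemma hausdorff_content_le_sum:
  fixes C :: "'i \<Rightarrow> 'a::metric_space set"
  assumes I: "finite I" and r: "0 \<le> r" and A: "A \<subseteq> (\<Union>i\<in>I. C i)"
    and C: "\<And>i. i \<in> I \<Longrightarrow> bounded (C i) \<and> diameter (C i) \<le> r"
  shows "hausdorff_content s r A \<le> (\<Sum>i\<in>I. hausdorff_weight s (C i))"
proof -
  obtain g where g: "bij_betw g {0..<card I} I" using ex_bij_betw_nat_finite[OF I] by blast
  define C' where "C' n = (if n < card I then C (g n) else {})" for n
  have gI: "g n \<in> I" if "n < card I" for n using g that by (auto simp: bij_betw_def)
  have "A \<subseteq> (\<Union>n. C' n)"
  proof
    fix x assume "x \<in> A"
    then obtain i where "i \<in> I" "x \<in> C i" using A by blast
    moreover then obtain n where "n < card I" "g n = i" using g unfolding bij_betw_def by (metis atLeastLessThan_iff imageE)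
    ultimately show "x \<in> (\<Union>n. C' n)" by (auto simp: C'_def intro!: exI[of _ n])
  qed
  moreover have "bounded (C' n) \<and> diameter (C' n) \<le> r" for n
    using C[OF gI, of n] r by (auto simp: C'_def)
  ultimately have "C' \<in> fine_covers r A" by (auto simp: fine_covers_def)
  then have "hausdorff_content s r A \<le> (\<Sum>n. hausdorff_weight s (C' n))"
    unfolding hausdorff_content_def by (rule INF_lower)
  also have "\<dots> = (\<Sum>n\<in>{0..<card I}. hausdorff_weight s (C' n))"
    by (rule suminf_finite) (auto simp: C'_def)
  also have "\<dots> = (\<Sum>n\<in>{0..<card I}. hausdorff_weight s (C (g n)))"
    by (intro sum.cong) (auto simp: C'_def)
  also have "\<dots> = (\<Sum>i\<in>I. hausdorff_weight s (C i))"
    by (rule sum.reindex_bij_betw[OF g])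
  finally show ?thesis .
qed

text \<open>A grid of mesh \<open>1 / m\<close> covers the flat cube by \<open>(2 m + 1)^s\<close>
  cells of diameter at most \<open>d / m\<close>, where \<open>d = s + 1\<close>; the sum of their
  weights stays bounded as the mesh is refined.\<close>

lemma hausdorff_unit_cube_finite:
  fixes i :: "'n::finite"
  defines "A \<equiv> {x :: real^'n. x $ i = 0 \<and> (\<forall>j. \<bar>x $ j\<bar> \<le> 1)}"
  shows "hausdorff_outer (CARD('n) - 1) A < top"
proof -
  let ?d = "real CARD('n)" and ?s = "CARD('n) - 1"
  define \<omega> where "\<omega> = unit_ball_vol (real ?s)"
  have om: "0 < \<omega>" unfolding \<omega>_def by (rule unit_ball_vol_pos) simp
  \<comment> \<open>The 3 bounds \<open>(2 m + 1) / m\<close>, so the constant is independent of the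
    mesh.\<close>
  let ?K = "\<omega> * (3 * ?d / 2) ^ ?s"
  have "hausdorff_outer ?s A \<le> ennreal ?K"
    unfolding hausdorff_outer_SUP
  proof (rule SUP_least)
    fix r :: real assume "r \<in> {0<..}"
    then have r: "0 < r" by simp
    obtain m0 :: nat where m0: "?d / r < real m0" using reals_Archimedean2 by blast
    define m where "m = Suc m0"
    have m: "0 < m" "?d / real m \<le> r"
    proof -
      have "?d / r < real m" using m0 by (simp add: m_def)
      then show "?d / real m \<le> r" using r by (simp add: m_def field_simps)
    qed (simp add: m_def)
    define I where "I = PiE (UNIV - {i}) (\<lambda>_. {- int m..int m})"
    define C where "C k = {x :: real^'n. x $ i = 0 \<and>
      (\<forall>j. j \<noteq> i \<longrightarrow> of_int (k j) / real m \<le> x $ j \<and> x $ j \<le> (of_int (k j) + 1) / real m)}" for k :: "'n \<Rightarrow> int"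
    have fI: "finite I" unfolding I_def by (intro finite_PiE) auto
    have cI: "card I = (2 * m + 1) ^ ?s"
    proof -
      have "card I = (\<Prod>j\<in>UNIV - {i}. card {- int m..int m})" unfolding I_def by (rule card_PiE) auto
      also have "card {- int m..int m} = 2 * m + 1" by simp
      finally show ?thesis by (simp add: card_Diff_singleton)
    qed
    have nC: "norm (x - y) \<le> ?d / real m" if "x \<in> C k" "y \<in> C k" for x y k
    proof -
      have "\<bar>(x - y) $ j\<bar> \<le> 1 / real m" for j
        using that m by (cases "j = i") (auto simp: C_def add_divide_distrib abs_le_iff dest!: spec[of _ j])
      then have "(\<Sum>j\<in>UNIV. \<bar>(x - y) $ j\<bar>) \<le> (\<Sum>j\<in>(UNIV :: 'n set). 1 / real m)" by (intro sum_mono)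
      then show ?thesis using norm_le_l1_cart[of "x - y"] by simp
    qed
    have dC: "bounded (C k)" "diameter (C k) \<le> ?d / real m" for k
    proof -
      show "bounded (C k)" unfolding bounded_two_points using nC by (auto simp: dist_norm)
      show "diameter (C k) \<le> ?d / real m" using nC by (intro diameter_le) auto
    qed
    have "A \<subseteq> (\<Union>k\<in>I. C k)"
    proof
      fix x assume x: "x \<in> A"
      define k where "k = restrict (\<lambda>j. \<lfloor>x $ j * real m\<rfloor>) (UNIV - {i})"
      have "- int m \<le> \<lfloor>x $ j * real m\<rfloor> \<and> \<lfloor>x $ j * real m\<rfloor> \<le> int m" for j
      proof -
        have "\<bar>x $ j * real m\<bar> \<le> 1 * real m"
          unfolding abs_mult using x by (intro mult_mono) (auto simp: A_def)
        then have "- real m \<le> x $ j * real m" "x $ j * real m \<le> real m" by (simp_all add: abs_le_iff)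
        then show ?thesis by (simp add: le_floor_iff floor_le_iff)
      qed
      then have "k \<in> I" by (auto simp: k_def I_def)
      moreover have "x \<in> C k"
      proof -
        have "of_int \<lfloor>x $ j * real m\<rfloor> / real m \<le> x $ j \<and> x $ j \<le> (of_int \<lfloor>x $ j * real m\<rfloor> + 1) / real m" for j
        proof -
          have "of_int \<lfloor>x $ j * real m\<rfloor> \<le> x $ j * real m" "x $ j * real m \<le> of_int \<lfloor>x $ j * real m\<rfloor> + 1"
            by linarith+
          then show ?thesis using m by (simp add: field_simps)
        qed
        then show ?thesis using x by (auto simp: C_def k_def A_def)
      qed
      ultimately show "x \<in> (\<Union>k\<in>I. C k)" by blast
    qed
    then have "hausdorff_content ?s r A \<le> (\<Sum>k\<in>I. hausdorff_weight ?s (C k))"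
      using fI r dC m by (intro hausdorff_content_le_sum) (auto intro: order_trans)
    also have "\<dots> \<le> (\<Sum>k\<in>I. ennreal (\<omega> * (?d / real m / 2) ^ ?s))"
    proof (intro sum_mono)
      fix k
      have "\<omega> * (diameter (C k) / 2) ^ ?s \<le> \<omega> * (?d / real m / 2) ^ ?s"
        using dC[of k] diameter_ge_0[OF dC(1)[of k]] by (intro mult_left_mono power_mono divide_right_mono) (use om in auto)
      note le = ennreal_leI[OF this]
      show "hausdorff_weight ?s (C k) \<le> ennreal (\<omega> * (?d / real m / 2) ^ ?s)"
      proof (cases "C k = {}")
        case False
        then have "hausdorff_weight ?s (C k) = ennreal (\<omega> * (diameter (C k) / 2) ^ ?s)"
          unfolding hausdorff_weight_def \<omega>_def by (rule if_not_P)
        then show ?thesis using le by (simp only:)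
      qed simp
    qed
    also have "\<dots> = ennreal ((real (2 * m + 1)) ^ ?s * (\<omega> * (?d / real m / 2) ^ ?s))"
    proof -
      have "real (card I) = (real (2 * m + 1)) ^ ?s" by (simp only: cI of_nat_power)
      then show ?thesis
        using om by (simp only: sum_constant ennreal_of_nat_eq_real_of_nat) (intro ennreal_mult[symmetric], auto)
    qed
    also have "\<dots> \<le> ennreal ?K"
    proof (rule ennreal_leI)
      have "(real (2 * m + 1)) ^ ?s * (\<omega> * (?d / real m / 2) ^ ?s) = \<omega> * (real (2 * m + 1) * (?d / real m / 2)) ^ ?s"
        by (simp only: power_mult_distrib mult_ac)
      also have "\<dots> \<le> ?K"
        using m om by (intro mult_left_mono power_mono) (auto simp: field_simps)
      finally show "(real (2 * m + 1)) ^ ?s * (\<omega> * (?d / real m / 2) ^ ?s) \<le> ?K" .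
    qed
    finally show "hausdorff_content ?s r A \<le> ennreal ?K" .
  qed
  then show ?thesis by (rule order_le_less_trans) simp
qed

text \<open>Mass distribution: each set \<open>C\<close> of a cover contributes at most a constant times the volume of a box
  containing \<open>C \<times> [0, 1]\<close>.\<close>

lemma hausdorff_outer_ge_volume:
  fixes i :: "'n::finite" and A :: "(real^'n) set"
  assumes T: "T \<in> sets borel" and sub: "\<And>x. x \<in> T \<Longrightarrow> 0 \<le> x $ i \<and> x $ i \<le> 1 \<and> (\<chi> j. if j = i then 0 else x $ j) \<in> A"
    and A: "\<And>x. x \<in> A \<Longrightarrow> x $ i = 0"
  shows "emeasure lborel T \<le> ennreal (4 ^ (CARD('n) - 1) / unit_ball_vol (real (CARD('n) - 1))) * hausdorff_outer (CARD('n) - 1) A"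
proof -
  let ?s = "CARD('n) - 1"
  define \<omega> where "\<omega> = unit_ball_vol (real ?s)"
  have om: "0 < \<omega>" unfolding \<omega>_def by (rule unit_ball_vol_pos) simp
  \<comment> \<open>A set of diameter \<open>\<Delta>\<close> is enclosed in a box with one side 1
    and all others \<open>2 \<Delta>\<close>; its volume is \<open>4^s / \<omega>\<close> times the
    weight \<open>\<omega> (\<Delta> / 2)^s\<close>.\<close>
  let ?c = "4 ^ ?s / \<omega>" and ?c' = "\<omega> / 4 ^ ?s"
  have cc: "ennreal ?c * ennreal ?c' = 1" "ennreal ?c' * ennreal ?c = 1" using om by (simp_all add: ennreal_mult[symmetric])
  have "ennreal ?c' * emeasure lborel T \<le> hausdorff_content ?s 1 A"
    unfolding hausdorff_content_def
  proof (rule INF_greatest)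
    fix C assume C: "C \<in> fine_covers 1 A"
    have bC: "bounded (C n)" for n using C by (simp add: fine_covers_def)
    define x0 where "x0 n = (SOME x. x \<in> C n \<inter> A)" for n
    have x0: "x0 n \<in> C n \<inter> A" if "C n \<inter> A \<noteq> {}" for n
      unfolding x0_def using that by (rule some_in_eq[THEN iffD2])
    define Bx where "Bx n = cbox (\<chi> j. if j = i then 0 else x0 n $ j - diameter (C n))
       (\<chi> j. if j = i then 1 else x0 n $ j + diameter (C n))" for n
    define E where "E n = (if C n \<inter> A = {} then {} else Bx n)" for n
    have "T \<subseteq> (\<Union>n. E n)"
    proof
      fix x assume x: "x \<in> T"
      let ?x = "(\<chi> j. if j = i then 0 else x $ j) :: real^'n"
      have "?x \<in> A" using sub[OF x] by blast
      then obtain n where n: "?x \<in> C n" using C by (auto simp: fine_covers_def)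
      then have ne: "C n \<inter> A \<noteq> {}" using \<open>?x \<in> A\<close> by blast
      have "\<bar>x $ j - x0 n $ j\<bar> \<le> diameter (C n)" if "j \<noteq> i" for j
      proof -
        have "\<bar>(?x - x0 n) $ j\<bar> \<le> norm (?x - x0 n)" by (rule component_le_norm_cart)
        also have "\<dots> \<le> diameter (C n)"
          using diameter_bounded_bound[OF bC n] x0[OF ne] by (simp add: dist_norm)
        finally show ?thesis using that by simp
      qed
      then have "x \<in> Bx n" using sub[OF x] by (auto simp: Bx_def mem_box_cart abs_le_iff) (force simp: abs_le_iff)+
      then show "x \<in> (\<Union>n. E n)" using ne by (auto simp: E_def)
    qed
    moreover have E_sets: "E n \<in> sets lborel" for n by (simp add: E_def Bx_def)
    ultimately have "emeasure lborel T \<le> (\<Sum>n. emeasure lborel (E n))"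
      using T by (intro order_trans[OF emeasure_mono emeasure_subadditive_countably]) auto
    also have "\<dots> \<le> (\<Sum>n. ennreal ?c * hausdorff_weight ?s (C n))"
    proof (intro suminf_le summableI)
      fix n
      show "emeasure lborel (E n) \<le> ennreal ?c * hausdorff_weight ?s (C n)"
      proof (cases "C n \<inter> A = {}")
        case False
        have dn: "0 \<le> diameter (C n)" by (rule diameter_ge_0[OF bC])
        have ne: "Bx n \<noteq> {}" unfolding Bx_def interval_ne_empty_cart using dn by auto
        have "measure lborel (Bx n) = (\<Prod>j\<in>UNIV. (if j = i then 1 else 2 * diameter (C n)))"
          using content_cbox_cart[OF ne[unfolded Bx_def]] unfolding Bx_def
          by (simp, intro prod.cong) auto
        also have "\<dots> = (\<Prod>j\<in>UNIV - {i}. 2 * diameter (C n))"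
          by (subst prod.remove[of UNIV i]) auto
        also have "\<dots> = (2 * diameter (C n)) ^ ?s" by (simp add: card_Diff_singleton)
        finally have m: "measure lborel (Bx n) = (2 * diameter (C n)) ^ ?s" .
        have "emeasure lborel (Bx n) = ennreal ((2 * diameter (C n)) ^ ?s)"
        proof -
          have "emeasure lborel (Bx n) < \<infinity>"
            unfolding Bx_def by (rule emeasure_lborel_cbox_finite)
          then have "emeasure lborel (Bx n) \<noteq> top" by (simp add: less_top)
          from emeasure_eq_ennreal_measure[OF this] show ?thesis by (simp only: m)
        qed
        also have "(2 * diameter (C n)) ^ ?s = ?c * (\<omega> * (diameter (C n) / 2) ^ ?s)"
        proof -
          have "(2 * diameter (C n)) ^ ?s = (4 * (diameter (C n) / 2)) ^ ?s" by simp
          then show ?thesis using om by (simp only: power_mult_distrib) simp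
        qed
        also have "ennreal \<dots> = ennreal ?c * ennreal (\<omega> * (diameter (C n) / 2) ^ ?s)"
          using om dn by (intro ennreal_mult) auto
        finally have "emeasure lborel (Bx n) = ennreal ?c * ennreal (\<omega> * (diameter (C n) / 2) ^ ?s)" .
        moreover have "hausdorff_weight ?s (C n) = ennreal (\<omega> * (diameter (C n) / 2) ^ ?s)"
          unfolding hausdorff_weight_def \<omega>_def using False by (intro if_not_P) auto
        moreover have "E n = Bx n" using False by (simp only: E_def if_False)
        ultimately show ?thesis by (simp only: order_refl)
      qed (simp add: E_def)
    qed
    also have "\<dots> = ennreal ?c * (\<Sum>n. hausdorff_weight ?s (C n))" by simp
    finally have "ennreal ?c' * emeasure lborel T \<le> ennreal ?c' * (ennreal ?c * (\<Sum>n. hausdorff_weight ?s (C n)))"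
      by (rule mult_left_mono) simp
    then show "ennreal ?c' * emeasure lborel T \<le> (\<Sum>n. hausdorff_weight ?s (C n))"
      by (simp only: mult.assoc[symmetric] cc) simp
  qed
  also have "\<dots> \<le> hausdorff_outer ?s A" by (rule hausdorff_content_le_outer) simp
  finally have "ennreal ?c * (ennreal ?c' * emeasure lborel T) \<le> ennreal ?c * hausdorff_outer ?s A"
    by (rule mult_left_mono) simp
  then have "emeasure lborel T \<le> ennreal ?c * hausdorff_outer ?s A" unfolding mult.assoc[symmetric] cc mult_1 .
  then show ?thesis unfolding \<omega>_def .
qed

section \<open>Integration along parallel lines\<close>

lemma nn_integral_lborel_translate:
  fixes f :: "'a::euclidean_space \<Rightarrow> ennreal"
  assumes [measurable]: "f \<in> borel_measurable borel"
  shows "(\<integral>\<^sup>+y. f (y + c) \<partial>lborel) = (\<integral>\<^sup>+y. f y \<partial>lborel)"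
proof -
  have "(\<integral>\<^sup>+y. f y \<partial>lborel) = (\<integral>\<^sup>+y. f y \<partial>distr lborel borel ((+) c))"
    by (simp add: lborel_distr_plus)
  also have "\<dots> = (\<integral>\<^sup>+y. f (c + y) \<partial>lborel)"
    by (rule nn_integral_distr) simp_all
  finally show ?thesis by (simp add: add.commute)
qed

text \<open>Fubini along the lines of direction \<open>e\<close> without coordinates on the
  orthogonal complement. The base point \<open>y\<close> runs through a slab that cuts every such
  line in a segment of length 1, so that each line is counted with total weight 1.\<close>

lemma nn_integral_lines:
  fixes f :: "'a::euclidean_space \<Rightarrow> ennreal"
  assumes [measurable]: "f \<in> borel_measurable borel" and e: "norm e = 1"
  shows "(\<integral>\<^sup>+x. f x \<partial>lborel) =
    (\<integral>\<^sup>+y. indicator {0..1} (e \<bullet> y) * (\<integral>\<^sup>+t. f (y + t *\<^sub>R e) \<partial>lborel) \<partial>lborel)"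
proof -
  let ?I = "indicator {0..1::real} :: real \<Rightarrow> ennreal"
  have ee: "e \<bullet> e = 1" using e by (simp add: dot_square_norm)
  have "(\<integral>\<^sup>+y. ?I (e \<bullet> y) * (\<integral>\<^sup>+t. f (y + t *\<^sub>R e) \<partial>lborel) \<partial>lborel)
      = (\<integral>\<^sup>+y. (\<integral>\<^sup>+t. ?I (e \<bullet> y) * f (y + t *\<^sub>R e) \<partial>lborel) \<partial>lborel)"
    by (simp add: nn_integral_cmult)
  also have "\<dots> = (\<integral>\<^sup>+t. (\<integral>\<^sup>+y. ?I (e \<bullet> y) * f (y + t *\<^sub>R e) \<partial>lborel) \<partial>lborel)"
    using lborel_pair.Fubini'[of "\<lambda>y t. ?I (e \<bullet> y) * f (y + t *\<^sub>R e)"] by simp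
  also have "\<dots> = (\<integral>\<^sup>+t. (\<integral>\<^sup>+y. ?I (e \<bullet> y - t) * f y \<partial>lborel) \<partial>lborel)"
  proof (rule nn_integral_cong)
    fix t
    show "(\<integral>\<^sup>+y. ?I (e \<bullet> y) * f (y + t *\<^sub>R e) \<partial>lborel) = (\<integral>\<^sup>+y. ?I (e \<bullet> y - t) * f y \<partial>lborel)"
      using nn_integral_lborel_translate[of "\<lambda>y. ?I (e \<bullet> y - t) * f y" "t *\<^sub>R e"]
      by (simp add: inner_add_right ee)
  qed
  also have "\<dots> = (\<integral>\<^sup>+y. (\<integral>\<^sup>+t. ?I (e \<bullet> y - t) * f y \<partial>lborel) \<partial>lborel)"
    using lborel_pair.Fubini'[of "\<lambda>y t. ?I (e \<bullet> y - t) * f y"] by simp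
  also have "\<dots> = (\<integral>\<^sup>+y. f y \<partial>lborel)"
  proof (rule nn_integral_cong)
    fix y :: 'a
    have "(\<integral>\<^sup>+t. ?I (e \<bullet> y - t) * f y \<partial>lborel) = (\<integral>\<^sup>+t. indicator {e \<bullet> y - 1..e \<bullet> y} t \<partial>lborel) * f y"
      by (subst nn_integral_multc[symmetric]) (auto intro!: nn_integral_cong split: split_indicator)
    then show "(\<integral>\<^sup>+t. ?I (e \<bullet> y - t) * f y \<partial>lborel) = f y" by simp
  qed
  finally show ?thesis ..
qed

lemma nn_integral_line_shift:
  fixes f :: "'a::euclidean_space \<Rightarrow> ennreal"
  assumes [measurable]: "f \<in> borel_measurable borel" and h: "h > 0"
  shows "(\<integral>\<^sup>+t. f (y + t *\<^sub>R e) \<partial>lborel) = ennreal h * (\<integral>\<^sup>+t. f (y + (c + h * t) *\<^sub>R e) \<partial>lborel)"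
  using nn_integral_real_affine[of "\<lambda>t. f (y + t *\<^sub>R e)" h c] h by simp

text \<open>\<open>\<gamma>\<close> is constant along \<open>e\<close>, so the map translates every
  line of direction \<open>e\<close> within itself and leaves the integral over that line
  unchanged.\<close>

lemma nn_integral_shear:
  fixes f :: "'a::euclidean_space \<Rightarrow> ennreal"
  assumes [measurable]: "f \<in> borel_measurable borel" "\<gamma> \<in> borel_measurable borel"
    and e: "norm e = 1" and inv: "\<And>y t. \<gamma> (y + t *\<^sub>R e) = \<gamma> y"
  shows "(\<integral>\<^sup>+y. f (y + \<gamma> y *\<^sub>R e) \<partial>lborel) = (\<integral>\<^sup>+y. f y \<partial>lborel)"
proof -
  have "(\<integral>\<^sup>+t. f (y + t *\<^sub>R e + \<gamma> (y + t *\<^sub>R e) *\<^sub>R e) \<partial>lborel) = (\<integral>\<^sup>+t. f (y + t *\<^sub>R e) \<partial>lborel)" for y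
    using nn_integral_line_shift[of f 1 y e "\<gamma> y"] by (simp add: inv scaleR_add_left ac_simps)
  then show ?thesis
    using nn_integral_lines[of f e] nn_integral_lines[of "\<lambda>y. f (y + \<gamma> y *\<^sub>R e)" e] e by simp
qed

lemma emeasure_shear:
  fixes A :: "'a::euclidean_space set" and w \<nu> :: 'a
  assumes A [measurable]: "A \<in> sets borel" and w: "\<nu> \<bullet> w = 0"
  shows "emeasure lborel {y. y + (\<nu> \<bullet> y) *\<^sub>R w \<in> A} = emeasure lborel A"
proof (cases "w = 0")
  case False
  let ?e = "w /\<^sub>R norm w"
  have "(\<integral>\<^sup>+y. indicator A (y + ((\<nu> \<bullet> y) * norm w) *\<^sub>R ?e) \<partial>lborel) = (\<integral>\<^sup>+y. indicator A y \<partial>lborel)"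
    using False w by (intro nn_integral_shear) (auto simp: inner_add_right)
  moreover have "indicator A (y + ((\<nu> \<bullet> y) * norm w) *\<^sub>R ?e) = (indicator {y. y + (\<nu> \<bullet> y) *\<^sub>R w \<in> A} y :: ennreal)" for y
  proof -
    have "((\<nu> \<bullet> y) * norm w) *\<^sub>R ?e = (\<nu> \<bullet> y) *\<^sub>R w" using False by (simp add: divide_inverse[symmetric])
    then show ?thesis by (simp only:) (simp add: indicator_def)
  qed
  ultimately have "(\<integral>\<^sup>+y. indicator {y. y + (\<nu> \<bullet> y) *\<^sub>R w \<in> A} y \<partial>lborel) = (\<integral>\<^sup>+y. indicator A y \<partial>lborel)"
    by (simp only:)
  then show ?thesis by simp
qed simp

text \<open>Pairs of a base point in the unit slab and a position on the line through it. Boundary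
  layers of all widths \<open>h\<close> become integrals over this one measure, so that dominated
  convergence can be applied as \<open>h\<close> tends to 0.\<close>

definition slab_measure :: "'a::euclidean_space \<Rightarrow> ('a \<times> real) measure" where
  "slab_measure e = density (lborel \<Otimes>\<^sub>M lborel) (\<lambda>(y, t). indicator {0..1} (e \<bullet> y))"

lemma sets_slab_measure [simp, measurable_cong]: "sets (slab_measure e) = sets (borel \<Otimes>\<^sub>M borel)"
  by (simp add: slab_measure_def cong: sets_pair_measure_cong)

lemma nn_integral_slab_measure:
  fixes f :: "'a::euclidean_space \<times> real \<Rightarrow> ennreal"
  assumes [measurable]: "f \<in> borel_measurable (borel \<Otimes>\<^sub>M borel)"
  shows "(\<integral>\<^sup>+p. f p \<partial>slab_measure e) =
    (\<integral>\<^sup>+y. indicator {0..1} (e \<bullet> y) * (\<integral>\<^sup>+t. f (y, t) \<partial>lborel) \<partial>lborel)"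
proof -
  have "(\<integral>\<^sup>+p. f p \<partial>slab_measure e) = (\<integral>\<^sup>+p. indicator {0..1} (e \<bullet> fst p) * f p \<partial>(lborel \<Otimes>\<^sub>M lborel))"
    unfolding slab_measure_def by (subst nn_integral_density) (auto simp: split_def)
  also have "\<dots> = (\<integral>\<^sup>+y. \<integral>\<^sup>+t. indicator {0..1} (e \<bullet> y) * f (y, t) \<partial>lborel \<partial>lborel)"
    by (subst lborel.nn_integral_fst[symmetric]) auto
  also have "\<dots> = (\<integral>\<^sup>+y. indicator {0..1} (e \<bullet> y) * (\<integral>\<^sup>+t. f (y, t) \<partial>lborel) \<partial>lborel)"
    by (simp add: nn_integral_cmult)
  finally show ?thesis .
qed

text \<open>The origin \<open>c y\<close> on each line is free and the scale \<open>h\<close>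
  contributes only its Jacobian. Later \<open>c\<close> is minus the height, which replaces the base
  point by its foot on the boundary.\<close>

lemma distr_slab_measure:
  fixes c :: "'a::euclidean_space \<Rightarrow> real"
  assumes [measurable]: "c \<in> borel_measurable borel" and e: "norm e = 1" and h: "h > 0"
  shows "distr (slab_measure e) borel (\<lambda>(y, t). y + (c y + h * t) *\<^sub>R e) = density lborel (\<lambda>_. ennreal (1 / h))"
proof (rule measure_eqI)
  fix A assume "A \<in> sets (distr (slab_measure e) borel (\<lambda>(y, t). y + (c y + h * t) *\<^sub>R e))"
  then have A [measurable]: "A \<in> sets borel" by simp
  have m1 [measurable]: "(\<lambda>(y, t). y + (c y + h * t) *\<^sub>R e) \<in> borel_measurable (borel \<Otimes>\<^sub>M borel)" by measurable
  have "emeasure (distr (slab_measure e) borel (\<lambda>(y, t). y + (c y + h * t) *\<^sub>R e)) A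
    = (\<integral>\<^sup>+p. indicator A (case p of (y, t) \<Rightarrow> y + (c y + h * t) *\<^sub>R e) \<partial>slab_measure e)"
    by (subst nn_integral_indicator[symmetric], simp) (subst nn_integral_distr, auto)
  also have "\<dots> = (\<integral>\<^sup>+y. indicator {0..1} (e \<bullet> y) * (\<integral>\<^sup>+t. indicator A (y + (c y + h * t) *\<^sub>R e) \<partial>lborel) \<partial>lborel)"
    by (subst nn_integral_slab_measure) auto
  also have "\<dots> = (\<integral>\<^sup>+y. indicator {0..1} (e \<bullet> y) * (ennreal (1 / h) * (\<integral>\<^sup>+t. indicator A (y + t *\<^sub>R e) \<partial>lborel)) \<partial>lborel)"
    using h by (intro nn_integral_cong, subst nn_integral_line_shift[where h = h])
      (auto simp: mult.assoc[symmetric] ennreal_mult[symmetric])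
  also have "\<dots> = ennreal (1 / h) * (\<integral>\<^sup>+y. indicator {0..1} (e \<bullet> y) * (\<integral>\<^sup>+t. indicator A (y + t *\<^sub>R e) \<partial>lborel) \<partial>lborel)"
    by (subst nn_integral_cmult[symmetric]) (auto simp: mult.left_commute)
  also have "\<dots> = ennreal (1 / h) * emeasure lborel A"
    using nn_integral_lines[of "indicator A" e] e by simp
  finally show "emeasure (distr (slab_measure e) borel (\<lambda>(y, t). y + (c y + h * t) *\<^sub>R e)) A
      = emeasure (density lborel (\<lambda>_. ennreal (1 / h))) A"
    by (simp add: emeasure_density nn_integral_cmult)
qed simp

lemma lborel_integral_slab:
  fixes c :: "'a::euclidean_space \<Rightarrow> real" and F :: "'a \<Rightarrow> real"
  assumes [measurable]: "c \<in> borel_measurable borel" "F \<in> borel_measurable borel"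
    and e: "norm e = 1" and h: "h > 0"
  shows "(LINT x|lborel. F x) = h * (LINT p|slab_measure e. F (fst p + (c (fst p) + h * snd p) *\<^sub>R e))"
proof -
  have m1 [measurable]: "(\<lambda>(y, t). y + (c y + h * t) *\<^sub>R e) \<in> borel_measurable (borel \<Otimes>\<^sub>M borel)" by measurable
  have "(LINT p|slab_measure e. F (fst p + (c (fst p) + h * snd p) *\<^sub>R e))
      = (LINT x|distr (slab_measure e) borel (\<lambda>(y, t). y + (c y + h * t) *\<^sub>R e). F x)"
    by (subst integral_distr) (auto simp: split_def)
  also have "\<dots> = (LINT x|lborel. (1 / h) * F x)"
    unfolding distr_slab_measure[OF assms(1) e h] using h by (subst integral_density) auto
  finally show ?thesis using h by simp
qed

section \<open>Hausdorff against Lebesgue measure on hyperplanes\<close>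

lemma hyperplane_rotation:
  fixes f :: "real^'n::finite \<Rightarrow> real^'n"
  assumes f: "orthogonal_transformation f" "f \<nu>0 = \<nu>"
  shows "f ` {x. \<nu>0 \<bullet> x = 0 \<and> P (norm x)} = {x. \<nu> \<bullet> x = 0 \<and> P (norm x)}"
proof -
  have in_eq: "f v \<bullet> f w = v \<bullet> w" for v w using f(1) by (simp add: orthogonal_transformation_def)
  have nm: "norm (f v) = norm v" for v by (rule orthogonal_transformation_norm[OF f(1)])
  have sf: "surj f" by (rule orthogonal_transformation_surj[OF f(1)])
  show ?thesis
  proof (intro equalityI subsetI)
    fix x assume "x \<in> f ` {x. \<nu>0 \<bullet> x = 0 \<and> P (norm x)}"
    then show "x \<in> {x. \<nu> \<bullet> x = 0 \<and> P (norm x)}" using in_eq[of \<nu>0] nm f(2) by auto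
  next
    fix x assume x: "x \<in> {x. \<nu> \<bullet> x = 0 \<and> P (norm x)}"
    obtain y where y: "x = f y" using sf by (rule surjE)
    then have "y \<in> {x. \<nu>0 \<bullet> x = 0 \<and> P (norm x)}" using x in_eq[of \<nu>0 y] nm f(2) by auto
    then show "x \<in> f ` {x. \<nu>0 \<bullet> x = 0 \<and> P (norm x)}" using y by blast
  qed
qed

lemma hausdorff_hyperplane_rotation:
  fixes \<nu> \<nu>0 :: "real^'n::finite"
  assumes "norm \<nu> = 1" "norm \<nu>0 = 1"
  shows "hausdorff_outer s {x. \<nu> \<bullet> x = 0 \<and> P (norm x)} = hausdorff_outer s {x. \<nu>0 \<bullet> x = 0 \<and> P (norm x)}"
proof -
  obtain f where f: "orthogonal_transformation f" "f \<nu>0 = \<nu>"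
    using orthogonal_transformation_exists_1[OF assms(2,1)] by blast
  have "dist (f x) (f y) = dist x y" for x y
    using f(1) by (simp add: dist_norm orthogonal_transformation_norm linear_diff[symmetric] orthogonal_transformation_linear)
  from hausdorff_outer_isometry[OF this, of s "{x. \<nu>0 \<bullet> x = 0 \<and> P (norm x)}"] show ?thesis
    unfolding hyperplane_rotation[OF f, of P] .
qed

lemma hausdorff_hyperplane_finite:
  fixes \<nu> :: "real^'n::finite"
  assumes nu: "norm \<nu> = 1" and r: "0 < r"
  shows "hausdorff_outer (CARD('n) - 1) {x. \<nu> \<bullet> x = 0 \<and> norm x \<le> r} < top"
proof -
  let ?s = "CARD('n) - 1"
  obtain i :: 'n where True by blast
  let ?A = "{x :: real^'n. x $ i = 0 \<and> (\<forall>j. \<bar>x $ j\<bar> \<le> 1)}"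
  let ?B = "{x :: real^'n. axis i 1 \<bullet> x = 0 \<and> norm x \<le> r}"
  have "?B \<subseteq> (\<lambda>x. r *\<^sub>R x) ` ?A"
  proof
    fix x assume x: "x \<in> ?B"
    have "\<bar>x $ j\<bar> \<le> r" for j using component_le_norm_cart[of x j] x by simp
    then have "(1 / r) *\<^sub>R x \<in> ?A" using x r by (auto simp: inner_axis' abs_mult)
    moreover have "x = r *\<^sub>R ((1 / r) *\<^sub>R x)" using r by simp
    ultimately show "x \<in> (\<lambda>x. r *\<^sub>R x) ` ?A" by blast
  qed
  then have "hausdorff_outer ?s ?B \<le> hausdorff_outer ?s ((\<lambda>x. r *\<^sub>R x) ` ?A)"
    by (rule hausdorff_outer_mono)
  also have "\<dots> \<le> ennreal (r ^ ?s) * hausdorff_outer ?s ?A"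
    using r by (intro hausdorff_outer_lipschitz) (auto simp: dist_norm scaleR_diff_right[symmetric])
  also have "\<dots> < top" using hausdorff_unit_cube_finite[of i] by (simp add: ennreal_mult_less_top)
  finally have "hausdorff_outer ?s ?B < top" .
  then show ?thesis
    using hausdorff_hyperplane_rotation[of \<nu> "axis i 1" ?s "\<lambda>t. t \<le> r"] nu by simp
qed

lemma emeasure_lborel_open_pos:
  fixes U :: "'a::euclidean_space set"
  assumes "open U" "U \<noteq> {}"
  shows "0 < emeasure lborel U"
proof (rule ccontr)
  assume "\<not> ?thesis"
  then have "U \<in> null_sets lborel" using assms by (auto simp: null_sets_def)
  then have "negligible U" by (simp add: negligible_iff_null_sets null_sets_completionI)
  then show False using assms open_not_negligible by blast
qed

lemma hausdorff_hyperplane_pos: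
  fixes \<nu> :: "real^'n::finite"
  assumes nu: "norm \<nu> = 1"
  shows "0 < hausdorff_outer (CARD('n) - 1) {x. \<nu> \<bullet> x = 0 \<and> norm x < 1}"
proof -
  let ?s = "CARD('n) - 1"
  obtain i :: 'n where True by blast
  let ?A = "{x :: real^'n. axis i 1 \<bullet> x = 0 \<and> norm x < 1}"
  \<comment> \<open>The open half ball has positive volume, lies between the heights 0 and 1 and
    projects into the disc.\<close>
  let ?T = "{x :: real^'n. 0 < x $ i} \<inter> ball 0 1"
  have oT: "open ?T" by (intro open_Int open_Collect_less continuous_intros) auto
  have "(1/2) *\<^sub>R axis i 1 \<in> ?T" by simp
  then have "0 < emeasure lborel ?T" using oT by (intro emeasure_lborel_open_pos) blast+
  also have "\<dots> \<le> ennreal (4 ^ ?s / unit_ball_vol (real ?s)) * hausdorff_outer ?s ?A"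
  proof (rule hausdorff_outer_ge_volume)
    show "?T \<in> sets borel" using oT by (rule borel_open)
    fix x assume x: "x \<in> ?T"
    have "norm ((\<chi> j. if j = i then 0 else x $ j) :: real^'n) \<le> norm x"
      by (rule norm_le_componentwise_cart) simp
    moreover have "x $ i \<le> 1" using component_le_norm_cart[of x i] x by simp
    ultimately show "0 \<le> x $ i \<and> x $ i \<le> 1 \<and> (\<chi> j. if j = i then 0 else x $ j) \<in> ?A"
      using x by (simp add: inner_axis')
  qed (simp add: inner_axis')
  finally have "hausdorff_outer ?s ?A \<noteq> 0" by auto
  then show ?thesis
    using hausdorff_hyperplane_rotation[of \<nu> "axis i 1" ?s "\<lambda>t. t < 1"] nu by (simp add: zero_less_iff_neq_zero)
qed

text \<open>Uniqueness of Haar measure in miniature: the double integral of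
  \<open>indicator Q y * indicator A (f x + y)\<close> is evaluated in both orders. The ball
  \<open>Q\<close> is invariant under \<open>f\<close>, which makes the proportionality factor
  1.\<close>

lemma emeasure_lborel_orthogonal_vimage:
  fixes f :: "'a::euclidean_space \<Rightarrow> 'a"
  assumes f: "orthogonal_transformation f" and A [measurable]: "A \<in> sets borel"
  shows "emeasure lborel {y. f y \<in> A} = emeasure lborel A"
proof -
  have lin: "linear f" by (rule orthogonal_transformation_linear[OF f])
  have sf: "surj f" by (rule orthogonal_transformation_surj[OF f])
  have [measurable]: "f \<in> borel_measurable borel"
    using lin by (intro borel_measurable_continuous_onI linear_continuous_on) (simp add: linear_conv_bounded_linear)
  define Q where "Q = (ball 0 1 :: 'a set)"
  have [measurable]: "Q \<in> sets borel" by (simp add: Q_def)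
  have 1: "(\<integral>\<^sup>+x. indicator A (f x + y) \<partial>lborel) = emeasure lborel {y. f y \<in> A}" for y
  proof -
    obtain z where z: "y = f z" using sf by (rule surjE)
    have "(\<integral>\<^sup>+x. indicator A (f x + y) \<partial>lborel) = (\<integral>\<^sup>+x. indicator A (f (x + z)) \<partial>lborel)"
      using lin by (simp add: z linear_add)
    also have "\<dots> = (\<integral>\<^sup>+x. indicator A (f x) \<partial>lborel)"
      by (rule nn_integral_lborel_translate) measurable
    also have "\<dots> = (\<integral>\<^sup>+x. indicator {y. f y \<in> A} x \<partial>lborel)"
      by (intro nn_integral_cong) (auto split: split_indicator)
    finally show ?thesis by simp
  qed
  have 2: "(\<integral>\<^sup>+x. indicator Q (y - f x) \<partial>lborel) = emeasure lborel Q" for y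
  proof -
    obtain z where z: "y = f z" using sf by (rule surjE)
    have nm: "norm (f z - f x) = norm (x - z)" for x
      using lin f by (simp add: linear_diff[symmetric] orthogonal_transformation_norm norm_minus_commute)
    have "(\<integral>\<^sup>+x. indicator Q (y - f x) \<partial>lborel) = (\<integral>\<^sup>+x. indicator Q (x + - z) \<partial>lborel)"
      by (intro nn_integral_cong) (simp add: z nm indicator_def Q_def)
    also have "\<dots> = (\<integral>\<^sup>+x. indicator Q x \<partial>lborel)"
      by (rule nn_integral_lborel_translate) measurable
    finally show ?thesis by simp
  qed
  have "emeasure lborel {y. f y \<in> A} * emeasure lborel Q
    = (\<integral>\<^sup>+y. (\<integral>\<^sup>+x. indicator Q y * indicator A (f x + y) \<partial>lborel) \<partial>lborel)"
    by (simp add: nn_integral_cmult 1 nn_integral_multc mult.commute)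
  also have "\<dots> = (\<integral>\<^sup>+x. (\<integral>\<^sup>+y. indicator Q y * indicator A (f x + y) \<partial>lborel) \<partial>lborel)"
    by (rule lborel_pair.Fubini') measurable
  also have "\<dots> = (\<integral>\<^sup>+x. (\<integral>\<^sup>+y. indicator Q (y - f x) * indicator A y \<partial>lborel) \<partial>lborel)"
  proof (rule nn_integral_cong)
    fix x
    have "(\<integral>\<^sup>+y. indicator Q y * indicator A (f x + y) \<partial>lborel)
      = (\<integral>\<^sup>+y. indicator Q (y + - f x) * indicator A (f x + (y + - f x)) \<partial>lborel)"
      by (rule nn_integral_lborel_translate[symmetric]) measurable
    then show "(\<integral>\<^sup>+y. indicator Q y * indicator A (f x + y) \<partial>lborel)
      = (\<integral>\<^sup>+y. indicator Q (y - f x) * indicator A y \<partial>lborel)" by simp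
  qed
  also have "\<dots> = (\<integral>\<^sup>+y. (\<integral>\<^sup>+x. indicator Q (y - f x) * indicator A y \<partial>lborel) \<partial>lborel)"
    by (rule lborel_pair.Fubini'[symmetric]) measurable
  also have "\<dots> = emeasure lborel A * emeasure lborel Q"
    by (simp add: nn_integral_cmult 2 nn_integral_multc mult.commute)
  finally have eq: "emeasure lborel {y. f y \<in> A} * emeasure lborel Q = emeasure lborel A * emeasure lborel Q" .
  have "emeasure lborel Q < top" unfolding Q_def using emeasure_bounded_finite[OF bounded_ball] by simp
  moreover have "0 < emeasure lborel Q" unfolding Q_def by (rule emeasure_lborel_open_pos) auto
  ultimately obtain q where q: "0 < q" "emeasure lborel Q = ennreal q" by (cases "emeasure lborel Q") auto
  have "emeasure lborel {y. f y \<in> A} * ennreal q * ennreal (1 / q) = emeasure lborel A * ennreal q * ennreal (1 / q)"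
    using eq by (simp only: q)
  then show ?thesis using q by (simp add: mult.assoc ennreal_mult[symmetric])
qed

text \<open>Lebesgue measure of the part of \<open>A\<close> in the hyperplane orthogonal to
  \<open>\<nu>\<close>, realised as the volume of the prism of height 1 over it.\<close>

definition slab_volume :: "real^'n::finite \<Rightarrow> (real^'n) set \<Rightarrow> ennreal" where
  "slab_volume \<nu> A = emeasure lborel {y. 0 \<le> \<nu> \<bullet> y \<and> \<nu> \<bullet> y \<le> 1 \<and> y - (\<nu> \<bullet> y) *\<^sub>R \<nu> \<in> A}"

lemma slab_ball_bounded:
  fixes \<nu> :: "real^'n::finite"
  assumes "norm \<nu> = 1"
  shows "{y. 0 \<le> \<nu> \<bullet> y \<and> \<nu> \<bullet> y \<le> 1 \<and> y - (\<nu> \<bullet> y) *\<^sub>R \<nu> \<in> ball 0 1} \<subseteq> cball 0 2"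
proof
  fix y assume y: "y \<in> {y. 0 \<le> \<nu> \<bullet> y \<and> \<nu> \<bullet> y \<le> 1 \<and> y - (\<nu> \<bullet> y) *\<^sub>R \<nu> \<in> ball 0 1}"
  have "norm y \<le> norm (y - (\<nu> \<bullet> y) *\<^sub>R \<nu>) + norm ((\<nu> \<bullet> y) *\<^sub>R \<nu>)"
    using norm_triangle_ineq[of "y - (\<nu> \<bullet> y) *\<^sub>R \<nu>" "(\<nu> \<bullet> y) *\<^sub>R \<nu>"] by simp
  then show "y \<in> cball 0 2" using y assms by simp
qed

lemma slab_sets:
  fixes \<nu> :: "real^'n::finite"
  assumes [measurable]: "A \<in> sets borel"
  shows "{y. 0 \<le> \<nu> \<bullet> y \<and> \<nu> \<bullet> y \<le> 1 \<and> y - (\<nu> \<bullet> y) *\<^sub>R \<nu> \<in> A} \<in> sets borel"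
  by measurable

lemma slab_volume_ball_rotation:
  fixes \<nu> \<nu>0 :: "real^'n::finite"
  assumes nu: "norm \<nu> = 1" "norm \<nu>0 = 1"
  shows "slab_volume \<nu> (ball 0 1) = slab_volume \<nu>0 (ball 0 1)"
proof -
  let ?S = "\<lambda>\<nu>. {y. 0 \<le> \<nu> \<bullet> y \<and> \<nu> \<bullet> y \<le> 1 \<and> y - (\<nu> \<bullet> y) *\<^sub>R \<nu> \<in> ball 0 (1::real)}"
  obtain f where f: "orthogonal_transformation f" "f \<nu>0 = \<nu>"
    using orthogonal_transformation_exists_1[OF nu(2,1)] by blast
  have lin: "linear f" using f(1) by (rule orthogonal_transformation_linear)
  have in_eq: "f v \<bullet> f w = v \<bullet> w" for v w using f(1) by (simp add: orthogonal_transformation_def)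
  have nm: "norm (f v) = norm v" for v by (rule orthogonal_transformation_norm[OF f(1)])
  have mem: "f y \<in> ?S \<nu> \<longleftrightarrow> y \<in> ?S \<nu>0" for y
  proof -
    have "\<nu> \<bullet> f y = \<nu>0 \<bullet> y" using in_eq[of \<nu>0 y] f(2) by simp
    moreover have "f y - (\<nu>0 \<bullet> y) *\<^sub>R \<nu> = f (y - (\<nu>0 \<bullet> y) *\<^sub>R \<nu>0)"
      using f(2) lin by (simp add: linear_diff linear_scale)
    ultimately show ?thesis by (simp add: nm)
  qed
  have "{y. f y \<in> ?S \<nu>} = ?S \<nu>0" using mem by blast
  then show ?thesis
    unfolding slab_volume_def using emeasure_lborel_orthogonal_vimage[OF f(1) slab_sets[of "ball 0 1" \<nu>]]
    by simp
qed

lemma slab_volume_ball_finite_pos: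
  fixes \<nu> :: "real^'n::finite"
  assumes nu: "norm \<nu> = 1"
  shows "slab_volume \<nu> (ball 0 1) < top" "0 < slab_volume \<nu> (ball 0 1)"
proof -
  let ?S = "{y. 0 \<le> \<nu> \<bullet> y \<and> \<nu> \<bullet> y \<le> 1 \<and> y - (\<nu> \<bullet> y) *\<^sub>R \<nu> \<in> ball 0 1}"
  have "emeasure lborel ?S \<le> emeasure lborel (cball 0 2 :: (real^'n) set)"
    by (rule emeasure_mono[OF slab_ball_bounded[OF nu]]) simp
  also have "\<dots> < top" using emeasure_bounded_finite[OF bounded_cball] by simp
  finally show "slab_volume \<nu> (ball 0 1) < top" by (simp add: slab_volume_def)
  let ?U = "{y. 0 < \<nu> \<bullet> y} \<inter> {y. \<nu> \<bullet> y < 1} \<inter> {y. norm (y - (\<nu> \<bullet> y) *\<^sub>R \<nu>) < 1}"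
  have oU: "open ?U" by (intro open_Int open_Collect_less continuous_intros)
  have "(1/2) *\<^sub>R \<nu> \<in> ?U" using nu by (simp add: dot_square_norm)
  then have "0 < emeasure lborel ?U" using oU by (intro emeasure_lborel_open_pos) blast+
  also have "\<dots> \<le> emeasure lborel ?S" by (rule emeasure_mono) (use slab_sets[of "ball 0 1" \<nu>] in auto)
  finally show "0 < slab_volume \<nu> (ball 0 1)" by (simp add: slab_volume_def)
qed

text \<open>Uniqueness of the translation invariant measure on the hyperplane, by the classical Fubini argument.\<close>

lemma hausdorff_hyperplane_proportional:
  fixes \<nu> :: "real^'n::finite"
  assumes nu: "norm \<nu> = 1" and A [measurable]: "A \<in> sets borel" and Q [measurable]: "Q \<in> sets borel"
  defines "P \<equiv> {x. \<nu> \<bullet> x = 0}"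
  shows "hausdorff_outer (CARD('n) - 1) (A \<inter> P) * slab_volume \<nu> Q =
    slab_volume \<nu> A * hausdorff_outer (CARD('n) - 1) (Q \<inter> P)"
proof -
  let ?s = "CARD('n) - 1"
  let ?H = "hausdorff_outer ?s :: (real^'n) set \<Rightarrow> ennreal"
  have nn: "\<nu> \<bullet> \<nu> = 1" using nu by (simp add: dot_square_norm)
  have "closed P" unfolding P_def by (intro closed_Collect_eq continuous_intros)
  then have P [measurable]: "P \<in> sets borel" by (rule borel_closed)
  define HP where "HP = density (hausdorff_measure ?s :: (real^'n) measure) (indicator P)"
  have [simp, measurable_cong]: "sets HP = sets borel" and [simp]: "space HP = UNIV"
    by (simp_all add: HP_def)
  have HP: "emeasure HP B = ?H (B \<inter> P)" if "B \<in> sets borel" for B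
    unfolding HP_def using that P
    by (subst emeasure_restricted) (auto simp: emeasure_hausdorff_measure Int_commute)
  have "sigma_finite_measure HP"
  proof
    show "\<exists>C. countable C \<and> C \<subseteq> sets HP \<and> \<Union>C = space HP \<and> (\<forall>a\<in>C. emeasure HP a \<noteq> \<infinity>)"
    proof (intro exI[of _ "range (\<lambda>n. cball 0 (real (Suc n)))"] conjI ballI)
      show "\<Union>(range (\<lambda>n. cball 0 (real (Suc n)))) = space HP"
      proof -
        have "\<exists>n. norm x \<le> real (Suc n)" for x :: "real^'n"
          using real_arch_simple[of "norm x"] by (metis order_trans of_nat_le_iff le_SucI order_refl)
        then show ?thesis by auto
      qed
      fix B assume "B \<in> range (\<lambda>n. cball 0 (real (Suc n)) :: (real^'n) set)"
      then obtain n where B: "B = cball 0 (real (Suc n))" by blast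
      have "emeasure HP B = ?H {x. \<nu> \<bullet> x = 0 \<and> norm x \<le> real (Suc n)}"
        by (subst HP) (auto simp: B P_def Int_def conj_commute)
      also have "\<dots> < top" by (rule hausdorff_hyperplane_finite[OF nu]) simp
      finally show "emeasure HP B \<noteq> \<infinity>" by simp
    qed auto
  qed
  then interpret F: pair_sigma_finite HP "lborel :: (real^'n) measure"
    by (intro pair_sigma_finite.intro lborel.sigma_finite_measure_axioms)
  let ?I = "\<lambda>y. indicator {0..1} (\<nu> \<bullet> y) :: ennreal" and ?\<pi> = "\<lambda>y. y - (\<nu> \<bullet> y) *\<^sub>R \<nu>"
  have \<pi>P: "?\<pi> y \<in> P" for y by (simp add: P_def inner_diff_right nn)
  have vol: "slab_volume \<nu> B = (\<integral>\<^sup>+y. ?I y * indicator B (?\<pi> y) \<partial>lborel)" if "B \<in> sets borel" for B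
  proof -
    have "(\<integral>\<^sup>+y. ?I y * indicator B (?\<pi> y) \<partial>lborel)
      = (\<integral>\<^sup>+y. indicator {y. 0 \<le> \<nu> \<bullet> y \<and> \<nu> \<bullet> y \<le> 1 \<and> y - (\<nu> \<bullet> y) *\<^sub>R \<nu> \<in> B} y \<partial>lborel)"
      by (intro nn_integral_cong) (auto split: split_indicator)
    then show ?thesis using slab_sets[OF that, of \<nu>] by (simp add: slab_volume_def)
  qed
  have shift: "(\<integral>\<^sup>+x. indicator A (x + ?\<pi> y) \<partial>HP) = ?H (A \<inter> P)" for y
  proof -
    have "(\<integral>\<^sup>+x. indicator A (x + ?\<pi> y) \<partial>HP) = (\<integral>\<^sup>+x. indicator {x. x + ?\<pi> y \<in> A} x \<partial>HP)"
      by (intro nn_integral_cong) (auto split: split_indicator)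
    also have "\<dots> = ?H ({x. x + ?\<pi> y \<in> A} \<inter> P)"
      by (subst nn_integral_indicator, simp) (rule HP, simp)
    also have "{x. x + ?\<pi> y \<in> A} \<inter> P = (\<lambda>x. x - ?\<pi> y) ` (A \<inter> P)"
    proof (intro equalityI subsetI)
      fix x assume "x \<in> {x. x + ?\<pi> y \<in> A} \<inter> P"
      then have "x + ?\<pi> y \<in> A \<inter> P" using \<pi>P[of y] by (simp add: P_def inner_add_right)
      then show "x \<in> (\<lambda>x. x - ?\<pi> y) ` (A \<inter> P)" by (rule rev_image_eqI) simp
    next
      fix x assume "x \<in> (\<lambda>x. x - ?\<pi> y) ` (A \<inter> P)"
      then show "x \<in> {x. x + ?\<pi> y \<in> A} \<inter> P" using \<pi>P[of y] by (auto simp: P_def inner_diff_right)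
    qed
    also have "?H \<dots> = ?H (A \<inter> P)" by (rule hausdorff_outer_isometry) (simp add: dist_norm)
    finally show ?thesis .
  qed
  have reflect: "(\<integral>\<^sup>+x. indicator Q (?\<pi> y - x) \<partial>HP) = ?H (Q \<inter> P)" for y
  proof -
    have "(\<integral>\<^sup>+x. indicator Q (?\<pi> y - x) \<partial>HP) = (\<integral>\<^sup>+x. indicator {x. ?\<pi> y - x \<in> Q} x \<partial>HP)"
      by (intro nn_integral_cong) (auto split: split_indicator)
    also have "\<dots> = ?H ({x. ?\<pi> y - x \<in> Q} \<inter> P)"
      by (subst nn_integral_indicator, simp) (rule HP, simp)
    also have "{x. ?\<pi> y - x \<in> Q} \<inter> P = (\<lambda>x. ?\<pi> y - x) ` (Q \<inter> P)"
    proof (intro equalityI subsetI)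
      fix x assume "x \<in> {x. ?\<pi> y - x \<in> Q} \<inter> P"
      then have "?\<pi> y - x \<in> Q \<inter> P" using \<pi>P[of y] by (simp add: P_def inner_diff_right)
      then show "x \<in> (\<lambda>x. ?\<pi> y - x) ` (Q \<inter> P)" by (rule rev_image_eqI) simp
    next
      fix x assume "x \<in> (\<lambda>x. ?\<pi> y - x) ` (Q \<inter> P)"
      then show "x \<in> {x. ?\<pi> y - x \<in> Q} \<inter> P" using \<pi>P[of y] by (auto simp: P_def inner_diff_right)
    qed
    also have "?H \<dots> = ?H (Q \<inter> P)" by (rule hausdorff_outer_isometry) (simp add: dist_norm norm_minus_commute)
    finally show ?thesis .
  qed
  have "?H (A \<inter> P) * slab_volume \<nu> Q = (\<integral>\<^sup>+y. (\<integral>\<^sup>+x. ?I y * indicator Q (?\<pi> y) * indicator A (x + ?\<pi> y) \<partial>HP) \<partial>lborel)"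
    by (simp add: nn_integral_cmult shift nn_integral_multc vol mult.commute)
  also have "\<dots> = (\<integral>\<^sup>+x. (\<integral>\<^sup>+y. ?I y * indicator Q (?\<pi> y) * indicator A (x + ?\<pi> y) \<partial>lborel) \<partial>HP)"
    by (rule F.Fubini') measurable
  \<comment> \<open>Substituting \<open>y - x\<close> for \<open>y\<close> with \<open>x\<close> in
    the hyperplane preserves the slab and exchanges the places of \<open>A\<close> and
    \<open>Q\<close>; the outer integral sees only points of the hyperplane.\<close>
  also have "\<dots> = (\<integral>\<^sup>+x. (\<integral>\<^sup>+y. ?I y * indicator A (?\<pi> y) * indicator Q (?\<pi> y - x) \<partial>lborel) \<partial>HP)"
  proof (rule nn_integral_cong_AE)
    have "AE x in HP. x \<in> P"
      unfolding HP_def using P by (subst AE_density) (auto split: split_indicator)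
    then show "AE x in HP. (\<integral>\<^sup>+y. ?I y * indicator Q (?\<pi> y) * indicator A (x + ?\<pi> y) \<partial>lborel)
      = (\<integral>\<^sup>+y. ?I y * indicator A (?\<pi> y) * indicator Q (?\<pi> y - x) \<partial>lborel)"
    proof (rule AE_mp, intro AE_I2 impI)
      fix x assume "x \<in> P"
      then have x: "\<nu> \<bullet> x = 0" by (simp add: P_def)
      have "(\<integral>\<^sup>+y. ?I y * indicator Q (?\<pi> y) * indicator A (x + ?\<pi> y) \<partial>lborel)
        = (\<integral>\<^sup>+y. ?I (y + - x) * indicator Q (?\<pi> (y + - x)) * indicator A (x + ?\<pi> (y + - x)) \<partial>lborel)"
        by (rule nn_integral_lborel_translate[symmetric]) measurable
      also have "\<dots> = (\<integral>\<^sup>+y. ?I y * indicator A (?\<pi> y) * indicator Q (?\<pi> y - x) \<partial>lborel)"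
        by (intro nn_integral_cong) (simp add: inner_diff_right x algebra_simps)
      finally show "(\<integral>\<^sup>+y. ?I y * indicator Q (?\<pi> y) * indicator A (x + ?\<pi> y) \<partial>lborel)
        = (\<integral>\<^sup>+y. ?I y * indicator A (?\<pi> y) * indicator Q (?\<pi> y - x) \<partial>lborel)" .
    qed
  qed
  also have "\<dots> = (\<integral>\<^sup>+y. (\<integral>\<^sup>+x. ?I y * indicator A (?\<pi> y) * indicator Q (?\<pi> y - x) \<partial>HP) \<partial>lborel)"
    by (rule F.Fubini'[symmetric]) measurable
  also have "\<dots> = slab_volume \<nu> A * ?H (Q \<inter> P)"
    by (simp add: nn_integral_cmult reflect nn_integral_multc vol)
  finally show ?thesis .
qed

text \<open>The prism may be tilted. A shear orthogonal to \<open>\<nu>\<close> turns the orthogonal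
  projection into the projection along \<open>e\<close>, and each line of direction \<open>e\<close>
  meets the slab of \<open>\<nu>\<close> in a segment of length
  \<open>1 / (\<nu> \<bullet> e)\<close>.\<close>

lemma slab_volume_oblique:
  fixes \<nu> e :: "real^'n::finite"
  assumes nu: "norm \<nu> = 1" and e: "norm e = 1" and ne: "0 < \<nu> \<bullet> e" and A [measurable]: "A \<in> sets borel"
  shows "slab_volume \<nu> A = ennreal (1 / (\<nu> \<bullet> e)) *
    emeasure lborel {y. 0 \<le> e \<bullet> y \<and> e \<bullet> y \<le> 1 \<and> y - ((\<nu> \<bullet> y) / (\<nu> \<bullet> e)) *\<^sub>R e \<in> A}"
proof -
  let ?w = "\<nu> - (1 / (\<nu> \<bullet> e)) *\<^sub>R e"
  let ?\<pi> = "\<lambda>y. y - ((\<nu> \<bullet> y) / (\<nu> \<bullet> e)) *\<^sub>R e"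
  let ?S = "{y. 0 \<le> \<nu> \<bullet> y \<and> \<nu> \<bullet> y \<le> 1 \<and> y - (\<nu> \<bullet> y) *\<^sub>R \<nu> \<in> A}"
  let ?S' = "{y. 0 \<le> \<nu> \<bullet> y \<and> \<nu> \<bullet> y \<le> 1 \<and> ?\<pi> y \<in> A}"
  let ?E = "{y. 0 \<le> e \<bullet> y \<and> e \<bullet> y \<le> 1 \<and> ?\<pi> y \<in> A}"
  have nn: "\<nu> \<bullet> \<nu> = 1" "e \<bullet> e = 1" using nu e by (simp_all add: dot_square_norm)
  have w0: "\<nu> \<bullet> ?w = 0" using ne nn by (simp add: inner_diff_right)
  have "{y. y + (\<nu> \<bullet> y) *\<^sub>R ?w \<in> ?S} = ?S'"
  proof -
    have "\<nu> \<bullet> (y + (\<nu> \<bullet> y) *\<^sub>R ?w) = \<nu> \<bullet> y" for y by (simp only: inner_add_right inner_scaleR_right w0 mult_zero_right add_0_right)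
    moreover have "y + (\<nu> \<bullet> y) *\<^sub>R ?w - (\<nu> \<bullet> y) *\<^sub>R \<nu> = ?\<pi> y" for y by (simp add: algebra_simps)
    ultimately show ?thesis by (simp only: mem_Collect_eq)
  qed
  then have "slab_volume \<nu> A = emeasure lborel ?S'"
    unfolding slab_volume_def using emeasure_shear[OF slab_sets[OF A, of \<nu>] w0] by (simp only:)
  also have "\<dots> = (\<integral>\<^sup>+y. indicator ?S' y \<partial>lborel)" by simp
  also have "\<dots> = (\<integral>\<^sup>+y. indicator {0..1} (e \<bullet> y) * (\<integral>\<^sup>+t. indicator ?S' (y + t *\<^sub>R e) \<partial>lborel) \<partial>lborel)"
    by (rule nn_integral_lines[OF _ e]) measurable
  also have "\<dots> = (\<integral>\<^sup>+y. ennreal (1 / (\<nu> \<bullet> e)) * indicator ?E y \<partial>lborel)"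
  proof (rule nn_integral_cong)
    fix y :: "real^'n"
    have pi: "?\<pi> (y + t *\<^sub>R e) = ?\<pi> y" for t
      using ne by (simp add: inner_add_right add_divide_distrib algebra_simps)
    have "(\<integral>\<^sup>+t. indicator ?S' (y + t *\<^sub>R e) \<partial>lborel)
      = (\<integral>\<^sup>+t. indicator A (?\<pi> y) * indicator {- (\<nu> \<bullet> y) / (\<nu> \<bullet> e) .. (1 - \<nu> \<bullet> y) / (\<nu> \<bullet> e)} t \<partial>lborel)"
    proof (rule nn_integral_cong)
      fix t
      have "0 \<le> \<nu> \<bullet> (y + t *\<^sub>R e) \<and> \<nu> \<bullet> (y + t *\<^sub>R e) \<le> 1 \<longleftrightarrow> t \<in> {- (\<nu> \<bullet> y) / (\<nu> \<bullet> e) .. (1 - \<nu> \<bullet> y) / (\<nu> \<bullet> e)}"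
        using ne by (simp add: inner_add_right field_simps) linarith
      then show "(indicator ?S' (y + t *\<^sub>R e) :: ennreal)
        = indicator A (?\<pi> y) * indicator {- (\<nu> \<bullet> y) / (\<nu> \<bullet> e) .. (1 - \<nu> \<bullet> y) / (\<nu> \<bullet> e)} t"
        unfolding indicator_def mem_Collect_eq pi by auto
    qed
    also have "\<dots> = indicator A (?\<pi> y) * ennreal (1 / (\<nu> \<bullet> e))"
    proof -
      have "(1 - \<nu> \<bullet> y) / (\<nu> \<bullet> e) - - (\<nu> \<bullet> y) / (\<nu> \<bullet> e) = 1 / (\<nu> \<bullet> e)" by (simp add: diff_divide_distrib)
      moreover have "- (\<nu> \<bullet> y) / (\<nu> \<bullet> e) \<le> (1 - \<nu> \<bullet> y) / (\<nu> \<bullet> e)" using ne by (intro divide_right_mono) auto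
      ultimately have "(\<integral>\<^sup>+t. indicator {- (\<nu> \<bullet> y) / (\<nu> \<bullet> e) .. (1 - \<nu> \<bullet> y) / (\<nu> \<bullet> e)} t \<partial>lborel) = ennreal (1 / (\<nu> \<bullet> e))"
        by (subst nn_integral_indicator) (simp_all only: emeasure_lborel_Icc, simp)
      then show ?thesis by (subst nn_integral_cmult) (simp, simp only:)
    qed
    finally show "indicator {0..1} (e \<bullet> y) * (\<integral>\<^sup>+t. indicator ?S' (y + t *\<^sub>R e) \<partial>lborel) = ennreal (1 / (\<nu> \<bullet> e)) * indicator ?E y"
      by (auto split: split_indicator)
  qed
  also have "\<dots> = ennreal (1 / (\<nu> \<bullet> e)) * emeasure lborel ?E"
    by (subst nn_integral_cmult) auto
  finally show ?thesis .
qed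

text \<open>The ratio of the two measures is read off from the unit disc of one coordinate
  hyperplane. Both measures are invariant under rotations and translations, hence one
  \<open>c\<close> serves all hyperplanes.\<close>

lemma hausdorff_hyperplane_formula:
  obtains c :: real where "0 < c"
    "\<And>\<nu> e z :: real^'n::finite. \<And>B. norm \<nu> = 1 \<Longrightarrow> norm e = 1 \<Longrightarrow> 0 < \<nu> \<bullet> e \<Longrightarrow> B \<in> sets borel \<Longrightarrow>
      B \<subseteq> {x. \<nu> \<bullet> (x - z) = 0} \<Longrightarrow>
      hausdorff_outer (CARD('n) - 1) B = ennreal (c / (\<nu> \<bullet> e)) *
        emeasure lborel {y. 0 \<le> e \<bullet> y \<and> e \<bullet> y \<le> 1 \<and> y - ((\<nu> \<bullet> (y - z)) / (\<nu> \<bullet> e)) *\<^sub>R e \<in> B}"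
proof -
  let ?s = "CARD('n) - 1"
  obtain i :: 'n where True by blast
  let ?\<nu>0 = "axis i 1 :: real^'n"
  let ?HQ = "hausdorff_outer ?s {x. ?\<nu>0 \<bullet> x = 0 \<and> norm x < 1}"
  let ?VQ = "slab_volume ?\<nu>0 (ball 0 1)"
  have n0: "norm ?\<nu>0 = 1" by simp
  have "?HQ \<le> hausdorff_outer ?s {x. ?\<nu>0 \<bullet> x = 0 \<and> norm x \<le> 1}" by (rule hausdorff_outer_mono) auto
  also have "\<dots> < top" by (rule hausdorff_hyperplane_finite[OF n0]) simp
  finally have "?HQ < top" .
  then obtain hq where hq: "0 < hq" "?HQ = ennreal hq"
    using hausdorff_hyperplane_pos[OF n0] by (cases ?HQ) auto
  obtain vq where vq: "0 < vq" "?VQ = ennreal vq"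
    using slab_volume_ball_finite_pos[OF n0] by (cases ?VQ) auto
  show thesis
  proof (rule that[of "hq / vq"])
    show "0 < hq / vq" using hq vq by simp
    fix \<nu> e z :: "real^'n" and B
    assume nu: "norm \<nu> = 1" and e: "norm e = 1" and ne: "0 < \<nu> \<bullet> e" and B [measurable]: "B \<in> sets borel"
      and sub: "B \<subseteq> {x. \<nu> \<bullet> (x - z) = 0}"
    have ee: "e \<bullet> e = 1" using e by (simp add: dot_square_norm)
    define A where "A = {x. x + z \<in> B}"
    have A [measurable]: "A \<in> sets borel" unfolding A_def by measurable
    have AP: "A \<inter> {x. \<nu> \<bullet> x = 0} = A" using sub by (auto simp: A_def)
    have QP: "ball 0 1 \<inter> {x. \<nu> \<bullet> x = 0} = {x. \<nu> \<bullet> x = 0 \<and> norm x < 1}" by auto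
    have "hausdorff_outer ?s A * ennreal vq = slab_volume \<nu> A * ennreal hq"
      using hausdorff_hyperplane_proportional[OF nu A, of "ball 0 1"] slab_volume_ball_rotation[OF nu n0]
        hausdorff_hyperplane_rotation[OF nu n0, of ?s "\<lambda>t. t < 1"]
      unfolding AP QP hq vq by simp
    then have "hausdorff_outer ?s A * ennreal vq * ennreal (1 / vq) = slab_volume \<nu> A * ennreal hq * ennreal (1 / vq)" by simp
    then have HA: "hausdorff_outer ?s A = slab_volume \<nu> A * ennreal (hq / vq)"
      using hq vq by (simp add: mult.assoc ennreal_mult[symmetric])
    have "B = (\<lambda>x. x + z) ` A"
    proof (intro equalityI subsetI)
      fix x assume "x \<in> B"
      then have "x - z \<in> A" by (simp add: A_def)
      then show "x \<in> (\<lambda>x. x + z) ` A" by (rule rev_image_eqI) simp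
    qed (auto simp: A_def)
    then have HB: "hausdorff_outer ?s B = hausdorff_outer ?s A"
      using hausdorff_outer_isometry[of "\<lambda>x. x + z" ?s A] by (simp add: dist_norm)
    \<comment> \<open>Translation by the part of \<open>z\<close> orthogonal to \<open>e\<close>
      keeps the slab; the remaining part of \<open>z\<close> is supplied by the projection along
      \<open>e\<close>.\<close>
    let ?w = "z - (e \<bullet> z) *\<^sub>R e"
    let ?E = "{y. 0 \<le> e \<bullet> y \<and> e \<bullet> y \<le> 1 \<and> y - ((\<nu> \<bullet> (y - z)) / (\<nu> \<bullet> e)) *\<^sub>R e \<in> B}"
    have "emeasure lborel {y. 0 \<le> e \<bullet> y \<and> e \<bullet> y \<le> 1 \<and> y - ((\<nu> \<bullet> y) / (\<nu> \<bullet> e)) *\<^sub>R e \<in> A}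
      = (\<integral>\<^sup>+y. indicator ?E (y + ?w) \<partial>lborel)"
    proof -
      have "indicator ?E (y + ?w) = (indicator {y. 0 \<le> e \<bullet> y \<and> e \<bullet> y \<le> 1 \<and> y - ((\<nu> \<bullet> y) / (\<nu> \<bullet> e)) *\<^sub>R e \<in> A} y :: ennreal)" for y
      proof -
        have 1: "e \<bullet> (y + ?w) = e \<bullet> y" using ee by (simp add: inner_add_right inner_diff_right)
        have "(\<nu> \<bullet> (y + ?w - z)) / (\<nu> \<bullet> e) = (\<nu> \<bullet> y) / (\<nu> \<bullet> e) - e \<bullet> z"
          using ne by (simp add: inner_add_right inner_diff_right diff_divide_distrib)
        then have 2: "y + ?w - ((\<nu> \<bullet> (y + ?w - z)) / (\<nu> \<bullet> e)) *\<^sub>R e = y - ((\<nu> \<bullet> y) / (\<nu> \<bullet> e)) *\<^sub>R e + z"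
          by (simp only:) (simp add: algebra_simps)
        show ?thesis unfolding indicator_def mem_Collect_eq 1 2 A_def ..
      qed
      then show ?thesis by simp
    qed
    also have "\<dots> = emeasure lborel ?E"
      by (subst nn_integral_lborel_translate) auto
    finally have "slab_volume \<nu> A = ennreal (1 / (\<nu> \<bullet> e)) * emeasure lborel ?E"
      using slab_volume_oblique[OF nu e ne A] by simp
    then have "hausdorff_outer ?s B = (ennreal (1 / (\<nu> \<bullet> e)) * ennreal (hq / vq)) * emeasure lborel ?E"
      unfolding HB HA by (simp add: mult_ac)
    also have "ennreal (1 / (\<nu> \<bullet> e)) * ennreal (hq / vq) = ennreal (hq / vq / (\<nu> \<bullet> e))"
      using ne hq vq by (simp add: ennreal_mult[symmetric])
    finally show "hausdorff_outer ?s B = ennreal (hq / vq / (\<nu> \<bullet> e)) * emeasure lborel ?E" .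
  qed
qed

section \<open>Boundary patches\<close>

text \<open>\<open>\<gamma>\<close> is a measurable function on the whole space, constant along
  \<open>e\<close>, so that heights and feet are available on entire lines of direction
  \<open>e\<close>; smoothness and the relation to \<open>D\<close> are known inside the
  ball.\<close>

locale graph_patch =
  fixes D :: "(real^'n::finite) set" and z :: "real^'n" and r :: real and e :: "real^'n" and \<gamma> :: "real^'n \<Rightarrow> real"
  assumes D: "open D" and r: "0 < r" and e: "norm e = 1"
    and \<gamma>_inv: "\<And>x t. \<gamma> (x + t *\<^sub>R e) = \<gamma> x"
    and \<gamma>_C1: "Ck_on 1 (ball z r) \<gamma>"
    and \<gamma>_meas [measurable]: "\<gamma> \<in> borel_measurable borel"
    and graph: "D \<inter> ball z r = {x \<in> ball z r. \<gamma> x < e \<bullet> x}"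
begin

definition height :: "real^'n \<Rightarrow> real" where "height x = e \<bullet> x - \<gamma> x"
text \<open>The gradient of \<open>height\<close>: an inward normal scaled so that its product with
  \<open>e\<close> is 1. Its length is the area element of the graph over the hyperplane orthogonal
  to \<open>e\<close>.\<close>

definition slope :: "real^'n \<Rightarrow> real^'n" where "slope x = e - gradient \<gamma> x"
definition foot :: "real^'n \<Rightarrow> real^'n" where "foot x = x - height x *\<^sub>R e"

lemma ee: "e \<bullet> e = 1" using e by (simp add: dot_square_norm)

lemma height_add: "height (x + t *\<^sub>R e) = height x + t"
  by (simp add: height_def \<gamma>_inv inner_add_right ee)

lemma foot_add: "foot (x + t *\<^sub>R e) = foot x"
  by (simp add: foot_def height_add algebra_simps)

lemma height_foot: "height (foot x) = 0"
  using height_add[of x "- height x"] by (simp add: foot_def)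

lemma height_meas [measurable]: "height \<in> borel_measurable borel"
  unfolding height_def by measurable

lemma foot_meas [measurable]: "foot \<in> borel_measurable borel"
  unfolding foot_def by measurable

lemma height_deriv:
  assumes "x \<in> ball z r"
  shows "(height has_derivative (\<lambda>v. slope x \<bullet> v)) (at x)"
proof -
  have "partials [] \<gamma> differentiable (at x)"
    using \<gamma>_C1 assms unfolding Ck_on_def by (metis less_one list.size(3))
  then have "(\<gamma> has_derivative (\<lambda>v. gradient \<gamma> x \<bullet> v)) (at x)"
    by (intro has_derivative_gradient) simp
  then have "((\<lambda>x. e \<bullet> x - \<gamma> x) has_derivative (\<lambda>v. e \<bullet> v - gradient \<gamma> x \<bullet> v)) (at x)"
    by (intro derivative_intros)
  then show ?thesis by (simp add: height_def[abs_def] slope_def inner_diff_left)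
qed

lemma slope_cont: "continuous_on (ball z r) slope"
proof -
  have "continuous_on (ball z r) (partial j \<gamma>)" for j
  proof -
    have "continuous_on (ball z r) (partials [j] \<gamma>)"
      using \<gamma>_C1 unfolding Ck_on_def by (metis One_nat_def le_refl length_Cons list.size(3))
    then show ?thesis by (simp add: partials_Cons)
  qed
  then have "continuous_on (ball z r) (gradient \<gamma>)"
    unfolding gradient_def[abs_def] by (intro continuous_on_vec_lambda)
  then show ?thesis unfolding slope_def[abs_def] by (intro continuous_intros)
qed

lemma height_cont: "continuous_on (ball z r) height"
  using height_deriv by (meson continuous_at_imp_continuous_on has_derivative_continuous)

lemma slope_e: "x \<in> ball z r \<Longrightarrow> slope x \<bullet> e = 1"
proof -
  assume x: "x \<in> ball z r"
  have "((\<lambda>t. x + t *\<^sub>R e) has_derivative (\<lambda>t. t *\<^sub>R e)) (at 0)"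
    by (auto intro!: derivative_eq_intros)
  moreover have "(height has_derivative (\<lambda>v. slope x \<bullet> v)) (at (x + 0 *\<^sub>R e))"
    using height_deriv[OF x] by simp
  ultimately have "((\<lambda>t. height (x + t *\<^sub>R e)) has_derivative (\<lambda>t. slope x \<bullet> (t *\<^sub>R e))) (at 0)"
    by (rule has_derivative_compose)
  then have 1: "((\<lambda>t. height x + t) has_derivative (\<lambda>t. slope x \<bullet> (t *\<^sub>R e))) (at 0)"
    by (simp only: height_add)
  have 2: "((\<lambda>t. height x + t) has_derivative (\<lambda>t. t)) (at 0)"
    by (auto intro!: derivative_eq_intros)
  from fun_cong[OF has_derivative_unique[OF 1 2], of 1] show ?thesis by simp
qed

lemma norm_slope_ge_1: "x \<in> ball z r \<Longrightarrow> 1 \<le> norm (slope x)"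
  using slope_e[of x] norm_cauchy_schwarz[of "slope x" e] e by simp

lemma mem_D: "x \<in> ball z r \<Longrightarrow> x \<in> D \<longleftrightarrow> 0 < height x"
proof -
  assume x: "x \<in> ball z r"
  then have "x \<in> D \<longleftrightarrow> x \<in> D \<inter> ball z r" by blast
  also have "\<dots> \<longleftrightarrow> 0 < height x" unfolding graph using x by (simp add: height_def)
  finally show ?thesis .
qed

lemma line_eventually:
  fixes x v :: "real^'n"
  assumes "open U" "x \<in> U"
  shows "\<forall>\<^sub>F t in at_right 0. x + t *\<^sub>R v \<in> U"
proof -
  have "((\<lambda>t. x + t *\<^sub>R v) \<longlongrightarrow> x + 0 *\<^sub>R v) (at_right 0)" by (intro tendsto_intros)
  then show ?thesis using assms by (auto simp: topological_tendstoD)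
qed

lemma closure_iff:
  assumes x: "x \<in> ball z r"
  shows "x \<in> closure D \<longleftrightarrow> 0 \<le> height x"
proof
  assume cl: "x \<in> closure D"
  show "0 \<le> height x"
  proof (rule ccontr)
    assume "\<not> 0 \<le> height x"
    then have "x \<in> ball z r \<inter> height -` {..<0}" using x by simp
    moreover have "open (ball z r \<inter> height -` {..<0})"
      using height_cont by (intro continuous_open_preimage) auto
    ultimately have "ball z r \<inter> height -` {..<0} \<inter> D \<noteq> {}"
      using cl open_Int_closure_eq_empty[of "ball z r \<inter> height -` {..<0}" D] by blast
    then show False using mem_D by force
  qed
next
  assume h: "0 \<le> height x"
  have "\<forall>\<^sub>F t in at_right 0. x + t *\<^sub>R e \<in> ball z r" by (rule line_eventually) (use x in auto)
  moreover have "\<forall>\<^sub>F t in at_right (0::real). 0 < t" by (simp add: eventually_at_right_less)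
  ultimately have "\<forall>\<^sub>F t in at_right 0. x + t *\<^sub>R e \<in> D"
    by eventually_elim (use h in \<open>auto simp: mem_D height_add\<close>)
  moreover have "((\<lambda>t. x + t *\<^sub>R e) \<longlongrightarrow> x + 0 *\<^sub>R e) (at_right 0)" by (intro tendsto_intros)
  moreover from \<open>\<forall>\<^sub>F t in at_right 0. x + t *\<^sub>R e \<in> D\<close> have "\<forall>\<^sub>F t in at_right 0. x + t *\<^sub>R e \<in> closure D"
    by (rule eventually_mono) (use closure_subset in blast)
  ultimately show "x \<in> closure D"
    using Lim_in_closed_set[of "closure D" "\<lambda>t. x + t *\<^sub>R e" "at_right 0" x] by simp
qed

lemma frontier_iff: "x \<in> ball z r \<Longrightarrow> x \<in> frontier D \<longleftrightarrow> height x = 0"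
  using closure_iff[of x] mem_D[of x] D by (auto simp: frontier_def interior_open)

lemma foot_frontier: "foot y \<in> ball z r \<Longrightarrow> foot y \<in> frontier D"
  by (simp add: frontier_iff height_foot)

lemma foot_eq: "x \<in> ball z r \<Longrightarrow> x \<in> frontier D \<Longrightarrow> foot x = x"
  by (simp add: frontier_iff foot_def)

text \<open>The mean value inequality for \<open>height\<close> minus its linear part at
  \<open>p\<close>, whose gradient is small near \<open>p\<close>. The estimate for arbitrary pairs
  of points is what later makes the projection to the tangent plane almost isometric.\<close>

lemma height_chord:
  assumes p: "p \<in> ball z r" and \<eta>: "0 < \<eta>"
  obtains \<rho> where "0 < \<rho>" "ball p \<rho> \<subseteq> ball z r"
    "\<And>x. x \<in> ball p \<rho> \<Longrightarrow> norm (slope x - slope p) \<le> \<eta>"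
    "\<And>x y. x \<in> ball p \<rho> \<Longrightarrow> y \<in> ball p \<rho> \<Longrightarrow> \<bar>height x - height y - slope p \<bullet> (x - y)\<bar> \<le> \<eta> * norm (x - y)"
proof -
  have "isCont slope p" using slope_cont p by (simp add: continuous_on_eq_continuous_at)
  then obtain d where d: "d > 0" "\<And>x. dist x p < d \<Longrightarrow> dist (slope x) (slope p) < \<eta>"
    using \<eta> unfolding continuous_at_eps_delta by blast
  obtain d' where d': "d' > 0" "ball p d' \<subseteq> ball z r" using p open_contains_ball[of "ball z r"] by blast
  define \<rho> where "\<rho> = min d d'"
  show thesis
  proof (rule that[of \<rho>])
    show "0 < \<rho>" "ball p \<rho> \<subseteq> ball z r" using d d' by (auto simp: \<rho>_def)
    show sl: "norm (slope x - slope p) \<le> \<eta>" if "x \<in> ball p \<rho>" for x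
      using d(2)[of x] that by (simp add: \<rho>_def dist_commute) (simp add: dist_norm norm_minus_commute)
    fix x y assume xy: "x \<in> ball p \<rho>" "y \<in> ball p \<rho>"
    let ?f = "\<lambda>x. height x - slope p \<bullet> x"
    have "norm (?f x - ?f y) \<le> \<eta> * norm (x - y)"
    proof (rule differentiable_bound[where S = "ball p \<rho>" and f' = "\<lambda>x v. (slope x - slope p) \<bullet> v"])
      show "(?f has_derivative (\<lambda>v. (slope x - slope p) \<bullet> v)) (at x within ball p \<rho>)" if "x \<in> ball p \<rho>" for x
      proof -
        have "x \<in> ball z r" using that \<open>ball p \<rho> \<subseteq> ball z r\<close> by blast
        then have "(?f has_derivative (\<lambda>v. slope x \<bullet> v - slope p \<bullet> v)) (at x)"
          by (intro derivative_intros height_deriv)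
        then show ?thesis by (simp add: inner_diff_left has_derivative_at_withinI)
      qed
      show "onorm (\<lambda>v. (slope x - slope p) \<bullet> v) \<le> \<eta>" if "x \<in> ball p \<rho>" for x
      proof (rule onorm_le)
        fix v
        have "\<bar>(slope x - slope p) \<bullet> v\<bar> \<le> norm (slope x - slope p) * norm v" by (rule Cauchy_Schwarz_ineq2)
        also have "\<dots> \<le> \<eta> * norm v" using sl[OF that] by (intro mult_right_mono) auto
        finally show "norm ((slope x - slope p) \<bullet> v) \<le> \<eta> * norm v" by simp
      qed
    qed (use xy in auto)
    then show "\<bar>height x - height y - slope p \<bullet> (x - y)\<bar> \<le> \<eta> * norm (x - y)"
      by (simp add: inner_diff_right algebra_simps)
  qed
qed

definition normal :: "real^'n \<Rightarrow> real^'n" where "normal x = slope x /\<^sub>R norm (slope x)"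

lemma boundary_curve:
  assumes x: "x \<in> ball z r" "x \<in> frontier D" and v: "slope x \<bullet> v = 0"
  obtains c where "c 0 = x" "\<And>t::real. c t \<in> frontier D" "(c has_vector_derivative v) (at 0)"
proof -
  let ?g = "\<lambda>t. x + t *\<^sub>R v - height (x + t *\<^sub>R v) *\<^sub>R e"
  \<comment> \<open>The tangent line is dropped onto the boundary along \<open>e\<close>. Tangent
    curves must stay in the boundary for all times, so the curve is replaced by the constant
    \<open>x\<close> where it would leave the patch.\<close>
  define c where "c t = (if ?g t \<in> ball z r then ?g t else x)" for t
  have h0: "height x = 0" using x frontier_iff by blast
  have g0: "?g 0 = x" by (simp add: h0)
  have gfr: "?g t \<in> ball z r \<Longrightarrow> ?g t \<in> frontier D" for t
    using foot_frontier[of "x + t *\<^sub>R v"] by (simp add: foot_def)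
  have "((\<lambda>t. x + t *\<^sub>R v) has_derivative (\<lambda>t. t *\<^sub>R v)) (at 0)" by (auto intro!: derivative_eq_intros)
  moreover have "(height has_derivative (\<lambda>v. slope x \<bullet> v)) (at (x + 0 *\<^sub>R v))" using height_deriv[OF x(1)] by simp
  ultimately have hd: "((\<lambda>t. height (x + t *\<^sub>R v)) has_derivative (\<lambda>t. slope x \<bullet> (t *\<^sub>R v))) (at 0)"
    by (rule has_derivative_compose)
  have "(?g has_derivative (\<lambda>t. 0 + t *\<^sub>R v - (slope x \<bullet> (t *\<^sub>R v)) *\<^sub>R e)) (at 0)"
    by (intro derivative_intros hd)
  then have gd: "(?g has_derivative (\<lambda>t. t *\<^sub>R v)) (at 0)" by (simp add: v)
  then have "isCont ?g 0" by (rule has_derivative_continuous)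
  then have "(?g \<longlongrightarrow> x) (at 0)" unfolding isCont_def g0 .
  then have ev: "\<forall>\<^sub>F t in at 0. ?g t \<in> ball z r" by (rule topological_tendstoD[OF _ open_ball x(1)])
  then have "\<forall>\<^sub>F t in at 0. ?g t = c t" by eventually_elim (simp add: c_def)
  moreover have "?g 0 = c 0" by (simp add: c_def h0)
  ultimately have cd: "(c has_derivative (\<lambda>t. t *\<^sub>R v)) (at 0)"
    by (rule has_derivative_transform_eventually[OF gd _ _ UNIV_I])
  show thesis
  proof (rule that[of c])
    show "c 0 = x" by (simp add: c_def h0)
    show "c t \<in> frontier D" for t using gfr[of t] x by (simp add: c_def)
    show "(c has_vector_derivative v) (at 0)" using cd by (simp add: has_vector_derivative_def)
  qed
qed

text \<open>The component of \<open>m\<close> orthogonal to the slope is the velocity of a boundary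
  curve, so orthogonality to tangent vectors annihilates it and \<open>m\<close> is a multiple of
  the slope. Entering \<open>D\<close> excludes the negative multiple.\<close>

lemma inward_unit_normal_unique:
  assumes x: "x \<in> ball z r" "x \<in> frontier D" and m: "inward_unit_normal D x m"
  shows "m = normal x"
proof -
  let ?G = "slope x"
  have m1: "norm m = 1" and mD: "\<forall>\<^sub>F t in at_right (0::real). x + t *\<^sub>R m \<in> D"
    and mt: "\<And>c v. c 0 = x \<Longrightarrow> (\<And>t::real. c t \<in> frontier D) \<Longrightarrow> (c has_vector_derivative v) (at 0) \<Longrightarrow> m \<bullet> v = 0"
    using m unfolding inward_unit_normal_def by blast+
  have G1: "1 \<le> norm ?G" by (rule norm_slope_ge_1[OF x(1)])
  then have G0: "?G \<bullet> ?G \<noteq> 0" by auto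
  let ?k = "(m \<bullet> ?G) / (?G \<bullet> ?G)"
  let ?v = "m - ?k *\<^sub>R ?G"
  have Gv: "?G \<bullet> ?v = 0" using G0 by (simp add: inner_diff_right inner_commute)
  from boundary_curve[OF x Gv] mt have "m \<bullet> ?v = 0" by metis
  then have "?v \<bullet> ?v = 0" using Gv by (simp add: inner_diff_left)
  then have mk: "m = ?k *\<^sub>R ?G" by simp
  then have kn: "\<bar>?k\<bar> * norm ?G = 1" using m1 by (metis norm_scaleR)
  have hx: "height x = 0" using x frontier_iff by blast
  have "((\<lambda>t. x + t *\<^sub>R m) has_derivative (\<lambda>t. t *\<^sub>R m)) (at 0)" by (auto intro!: derivative_eq_intros)
  moreover have "(height has_derivative (\<lambda>v. slope x \<bullet> v)) (at (x + 0 *\<^sub>R m))" using height_deriv[OF x(1)] by simp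
  ultimately have "((\<lambda>t. height (x + t *\<^sub>R m)) has_derivative (\<lambda>t. slope x \<bullet> (t *\<^sub>R m))) (at 0)"
    by (rule has_derivative_compose)
  then have hd: "((\<lambda>t. height (x + t *\<^sub>R m)) has_real_derivative slope x \<bullet> m) (at 0)"
    by (rule has_derivative_imp_has_field_derivative) simp
  have "0 \<le> slope x \<bullet> m"
  proof (rule ccontr)
    assume "\<not> 0 \<le> slope x \<bullet> m"
    then obtain d where d: "d > 0" "\<And>t. t > 0 \<Longrightarrow> t < d \<Longrightarrow> height (x + t *\<^sub>R m) < 0"
      using DERIV_neg_dec_right[OF hd] hx by (auto simp: not_le)
    have "\<forall>\<^sub>F t in at_right (0::real). t < d" using d(1) by (rule eventually_at_right_real[THEN eventually_mono]) auto
    moreover have "\<forall>\<^sub>F t in at_right (0::real). 0 < t" by (simp add: eventually_at_right_less)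
    moreover have "\<forall>\<^sub>F t in at_right (0::real). x + t *\<^sub>R m \<in> ball z r" by (rule line_eventually) (use x in auto)
    ultimately have "\<forall>\<^sub>F t in at_right (0::real). False"
      using mD by eventually_elim (use d mem_D in force)
    then show False by simp
  qed
  then have "0 \<le> ?k" by (simp add: inner_commute)
  then have "?k * norm ?G = 1" using kn by (simp only: abs_of_nonneg)
  then have "?k = 1 / norm ?G" using G1 by (subst nonzero_eq_divide_eq) auto
  then show ?thesis using mk by (simp add: normal_def inverse_eq_divide)
qed

lemma norm_normal: "x \<in> ball z r \<Longrightarrow> norm (normal x) = 1"
proof -
  assume "x \<in> ball z r"
  then have "norm (slope x) \<noteq> 0" using norm_slope_ge_1[of x] by linarith
  then show ?thesis by (simp add: normal_def)
qed

lemma normal_e: "x \<in> ball z r \<Longrightarrow> normal x \<bullet> e = 1 / norm (slope x)"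
  using slope_e[of x] by (simp add: normal_def inverse_eq_divide)

lemma normal_e_pos: "x \<in> ball z r \<Longrightarrow> 0 < normal x \<bullet> e"
  using norm_slope_ge_1[of x] by (auto simp: normal_e)

lemma normal_cont: "continuous_on (ball z r) normal"
  unfolding normal_def[abs_def] using norm_slope_ge_1
  by (intro continuous_intros slope_cont) force

text \<open>The conditions \<open>above\<close> and \<open>flat\<close> of the boundary layer, read
  off from the chord estimate at \<open>p\<close>, where the height is 0. Passing to the unit normal
  divides by a length of at least 1 and only improves the bound.\<close>

lemma normal_above:
  assumes p: "p \<in> ball z r" "p \<in> frontier D" and \<eta>: "0 < \<eta>"
  shows "\<exists>\<rho>>0. \<forall>x\<in>closure D. dist x p < \<rho> \<longrightarrow> - \<eta> * dist x p \<le> normal p \<bullet> (x - p)"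
    and "\<exists>\<rho>>0. \<forall>x\<in>frontier D. dist x p < \<rho> \<longrightarrow> \<bar>normal p \<bullet> (x - p)\<bar> \<le> \<eta> * dist x p"
proof -
  from height_chord[OF p(1) \<eta>] obtain \<rho> where \<rho>: "0 < \<rho>" "ball p \<rho> \<subseteq> ball z r"
    "\<And>x y. x \<in> ball p \<rho> \<Longrightarrow> y \<in> ball p \<rho> \<Longrightarrow> \<bar>height x - height y - slope p \<bullet> (x - y)\<bar> \<le> \<eta> * norm (x - y)"
    by metis
  have hp: "height p = 0" using p frontier_iff by blast
  have G1: "1 \<le> norm (slope p)" by (rule norm_slope_ge_1[OF p(1)])
  have np: "normal p \<bullet> w = (slope p \<bullet> w) / norm (slope p)" for w by (simp add: normal_def divide_inverse mult.commute)
  have chord: "\<bar>height x - slope p \<bullet> (x - p)\<bar> \<le> \<eta> * dist x p" if "dist x p < \<rho>" for x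
    using \<rho>(3)[of x p] that \<rho>(1) hp by (simp add: dist_commute dist_norm norm_minus_commute)
  have div: "\<bar>y / norm (slope p)\<bar> \<le> \<bar>y\<bar>" for y
    using G1 by (simp add: abs_mult divide_le_eq) (metis abs_ge_zero mult_left_mono mult.right_neutral)
  show "\<exists>\<rho>>0. \<forall>x\<in>frontier D. dist x p < \<rho> \<longrightarrow> \<bar>normal p \<bullet> (x - p)\<bar> \<le> \<eta> * dist x p"
  proof (intro exI[of _ \<rho>] conjI ballI impI)
    fix x assume x: "x \<in> frontier D" "dist x p < \<rho>"
    then have "height x = 0" using frontier_iff[of x] \<rho>(2) by (auto simp: dist_commute)
    then have "\<bar>slope p \<bullet> (x - p)\<bar> \<le> \<eta> * dist x p" using chord[OF x(2)] by simp
    then show "\<bar>normal p \<bullet> (x - p)\<bar> \<le> \<eta> * dist x p" unfolding np using div order_trans by blast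
  qed (rule \<rho>)
  show "\<exists>\<rho>>0. \<forall>x\<in>closure D. dist x p < \<rho> \<longrightarrow> - \<eta> * dist x p \<le> normal p \<bullet> (x - p)"
  proof (intro exI[of _ \<rho>] conjI ballI impI)
    fix x assume x: "x \<in> closure D" "dist x p < \<rho>"
    then have "0 \<le> height x" using closure_iff[of x] \<rho>(2) by (auto simp: dist_commute)
    then have s: "- (\<eta> * dist x p) \<le> slope p \<bullet> (x - p)" using chord[OF x(2)] by linarith
    show "- \<eta> * dist x p \<le> normal p \<bullet> (x - p)"
    proof (cases "0 \<le> slope p \<bullet> (x - p)")
      case True
      then have "0 \<le> normal p \<bullet> (x - p)" unfolding np by simp
      moreover have "- \<eta> * dist x p \<le> 0" using \<eta> by simp
      ultimately show ?thesis by linarith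
    next
      case False
      then show ?thesis unfolding np using s div[of "slope p \<bullet> (x - p)"] by linarith
    qed
  qed (rule \<rho>)
qed

lemma height_lipschitz:
  assumes r': "0 < r'" "r' < r"
  obtains L where "1 \<le> L" "\<And>x y. x \<in> cball z r' \<Longrightarrow> y \<in> cball z r' \<Longrightarrow> \<bar>height x - height y\<bar> \<le> L * dist x y"
    "\<And>x. x \<in> cball z r' \<Longrightarrow> norm (slope x) \<le> L"
proof -
  have sub: "cball z r' \<subseteq> ball z r" using r' by auto
  have "compact (slope ` cball z r')"
    using slope_cont sub by (intro compact_continuous_image) (auto intro: continuous_on_subset)
  then obtain L0 where L0: "\<And>x. x \<in> cball z r' \<Longrightarrow> norm (slope x) \<le> L0"
    using compact_imp_bounded bounded_iff by (metis imageI)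
  show thesis
  proof (rule that[of "max 1 L0"])
    show n: "norm (slope x) \<le> max 1 L0" if "x \<in> cball z r'" for x using L0[OF that] by simp
    fix x y assume xy: "x \<in> cball z r'" "y \<in> cball z r'"
    have "norm (height x - height y) \<le> max 1 L0 * norm (x - y)"
    proof (rule differentiable_bound[where S = "cball z r'" and f' = "\<lambda>x v. slope x \<bullet> v"])
      show "(height has_derivative (\<lambda>v. slope x \<bullet> v)) (at x within cball z r')" if "x \<in> cball z r'" for x
        using height_deriv[of x] sub that by (blast intro: has_derivative_at_withinI)
      show "onorm (\<lambda>v. slope x \<bullet> v) \<le> max 1 L0" if "x \<in> cball z r'" for x
      proof (rule onorm_le)
        fix v
        have "\<bar>slope x \<bullet> v\<bar> \<le> norm (slope x) * norm v" by (rule Cauchy_Schwarz_ineq2)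
        also have "\<dots> \<le> max 1 L0 * norm v" by (rule mult_right_mono[OF n[OF that]]) simp
        finally show "norm (slope x \<bullet> v) \<le> max 1 L0 * norm v" by simp
      qed
    qed (use xy in auto)
    then show "\<bar>height x - height y\<bar> \<le> max 1 L0 * dist x y" by (simp add: dist_norm)
  qed simp
qed

end

lemma graph_patch_exists:
  fixes D :: "(real^'n::finite) set"
  assumes "open D" "Ck_holder_boundary 2 \<alpha> D" "z \<in> frontier D"
  obtains r i s \<gamma> where "s \<in> {-1, 1::real}" "graph_patch D z r (s *\<^sub>R axis i 1) \<gamma>"
proof -
  obtain r i s \<gamma> where r: "r > 0" and s: "s \<in> {-1, 1::real}" and inv: "\<And>x t. \<gamma> (x + t *\<^sub>R axis i 1) = \<gamma> x"
    and C: "Ck_holder_closure 2 \<alpha> (ball z r) \<gamma>" and gr: "D \<inter> ball z r = {x \<in> ball z r. s * x $ i > \<gamma> x}"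
    using bspec[OF assms(2)[unfolded Ck_holder_boundary_def] assms(3)] by blast
  let ?e = "s *\<^sub>R axis i 1 :: real^'n"
  have C2: "Ck_on 2 (ball z r) \<gamma>" using C by (simp add: Ck_holder_closure_def Ck_closure_def)
  have cont: "continuous_on (ball z r) \<gamma>"
  proof -
    have "continuous_on (ball z r) (partials [] \<gamma>)" using C2 unfolding Ck_on_def by (metis le0 list.size(3))
    then show ?thesis by simp
  qed
  \<comment> \<open>\<open>\<gamma>\<close> is continuous on the ball and, by invariance, on the
    open cylinder \<open>U\<close> over it. Setting it to 0 elsewhere yields a Borel function that
    is still constant along the axis.\<close>
  define U where "U = (\<Union>t. (\<lambda>x. x + t *\<^sub>R axis i 1) -` ball z r)"
  define \<gamma>' where "\<gamma>' x = (if x \<in> U then \<gamma> x else 0)" for x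
  have openV: "open ((\<lambda>x. x + t *\<^sub>R axis i 1) -` ball z r)" for t :: real
    by (intro open_vimage continuous_intros) auto
  then have "open U" unfolding U_def by blast
  have "continuous_on U \<gamma>"
    unfolding U_def
  proof (rule continuous_on_open_UN)
    fix t :: real
    have "continuous_on ((\<lambda>x. x + t *\<^sub>R axis i 1) -` ball z r) (\<lambda>x. \<gamma> (x + t *\<^sub>R axis i 1))"
      by (rule continuous_on_compose2[OF cont]) (auto intro!: continuous_intros)
    then show "continuous_on ((\<lambda>x. x + t *\<^sub>R axis i 1) -` ball z r) \<gamma>" by (simp add: inv)
  qed (rule openV)
  then have meas: "\<gamma>' \<in> borel_measurable borel"
    unfolding \<gamma>'_def using \<open>open U\<close> by (intro borel_measurable_continuous_on_if) auto
  have Uinv: "x + t *\<^sub>R axis i 1 \<in> U \<longleftrightarrow> x \<in> U" for x and t :: real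
  proof
    assume "x + t *\<^sub>R axis i 1 \<in> U"
    then obtain t' where "x + t *\<^sub>R axis i 1 + t' *\<^sub>R axis i 1 \<in> ball z r" by (auto simp: U_def)
    then have "x + (t + t') *\<^sub>R axis i 1 \<in> ball z r" by (simp add: algebra_simps)
    then show "x \<in> U" unfolding U_def by blast
  next
    assume "x \<in> U"
    then obtain t' where "x + t' *\<^sub>R axis i 1 \<in> ball z r" by (auto simp: U_def)
    then have "x + t *\<^sub>R axis i 1 + (t' - t) *\<^sub>R axis i 1 \<in> ball z r" by (simp add: algebra_simps)
    then show "x + t *\<^sub>R axis i 1 \<in> U" unfolding U_def by blast
  qed
  have BU: "ball z r \<subseteq> U"
  proof
    fix x assume "x \<in> ball z r"
    then have "x + 0 *\<^sub>R axis i 1 \<in> ball z r" by simp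
    then show "x \<in> U" unfolding U_def by blast
  qed
  have eqB: "\<gamma>' x = \<gamma> x" if "x \<in> ball z r" for x using that BU by (auto simp: \<gamma>'_def)
  have "graph_patch D z r ?e \<gamma>'"
  proof
    show "norm ?e = 1" using s by auto
    show "\<gamma>' (x + t *\<^sub>R ?e) = \<gamma>' x" for x t
      using Uinv[of x "t * s"] inv[of x "t * s"] by (simp add: \<gamma>'_def)
    have pe: "partials is \<gamma>' x = partials is \<gamma> x" if "x \<in> ball z r" for "is" x
      by (rule partials_cong_open[OF open_ball eqB that])
    have C1: "Ck_on 1 (ball z r) \<gamma>" using C2 by (rule Ck_on_mono) auto
    show "Ck_on 1 (ball z r) \<gamma>'"
      unfolding Ck_on_def
    proof (intro conjI allI impI ballI)
      fix "is" :: "'n list" and x assume l: "length is < 1" and x: "x \<in> ball z r"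
      show "partials is \<gamma>' differentiable at x"
        by (rule differentiable_cong_open[OF open_ball x pe[symmetric]])
          (use C1 l x in \<open>auto simp: Ck_on_def\<close>)
    next
      fix "is" :: "'n list" assume l: "length is \<le> 1"
      have "continuous_on (ball z r) (partials is \<gamma>)" using C1 l unfolding Ck_on_def by blast
      then show "continuous_on (ball z r) (partials is \<gamma>')" using pe by (subst continuous_on_cong[OF refl pe]) auto
    qed
    show "D \<inter> ball z r = {x \<in> ball z r. \<gamma>' x < ?e \<bullet> x}"
      unfolding gr using eqB by (auto simp: inner_axis')
  qed (use assms r meas in auto)
  with s that show thesis by blast
qed

section \<open>Surface measure of a boundary patch\<close>

lemma ennreal_le_if_le_mult:
  fixes a b :: ennreal
  assumes "\<And>K::real. 1 < K \<Longrightarrow> a \<le> ennreal K * b"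
  shows "a \<le> b"
proof (rule ennreal_le_epsilon)
  fix \<epsilon> :: real assume b: "b < top" and \<epsilon>: "0 < \<epsilon>"
  then obtain m where m: "0 \<le> m" "b = ennreal m" by (cases b) auto
  let ?K = "1 + \<epsilon> / (m + 1)"
  have "a \<le> ennreal ?K * b" using \<epsilon> m by (intro assms) auto
  also have "\<dots> = ennreal (?K * m)" using \<epsilon> m by (simp add: ennreal_mult)
  also have "?K * m \<le> m + \<epsilon>"
  proof -
    have "\<epsilon> / (m + 1) * m \<le> \<epsilon>" using \<epsilon> m by (simp add: field_simps)
    then show ?thesis by (simp add: distrib_right)
  qed
  then have "ennreal (?K * m) \<le> b + ennreal \<epsilon>" using \<epsilon> m by (simp add: ennreal_plus[symmetric] ennreal_leI del: ennreal_plus)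
  finally show "a \<le> b + ennreal \<epsilon>" .
qed

text \<open>By Lindelof countably many of the neighbourhoods cover \<open>X\<close>; cutting
  \<open>A\<close> into disjoint pieces inside them, the local inequalities add up with the same
  factor \<open>K\<close>.\<close>

lemma emeasure_le_locally:
  fixes M N :: "'a::second_countable_topology measure"
  assumes sM: "sets M = sets borel" and sN: "sets N = sets borel"
    and loc: "\<And>p. p \<in> X \<Longrightarrow> \<exists>U. open U \<and> p \<in> U \<and> (\<forall>A\<in>sets borel. A \<subseteq> X \<inter> U \<longrightarrow> emeasure M A \<le> K * emeasure N A)"
    and A: "A \<in> sets borel" "A \<subseteq> X"
  shows "emeasure M A \<le> K * emeasure N A"
proof (cases "X = {}")
  case False
  obtain U where U: "\<And>p. p \<in> X \<Longrightarrow> open (U p)" "\<And>p. p \<in> X \<Longrightarrow> p \<in> U p"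
    "\<And>p A. p \<in> X \<Longrightarrow> A \<in> sets borel \<Longrightarrow> A \<subseteq> X \<inter> U p \<Longrightarrow> emeasure M A \<le> K * emeasure N A"
    using loc by metis
  obtain F where F: "F \<subseteq> U ` X" "countable F" "\<Union>F = \<Union>(U ` X)"
    using Lindelof[of "U ` X"] U(1) by blast
  have "F \<noteq> {}" using False F(3) U(2) by blast
  define g where "g = from_nat_into F"
  have g: "range g = F" unfolding g_def using F(2) \<open>F \<noteq> {}\<close> by (rule range_from_nat_into[rotated])
  have gU: "\<exists>p\<in>X. g n = U p" for n using g F(1) by blast
  then have go: "open (g n)" for n using U(1) by metis
  have cov: "X \<subseteq> (\<Union>n. g n)" using U(2) F(3) g by blast
  let ?A = "\<lambda>n. A \<inter> disjointed g n"
  have "range g \<subseteq> sets borel" using go by (auto intro: borel_open)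
  then have "range (disjointed g) \<subseteq> sets borel" by (rule sets.range_disjointed_sets)
  then have As: "?A n \<in> sets borel" for n using A(1) by (intro sets.Int) blast+
  have dA: "disjoint_family ?A" by (rule disjoint_family_on_bisimulation[OF disjoint_family_disjointed[of g]]) auto
  have UA: "(\<Union>n. ?A n) = A"
  proof -
    have "(\<Union>n. ?A n) = A \<inter> (\<Union>n. disjointed g n)" by (rule Int_UN_distrib[symmetric])
    also have "\<dots> = A \<inter> (\<Union>n. g n)" by (simp only: UN_disjointed_eq)
    also have "\<dots> = A" using subset_trans[OF A(2) cov] by (rule Int_absorb2)
    finally show ?thesis .
  qed
  have sub: "range ?A \<subseteq> sets M" "range ?A \<subseteq> sets N" using As unfolding sM sN by blast+
  have "emeasure M A = (\<Sum>n. emeasure M (?A n))"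
    using suminf_emeasure[OF sub(1) dA] unfolding UA by (rule sym)
  also have "\<dots> \<le> (\<Sum>n. K * emeasure N (?A n))"
  proof (intro suminf_le summableI)
    fix n
    obtain p where p: "p \<in> X" "g n = U p" using gU by blast
    have "disjointed g n \<subseteq> U p" using disjointed_subset[of g n] p by simp
    then show "emeasure M (?A n) \<le> K * emeasure N (?A n)"
      using A(2) by (intro U(3)[OF p(1) As]) blast
  qed
  also have "\<dots> = K * (\<Sum>n. emeasure N (?A n))" by simp
  also have "(\<Sum>n. emeasure N (?A n)) = emeasure N A"
    using suminf_emeasure[OF sub(2) dA] unfolding UA .
  finally show ?thesis .
qed (use A in auto)

text \<open>Named so that one constant can be shared by all patches and cancel in the final
  quotient. The type argument carries the dimension, which a real number does not show.\<close>

definition is_hausdorff_ratio :: "'n::finite itself \<Rightarrow> real \<Rightarrow> bool" where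
  "is_hausdorff_ratio T c \<longleftrightarrow> 0 < c \<and>
    (\<forall>\<nu> e z :: real^'n. \<forall>B. norm \<nu> = 1 \<longrightarrow> norm e = 1 \<longrightarrow> 0 < \<nu> \<bullet> e \<longrightarrow> B \<in> sets borel \<longrightarrow>
      B \<subseteq> {x. \<nu> \<bullet> (x - z) = 0} \<longrightarrow>
      hausdorff_outer (CARD('n) - 1) B = ennreal (c / (\<nu> \<bullet> e)) *
        emeasure lborel {y. 0 \<le> e \<bullet> y \<and> e \<bullet> y \<le> 1 \<and> y - ((\<nu> \<bullet> (y - z)) / (\<nu> \<bullet> e)) *\<^sub>R e \<in> B})"

lemma is_hausdorff_ratio_exists: obtains c where "is_hausdorff_ratio TYPE('n::finite) c"
proof (rule hausdorff_hyperplane_formula[where 'n = 'n])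
  fix c :: real
  assume c: "0 < c" and *: "\<And>\<nu> e z :: real^'n::finite. \<And>B. norm \<nu> = 1 \<Longrightarrow> norm e = 1 \<Longrightarrow> 0 < \<nu> \<bullet> e \<Longrightarrow> B \<in> sets borel \<Longrightarrow>
      B \<subseteq> {x. \<nu> \<bullet> (x - z) = 0} \<Longrightarrow>
      hausdorff_outer (CARD('n) - 1) B = ennreal (c / (\<nu> \<bullet> e)) *
        emeasure lborel {y. 0 \<le> e \<bullet> y \<and> e \<bullet> y \<le> 1 \<and> y - ((\<nu> \<bullet> (y - z)) / (\<nu> \<bullet> e)) *\<^sub>R e \<in> B}"
  show thesis
    by (rule that[of c], unfold is_hausdorff_ratio_def, intro conjI allI impI c, rule *)
qed

context graph_patch
begin

text \<open>The length of the slope is the classical area element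
  \<open>sqrt (1 + |grad \<gamma>|^2)\<close> of a graph; the indicator selects base points in the
  unit slab, so that every line counts once.\<close>

definition area_density :: "real^'n \<Rightarrow> real" where
  "area_density y = indicator {0..1} (e \<bullet> y) * (if foot y \<in> ball z r then norm (slope (foot y)) else 0)"

lemma area_density_nonneg [simp]: "0 \<le> area_density y" by (simp add: area_density_def)

lemma area_density_meas [measurable]: "area_density \<in> borel_measurable borel"
proof -
  have "continuous_on (ball z r) (\<lambda>x. norm (slope x))" by (intro continuous_intros slope_cont)
  then have [measurable]: "(\<lambda>x. if x \<in> ball z r then norm (slope x) else 0) \<in> borel_measurable borel"
    by (intro borel_measurable_continuous_on_if) auto
  show ?thesis unfolding area_density_def[abs_def]
    by (intro borel_measurable_times measurable_compose[OF foot_meas, of "\<lambda>x. if x \<in> ball z r then norm (slope x) else 0"]) measurable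
qed

text \<open>The area formula for graphs taken as a definition: the weighted slab is pushed onto the
  boundary along \<open>e\<close>, up to the factor \<open>c\<close> between Hausdorff and Lebesgue
  measure.\<close>

definition area_measure :: "real \<Rightarrow> (real^'n) measure" where
  "area_measure c = distr (density lborel (\<lambda>y. ennreal (c * area_density y))) borel foot"

lemma sets_area_measure [simp]: "sets (area_measure c) = sets borel"
  by (simp add: area_measure_def)

lemma emeasure_area_measure:
  assumes [measurable]: "A \<in> sets borel"
  shows "emeasure (area_measure c) A = (\<integral>\<^sup>+y. ennreal (c * area_density y) * indicator A (foot y) \<partial>lborel)"
proof -
  have "emeasure (area_measure c) A = emeasure (density lborel (\<lambda>y. ennreal (c * area_density y))) (foot -` A)"
    unfolding area_measure_def by (subst emeasure_distr) auto
  also have "\<dots> = (\<integral>\<^sup>+y. ennreal (c * area_density y) * indicator (foot -` A) y \<partial>lborel)"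
    by (subst emeasure_density) (auto intro: measurable_sets_borel[OF foot_meas])
  also have "\<dots> = (\<integral>\<^sup>+y. ennreal (c * area_density y) * indicator A (foot y) \<partial>lborel)"
    by (intro nn_integral_cong) (auto split: split_indicator)
  finally show ?thesis .
qed

text \<open>Near \<open>p\<close>, the projection along \<open>e\<close> onto the tangent plane at \<open>p\<close> is almost an isometry of the boundary.\<close>

lemma hausdorff_near_tangent:
  assumes p: "p \<in> ball z r" "p \<in> frontier D" and \<eta>: "0 < \<eta>" "\<eta> < 1"
    and c: "is_hausdorff_ratio TYPE('n) c"
  obtains \<rho> where "0 < \<rho>" "ball p \<rho> \<subseteq> ball z r"
    "\<And>A. A \<in> sets borel \<Longrightarrow> A \<subseteq> frontier D \<inter> ball p \<rho> \<Longrightarrow>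
       hausdorff_outer (CARD('n) - 1) A \<le> ennreal ((1 / (1 - \<eta>)) ^ CARD('n)) * emeasure (area_measure c) A"
    "\<And>A. A \<in> sets borel \<Longrightarrow> A \<subseteq> frontier D \<inter> ball p \<rho> \<Longrightarrow>
       emeasure (area_measure c) A \<le> ennreal ((1 + \<eta>) ^ CARD('n)) * hausdorff_outer (CARD('n) - 1) A"
proof -
  let ?s = "CARD('n) - 1"
  let ?H = "hausdorff_outer ?s :: (real^'n) set \<Rightarrow> ennreal"
  let ?G = "slope p"
  \<comment> \<open>Of the factors in the two bounds, \<open>s\<close> come from Lipschitz maps
    acting on \<open>s\<close>-dimensional measure and one more from the variation of the area
    density.\<close>
  have sC: "CARD('n) = Suc ?s" by simp
  have c0: "0 < c" using c by (simp add: is_hausdorff_ratio_def)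
  have G1: "1 \<le> norm ?G" and Ge: "?G \<bullet> e = 1" using norm_slope_ge_1 slope_e p by auto
  obtain \<rho> where \<rho>: "0 < \<rho>" "ball p \<rho> \<subseteq> ball z r"
    "\<And>x. x \<in> ball p \<rho> \<Longrightarrow> norm (slope x - ?G) \<le> \<eta>"
    "\<And>x y. x \<in> ball p \<rho> \<Longrightarrow> y \<in> ball p \<rho> \<Longrightarrow> \<bar>height x - height y - ?G \<bullet> (x - y)\<bar> \<le> \<eta> * norm (x - y)"
    using height_chord[OF p(1) \<eta>(1)] by blast
  show thesis
  proof (rule that[OF \<rho>(1,2)])
    fix A assume A [measurable]: "A \<in> sets borel" and sub: "A \<subseteq> frontier D \<inter> ball p \<rho>"
    have Ab: "x \<in> ball z r" "x \<in> frontier D" "x \<in> ball p \<rho>" "height x = 0" "foot x = x" if "x \<in> A" for x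
    proof -
      show 1: "x \<in> ball z r" "x \<in> frontier D" "x \<in> ball p \<rho>" using that sub \<rho>(2) by auto
      show "height x = 0" "foot x = x" using 1 frontier_iff foot_eq by auto
    qed
    define \<tau> where "\<tau> x = x - (?G \<bullet> (x - p)) *\<^sub>R e" for x
    have \<tau>foot: "foot (\<tau> x) = foot x" for x using foot_add[of x "- (?G \<bullet> (x - p))"] by (simp add: \<tau>_def)
    \<comment> \<open>Boundary points have height 0, so the chord estimate bounds the component of
      \<open>x - y\<close> along the slope, which is exactly what \<open>\<tau>\<close>
      removes.\<close>
    have near: "norm (\<tau> x - \<tau> y - (x - y)) \<le> \<eta> * norm (x - y)" if "x \<in> A" "y \<in> A" for x y
    proof -
      have "\<tau> x - \<tau> y - (x - y) = - (?G \<bullet> (x - y)) *\<^sub>R e"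
        by (simp add: \<tau>_def inner_diff_right algebra_simps)
      then have "norm (\<tau> x - \<tau> y - (x - y)) = \<bar>?G \<bullet> (x - y)\<bar>" using e by simp
      also have "\<dots> \<le> \<eta> * norm (x - y)"
        using \<rho>(4)[OF Ab(3)[OF that(1)] Ab(3)[OF that(2)]] Ab(4)[OF that(1)] Ab(4)[OF that(2)] by simp
      finally show ?thesis .
    qed
    have up: "dist (\<tau> x) (\<tau> y) \<le> (1 + \<eta>) * dist x y" if "x \<in> A" "y \<in> A" for x y
      using near[OF that] norm_triangle_ineq[of "\<tau> x - \<tau> y - (x - y)" "x - y"] by (simp add: dist_norm algebra_simps)
    have lo: "dist x y \<le> (1 / (1 - \<eta>)) * dist (\<tau> x) (\<tau> y)" if "x \<in> A" "y \<in> A" for x y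
    proof -
      have "norm (x - y) \<le> norm (\<tau> x - \<tau> y) + norm (\<tau> x - \<tau> y - (x - y))"
        using norm_triangle_ineq4[of "\<tau> x - \<tau> y" "\<tau> x - \<tau> y - (x - y)"] by simp
      then have "(1 - \<eta>) * dist x y \<le> dist (\<tau> x) (\<tau> y)"
        using near[OF that] by (simp add: dist_norm algebra_simps)
      then show ?thesis using \<eta> by (simp add: field_simps)
    qed
    have HB_le: "?H (\<tau> ` A) \<le> ennreal ((1 + \<eta>) ^ ?s) * ?H A"
      using \<eta> up by (intro hausdorff_outer_lipschitz) auto
    have HA_le: "?H A \<le> ennreal ((1 / (1 - \<eta>)) ^ ?s) * ?H (\<tau> ` A)"
    proof -
      have "foot ` \<tau> ` A = A" using Ab(5) \<tau>foot by (simp add: image_image)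
      moreover have "?H (foot ` \<tau> ` A) \<le> ennreal ((1 / (1 - \<eta>)) ^ ?s) * ?H (\<tau> ` A)"
        using \<eta> lo Ab(5) by (intro hausdorff_outer_lipschitz) (auto simp: \<tau>foot)
      ultimately show ?thesis by simp
    qed
    have \<tau>A: "\<tau> ` A = {u. ?G \<bullet> (u - p) = 0 \<and> foot u \<in> A}"
    proof (intro equalityI subsetI)
      fix u assume "u \<in> \<tau> ` A"
      then obtain x where x: "x \<in> A" "u = \<tau> x" by blast
      have "?G \<bullet> (\<tau> x - p) = 0" using Ge by (simp add: \<tau>_def inner_diff_right)
      then show "u \<in> {u. ?G \<bullet> (u - p) = 0 \<and> foot u \<in> A}" using x Ab(5)[OF x(1)] by (simp add: \<tau>foot)
    next
      fix u assume u: "u \<in> {u. ?G \<bullet> (u - p) = 0 \<and> foot u \<in> A}"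
      have "?G \<bullet> (foot u - p) = - height u"
        using u Ge by (simp add: foot_def inner_diff_right)
      then have "\<tau> (foot u) = u" by (simp add: \<tau>_def) (simp add: foot_def)
      then show "u \<in> \<tau> ` A" using u by (metis (no_types, lifting) imageI mem_Collect_eq)
    qed
    define S where "S = {y. 0 \<le> e \<bullet> y \<and> e \<bullet> y \<le> 1 \<and> foot y \<in> A}"
    have S [measurable]: "S \<in> sets borel" unfolding S_def by measurable
    have HB: "?H (\<tau> ` A) = ennreal (c * norm ?G) * emeasure lborel S"
    proof -
      \<comment> \<open>The oblique projection in the hyperplane formula depends only on this
        quotient, hence it coincides with \<open>\<tau>\<close>.\<close>
      have nw: "(normal p \<bullet> w) / (normal p \<bullet> e) = ?G \<bullet> w" for w
      proof -
        have "norm ?G \<noteq> 0" using G1 by linarith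
        then show ?thesis by (subst normal_e[OF p(1)]) (simp add: normal_def)
      qed
      have "{y. 0 \<le> e \<bullet> y \<and> e \<bullet> y \<le> 1 \<and> y - (?G \<bullet> (y - p)) *\<^sub>R e \<in> \<tau> ` A} = S"
      proof -
        have "y - (?G \<bullet> (y - p)) *\<^sub>R e \<in> \<tau> ` A \<longleftrightarrow> foot y \<in> A" for y
        proof -
          have "?G \<bullet> (y - (?G \<bullet> (y - p)) *\<^sub>R e - p) = 0" using Ge by (simp add: inner_diff_right)
          moreover have "foot (y - (?G \<bullet> (y - p)) *\<^sub>R e) = foot y" using \<tau>foot[of y] by (simp only: \<tau>_def)
          ultimately show ?thesis unfolding \<tau>A by simp
        qed
        then show ?thesis unfolding S_def by simp
      qed
      moreover have "\<tau> ` A \<in> sets borel" unfolding \<tau>A by measurable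
      moreover have "\<tau> ` A \<subseteq> {x. normal p \<bullet> (x - p) = 0}" unfolding \<tau>A by (auto simp: normal_def)
      moreover have "c / (normal p \<bullet> e) = c * norm ?G" by (simp add: normal_e[OF p(1)])
      ultimately show ?thesis
        using c norm_normal[OF p(1)] e normal_e_pos[OF p(1)] unfolding is_hausdorff_ratio_def by (simp add: nw)
    qed
    have Mc: "emeasure (area_measure c) A = (\<integral>\<^sup>+y. ennreal (c * norm (slope (foot y))) * indicator S y \<partial>lborel)"
      unfolding emeasure_area_measure[OF A]
    proof (rule nn_integral_cong)
      fix y
      show "ennreal (c * area_density y) * indicator A (foot y) = ennreal (c * norm (slope (foot y))) * indicator S y"
        using Ab(1)[of "foot y"] by (auto simp: area_density_def S_def split: split_indicator)
    qed
    have sl: "(1 - \<eta>) * norm ?G \<le> norm (slope (foot y))" "norm (slope (foot y)) \<le> (1 + \<eta>) * norm ?G" if "y \<in> S" for y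
    proof -
      have "foot y \<in> ball p \<rho>" using that Ab(3) by (simp add: S_def)
      then have "norm (slope (foot y) - ?G) \<le> \<eta>" by (rule \<rho>(3))
      moreover have "\<eta> \<le> \<eta> * norm ?G" using G1 \<eta> by simp
      ultimately have "\<bar>norm (slope (foot y)) - norm ?G\<bar> \<le> \<eta> * norm ?G"
        using norm_triangle_ineq3[of "slope (foot y)" ?G] by linarith
      then show "(1 - \<eta>) * norm ?G \<le> norm (slope (foot y))" "norm (slope (foot y)) \<le> (1 + \<eta>) * norm ?G"
        by (simp_all add: algebra_simps abs_le_iff)
    qed
    have "emeasure (area_measure c) A \<le> (\<integral>\<^sup>+y. ennreal ((1 + \<eta>) * (c * norm ?G)) * indicator S y \<partial>lborel)"
      unfolding Mc
    proof (rule nn_integral_mono)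
      fix y
      have "c * norm (slope (foot y)) \<le> (1 + \<eta>) * (c * norm ?G)" if "y \<in> S"
        using mult_left_mono[OF sl(2)[OF that], of c] c0 by (simp add: mult_ac)
      then show "ennreal (c * norm (slope (foot y))) * indicator S y \<le> ennreal ((1 + \<eta>) * (c * norm ?G)) * indicator S y"
        by (auto split: split_indicator intro: ennreal_leI)
    qed
    also have "\<dots> = ennreal ((1 + \<eta>) * (c * norm ?G)) * emeasure lborel S"
      by (rule nn_integral_cmult_indicator) simp
    also have "ennreal ((1 + \<eta>) * (c * norm ?G)) = ennreal (1 + \<eta>) * ennreal (c * norm ?G)"
      using \<eta> c0 by (intro ennreal_mult) auto
    also have "ennreal (1 + \<eta>) * ennreal (c * norm ?G) * emeasure lborel S = ennreal (1 + \<eta>) * ?H (\<tau> ` A)"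
      by (simp only: HB mult.assoc)
    also have "\<dots> \<le> ennreal (1 + \<eta>) * (ennreal ((1 + \<eta>) ^ ?s) * ?H A)"
      by (rule mult_left_mono[OF HB_le]) simp
    also have "\<dots> = ennreal ((1 + \<eta>) ^ CARD('n)) * ?H A"
    proof -
      have "ennreal (1 + \<eta>) * ennreal ((1 + \<eta>) ^ ?s) = ennreal ((1 + \<eta>) ^ Suc ?s)"
        unfolding power_Suc using \<eta> by (intro ennreal_mult[symmetric]) auto
      then show ?thesis unfolding sC[symmetric] by (simp only: mult.assoc[symmetric])
    qed
    finally show "emeasure (area_measure c) A \<le> ennreal ((1 + \<eta>) ^ CARD('n)) * ?H A" .
    have "ennreal ((1 - \<eta>) * (c * norm ?G)) * emeasure lborel S
        = (\<integral>\<^sup>+y. ennreal ((1 - \<eta>) * (c * norm ?G)) * indicator S y \<partial>lborel)"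
      by (simp add: nn_integral_cmult)
    also have "\<dots> \<le> emeasure (area_measure c) A"
      unfolding Mc
    proof (rule nn_integral_mono)
      fix y
      have "(1 - \<eta>) * (c * norm ?G) \<le> c * norm (slope (foot y))" if "y \<in> S"
        using mult_left_mono[OF sl(1)[OF that], of c] c0 by (simp add: mult_ac)
      then show "ennreal ((1 - \<eta>) * (c * norm ?G)) * indicator S y \<le> ennreal (c * norm (slope (foot y))) * indicator S y"
        by (auto split: split_indicator intro: ennreal_leI)
    qed
    finally have "ennreal (1 / (1 - \<eta>)) * (ennreal ((1 - \<eta>) * (c * norm ?G)) * emeasure lborel S)
        \<le> ennreal (1 / (1 - \<eta>)) * emeasure (area_measure c) A"
      by (rule mult_left_mono) simp
    moreover have "ennreal (1 / (1 - \<eta>)) * ennreal ((1 - \<eta>) * (c * norm ?G)) = ennreal (c * norm ?G)"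
      using \<eta> c0 by (simp add: ennreal_mult[symmetric])
    ultimately have "?H (\<tau> ` A) \<le> ennreal (1 / (1 - \<eta>)) * emeasure (area_measure c) A"
      by (simp only: HB mult.assoc[symmetric])
    then have "ennreal ((1 / (1 - \<eta>)) ^ ?s) * ?H (\<tau> ` A)
        \<le> ennreal ((1 / (1 - \<eta>)) ^ ?s) * (ennreal (1 / (1 - \<eta>)) * emeasure (area_measure c) A)"
      by (rule mult_left_mono) simp
    also have "\<dots> = ennreal ((1 / (1 - \<eta>)) ^ CARD('n)) * emeasure (area_measure c) A"
    proof -
      have "ennreal ((1 / (1 - \<eta>)) ^ ?s) * ennreal (1 / (1 - \<eta>)) = ennreal ((1 / (1 - \<eta>)) ^ Suc ?s)"
        unfolding power_Suc mult.commute[of "1 / (1 - \<eta>)"] using \<eta> by (intro ennreal_mult[symmetric]) auto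
      then show ?thesis unfolding sC[symmetric] by (simp only: mult.assoc[symmetric])
    qed
    finally show "?H A \<le> ennreal ((1 / (1 - \<eta>)) ^ CARD('n)) * emeasure (area_measure c) A"
      using HA_le by (rule order_trans[rotated])
  qed
qed

text \<open>Near each boundary point the two measures agree up to a factor as close to 1 as desired.
  Localisation keeps the factor for the whole set, and then it is sent to 1.\<close>

lemma hausdorff_eq_area_measure:
  assumes c: "is_hausdorff_ratio TYPE('n) c" and A: "A \<in> sets borel" "A \<subseteq> frontier D \<inter> ball z r"
  shows "emeasure (hausdorff_measure (CARD('n) - 1)) A = emeasure (area_measure c) A"
proof (rule antisym)
  let ?H = "hausdorff_measure (CARD('n) - 1) :: (real^'n) measure"
  have loc: "\<exists>U. open U \<and> p \<in> U \<and>
      (\<forall>A\<in>sets borel. A \<subseteq> (frontier D \<inter> ball z r) \<inter> U \<longrightarrow> emeasure ?H A \<le> ennreal K * emeasure (area_measure c) A \<and>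
         emeasure (area_measure c) A \<le> ennreal K * emeasure ?H A)"
    if K: "1 < K" and p: "p \<in> frontier D \<inter> ball z r" for K p
  proof -
    have "((\<lambda>\<eta>::real. (1 / (1 - \<eta>)) ^ CARD('n)) \<longlongrightarrow> (1 / (1 - 0)) ^ CARD('n)) (at_right 0)"
      "((\<lambda>\<eta>::real. (1 + \<eta>) ^ CARD('n)) \<longlongrightarrow> (1 + 0) ^ CARD('n)) (at_right 0)"
      by (auto intro!: tendsto_eq_intros)
    then have "\<forall>\<^sub>F \<eta> in at_right (0::real). (1 / (1 - \<eta>)) ^ CARD('n) < K" "\<forall>\<^sub>F \<eta> in at_right (0::real). (1 + \<eta>) ^ CARD('n) < K"
      using K by (auto dest!: order_tendstoD(2)[of _ _ _ K])
    moreover have "\<forall>\<^sub>F \<eta> in at_right (0::real). \<eta> \<in> {0<..<1}" by (rule eventually_at_right_real) simp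
    ultimately have "\<forall>\<^sub>F \<eta> in at_right (0::real). (1 / (1 - \<eta>)) ^ CARD('n) < K \<and> (1 + \<eta>) ^ CARD('n) < K \<and> \<eta> \<in> {0<..<1}"
      by eventually_elim simp
    then obtain \<eta> where \<eta>: "(1 / (1 - \<eta>)) ^ CARD('n) < K" "(1 + \<eta>) ^ CARD('n) < K" "0 < \<eta>" "\<eta> < 1"
      using eventually_happens[of _ "at_right (0::real)"] by auto
    obtain \<rho> where \<rho>: "0 < \<rho>" "ball p \<rho> \<subseteq> ball z r"
      "\<And>A. A \<in> sets borel \<Longrightarrow> A \<subseteq> frontier D \<inter> ball p \<rho> \<Longrightarrow>
         hausdorff_outer (CARD('n) - 1) A \<le> ennreal ((1 / (1 - \<eta>)) ^ CARD('n)) * emeasure (area_measure c) A"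
      "\<And>A. A \<in> sets borel \<Longrightarrow> A \<subseteq> frontier D \<inter> ball p \<rho> \<Longrightarrow>
         emeasure (area_measure c) A \<le> ennreal ((1 + \<eta>) ^ CARD('n)) * hausdorff_outer (CARD('n) - 1) A"
      using hausdorff_near_tangent[OF _ _ \<eta>(3,4) c, of p] p by blast
    show ?thesis
    proof (intro exI[of _ "ball p \<rho>"] conjI ballI impI)
      fix A assume A: "A \<in> sets borel" "A \<subseteq> (frontier D \<inter> ball z r) \<inter> ball p \<rho>"
      then have A': "A \<subseteq> frontier D \<inter> ball p \<rho>" by blast
      show "emeasure ?H A \<le> ennreal K * emeasure (area_measure c) A"
        unfolding emeasure_hausdorff_measure[OF A(1)]
        using \<rho>(3)[OF A(1) A'] by (rule order_trans) (intro mult_right_mono ennreal_leI less_imp_le[OF \<eta>(1)], simp)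
      show "emeasure (area_measure c) A \<le> ennreal K * emeasure ?H A"
        unfolding emeasure_hausdorff_measure[OF A(1)]
        using \<rho>(4)[OF A(1) A'] by (rule order_trans) (intro mult_right_mono ennreal_leI less_imp_le[OF \<eta>(2)], simp)
    qed (use \<rho> in auto)
  qed
  show "emeasure ?H A \<le> emeasure (area_measure c) A"
  proof (rule ennreal_le_if_le_mult)
    fix K :: real assume "1 < K"
    show "emeasure ?H A \<le> ennreal K * emeasure (area_measure c) A"
    proof (rule emeasure_le_locally[OF _ _ _ A])
      fix p assume "p \<in> frontier D \<inter> ball z r"
      from loc[OF \<open>1 < K\<close> this] obtain U where U: "open U" "p \<in> U"
        "\<forall>A\<in>sets borel. A \<subseteq> (frontier D \<inter> ball z r) \<inter> U \<longrightarrow> emeasure ?H A \<le> ennreal K * emeasure (area_measure c) A \<and>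
         emeasure (area_measure c) A \<le> ennreal K * emeasure ?H A" by (elim exE conjE)
      then show "\<exists>U. open U \<and> p \<in> U \<and> (\<forall>A\<in>sets borel. A \<subseteq> (frontier D \<inter> ball z r) \<inter> U \<longrightarrow>
          emeasure ?H A \<le> ennreal K * emeasure (area_measure c) A)" by (intro exI[of _ U]) simp
    qed simp_all
  qed
  show "emeasure (area_measure c) A \<le> emeasure ?H A"
  proof (rule ennreal_le_if_le_mult)
    fix K :: real assume "1 < K"
    show "emeasure (area_measure c) A \<le> ennreal K * emeasure ?H A"
    proof (rule emeasure_le_locally[OF _ _ _ A])
      fix p assume "p \<in> frontier D \<inter> ball z r"
      from loc[OF \<open>1 < K\<close> this] obtain U where U: "open U" "p \<in> U"
        "\<forall>A\<in>sets borel. A \<subseteq> (frontier D \<inter> ball z r) \<inter> U \<longrightarrow> emeasure ?H A \<le> ennreal K * emeasure (area_measure c) A \<and>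
         emeasure (area_measure c) A \<le> ennreal K * emeasure ?H A" by (elim exE conjE)
      then show "\<exists>U. open U \<and> p \<in> U \<and> (\<forall>A\<in>sets borel. A \<subseteq> (frontier D \<inter> ball z r) \<inter> U \<longrightarrow>
          emeasure (area_measure c) A \<le> ennreal K * emeasure ?H A)" by (intro exI[of _ U]) simp
    qed simp_all
  qed
qed

lemma integral_hausdorff_patch:
  fixes g :: "real^'n \<Rightarrow> real"
  assumes c: "is_hausdorff_ratio TYPE('n) c" and g [measurable]: "g \<in> borel_measurable borel"
    and g0: "\<And>x. x \<notin> frontier D \<inter> ball z r \<Longrightarrow> g x = 0"
  shows "(LINT x|hausdorff_measure (CARD('n) - 1). g x) = (LINT y|lborel. c * area_density y * g (foot y))"
    and "integrable (hausdorff_measure (CARD('n) - 1)) g \<longleftrightarrow> integrable lborel (\<lambda>y. c * area_density y * g (foot y))"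
proof -
  let ?H = "hausdorff_measure (CARD('n) - 1) :: (real^'n) measure"
  let ?F = "frontier D \<inter> ball z r"
  have c0: "0 < c" using c by (simp add: is_hausdorff_ratio_def)
  have F [measurable]: "?F \<in> sets borel" by (intro sets.Int) auto
  have eq: "density ?H (\<lambda>x. ennreal (indicator ?F x)) = area_measure c"
  proof (rule measure_eqI)
    fix A assume "A \<in> sets (density ?H (\<lambda>x. ennreal (indicator ?F x)))"
    then have A [measurable]: "A \<in> sets borel" by simp
    have "emeasure (density ?H (\<lambda>x. ennreal (indicator ?F x))) A = (\<integral>\<^sup>+x. ennreal (indicator ?F x) * indicator A x \<partial>?H)"
      by (rule emeasure_density) auto
    also have "\<dots> = (\<integral>\<^sup>+x. indicator (?F \<inter> A) x \<partial>?H)"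
      by (intro nn_integral_cong) (auto split: split_indicator)
    also have "\<dots> = emeasure ?H (?F \<inter> A)" by (rule nn_integral_indicator) auto
    also have "\<dots> = emeasure (area_measure c) (?F \<inter> A)"
      by (rule hausdorff_eq_area_measure[OF c]) auto
    also have "\<dots> = emeasure (area_measure c) A"
    proof -
      have "area_density y = 0" if "foot y \<notin> ?F" for y
        using that foot_frontier[of y] by (auto simp: area_density_def)
      then have "ennreal (c * area_density y) * indicator (?F \<inter> A) (foot y) = ennreal (c * area_density y) * indicator A (foot y)" for y
        by (cases "foot y \<in> ?F") (auto split: split_indicator)
      then show ?thesis by (simp only: emeasure_area_measure[OF A] emeasure_area_measure[OF sets.Int[OF F A]])
    qed
    finally show "emeasure (density ?H (\<lambda>x. ennreal (indicator ?F x))) A = emeasure (area_measure c) A" .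
  qed simp
  have gi: "indicator ?F x *\<^sub>R g x = g x" for x using g0[of x] by (auto split: split_indicator)
  have "(LINT x|?H. g x) = (LINT x|?H. indicator ?F x *\<^sub>R g x)" by (simp only: gi)
  also have "\<dots> = (LINT x|density ?H (\<lambda>x. ennreal (indicator ?F x)). g x)"
    by (subst integral_density) auto
  also have "\<dots> = (LINT y|density lborel (\<lambda>y. ennreal (c * area_density y)). g (foot y))"
    unfolding eq area_measure_def by (rule integral_distr) auto
  also have "\<dots> = (LINT y|lborel. (c * area_density y) *\<^sub>R g (foot y))"
    using c0 by (subst integral_density) auto
  finally show "(LINT x|?H. g x) = (LINT y|lborel. c * area_density y * g (foot y))" by simp
  have "integrable ?H g \<longleftrightarrow> integrable ?H (\<lambda>x. indicator ?F x *\<^sub>R g x)" by (simp only: gi)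
  also have "\<dots> \<longleftrightarrow> integrable (density ?H (\<lambda>x. ennreal (indicator ?F x))) g"
    by (subst integrable_density) auto
  also have "\<dots> \<longleftrightarrow> integrable (density lborel (\<lambda>y. ennreal (c * area_density y))) (\<lambda>y. g (foot y))"
    unfolding eq area_measure_def by (rule integrable_distr_eq) auto
  also have "\<dots> \<longleftrightarrow> integrable lborel (\<lambda>y. (c * area_density y) *\<^sub>R g (foot y))"
    using c0 by (subst integrable_density) auto
  finally show "integrable ?H g \<longleftrightarrow> integrable lborel (\<lambda>y. c * area_density y * g (foot y))" by simp
qed

text \<open>Base points whose feet lie in a ball form a bounded set, hence one of finite volume:
  this gives finite surface measure and integrable majorants.\<close>

lemma slab_foot_bounded:
  "{y. 0 \<le> e \<bullet> y \<and> e \<bullet> y \<le> 1 \<and> foot y \<in> cball z r'} \<subseteq> cball 0 (2 * (norm z + r') + 1)"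
proof
  fix y assume y: "y \<in> {y. 0 \<le> e \<bullet> y \<and> e \<bullet> y \<le> 1 \<and> foot y \<in> cball z r'}"
  have "norm (foot y) \<le> norm z + norm (foot y - z)" using norm_triangle_ineq[of z "foot y - z"] by simp
  then have f: "norm (foot y) \<le> norm z + r'" using y by (simp add: dist_norm norm_minus_commute)
  have "e \<bullet> foot y = e \<bullet> y - height y" by (simp add: foot_def inner_diff_right ee)
  then have "y = foot y + (e \<bullet> y - e \<bullet> foot y) *\<^sub>R e" by (simp add: foot_def)
  then have ny: "norm y \<le> norm (foot y) + \<bar>e \<bullet> y - e \<bullet> foot y\<bar>"
    using norm_triangle_ineq[of "foot y" "(e \<bullet> y - e \<bullet> foot y) *\<^sub>R e"] e by simp
  have "\<bar>e \<bullet> y\<bar> \<le> 1" using y by auto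
  moreover have "\<bar>e \<bullet> foot y\<bar> \<le> norm (foot y)" using Cauchy_Schwarz_ineq2[of e "foot y"] e by simp
  ultimately have "\<bar>e \<bullet> y - e \<bullet> foot y\<bar> \<le> 1 + norm (foot y)"
    using abs_triangle_ineq4[of "e \<bullet> y" "e \<bullet> foot y"] by (meson add_mono order_trans)
  then have "norm y \<le> norm (foot y) + (1 + norm (foot y))" using ny by (meson add_left_mono order_trans)
  then have "norm y \<le> 2 * (norm z + r') + 1" using f by simp
  then show "y \<in> cball 0 (2 * (norm z + r') + 1)" by simp
qed

lemma hausdorff_patch_finite:
  assumes r': "0 < r'" "r' < r"
  shows "emeasure (hausdorff_measure (CARD('n) - 1)) (frontier D \<inter> cball z r') < top"
proof -
  obtain c where c: "is_hausdorff_ratio TYPE('n) c" by (rule is_hausdorff_ratio_exists)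
  have c0: "0 < c" using c by (simp add: is_hausdorff_ratio_def)
  obtain L where L: "\<And>x. x \<in> cball z r' \<Longrightarrow> norm (slope x) \<le> L" using height_lipschitz[OF r'] by metis
  have F: "frontier D \<inter> cball z r' \<in> sets borel" by auto
  have "emeasure (hausdorff_measure (CARD('n) - 1)) (frontier D \<inter> cball z r') = emeasure (area_measure c) (frontier D \<inter> cball z r')"
    using r' by (intro hausdorff_eq_area_measure[OF c F]) auto
  also have "\<dots> \<le> (\<integral>\<^sup>+y. ennreal (c * L) * indicator (cball (0::real^'n) (2 * (norm z + r') + 1)) y \<partial>lborel)"
    unfolding emeasure_area_measure[OF F]
  proof (rule nn_integral_mono)
    fix y
    show "ennreal (c * area_density y) * indicator (frontier D \<inter> cball z r') (foot y)
      \<le> ennreal (c * L) * indicator (cball 0 (2 * (norm z + r') + 1)) y"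
    proof (cases "e \<bullet> y \<in> {0..1} \<and> foot y \<in> cball z r'")
      case True
      then have "y \<in> cball 0 (2 * (norm z + r') + 1)" using slab_foot_bounded[of r'] by auto
      moreover have "area_density y \<le> L" using True L[of "foot y"] norm_ge_zero[of "slope (foot y)"]
        unfolding area_density_def by (auto simp del: norm_ge_zero intro: order_trans)
      then have "ennreal (c * area_density y) \<le> ennreal (c * L)" using c0 by (intro ennreal_leI) simp
      ultimately show ?thesis by (auto split: split_indicator)
    next
      case False
      then show ?thesis by (auto simp: area_density_def)
    qed
  qed
  also have "\<dots> < top"
    using emeasure_bounded_finite[OF bounded_cball, of "0::real^'n" "2 * (norm z + r') + 1"]
    by (subst nn_integral_cmult_indicator) (auto simp: ennreal_mult_less_top)
  finally show ?thesis .
qed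

lemma hausdorff_patch_pos:
  assumes p: "p \<in> ball z r" "p \<in> frontier D" and U: "open U" "p \<in> U"
  shows "0 < emeasure (hausdorff_measure (CARD('n) - 1)) (frontier D \<inter> U \<inter> ball z r)"
proof -
  obtain c where c: "is_hausdorff_ratio TYPE('n) c" by (rule is_hausdorff_ratio_exists)
  have c0: "0 < c" using c by (simp add: is_hausdorff_ratio_def)
  have A: "frontier D \<inter> U \<inter> ball z r \<in> sets borel" using U by (intro sets.Int) auto
  \<comment> \<open>Moving \<open>p\<close> by this amount along \<open>e\<close> puts it in the
    middle of the unit slab and does not change its foot.\<close>
  let ?t = "1/2 - e \<bullet> p"
  have fc: "continuous_on (ball z r) foot" unfolding foot_def[abs_def] by (intro continuous_intros height_cont)
  have oW: "open (ball z r \<inter> foot -` (U \<inter> ball z r))"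
    by (rule continuous_open_preimage[OF fc]) (use U in auto)
  define W where "W = (\<lambda>y. y - ?t *\<^sub>R e) -` (ball z r \<inter> foot -` (U \<inter> ball z r)) \<inter> {y. 0 < e \<bullet> y} \<inter> {y. e \<bullet> y < 1}"
  have "open W" unfolding W_def
    by (intro open_Int open_vimage oW open_Collect_less continuous_intros)
  moreover have "p + ?t *\<^sub>R e \<in> W"
    using p U foot_eq[OF p] by (simp add: W_def inner_add_right ee)
  ultimately have Wpos: "0 < emeasure lborel W" using emeasure_lborel_open_pos[of W] by blast
  have Ws: "W \<in> sets borel" using \<open>open W\<close> by simp
  have "ennreal c * emeasure lborel W = (\<integral>\<^sup>+y. ennreal c * indicator W y \<partial>lborel)"
    using Ws by (simp add: nn_integral_cmult)
  also have "\<dots> \<le> emeasure (area_measure c) (frontier D \<inter> U \<inter> ball z r)"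
    unfolding emeasure_area_measure[OF A]
  proof (rule nn_integral_mono)
    fix y
    show "ennreal c * indicator W y \<le> ennreal (c * area_density y) * indicator (frontier D \<inter> U \<inter> ball z r) (foot y)"
    proof (cases "y \<in> W")
      case True
      have "foot (y - ?t *\<^sub>R e) = foot y" using foot_add[of y "- ?t"] by (simp only: scaleR_minus_left diff_conv_add_uminus)
      then have fy: "foot y \<in> U" "foot y \<in> ball z r" using True by (auto simp: W_def)
      then have "1 \<le> area_density y"
        using norm_slope_ge_1[of "foot y"] True by (simp add: area_density_def W_def)
      then have "c \<le> c * area_density y" using c0 by simp
      then show ?thesis using True fy foot_frontier[of y] by (simp add: ennreal_leI)
    qed simp
  qed
  also have "\<dots> = emeasure (hausdorff_measure (CARD('n) - 1)) (frontier D \<inter> U \<inter> ball z r)"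
    by (rule hausdorff_eq_area_measure[OF c A, symmetric]) auto
  finally have le: "ennreal c * emeasure lborel W \<le> emeasure (hausdorff_measure (CARD('n) - 1)) (frontier D \<inter> U \<inter> ball z r)" .
  have "0 < ennreal c * emeasure lborel W" using Wpos c0 by (simp add: ennreal_zero_less_mult_iff)
  then show ?thesis using le by (rule order_less_le_trans)
qed

end

section \<open>Boundary jets\<close>

definition extends_to_closure :: "(real^'n::finite) set \<Rightarrow> (real^'n \<Rightarrow> real) \<Rightarrow> bool" where
  "extends_to_closure S g \<longleftrightarrow> (\<exists>h. continuous_on (closure S) h \<and> (\<forall>x\<in>S. h x = g x))"

lemma extends_cong: "(\<And>x. x \<in> S \<Longrightarrow> f x = g x) \<Longrightarrow> extends_to_closure S f \<Longrightarrow> extends_to_closure S g"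
  unfolding extends_to_closure_def by (metis (full_types))

lemma extends_add: "extends_to_closure S f \<Longrightarrow> extends_to_closure S g \<Longrightarrow> extends_to_closure S (\<lambda>x. f x + g x)"
  unfolding extends_to_closure_def
proof (elim exE conjE)
  fix h k assume "continuous_on (closure S) h" "\<forall>x\<in>S. h x = f x" "continuous_on (closure S) k" "\<forall>x\<in>S. k x = g x"
  then show "\<exists>h. continuous_on (closure S) h \<and> (\<forall>x\<in>S. h x = f x + g x)"
    by (intro exI[of _ "\<lambda>x. h x + k x"]) (auto intro: continuous_on_add)
qed

lemma extends_mult: "extends_to_closure S f \<Longrightarrow> extends_to_closure S g \<Longrightarrow> extends_to_closure S (\<lambda>x. f x * g x)"
  unfolding extends_to_closure_def
proof (elim exE conjE)
  fix h k assume "continuous_on (closure S) h" "\<forall>x\<in>S. h x = f x" "continuous_on (closure S) k" "\<forall>x\<in>S. k x = g x"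
  then show "\<exists>h. continuous_on (closure S) h \<and> (\<forall>x\<in>S. h x = f x * g x)"
    by (intro exI[of _ "\<lambda>x. h x * k x"]) (auto intro: continuous_on_mult)
qed

lemma extends_const: "extends_to_closure S (\<lambda>x. c)"
  unfolding extends_to_closure_def by (intro exI[of _ "\<lambda>x. c"]) auto

lemma at_within_closure_nonbot:
  fixes p :: "'a::metric_space"
  assumes "p \<in> closure S" "p \<notin> S"
  shows "at p within S \<noteq> bot"
  using assms by (auto simp: trivial_limit_within closure_def)

text \<open>Boundary values are values of a continuous extension. In this form they inherit
  continuity along the boundary and can be computed as limits along any approach from
  inside.\<close>

lemma extends_boundary_value:
  assumes "extends_to_closure S g"
  obtains h where "continuous_on (closure S) h" "\<And>x. x \<in> S \<Longrightarrow> h x = g x"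
    "\<And>p. p \<in> closure S \<Longrightarrow> p \<notin> S \<Longrightarrow> boundary_value S g p = h p"
    "\<And>p. p \<in> closure S \<Longrightarrow> (g \<longlongrightarrow> h p) (at p within S)"
proof -
  obtain h where h: "continuous_on (closure S) h" "\<And>x. x \<in> S \<Longrightarrow> h x = g x"
    using assms unfolding extends_to_closure_def by blast
  have lim: "(g \<longlongrightarrow> h p) (at p within S)" if "p \<in> closure S" for p
  proof -
    have "(h \<longlongrightarrow> h p) (at p within closure S)" using h(1) that by (simp add: continuous_on_def)
    then have "(h \<longlongrightarrow> h p) (at p within S)" by (rule tendsto_within_subset[OF _ closure_subset])
    moreover have "\<forall>\<^sub>F x in at p within S. h x = g x" using h(2) by (simp add: eventually_at_filter)
    ultimately show ?thesis by (simp add: tendsto_cong)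
  qed
  have "boundary_value S g p = h p" if "p \<in> closure S" "p \<notin> S" for p
    unfolding boundary_value_def by (rule tendsto_Lim[OF at_within_closure_nonbot[OF that] lim[OF that(1)]])
  with h lim that show thesis by blast
qed

lemma boundary_value_tendsto:
  assumes "extends_to_closure S g" "p \<in> closure S" "p \<notin> S"
  shows "(g \<longlongrightarrow> boundary_value S g p) (at p within S)"
  using extends_boundary_value[OF assms(1)] assms(2,3) by metis

lemma boundary_value_eqI:
  assumes "(g \<longlongrightarrow> l) (at p within S)" "p \<in> closure S" "p \<notin> S"
  shows "boundary_value S g p = l"
  unfolding boundary_value_def by (rule tendsto_Lim[OF at_within_closure_nonbot[OF assms(2,3)] assms(1)])

lemma boundary_value_add:
  assumes "extends_to_closure S f" "extends_to_closure S g" "p \<in> closure S" "p \<notin> S"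
  shows "boundary_value S (\<lambda>x. f x + g x) p = boundary_value S f p + boundary_value S g p"
  using assms by (intro boundary_value_eqI tendsto_add boundary_value_tendsto)

lemma boundary_value_mult:
  assumes "extends_to_closure S f" "extends_to_closure S g" "p \<in> closure S" "p \<notin> S"
  shows "boundary_value S (\<lambda>x. f x * g x) p = boundary_value S f p * boundary_value S g p"
  using assms by (intro boundary_value_eqI tendsto_mult boundary_value_tendsto)

lemma boundary_value_const:
  assumes "p \<in> closure S" "p \<notin> S"
  shows "boundary_value S (\<lambda>x. c) p = c"
  using assms by (intro boundary_value_eqI tendsto_const)

lemma boundary_value_cong:
  assumes "\<And>x. x \<in> S \<Longrightarrow> f x = g x"
  shows "boundary_value S f p = boundary_value S g p"
proof -
  have "(f \<longlongrightarrow> l) (at p within S) \<longleftrightarrow> (g \<longlongrightarrow> l) (at p within S)" for l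
    using assms by (intro tendsto_cong) (simp add: eventually_at_filter)
  then show ?thesis unfolding boundary_value_def t2_space_class.Lim_def by simp
qed

text \<open>A recursive counterpart of \<open>Ck_closure\<close> that splits off the innermost
  derivative, as inductions through sums and products need. It speaks about values on
  \<open>S\<close> only, so functions that agree on \<open>S\<close> are interchangeable.\<close>

primrec Cext :: "nat \<Rightarrow> (real^'n::finite) set \<Rightarrow> (real^'n \<Rightarrow> real) \<Rightarrow> bool" where
  "Cext 0 S g \<longleftrightarrow> extends_to_closure S g"
| "Cext (Suc m) S g \<longleftrightarrow> extends_to_closure S g \<and> (\<forall>x\<in>S. g differentiable (at x)) \<and> (\<forall>i. Cext m S (partial i g))"

lemma Cext_extends: "Cext m S g \<Longrightarrow> extends_to_closure S g"
  by (cases m) auto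

lemma Cext_Suc_imp: "Cext (Suc m) S g \<Longrightarrow> Cext m S g"
  by (induction m arbitrary: g) auto

lemma Cext_mono: "Cext m S g \<Longrightarrow> l \<le> m \<Longrightarrow> Cext l S g"
  by (induction m) (auto simp: le_Suc_eq simp del: Cext.simps(2) dest: Cext_Suc_imp)

lemma Ck_closure_Cext: "Ck_closure m S g \<Longrightarrow> Cext m S g"
proof -
  assume C: "Ck_closure m S g"
  have "Cext l S (partials is g)" if "length is + l \<le> m" for l "is"
    using that
  proof (induction l arbitrary: "is")
    case 0
    then have "\<exists>h. continuous_on (closure S) h \<and> (\<forall>x\<in>S. h x = partials is g x)"
      using C unfolding Ck_closure_def by simp
    then show ?case by (simp add: extends_to_closure_def)
  next
    case (Suc l)
    have "\<exists>h. continuous_on (closure S) h \<and> (\<forall>x\<in>S. h x = partials is g x)"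
      using C Suc.prems unfolding Ck_closure_def by simp
    moreover have "\<forall>x\<in>S. partials is g differentiable (at x)"
      using C Suc.prems unfolding Ck_closure_def Ck_on_def by simp
    moreover have "Cext l S (partial i (partials is g))" for i
      using Suc.IH[of "i # is"] Suc.prems by (simp add: partials_Cons)
    ultimately show ?case by (simp add: extends_to_closure_def)
  qed
  from this[of "[]" m] show ?thesis by simp
qed

lemma Cext_cong:
  assumes S: "open S" and "\<And>x. x \<in> S \<Longrightarrow> f x = g x" "Cext m S f"
  shows "Cext m S g"
  using assms(2,3)
proof (induction m arbitrary: f g)
  case 0
  then show ?case using extends_cong[of S f g] by simp
next
  case (Suc m)
  have "extends_to_closure S g" using extends_cong[of S f g] Suc.prems by simp
  moreover have "g differentiable (at x)" if "x \<in> S" for x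
    by (rule differentiable_cong_open[OF S that Suc.prems(1)]) (use Suc.prems that in auto)
  moreover have "Cext m S (partial i g)" for i
  proof (rule Suc.IH)
    show "partial i f x = partial i g x" if "x \<in> S" for x
      by (rule partial_cong_open[OF S that Suc.prems(1)])
    show "Cext m S (partial i f)" using Suc.prems by simp
  qed
  ultimately show ?case by simp
qed

lemma Cext_subset:
  assumes "T \<subseteq> S" "Cext m S g"
  shows "Cext m T g"
  using assms(2)
proof (induction m arbitrary: g)
  case 0
  then show ?case
    unfolding Cext.simps extends_to_closure_def using assms(1) closure_mono[OF assms(1)] by (meson continuous_on_subset subsetD)
next
  case (Suc m)
  have "extends_to_closure T g"
    using Cext_extends[OF Suc.prems] unfolding extends_to_closure_def
    using assms(1) closure_mono[OF assms(1)] by (meson continuous_on_subset subsetD)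
  then show ?case using Suc assms(1) by auto
qed

lemma Cext_add:
  assumes S: "open S" and "Cext m S f" "Cext m S g"
  shows "Cext m S (\<lambda>x. f x + g x)"
  using assms(2,3)
proof (induction m arbitrary: f g)
  case (Suc m)
  have "Cext m S (partial i (\<lambda>x. f x + g x))" for i
    by (rule Cext_cong[OF S, of "\<lambda>x. partial i f x + partial i g x"])
      (use Suc in \<open>simp_all add: partial_add\<close>)
  then show ?case using Suc.prems by (simp add: extends_add)
qed (simp add: extends_add)

lemma Cext_mult:
  assumes S: "open S" and "Cext m S f" "Cext m S g"
  shows "Cext m S (\<lambda>x. f x * g x)"
  using assms(2,3)
proof (induction m arbitrary: f g)
  case (Suc m)
  have "Cext m S f" "Cext m S g" using Suc.prems by (simp_all only: Cext_Suc_imp)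
  then have "Cext m S (\<lambda>x. partial i f x * g x + f x * partial i g x)" for i
    using Suc.prems by (intro Cext_add[OF S] Suc.IH) simp_all
  then have "Cext m S (partial i (\<lambda>x. f x * g x))" for i
    by (rule Cext_cong[OF S, rotated]) (use Suc.prems in \<open>simp add: partial_mult\<close>)
  then show ?case using Suc.prems by (simp add: extends_mult)
qed (simp add: extends_mult)

lemma Cext_const: "Cext m S (\<lambda>x. c)"
proof (induction m arbitrary: c)
  case (Suc m)
  have "partial i (\<lambda>x. c) = (\<lambda>x. 0)" for i :: 'a by (simp add: fun_eq_iff)
  then show ?case using Suc by (simp add: extends_const)
qed (simp add: extends_const)

lemma Cext_sum:
  assumes "open S" "finite I" "\<And>k. k \<in> I \<Longrightarrow> Cext m S (f k)"
  shows "Cext m S (\<lambda>x. \<Sum>k\<in>I. f k x)"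
  using assms(2,3) by (induction I rule: finite_induct) (auto intro!: Cext_add assms(1) Cext_const)

text \<open>Vanishing to order \<open>m\<close> on \<open>F\<close>, with the derivatives of order \<open>m\<close> given there by
  \<open>\<theta> \<cdot> \<nu>\<^sub>i \<nu>\<^sub>j \<dots>\<close>; this form is preserved by multiplication and by \<^const>\<open>adjoint_op\<close>.\<close>

primrec normal_jet :: "nat \<Rightarrow> (real^'n::finite) set \<Rightarrow> (real^'n) set \<Rightarrow> (real^'n \<Rightarrow> real^'n) \<Rightarrow>
    (real^'n \<Rightarrow> real) \<Rightarrow> (real^'n \<Rightarrow> real) \<Rightarrow> bool" where
  "normal_jet 0 S F \<nu> v \<theta> \<longleftrightarrow> Cext 0 S v \<and> (\<forall>p\<in>F. boundary_value S v p = \<theta> p)"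
| "normal_jet (Suc m) S F \<nu> v \<theta> \<longleftrightarrow> Cext (Suc m) S v \<and> (\<forall>p\<in>F. boundary_value S v p = 0) \<and>
     (\<forall>i. normal_jet m S F \<nu> (partial i v) (\<lambda>p. \<theta> p * \<nu> p $ i))"

lemma normal_jet_Cext: "normal_jet m S F \<nu> v \<theta> \<Longrightarrow> Cext m S v"
  by (cases m) auto

lemma normal_jet_theta_cong: "normal_jet m S F \<nu> v \<theta> \<Longrightarrow> (\<And>p. p \<in> F \<Longrightarrow> \<theta> p = \<theta>' p) \<Longrightarrow> normal_jet m S F \<nu> v \<theta>'"
proof (induction m arbitrary: v \<theta> \<theta>')
  case (Suc m)
  have "normal_jet m S F \<nu> (partial i v) (\<lambda>p. \<theta>' p * \<nu> p $ i)" for i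
    by (rule Suc.IH[of _ "\<lambda>p. \<theta> p * \<nu> p $ i"]) (use Suc.prems in simp_all)
  then show ?case using Suc.prems by simp
qed simp

lemma normal_jet_weaken: "normal_jet (Suc m) S F \<nu> v \<theta> \<Longrightarrow> normal_jet m S F \<nu> v (\<lambda>p. 0)"
proof (induction m arbitrary: v \<theta>)
  case (Suc m)
  have "normal_jet m S F \<nu> (partial i v) (\<lambda>p. 0)" for i
    by (rule Suc.IH[of _ "\<lambda>p. \<theta> p * \<nu> p $ i"]) (use Suc.prems in simp)
  then show ?case using Suc.prems Cext_Suc_imp[of "Suc m" S v] by simp
qed simp

lemma normal_jet_cong:
  assumes S: "open S" and "\<And>x. x \<in> S \<Longrightarrow> v x = w x" "normal_jet m S F \<nu> v \<theta>"
  shows "normal_jet m S F \<nu> w \<theta>"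
  using assms(2,3)
proof (induction m arbitrary: v w \<theta>)
  case 0
  have "boundary_value S w p = boundary_value S v p" for p by (rule boundary_value_cong) (simp add: 0)
  moreover have "Cext 0 S w" by (rule Cext_cong[OF S 0(1) normal_jet_Cext[OF 0(2)]])
  ultimately show ?case using 0(2) by (simp del: Cext.simps)
next
  case (Suc m)
  have eq: "partial i v x = partial i w x" if "x \<in> S" for i x
    by (rule partial_cong_open[OF S that Suc.prems(1)])
  have nj: "normal_jet m S F \<nu> (partial i v) (\<lambda>p. \<theta> p * \<nu> p $ i)" for i
    using Suc.prems(2) by (simp del: Cext.simps)
  have "normal_jet m S F \<nu> (partial i w) (\<lambda>p. \<theta> p * \<nu> p $ i)" for i
    by (rule Suc.IH[OF eq nj])
  moreover have "boundary_value S w p = boundary_value S v p" for p by (rule boundary_value_cong) (simp add: Suc.prems)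
  moreover have "Cext (Suc m) S w" by (rule Cext_cong[OF S Suc.prems(1) normal_jet_Cext[OF Suc.prems(2)]])
  ultimately show ?case using Suc.prems(2) by (simp del: Cext.simps)
qed

lemma normal_jet_add:
  assumes S: "open S" and F: "F \<subseteq> closure S - S" and "normal_jet m S F \<nu> v \<theta>" "normal_jet m S F \<nu> w \<theta>'"
  shows "normal_jet m S F \<nu> (\<lambda>x. v x + w x) (\<lambda>p. \<theta> p + \<theta>' p)"
  using assms(3,4)
proof (induction m arbitrary: v w \<theta> \<theta>')
  case 0
  then show ?case using F boundary_value_add[of S v w] by (auto simp: extends_add)
next
  case (Suc m)
  have "normal_jet m S F \<nu> (\<lambda>x. partial i v x + partial i w x) (\<lambda>p. \<theta> p * \<nu> p $ i + \<theta>' p * \<nu> p $ i)" for i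
    using Suc by simp
  then have "normal_jet m S F \<nu> (partial i (\<lambda>x. v x + w x)) (\<lambda>p. \<theta> p * \<nu> p $ i + \<theta>' p * \<nu> p $ i)" for i
    by (rule normal_jet_cong[OF S, rotated]) (use Suc.prems in \<open>simp add: partial_add\<close>)
  moreover have "Cext (Suc m) S (\<lambda>x. v x + w x)" using Suc.prems by (intro Cext_add[OF S] normal_jet_Cext)
  moreover have "boundary_value S (\<lambda>x. v x + w x) p = 0" if "p \<in> F" for p
    using Suc.prems that F boundary_value_add[of S v w p] by auto
  ultimately show ?case by (simp add: distrib_right del: Cext.simps)
qed

text \<open>In the product rule the term with a derivative of \<open>c\<close> contains
  \<open>v\<close> undifferentiated, and the jet of \<open>v\<close> of one order less is zero; so
  only the boundary value of \<open>c\<close> enters.\<close>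

lemma normal_jet_mult:
  assumes S: "open S" and F: "F \<subseteq> closure S - S" and "Cext m S c" "normal_jet m S F \<nu> v \<theta>"
  shows "normal_jet m S F \<nu> (\<lambda>x. c x * v x) (\<lambda>p. boundary_value S c p * \<theta> p)"
  using assms(3,4)
proof (induction m arbitrary: c v \<theta>)
  case 0
  then show ?case using F boundary_value_mult[of S c v] by (auto simp: extends_mult)
next
  case (Suc m)
  have cm: "Cext m S c" by (rule Cext_Suc_imp[OF Suc.prems(1)])
  have "normal_jet m S F \<nu> (\<lambda>x. partial i c x * v x + c x * partial i v x)
      (\<lambda>p. boundary_value S (partial i c) p * 0 + boundary_value S c p * (\<theta> p * \<nu> p $ i))" for i
    by (intro normal_jet_add[OF S F] Suc.IH cm)
      (use Suc.prems normal_jet_weaken[OF Suc.prems(2)] in simp_all)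
  then have "normal_jet m S F \<nu> (partial i (\<lambda>x. c x * v x))
      (\<lambda>p. boundary_value S (partial i c) p * 0 + boundary_value S c p * (\<theta> p * \<nu> p $ i))" for i
    by (rule normal_jet_cong[OF S, rotated]) (use Suc.prems in \<open>simp add: partial_mult\<close>)
  then have "normal_jet m S F \<nu> (partial i (\<lambda>x. c x * v x)) (\<lambda>p. boundary_value S c p * \<theta> p * \<nu> p $ i)" for i
    by (rule normal_jet_theta_cong) simp
  moreover have "Cext (Suc m) S (\<lambda>x. c x * v x)" by (rule Cext_mult[OF S Suc.prems(1) normal_jet_Cext[OF Suc.prems(2)]])
  moreover have "boundary_value S (\<lambda>x. c x * v x) p = 0" if "p \<in> F" for p
    using Suc.prems that F boundary_value_mult[of S c v p] by auto
  ultimately show ?case by (simp del: Cext.simps)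
qed

lemma normal_jet_zero: "F \<subseteq> closure S - S \<Longrightarrow> normal_jet m S F \<nu> (\<lambda>x. 0) (\<lambda>p. 0)"
proof (induction m)
  case (Suc m)
  have "partial i (\<lambda>x. 0) = (\<lambda>x. 0)" for i :: 'a by (simp add: fun_eq_iff)
  then show ?case using Suc Cext_const[of "Suc m" S 0] boundary_value_const[of _ S 0] by (auto simp del: Cext.simps)
qed (use boundary_value_const in \<open>auto simp: extends_const\<close>)

lemma normal_jet_sum:
  assumes "open S" "F \<subseteq> closure S - S" "finite I" "\<And>k. k \<in> I \<Longrightarrow> normal_jet m S F \<nu> (f k) (\<theta> k)"
  shows "normal_jet m S F \<nu> (\<lambda>x. \<Sum>k\<in>I. f k x) (\<lambda>p. \<Sum>k\<in>I. \<theta> k p)"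
  using assms(3,4)
  by (induction I rule: finite_induct) (auto intro!: normal_jet_add normal_jet_zero assms(1,2))

text \<open>The drift and zero order terms differentiate \<open>v\<close> at most once, so their
  jets of order \<open>m\<close> vanish. The second order part contributes the quadratic form of
  \<open>a\<close> at \<open>\<nu>\<close>, with the half from the generator.\<close>

lemma normal_jet_adjoint:
  assumes S: "open S" and F: "F \<subseteq> closure S - S"
    and a: "\<And>i j. Cext (Suc m) S (\<lambda>x. a x $ i $ j)" and b: "\<And>i. Cext (Suc m) S (\<lambda>x. b x $ i)"
    and v: "normal_jet (Suc (Suc m)) S F \<nu> v \<theta>"
  shows "normal_jet m S F \<nu> (adjoint_op a b v)
    (\<lambda>p. 1/2 * (\<Sum>i\<in>UNIV. \<Sum>j\<in>UNIV. \<nu> p $ i * \<nu> p $ j * boundary_value S (\<lambda>x. a x $ i $ j) p) * \<theta> p)"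
proof -
  let ?\<alpha> = "\<lambda>i j p. boundary_value S (\<lambda>x. a x $ i $ j) p"
  have dv: "normal_jet (Suc m) S F \<nu> (partial j v) (\<lambda>p. \<theta> p * \<nu> p $ j)" for j using v by (simp del: Cext.simps)
  have "normal_jet (Suc m) S F \<nu> (\<lambda>x. a x $ i $ j * partial j v x) (\<lambda>p. ?\<alpha> i j p * (\<theta> p * \<nu> p $ j))" for i j
    by (rule normal_jet_mult[OF S F a dv])
  then have "normal_jet m S F \<nu> (partial i (\<lambda>x. a x $ i $ j * partial j v x)) (\<lambda>p. ?\<alpha> i j p * (\<theta> p * \<nu> p $ j) * \<nu> p $ i)" for i j
    by (simp del: Cext.simps)
  then have 1: "normal_jet m S F \<nu> (div_grad a v) (\<lambda>p. \<Sum>i\<in>UNIV. \<Sum>j\<in>UNIV. ?\<alpha> i j p * (\<theta> p * \<nu> p $ j) * \<nu> p $ i)"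
    unfolding div_grad_def[abs_def] by (intro normal_jet_sum[OF S F] finite)
  have c: "Cext m S (\<lambda>x. c)" for c by (rule Cext_const)
  have 2: "normal_jet m S F \<nu> (\<lambda>x. 1/2 * div_grad a v x) (\<lambda>p. boundary_value S (\<lambda>x. 1/2) p * (\<Sum>i\<in>UNIV. \<Sum>j\<in>UNIV. ?\<alpha> i j p * (\<theta> p * \<nu> p $ j) * \<nu> p $ i))"
    by (rule normal_jet_mult[OF S F c 1])
  have "normal_jet m S F \<nu> (\<lambda>x. b x $ i * partial i v x) (\<lambda>p. boundary_value S (\<lambda>x. b x $ i) p * 0)" for i
    by (rule normal_jet_mult[OF S F Cext_Suc_imp[OF b] normal_jet_weaken[OF dv]])
  then have "normal_jet m S F \<nu> (\<lambda>x. \<Sum>i\<in>UNIV. b x $ i * partial i v x) (\<lambda>p. \<Sum>i\<in>UNIV. boundary_value S (\<lambda>x. b x $ i) p * 0)"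
    by (intro normal_jet_sum[OF S F] finite)
  from normal_jet_mult[OF S F c this] have 3: "normal_jet m S F \<nu> (\<lambda>x. (-1) * (\<Sum>i\<in>UNIV. b x $ i * partial i v x)) (\<lambda>p. 0)"
    by (rule normal_jet_theta_cong) simp
  have "Cext m S (\<lambda>x. \<Sum>i\<in>UNIV. partial i (\<lambda>y. b y $ i) x)"
    using b by (intro Cext_sum[OF S]) auto
  then have "Cext m S (\<lambda>x. (-1) * (\<Sum>i\<in>UNIV. partial i (\<lambda>y. b y $ i) x))"
    by (rule Cext_mult[OF S c])
  from normal_jet_mult[OF S F this normal_jet_weaken[OF normal_jet_weaken[OF v]]]
  have 4: "normal_jet m S F \<nu> (\<lambda>x. (-1) * (\<Sum>i\<in>UNIV. partial i (\<lambda>y. b y $ i) x) * v x) (\<lambda>p. 0)"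
    by (rule normal_jet_theta_cong) simp
  have "normal_jet m S F \<nu> (\<lambda>x. (1/2 * div_grad a v x + (-1) * (\<Sum>i\<in>UNIV. b x $ i * partial i v x)) + (-1) * (\<Sum>i\<in>UNIV. partial i (\<lambda>y. b y $ i) x) * v x)
    (\<lambda>p. (boundary_value S (\<lambda>x. 1/2) p * (\<Sum>i\<in>UNIV. \<Sum>j\<in>UNIV. ?\<alpha> i j p * (\<theta> p * \<nu> p $ j) * \<nu> p $ i) + 0) + 0)"
    by (intro normal_jet_add[OF S F] 2 3 4)
  then have "normal_jet m S F \<nu> (adjoint_op a b v)
    (\<lambda>p. (boundary_value S (\<lambda>x. 1/2) p * (\<Sum>i\<in>UNIV. \<Sum>j\<in>UNIV. ?\<alpha> i j p * (\<theta> p * \<nu> p $ j) * \<nu> p $ i) + 0) + 0)"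
    by (rule normal_jet_cong[OF S, rotated]) (simp add: adjoint_op_def)
  then show ?thesis
  proof (rule normal_jet_theta_cong)
    fix p assume "p \<in> F"
    then have "boundary_value S (\<lambda>x. 1/2) p = 1/2" using F by (intro boundary_value_const) auto
    moreover have "(\<Sum>i\<in>UNIV. \<Sum>j\<in>UNIV. ?\<alpha> i j p * (\<theta> p * \<nu> p $ j) * \<nu> p $ i)
       = (\<Sum>i\<in>UNIV. \<Sum>j\<in>UNIV. \<nu> p $ i * \<nu> p $ j * ?\<alpha> i j p) * \<theta> p"
      unfolding sum_distrib_right by (intro sum.cong) (simp_all add: mult_ac)
    ultimately show "(boundary_value S (\<lambda>x. 1/2) p * (\<Sum>i\<in>UNIV. \<Sum>j\<in>UNIV. ?\<alpha> i j p * (\<theta> p * \<nu> p $ j) * \<nu> p $ i) + 0) + 0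
       = 1/2 * (\<Sum>i\<in>UNIV. \<Sum>j\<in>UNIV. \<nu> p $ i * \<nu> p $ j * ?\<alpha> i j p) * \<theta> p"
      by simp
  qed
qed

lemma normal_jetI:
  assumes "Cext m S v"
    and "\<And>is p. length is < m \<Longrightarrow> p \<in> F \<Longrightarrow> boundary_value S (partials is v) p = 0"
    and "\<And>is p. length is = m \<Longrightarrow> p \<in> F \<Longrightarrow> boundary_value S (partials is v) p = \<theta> p * prod_list (map (\<lambda>j. \<nu> p $ j) is)"
  shows "normal_jet m S F \<nu> v \<theta>"
  using assms
proof (induction m arbitrary: v \<theta>)
  case 0
  then show ?case using "0.prems"(3)[of "[]"] by simp
next
  case (Suc m)
  have "normal_jet m S F \<nu> (partial i v) (\<lambda>p. \<theta> p * \<nu> p $ i)" for i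
  proof (rule Suc.IH)
    show "Cext m S (partial i v)" using Suc.prems(1) by simp
    show "boundary_value S (partials is (partial i v)) p = 0" if "length is < m" "p \<in> F" for "is" p
      using Suc.prems(2)[of "is @ [i]" p] that by (simp add: partials_append partials_Cons)
    show "boundary_value S (partials is (partial i v)) p = \<theta> p * \<nu> p $ i * prod_list (map (\<lambda>j. \<nu> p $ j) is)"
      if "length is = m" "p \<in> F" for "is" p
      using Suc.prems(3)[of "is @ [i]" p] that by (simp add: partials_append partials_Cons mult_ac)
  qed
  moreover have "boundary_value S v p = 0" if "p \<in> F" for p using Suc.prems(2)[of "[]" p] that by simp
  ultimately show ?case using Suc.prems(1) by (simp del: Cext.simps)
qed

text \<open>\<open>g j\<close> plays the role of the derivative of order \<open>j\<close>, known on
  an open interval only. The missing endpoint is replaced by limits at 0, and the mean value theorem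
  is applied once per order; each application contributes a factor \<open>t\<close>.\<close>

lemma line_taylor_bound:
  fixes g :: "nat \<Rightarrow> real \<Rightarrow> real"
  assumes "\<And>j t. j < k \<Longrightarrow> 0 < t \<Longrightarrow> t < t0 \<Longrightarrow> (g j has_real_derivative g (Suc j) t) (at t)"
    and "\<And>j. j < k \<Longrightarrow> (g j \<longlongrightarrow> 0) (at_right 0)"
    and "\<And>t. 0 < t \<Longrightarrow> t < t0 \<Longrightarrow> \<bar>g k t\<bar> \<le> C"
    and "0 < t" "t < t0"
  shows "\<bar>g 0 t\<bar> \<le> C * t ^ k"
  using assms
proof (induction k arbitrary: g t)
  case (Suc k)
  have C0: "0 \<le> C" using Suc.prems(3)[OF Suc.prems(4,5)] by linarith
  have IH: "\<bar>g (Suc 0) \<tau>\<bar> \<le> C * \<tau> ^ k" if "0 < \<tau>" "\<tau> < t0" for \<tau>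
    using Suc.IH[of "\<lambda>j. g (Suc j)" \<tau>] Suc.prems(1-3) that by auto
  have "\<bar>g 0 t - g 0 \<tau>\<bar> \<le> C * t ^ Suc k" if \<tau>: "0 < \<tau>" "\<tau> < t" for \<tau>
  proof -
    have "(g 0 has_real_derivative g (Suc 0) x) (at x)" if "\<tau> \<le> x" "x \<le> t" for x
      using that \<tau> Suc.prems(5) by (intro Suc.prems(1)) auto
    from MVT2[OF \<tau>(2) this] obtain x where x: "\<tau> < x" "x < t" "g 0 t - g 0 \<tau> = (t - \<tau>) * g (Suc 0) x" by blast
    have "\<bar>g (Suc 0) x\<bar> \<le> C * x ^ k" using x \<tau> Suc.prems(5) by (intro IH) auto
    also have "\<dots> \<le> C * t ^ k" using x \<tau> C0 by (intro mult_left_mono power_mono) auto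
    finally have "\<bar>t - \<tau>\<bar> * \<bar>g (Suc 0) x\<bar> \<le> t * (C * t ^ k)" using \<tau> by (intro mult_mono) auto
    then show ?thesis unfolding x(3) abs_mult by (simp add: mult_ac)
  qed
  then have "\<forall>\<^sub>F \<tau> in at_right 0. \<bar>g 0 t - g 0 \<tau>\<bar> \<le> C * t ^ Suc k"
    using eventually_at_right_real[OF Suc.prems(4)] by (auto elim!: eventually_mono)
  moreover have "((\<lambda>\<tau>. \<bar>g 0 t - g 0 \<tau>\<bar>) \<longlongrightarrow> \<bar>g 0 t - 0\<bar>) (at_right 0)"
    by (intro tendsto_intros Suc.prems(2)) simp
  ultimately show ?case
    using tendsto_upperbound[of "\<lambda>\<tau>. \<bar>g 0 t - g 0 \<tau>\<bar>" "\<bar>g 0 t - 0\<bar>" "at_right 0" "C * t ^ Suc k"] by simp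
qed simp

lemma line_taylor_limit:
  fixes g :: "nat \<Rightarrow> real \<Rightarrow> real"
  assumes t0: "0 < t0" and d: "\<And>j t. j < k \<Longrightarrow> 0 < t \<Longrightarrow> t < t0 \<Longrightarrow> (g j has_real_derivative g (Suc j) t) (at t)"
    and z: "\<And>j. j < k \<Longrightarrow> (g j \<longlongrightarrow> 0) (at_right 0)"
    and l: "(g k \<longlongrightarrow> l) (at_right 0)"
  shows "((\<lambda>t. g 0 t / t ^ k) \<longlongrightarrow> l / fact k) (at_right 0)"
proof (rule tendstoI)
  fix \<eta> :: real assume \<eta>: "0 < \<eta>"
  then have "\<forall>\<^sub>F t in at_right 0. dist (g k t) l < \<eta> / 2" using tendstoD[OF l, of "\<eta> / 2"] by simp
  then obtain b where b: "0 < b" "\<And>t. 0 < t \<Longrightarrow> t < b \<Longrightarrow> \<bar>g k t - l\<bar> \<le> \<eta> / 2"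
    unfolding eventually_at_right_field by (auto simp: dist_real_def) (meson less_imp_le)
  define t1 where "t1 = min b t0"
  have t1: "0 < t1" "t1 \<le> b" "t1 \<le> t0" using b t0 by (auto simp: t1_def)
  \<comment> \<open>Subtracting the monomial with coefficient \<open>l / fact k\<close>, together
    with its derivatives, leaves a family whose top member is small near 0, so that the preceding
    bound applies.\<close>
  define G where "G j t = g j t - l * t ^ (k - j) / fact (k - j)" for j t
  have G1: "(G j has_real_derivative G (Suc j) t) (at t)" if j: "j < k" and t: "0 < t" "t < t1" for j t
  proof -
    obtain m where m: "k - j = Suc m" using j by (metis Suc_diff_Suc)
    then have m': "k - Suc j = m" by simp
    have "((\<lambda>t. (l / fact (Suc m)) * t ^ Suc m) has_real_derivative (l / fact (Suc m)) * (real (Suc m) * t ^ m)) (at t)"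
      using DERIV_cmult[OF DERIV_pow[of "Suc m" t UNIV], of "l / fact (Suc m)"] by simp
    moreover have "(l / fact (Suc m)) * (real (Suc m) * t ^ m) = l * t ^ m / fact m"
    proof -
      have "(fact (Suc m) :: real) = real (Suc m) * fact m" by (rule fact_Suc)
      then show ?thesis by (simp del: fact_Suc of_nat_Suc)
    qed
    ultimately have "((\<lambda>t. l * t ^ Suc m / fact (Suc m)) has_real_derivative l * t ^ m / fact m) (at t)"
      by (simp del: fact_Suc of_nat_Suc power_Suc)
    then show ?thesis
      unfolding G_def[abs_def] m m' using j t t1 by (intro DERIV_diff d) auto
  qed
  have G2: "(G j \<longlongrightarrow> 0) (at_right 0)" if j: "j < k" for j
  proof -
    have "((\<lambda>t. g j t - l * t ^ (k - j) / fact (k - j)) \<longlongrightarrow> 0 - l * 0 ^ (k - j) / fact (k - j)) (at_right 0)"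
      using j by (intro tendsto_intros z) auto
    then show ?thesis using j by (simp add: G_def[abs_def] power_0_left)
  qed
  have G3: "\<bar>G k t\<bar> \<le> \<eta> / 2" if "0 < t" "t < t1" for t
    using b(2)[of t] t1 that by (simp add: G_def)
  have bound: "\<bar>G 0 t\<bar> \<le> \<eta> / 2 * t ^ k" if "0 < t" "t < t1" for t
    using line_taylor_bound[of k t1 G "\<eta> / 2" t] G1 G2 G3 that by blast
  have "\<forall>\<^sub>F t in at_right 0. t \<in> {0<..<t1}" by (rule eventually_at_right_real[OF t1(1)])
  then show "\<forall>\<^sub>F t in at_right 0. dist (g 0 t / t ^ k) (l / fact k) < \<eta>"
  proof eventually_elim
    fix t assume t: "t \<in> {0<..<t1}"
    then have tk: "0 < t ^ k" by simp
    have "g 0 t / t ^ k - l / fact k = G 0 t / t ^ k" using t by (simp add: G_def diff_divide_distrib)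
    then have "\<bar>g 0 t / t ^ k - l / fact k\<bar> = \<bar>G 0 t\<bar> / t ^ k" using tk by simp
    also have "\<dots> \<le> \<eta> / 2" using bound[of t] t tk by (simp add: divide_le_eq)
    finally show "dist (g 0 t / t ^ k) (l / fact k) < \<eta>" using \<eta> by (simp add: dist_real_def)
  qed
qed

section \<open>Tangential and normal derivatives at the boundary\<close>

lemma open_boundary_collar: "open D \<Longrightarrow> open (boundary_collar D \<epsilon>)"
proof -
  assume D: "open D"
  have "open {x. infdist x (frontier D) < \<epsilon>}"
    by (intro open_Collect_less continuous_intros)
  moreover have "boundary_collar D \<epsilon> = D \<inter> {x. infdist x (frontier D) < \<epsilon>}"
    by (auto simp: boundary_collar_def)
  ultimately show ?thesis using D by auto
qed

lemma mem_boundary_collar: "x \<in> D \<Longrightarrow> p \<in> frontier D \<Longrightarrow> dist x p < \<epsilon> \<Longrightarrow> x \<in> boundary_collar D \<epsilon>"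
  using infdist_le[of p "frontier D" x] by (simp add: boundary_collar_def)

lemma frontier_collar_closure:
  assumes D: "open D" and \<epsilon>: "0 < \<epsilon>"
  shows "frontier D \<subseteq> closure (boundary_collar D \<epsilon>) - boundary_collar D \<epsilon>"
proof
  fix p assume p: "p \<in> frontier D"
  have "p \<in> closure (boundary_collar D \<epsilon>)"
    unfolding closure_approachable
  proof (intro allI impI)
    fix \<eta> :: real assume "0 < \<eta>"
    then have "0 < min \<eta> \<epsilon>" using \<epsilon> by simp
    moreover have "p \<in> closure D" using p by (simp add: frontier_def)
    ultimately obtain x where x: "x \<in> D" "dist x p < min \<eta> \<epsilon>"
      unfolding closure_approachable by blast
    then show "\<exists>y\<in>boundary_collar D \<epsilon>. dist y p < \<eta>"
      using mem_boundary_collar[OF x(1) p, of \<epsilon>] by auto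
  qed
  moreover have "p \<notin> boundary_collar D \<epsilon>"
    using p D by (auto simp: boundary_collar_def frontier_def interior_open)
  ultimately show "p \<in> closure (boundary_collar D \<epsilon>) - boundary_collar D \<epsilon>" by blast
qed

context graph_patch
begin

lemma line_in_collar:
  assumes p: "p \<in> ball z r" "p \<in> frontier D" and \<epsilon>: "0 < \<epsilon>"
  shows "\<forall>\<^sub>F t in at_right 0. p + t *\<^sub>R e \<in> boundary_collar D \<epsilon>"
proof -
  have hp: "height p = 0" using p frontier_iff by blast
  have "\<forall>\<^sub>F t in at_right 0. p + t *\<^sub>R e \<in> ball z r" by (rule line_eventually) (use p in auto)
  moreover have "\<forall>\<^sub>F t in at_right 0. p + t *\<^sub>R e \<in> ball p \<epsilon>" by (rule line_eventually) (use \<epsilon> in auto)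
  moreover have "\<forall>\<^sub>F t in at_right (0::real). 0 < t" by (simp add: eventually_at_right_less)
  ultimately show ?thesis
  proof eventually_elim
    case (elim t)
    then have "p + t *\<^sub>R e \<in> D" using mem_D hp height_add by simp
    then show ?case using elim(2) by (intro mem_boundary_collar[OF _ p(2)]) (simp_all add: dist_commute)
  qed
qed

lemma tendsto_along_line:
  assumes p: "p \<in> ball z r" "p \<in> frontier D" and \<epsilon>: "0 < \<epsilon>"
    and g: "(g \<longlongrightarrow> l) (at p within boundary_collar D \<epsilon>)"
  shows "((\<lambda>t. g (p + t *\<^sub>R e)) \<longlongrightarrow> l) (at_right 0)"
proof -
  have "filterlim (\<lambda>t. p + t *\<^sub>R e) (at p within boundary_collar D \<epsilon>) (at_right 0)"
    unfolding filterlim_at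
  proof
    have "((\<lambda>t. p + t *\<^sub>R e) \<longlongrightarrow> p + 0 *\<^sub>R e) (at_right 0)" by (intro tendsto_intros)
    then show "((\<lambda>t. p + t *\<^sub>R e) \<longlongrightarrow> p) (at_right 0)" by simp
    show "\<forall>\<^sub>F t in at_right 0. p + t *\<^sub>R e \<in> boundary_collar D \<epsilon> \<and> p + t *\<^sub>R e \<noteq> p"
      using line_in_collar[OF p \<epsilon>]
    proof (rule eventually_mono)
      fix t assume "p + t *\<^sub>R e \<in> boundary_collar D \<epsilon>"
      moreover have "p \<notin> D" using p D by (simp add: frontier_def interior_open)
      ultimately show "p + t *\<^sub>R e \<in> boundary_collar D \<epsilon> \<and> p + t *\<^sub>R e \<noteq> p"
        by (auto simp: boundary_collar_def)
    qed
  qed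
  from filterlim_compose[OF g this] show ?thesis .
qed

text \<open>Along the boundary-parallel curves \<open>\<tau> \<mapsto> foot (p + \<tau> v) + t e\<close> the increment of \<open>G\<close> tends to \<open>0\<close> as \<open>t\<close> does,
  while it is almost \<open>\<tau>\<close> times the tangential derivative at \<open>p\<close>.\<close>

lemma tangential_derivative_zero:
  assumes p: "p \<in> ball z r" "p \<in> frontier D" and \<epsilon>: "0 < \<epsilon>" and v: "slope p \<bullet> v = 0"
    and G: "Cext 1 (boundary_collar D \<epsilon>) G"
    and G0: "\<And>x. x \<in> frontier D \<Longrightarrow> boundary_value (boundary_collar D \<epsilon>) G x = 0"
  shows "(\<Sum>j\<in>UNIV. boundary_value (boundary_collar D \<epsilon>) (partial j G) p * v $ j) = 0"
proof (rule ccontr)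
  let ?S = "boundary_collar D \<epsilon>"
  let ?q = "\<Sum>j\<in>UNIV. boundary_value ?S (partial j G) p * v $ j"
  assume "?q \<noteq> 0"
  define \<eta> where "\<eta> = \<bar>?q\<bar> / 2"
  have \<eta>: "0 < \<eta>" using \<open>?q \<noteq> 0\<close> by (simp add: \<eta>_def)
  note Fcl = frontier_collar_closure[OF D \<epsilon>]
  have pS: "p \<in> closure ?S" "p \<notin> ?S" using Fcl p by auto
  define \<Gamma> where "\<Gamma> = (\<chi> j. boundary_value ?S (partial j G) p)"
  have q\<Gamma>: "?q = \<Gamma> \<bullet> v" by (simp add: \<Gamma>_def inner_vec_def)
  have "(gradient G \<longlongrightarrow> \<Gamma>) (at p within ?S)"
    unfolding \<Gamma>_def gradient_def[abs_def]
    by (intro tendsto_vec_lambda boundary_value_tendsto pS) (use G in simp)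
  moreover have "(slope \<longlongrightarrow> slope p) (at p within ?S)"
    using slope_cont p(1) by (meson at_le continuous_on_eq_continuous_at isCont_def open_ball subset_UNIV tendsto_mono)
  ultimately have \<Gamma>v: "((\<lambda>x. gradient G x \<bullet> v) \<longlongrightarrow> \<Gamma> \<bullet> v) (at p within ?S)"
    and \<Gamma>e: "((\<lambda>x. gradient G x \<bullet> e) \<longlongrightarrow> \<Gamma> \<bullet> e) (at p within ?S)"
    by (auto intro!: tendsto_intros)
  have "\<forall>\<^sub>F x in at p within ?S. dist (gradient G x \<bullet> v) (\<Gamma> \<bullet> v) < \<eta> / 2"
    "\<forall>\<^sub>F x in at p within ?S. dist (gradient G x \<bullet> e) (\<Gamma> \<bullet> e) < 1"
    using tendstoD[OF \<Gamma>v, of "\<eta> / 2"] tendstoD[OF \<Gamma>e, of 1] \<eta> by simp_all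
  then have "\<forall>\<^sub>F x in at p within ?S. dist (gradient G x \<bullet> v) (\<Gamma> \<bullet> v) < \<eta> / 2 \<and> dist (gradient G x \<bullet> e) (\<Gamma> \<bullet> e) < 1"
    by (rule eventually_conj)
  then obtain \<rho>1 where \<rho>1: "\<rho>1 > 0" "\<And>x. x \<in> ?S \<Longrightarrow> dist x p < \<rho>1 \<Longrightarrow> dist (gradient G x \<bullet> v) (\<Gamma> \<bullet> v) < \<eta> / 2 \<and> dist (gradient G x \<bullet> e) (\<Gamma> \<bullet> e) < 1"
    unfolding eventually_at using pS(2) by metis
  \<comment> \<open>The curves have velocity \<open>v\<close> minus
    \<open>(slope \<bullet> v)\<close> times \<open>e\<close>. The factor
    \<open>slope \<bullet> v\<close> is 0 at \<open>p\<close> and small nearby; \<open>M\<close>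
    bounds the derivative of \<open>G\<close> along \<open>e\<close> by which it is
    multiplied.\<close>
  define M where "M = \<bar>\<Gamma> \<bullet> e\<bar> + 1"
  have M: "0 < M" by (simp add: M_def)
  have hp: "height p = 0" using p frontier_iff by blast
  have sc: "((\<lambda>\<tau>. slope (p + \<tau> *\<^sub>R v) \<bullet> v) \<longlongrightarrow> slope p \<bullet> v) (at_right 0)"
  proof (intro tendsto_intros)
    have "(slope \<longlongrightarrow> slope p) (nhds p)"
      using slope_cont p(1) by (metis continuous_on_eq_continuous_at isCont_def open_ball tendsto_at_iff_tendsto_nhds)
    moreover have "((\<lambda>\<tau>. p + \<tau> *\<^sub>R v) \<longlongrightarrow> p + 0 *\<^sub>R v) (at_right 0)" by (intro tendsto_intros)
    ultimately show "((\<lambda>\<tau>. slope (p + \<tau> *\<^sub>R v)) \<longlongrightarrow> slope p) (at_right 0)"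
      by (auto intro: filterlim_compose)
  qed
  then have e1: "\<forall>\<^sub>F \<tau> in at_right 0. \<bar>slope (p + \<tau> *\<^sub>R v) \<bullet> v\<bar> < \<eta> / (2 * M)"
    using tendstoD[OF sc, of "\<eta> / (2 * M)"] \<eta> M v by (simp add: dist_real_def)
  have e2: "\<forall>\<^sub>F \<tau> in at_right 0. p + \<tau> *\<^sub>R v \<in> ball z r" by (rule line_eventually) (use p in auto)
  have "continuous_on (ball z r) foot" unfolding foot_def[abs_def] by (intro continuous_intros height_cont)
  then have "open (ball z r \<inter> foot -` (ball p (min \<rho>1 \<epsilon> / 2) \<inter> ball z r))"
    by (intro continuous_open_preimage) auto
  moreover have "p \<in> ball z r \<inter> foot -` (ball p (min \<rho>1 \<epsilon> / 2) \<inter> ball z r)"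
    using p foot_eq[OF p] \<rho>1(1) \<epsilon> by simp
  ultimately have e3: "\<forall>\<^sub>F \<tau> in at_right 0. p + \<tau> *\<^sub>R v \<in> ball z r \<inter> foot -` (ball p (min \<rho>1 \<epsilon> / 2) \<inter> ball z r)"
    by (rule line_eventually)
  have "\<forall>\<^sub>F \<tau> in at_right 0. \<bar>slope (p + \<tau> *\<^sub>R v) \<bullet> v\<bar> < \<eta> / (2 * M) \<and>
      p + \<tau> *\<^sub>R v \<in> ball z r \<and> foot (p + \<tau> *\<^sub>R v) \<in> ball p (min \<rho>1 \<epsilon> / 2) \<and> foot (p + \<tau> *\<^sub>R v) \<in> ball z r"
    using e1 e3 by eventually_elim auto
  then obtain b where b: "0 < b" "\<And>\<tau>. 0 < \<tau> \<Longrightarrow> \<tau> < b \<Longrightarrow> \<bar>slope (p + \<tau> *\<^sub>R v) \<bullet> v\<bar> < \<eta> / (2 * M) \<and>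
      p + \<tau> *\<^sub>R v \<in> ball z r \<and> foot (p + \<tau> *\<^sub>R v) \<in> ball p (min \<rho>1 \<epsilon> / 2) \<and> foot (p + \<tau> *\<^sub>R v) \<in> ball z r"
    unfolding eventually_at_right_field by blast
  \<comment> \<open>\<open>T\<close> stays fixed while \<open>t\<close> tends to 0: over the whole
    interval the increment of \<open>G\<close> is within \<open>T * \<eta>\<close> of
    \<open>T * ?q\<close>, and in the limit it is a difference of two zero boundary values.\<close>
  define T where "T = b / 2"
  have T: "0 < T" "T < b" using b by (auto simp: T_def)
  have near: "\<bar>slope (p + \<tau> *\<^sub>R v) \<bullet> v\<bar> < \<eta> / (2 * M)" "p + \<tau> *\<^sub>R v \<in> ball z r"
      "foot (p + \<tau> *\<^sub>R v) \<in> ball p (min \<rho>1 \<epsilon> / 2)" "foot (p + \<tau> *\<^sub>R v) \<in> ball z r" if "0 \<le> \<tau>" "\<tau> \<le> T" for \<tau>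
  proof -
    have "\<bar>slope (p + \<tau> *\<^sub>R v) \<bullet> v\<bar> < \<eta> / (2 * M) \<and>
      p + \<tau> *\<^sub>R v \<in> ball z r \<and> foot (p + \<tau> *\<^sub>R v) \<in> ball p (min \<rho>1 \<epsilon> / 2) \<and> foot (p + \<tau> *\<^sub>R v) \<in> ball z r"
    proof (cases "\<tau> = 0")
      case True
      then show ?thesis using v \<eta> M p foot_eq[OF p] \<rho>1(1) \<epsilon> by simp
    next
      case False
      then show ?thesis using b(2)[of \<tau>] that T by auto
    qed
    then show "\<bar>slope (p + \<tau> *\<^sub>R v) \<bullet> v\<bar> < \<eta> / (2 * M)" "p + \<tau> *\<^sub>R v \<in> ball z r"
      "foot (p + \<tau> *\<^sub>R v) \<in> ball p (min \<rho>1 \<epsilon> / 2)" "foot (p + \<tau> *\<^sub>R v) \<in> ball z r" by blast+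
  qed
  \<comment> \<open>Compactness of the curve of feet provides a margin \<open>d\<close>, so for all
    small \<open>t\<close> the curve shifted by \<open>t\<close> along \<open>e\<close> remains in
    the patch.\<close>
  have "compact ((\<lambda>\<tau>. foot (p + \<tau> *\<^sub>R v)) ` {0..T})"
    using near(2) by (intro compact_continuous_image continuous_on_compose2[OF \<open>continuous_on (ball z r) foot\<close>] continuous_intros) auto
  moreover have "(\<lambda>\<tau>. foot (p + \<tau> *\<^sub>R v)) ` {0..T} \<subseteq> ball z r" using near(4) by auto
  ultimately obtain d where d: "0 < d" "\<And>x y. x \<in> (\<lambda>\<tau>. foot (p + \<tau> *\<^sub>R v)) ` {0..T} \<Longrightarrow> dist x y < d \<Longrightarrow> y \<in> ball z r"
    using compact_subset_open_imp_ball_epsilon_subset[of "(\<lambda>\<tau>. foot (p + \<tau> *\<^sub>R v)) ` {0..T}" "ball z r"]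
    by (metis (no_types, lifting) UN_I mem_ball open_ball subset_iff)
  define t0 where "t0 = min d (min \<rho>1 \<epsilon> / 2)"
  have t0: "0 < t0" using d \<rho>1 \<epsilon> by (simp add: t0_def)
  define w where "w t \<tau> = p + \<tau> *\<^sub>R v + (t - height (p + \<tau> *\<^sub>R v)) *\<^sub>R e" for t \<tau>
  have w_foot: "w t \<tau> = foot (p + \<tau> *\<^sub>R v) + t *\<^sub>R e" for t \<tau> by (simp add: w_def foot_def algebra_simps)
  have wS: "w t \<tau> \<in> ?S" "dist (w t \<tau>) p < \<rho>1" if "0 < t" "t < t0" "0 \<le> \<tau>" "\<tau> \<le> T" for t \<tau>
  proof -
    have dd: "dist (foot (p + \<tau> *\<^sub>R v)) (w t \<tau>) = t" using that(1) e by (simp add: w_foot dist_norm)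
    have "w t \<tau> \<in> ball z r" by (rule d(2)[of "foot (p + \<tau> *\<^sub>R v)"]) (use that dd in \<open>auto simp: t0_def\<close>)
    moreover have "height (w t \<tau>) = t" by (simp add: w_foot height_add height_foot)
    ultimately have wD: "w t \<tau> \<in> D" using mem_D that by simp
    have "dist (w t \<tau>) p < min \<rho>1 \<epsilon>"
      using near(3)[OF that(3,4)] dd dist_triangle[of "w t \<tau>" p "foot (p + \<tau> *\<^sub>R v)"] that(2)
      by (simp add: t0_def dist_commute)
    then show "w t \<tau> \<in> ?S" "dist (w t \<tau>) p < \<rho>1" using mem_boundary_collar[OF wD p(2), of \<epsilon>] by auto
  qed
  have step: "\<bar>(G (w t T) - G (w t 0)) - T * ?q\<bar> \<le> T * \<eta>" if t: "0 < t" "t < t0" for t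
  proof -
    let ?g' = "\<lambda>\<tau>. gradient G (w t \<tau>) \<bullet> (v - (slope (p + \<tau> *\<^sub>R v) \<bullet> v) *\<^sub>R e)"
    have "((\<lambda>\<tau>. G (w t \<tau>)) has_real_derivative ?g' \<tau>) (at \<tau>)" if "0 \<le> \<tau>" "\<tau> \<le> T" for \<tau>
    proof -
      have l: "((\<lambda>\<tau>. p + \<tau> *\<^sub>R v) has_derivative (\<lambda>h. h *\<^sub>R v)) (at \<tau>)" by (auto intro!: derivative_eq_intros)
      have hd: "((\<lambda>\<tau>. height (p + \<tau> *\<^sub>R v)) has_derivative (\<lambda>h. slope (p + \<tau> *\<^sub>R v) \<bullet> (h *\<^sub>R v))) (at \<tau>)"
        by (rule has_derivative_compose[OF l height_deriv[OF near(2)[OF that]]])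
      have "(w t has_derivative (\<lambda>h. h *\<^sub>R v + (0 - slope (p + \<tau> *\<^sub>R v) \<bullet> (h *\<^sub>R v)) *\<^sub>R e)) (at \<tau>)"
        unfolding w_def[abs_def] by (intro derivative_intros l hd)
      moreover have "G differentiable (at (w t \<tau>))" using G wS(1)[OF t that] by simp
      ultimately have "((\<lambda>\<tau>. G (w t \<tau>)) has_derivative (\<lambda>h. gradient G (w t \<tau>) \<bullet> (h *\<^sub>R v + (0 - slope (p + \<tau> *\<^sub>R v) \<bullet> (h *\<^sub>R v)) *\<^sub>R e))) (at \<tau>)"
        by (intro has_derivative_compose[OF _ has_derivative_gradient])
      then show ?thesis
        by (rule has_derivative_imp_has_field_derivative) (simp add: inner_add_right inner_diff_right algebra_simps)
    qed
    from MVT2[OF T(1) this] obtain \<tau> where \<tau>: "0 < \<tau>" "\<tau> < T" "G (w t T) - G (w t 0) = (T - 0) * ?g' \<tau>" by blast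
    have n: "dist (gradient G (w t \<tau>) \<bullet> v) (\<Gamma> \<bullet> v) < \<eta> / 2" "dist (gradient G (w t \<tau>) \<bullet> e) (\<Gamma> \<bullet> e) < 1"
      using \<rho>1(2) wS[OF t, of \<tau>] \<tau> by auto
    have "\<bar>gradient G (w t \<tau>) \<bullet> e\<bar> \<le> M" using n(2) by (simp add: M_def dist_real_def abs_if split: if_splits)
    then have "\<bar>(slope (p + \<tau> *\<^sub>R v) \<bullet> v) * (gradient G (w t \<tau>) \<bullet> e)\<bar> \<le> \<eta> / (2 * M) * M"
      unfolding abs_mult using near(1)[of \<tau>] \<tau> M \<eta> by (intro mult_mono) auto
    also have "\<dots> = \<eta> / 2" using M by simp
    finally have "\<bar>?g' \<tau> - ?q\<bar> \<le> \<eta>"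
      using n(1) unfolding q\<Gamma> dist_real_def inner_diff_right inner_scaleR_right by linarith
    then have "T * \<bar>?g' \<tau> - ?q\<bar> \<le> T * \<eta>" using T by (intro mult_left_mono) auto
    moreover have "(G (w t T) - G (w t 0)) - T * ?q = T * (?g' \<tau> - ?q)" using \<tau>(3) by (simp add: right_diff_distrib)
    ultimately show ?thesis using T by (simp add: abs_mult)
  qed
  have lim: "((\<lambda>t. G (w t \<tau>)) \<longlongrightarrow> 0) (at_right 0)" if "0 \<le> \<tau>" "\<tau> \<le> T" for \<tau>
  proof -
    have f: "foot (p + \<tau> *\<^sub>R v) \<in> ball z r" "foot (p + \<tau> *\<^sub>R v) \<in> frontier D" using near(4)[OF that] foot_frontier by auto
    have "(G \<longlongrightarrow> boundary_value ?S G (foot (p + \<tau> *\<^sub>R v))) (at (foot (p + \<tau> *\<^sub>R v)) within ?S)"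
      by (rule boundary_value_tendsto) (use G Fcl f in auto)
    then have "(G \<longlongrightarrow> 0) (at (foot (p + \<tau> *\<^sub>R v)) within ?S)" using G0[OF f(2)] by simp
    from tendsto_along_line[OF f \<epsilon> this] show ?thesis unfolding w_foot .
  qed
  have "((\<lambda>t. \<bar>(G (w t T) - G (w t 0)) - T * ?q\<bar>) \<longlongrightarrow> \<bar>(0 - 0) - T * ?q\<bar>) (at_right 0)"
    using T by (intro tendsto_intros lim) auto
  moreover have "\<forall>\<^sub>F t in at_right 0. \<bar>(G (w t T) - G (w t 0)) - T * ?q\<bar> \<le> T * \<eta>"
    using eventually_at_right_real[OF t0] by (rule eventually_mono) (use step in auto)
  ultimately have "\<bar>(0 - 0) - T * ?q\<bar> \<le> T * \<eta>" by (rule tendsto_upperbound) simp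
  then have "T * \<bar>?q\<bar> \<le> T * \<eta>" using T by (simp add: abs_mult)
  then have "\<bar>?q\<bar> \<le> \<eta>" using T by simp
  then show False using \<eta> by (simp add: \<eta>_def)
qed

text \<open>The vector \<open>axis j 1\<close> minus \<open>slope p $ j\<close> times
  \<open>e\<close> is tangential because the slope has product 1 with \<open>e\<close>. So the
  boundary gradient of \<open>G\<close> is a multiple of the slope, and each partial is determined
  by the one in direction \<open>i\<close>.\<close>

lemma tangential_partials:
  assumes p: "p \<in> ball z r" "p \<in> frontier D" and \<epsilon>: "0 < \<epsilon>" and es: "e = s *\<^sub>R axis i 1" "s \<in> {-1, 1}"
    and G: "Cext 1 (boundary_collar D \<epsilon>) G"
    and G0: "\<And>x. x \<in> frontier D \<Longrightarrow> boundary_value (boundary_collar D \<epsilon>) G x = 0"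
  shows "boundary_value (boundary_collar D \<epsilon>) (partial j G) p
    = slope p $ j * s * boundary_value (boundary_collar D \<epsilon>) (partial i G) p"
proof -
  let ?v = "axis j 1 - (slope p $ j) *\<^sub>R e"
  have "slope p \<bullet> ?v = 0" using slope_e[OF p(1)] by (simp add: inner_diff_right inner_axis)
  from tangential_derivative_zero[OF p \<epsilon> this G G0]
  have 0: "(\<Sum>l\<in>UNIV. boundary_value (boundary_collar D \<epsilon>) (partial l G) p * ?v $ l) = 0" by simp
  let ?\<Gamma> = "(\<chi> l. boundary_value (boundary_collar D \<epsilon>) (partial l G) p) :: real^'n"
  have "(\<Sum>l\<in>UNIV. boundary_value (boundary_collar D \<epsilon>) (partial l G) p * ?v $ l) = ?\<Gamma> \<bullet> ?v"
    by (simp add: inner_vec_def)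
  also have "\<dots> = ?\<Gamma> $ j - slope p $ j * (s * ?\<Gamma> $ i)"
    by (simp only: inner_diff_right inner_scaleR_right es(1) inner_axis inner_real_def mult_1_right)
  finally show ?thesis using 0 by simp
qed

text \<open>A derivative of order \<open>k - 1\<close> vanishes on the whole boundary, so its
  derivative in direction \<open>j\<close> can be exchanged for the one in direction
  \<open>i\<close> at the price of a slope component. Repeating this converts every direction to
  \<open>i\<close>.\<close>

lemma rank_one_partials:
  assumes p: "p \<in> ball z r" "p \<in> frontier D" and \<epsilon>: "0 < \<epsilon>" and es: "e = s *\<^sub>R axis i 1" "s \<in> {-1, 1}"
    and \<mu>: "Ck_closure k (boundary_collar D \<epsilon>) \<mu>"
    and van: "\<And>is x. length is < k \<Longrightarrow> x \<in> frontier D \<Longrightarrow> boundary_value (boundary_collar D \<epsilon>) (partials is \<mu>) x = 0"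
    and len: "length js + m = k"
  shows "boundary_value (boundary_collar D \<epsilon>) (partials (js @ replicate m i) \<mu>) p =
    prod_list (map (\<lambda>j. slope p $ j * s) js) * boundary_value (boundary_collar D \<epsilon>) (partials (replicate k i) \<mu>) p"
  using len
proof (induction js arbitrary: m)
  case (Cons j js)
  let ?S = "boundary_collar D \<epsilon>"
  let ?G = "partials (js @ replicate m i) \<mu>"
  have Ck: "Ck_on k ?S \<mu>" using \<mu> by (simp add: Ck_closure_def)
  have lk: "length (js @ replicate m i) + 1 = k" using Cons.prems by simp
  have "Cext 1 ?S ?G"
  proof -
    have e: "extends_to_closure ?S (partials is \<mu>)" if "length is \<le> k" for "is"
      using \<mu> that unfolding Ck_closure_def extends_to_closure_def by blast
    have "extends_to_closure ?S ?G" using e lk by (metis le_add1)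
    moreover have "extends_to_closure ?S (partial l ?G)" for l
      using e[of "l # js @ replicate m i"] lk by (simp add: partials_Cons)
    moreover have "\<forall>x\<in>?S. ?G differentiable (at x)"
      using Ck lk unfolding Ck_on_def by (metis less_add_one)
    ultimately show ?thesis by simp
  qed
  moreover have "boundary_value ?S ?G x = 0" if "x \<in> frontier D" for x
    using van[OF _ that] lk by (metis less_add_one)
  ultimately have "boundary_value ?S (partial j ?G) p = slope p $ j * s * boundary_value ?S (partial i ?G) p"
    by (rule tangential_partials[OF p \<epsilon> es])
  \<comment> \<open>Commuting the derivatives brings the new \<open>i\<close> to the innermost block
    of directions \<open>i\<close>; the induction continues with the shorter list.\<close>
  also have "boundary_value ?S (partial i ?G) p = boundary_value ?S (partials (js @ replicate (Suc m) i) \<mu>) p"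
  proof (rule boundary_value_cong)
    fix x assume x: "x \<in> ?S"
    have "partials (i # (js @ replicate m i)) \<mu> x = partials ((js @ replicate m i) @ [i]) \<mu> x"
      by (rule partials_rotate[OF open_boundary_collar[OF D] Ck _ x]) (use lk in simp)
    then show "partial i ?G x = partials (js @ replicate (Suc m) i) \<mu> x"
      by (simp add: partials_Cons replicate_append_same)
  qed
  also have "\<dots> = prod_list (map (\<lambda>j. slope p $ j * s) js) * boundary_value ?S (partials (replicate k i) \<mu>) p"
    using Cons.prems by (intro Cons.IH) simp
  finally show ?case by (simp add: partials_Cons mult_ac)
qed simp

end

section \<open>Integrals over a boundary patch\<close>

lemma nn_integral_gamma:
  fixes b :: real
  assumes b: "0 < b"
  shows "(\<integral>\<^sup>+t. ennreal (indicator {0<..} t * (t ^ k * exp (- b * t))) \<partial>lborel) = ennreal (fact k / b ^ (k + 1))"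
proof -
  let ?F = "\<lambda>x::real. ennreal (x ^ k * exp (- x)) * indicator {0..} x"
  let ?J = "\<lambda>t::real. ennreal (indicator {0<..} t * (t ^ k * exp (- b * t)))"
  have "ennreal (fact k) = (\<integral>\<^sup>+x. ?F x \<partial>lborel)" using nn_intergal_power_times_exp_Ici[of k] by simp
  also have "\<dots> = ennreal b * (\<integral>\<^sup>+x. ?F (0 + b * x) \<partial>lborel)"
    using nn_integral_real_affine[of ?F b 0] b by simp
  also have "(\<integral>\<^sup>+x. ?F (0 + b * x) \<partial>lborel) = (\<integral>\<^sup>+t. ennreal (b ^ k) * ?J t \<partial>lborel)"
  proof (rule nn_integral_cong_AE)
    show "AE t in lborel. ?F (0 + b * t) = ennreal (b ^ k) * ?J t"
      using AE_lborel_singleton[of "0::real"]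
    proof eventually_elim
      case (elim t)
      then show ?case
      proof (cases "0 < t")
        case True
        then have "?F (0 + b * t) = ennreal (b ^ k * (t ^ k * exp (- b * t)))"
          using b by (simp add: power_mult_distrib mult.assoc)
        also have "\<dots> = ennreal (b ^ k) * ?J t" using True b by (simp add: ennreal_mult)
        finally show ?thesis .
      next
        case False
        then have "b * t < 0" using elim b by (simp add: mult_less_0_iff)
        then show ?thesis using False by simp
      qed
    qed
  qed
  also have "\<dots> = ennreal (b ^ k) * (\<integral>\<^sup>+t. ?J t \<partial>lborel)" by (rule nn_integral_cmult) measurable
  finally have "ennreal (1 / b ^ (k + 1)) * ennreal (fact k) = ennreal (1 / b ^ (k + 1)) * (ennreal b * ennreal (b ^ k)) * (\<integral>\<^sup>+t. ?J t \<partial>lborel)"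
    by (simp only: mult.assoc)
  moreover have "ennreal (1 / b ^ (k + 1)) * (ennreal b * ennreal (b ^ k)) = 1"
    using b by (simp add: ennreal_mult[symmetric])
  moreover have "ennreal (1 / b ^ (k + 1)) * ennreal (fact k) = ennreal (fact k / b ^ (k + 1))"
    using b by (simp add: ennreal_mult[symmetric])
  ultimately show ?thesis by simp
qed

lemma integral_gamma:
  fixes b :: real
  assumes b: "0 < b"
  shows "(LINT t|lborel. indicator {0<..} t * (t ^ k * exp (- b * t))) = fact k / b ^ (k + 1)"
proof -
  have "(LINT t|lborel. indicator {0<..} t * (t ^ k * exp (- b * t))) = enn2real (ennreal (fact k / b ^ (k + 1)))"
    unfolding nn_integral_gamma[OF b, symmetric]
    by (rule integral_eq_nn_integral) (auto split: split_indicator)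
  then show ?thesis using b by simp
qed

lemma integral_slab_measure:
  fixes f :: "'a::euclidean_space \<times> real \<Rightarrow> real"
  assumes "integrable (slab_measure e) f" and [measurable]: "f \<in> borel_measurable (borel \<Otimes>\<^sub>M borel)"
  shows "(LINT p|slab_measure e. f p) = (LINT y|lborel. indicator {0..1} (e \<bullet> y) * (LINT t|lborel. f (y, t)))"
proof -
  let ?I = "\<lambda>p::'a \<times> real. indicator {0..1} (e \<bullet> fst p) :: real"
  have eq: "slab_measure e = density (lborel \<Otimes>\<^sub>M lborel) (\<lambda>p. ennreal (?I p))"
    unfolding slab_measure_def by (intro arg_cong[where f = "density _"]) (auto simp: fun_eq_iff split: split_indicator)
  have "integrable (lborel \<Otimes>\<^sub>M lborel) (\<lambda>p. ?I p *\<^sub>R f p)"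
    using assms(1) unfolding eq by (subst (asm) integrable_density) auto
  then have "(LINT y|lborel. LINT t|lborel. ?I (y, t) *\<^sub>R f (y, t)) = (LINT p|(lborel \<Otimes>\<^sub>M lborel). ?I p *\<^sub>R f p)"
    by (rule lborel_pair.integral_fst')
  moreover have "(LINT p|slab_measure e. f p) = (LINT p|(lborel \<Otimes>\<^sub>M lborel). ?I p *\<^sub>R f p)"
    unfolding eq by (subst integral_density) auto
  ultimately show ?thesis by simp
qed

text \<open>What dominated convergence on one patch needs: \<open>mu_lim\<close> and
  \<open>profile\<close> describe the rescaled integrand pointwise, \<open>mu_bound\<close> and
  \<open>decay\<close> supply its majorant.\<close>

locale patch_limit = graph_patch D z r e \<gamma>
  for D :: "(real^'n::finite) set" and z :: "real^'n" and r :: real and e :: "real^'n" and \<gamma> :: "real^'n \<Rightarrow> real" +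
  fixes \<epsilon> :: real and \<mu> :: "real^'n \<Rightarrow> real" and k :: nat and \<theta> \<kappa> :: "real^'n \<Rightarrow> real" and \<kappa>0 :: real
    and h :: "nat \<Rightarrow> real" and u :: "nat \<Rightarrow> real^'n \<Rightarrow> real" and K Kd \<tau> :: real
  assumes bD: "bounded D" and z: "z \<in> frontier D" and eps: "0 < \<epsilon>"
    and mu_cont: "continuous_on (boundary_collar D \<epsilon>) \<mu>"
    and mu_lim: "\<And>p. p \<in> ball z r \<Longrightarrow> p \<in> frontier D \<Longrightarrow>
      ((\<lambda>t. \<mu> (p + t *\<^sub>R e) / t ^ k) \<longlongrightarrow> \<theta> p * (normal p \<bullet> e) ^ k / fact k) (at_right 0)"
    and mu_bound: "\<And>r1. 0 < r1 \<Longrightarrow> r1 < r \<Longrightarrow> \<exists>C t0. 0 < t0 \<and> 0 \<le> C \<and>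
      (\<forall>p\<in>frontier D \<inter> cball z r1. \<forall>t. 0 < t \<longrightarrow> t < t0 \<longrightarrow> \<bar>\<mu> (p + t *\<^sub>R e)\<bar> \<le> C * t ^ k)"
    and th_cont: "continuous_on (frontier D) \<theta>" and ka_cont: "continuous_on (frontier D) \<kappa>"
    and ka: "0 < \<kappa>0" "\<And>p. p \<in> frontier D \<Longrightarrow> \<kappa>0 \<le> \<kappa> p"
    and h: "\<And>j. 0 < h j" "h \<longlonglongrightarrow> 0"
    and u_cont: "\<And>j. continuous_on (closure D) (u j)"
    and K: "\<And>j x. x \<in> closure D \<Longrightarrow> \<bar>u j x\<bar> \<le> K"
    and Kd: "0 \<le> Kd" and tau: "0 < \<tau>"
    and decay: "\<And>j x \<rho>. 0 < \<rho> \<Longrightarrow> ball x \<rho> \<subseteq> D \<Longrightarrow> \<bar>u j x\<bar> \<le> Kd * exp (- (\<tau> * \<rho> / h j))"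
    and profile: "\<And>p t. p \<in> ball z r \<Longrightarrow> p \<in> frontier D \<Longrightarrow> 0 < t \<Longrightarrow>
      (\<lambda>j. u j (p + (h j * t) *\<^sub>R e) - u j p * exp (- (\<kappa> p * (normal p \<bullet> e)) * t)) \<longlonglongrightarrow> 0"
begin

abbreviation (input) "S \<equiv> boundary_collar D \<epsilon>"

definition weight :: "real^'n \<Rightarrow> real" where "weight x = \<theta> x / \<kappa> x ^ (k + 1)"

lemma measurable_on_frontier:
  "continuous_on (frontier D) g \<Longrightarrow> (\<lambda>x. if x \<in> frontier D then g x else 0 :: real) \<in> borel_measurable borel"
  by (rule borel_measurable_continuous_on_if) auto

text \<open>Points near the boundary are written as a foot plus \<open>h t\<close> times
  \<open>e\<close>. Of the power \<open>h^(k+1)\<close> one factor is the Jacobian and the others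
  come from the vanishing of \<open>\<mu>\<close>. What remains converges pointwise against an
  exponential profile, and the Gamma integral over \<open>t\<close> produces the power of
  \<open>\<kappa>\<close> in the weight. The cutoff \<open>\<zeta>\<close> keeps everything inside
  the patch.\<close>

lemma patch_integral_limit:
  obtains r2 where "0 < r2" "r2 < r"
    "\<And>\<zeta> c. continuous_on UNIV \<zeta> \<Longrightarrow> (\<And>x. \<bar>\<zeta> x\<bar> \<le> 1) \<Longrightarrow> (\<And>x. x \<notin> ball z r2 \<Longrightarrow> \<zeta> x = 0) \<Longrightarrow>
      is_hausdorff_ratio TYPE('n) c \<Longrightarrow>
      (\<lambda>j. (LINT x|lborel. (if x \<in> S then \<zeta> x * u j x * \<mu> x else 0)) / h j ^ (k + 1)
         - (1 / c) * (LINT x|hausdorff_measure (CARD('n) - 1). (if x \<in> frontier D then \<zeta> x * u j x * weight x else 0))) \<longlonglongrightarrow> 0"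
proof -
  define r1 where "r1 = r / 2"
  have r1: "0 < r1" "r1 < r" using r by (auto simp: r1_def)
  obtain L where L: "1 \<le> L" and Lh: "\<And>x y. x \<in> cball z r1 \<Longrightarrow> y \<in> cball z r1 \<Longrightarrow> \<bar>height x - height y\<bar> \<le> L * dist x y"
    and Ls: "\<And>x. x \<in> cball z r1 \<Longrightarrow> norm (slope x) \<le> L"
    using height_lipschitz[OF r1] by metis
  obtain C t0 where t0: "0 < t0" and C: "0 \<le> C"
    and mb: "\<And>p t. p \<in> frontier D \<inter> cball z r1 \<Longrightarrow> 0 < t \<Longrightarrow> t < t0 \<Longrightarrow> \<bar>\<mu> (p + t *\<^sub>R e)\<bar> \<le> C * t ^ k"
    using mu_bound[OF r1] by blast
  \<comment> \<open>Points of the ball of radius \<open>r2\<close> have height at most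
    \<open>L r2 < t0\<close>, so that the bound on \<open>\<mu>\<close> applies to them, and their
    feet stay within distance \<open>r1\<close> of \<open>z\<close>.\<close>
  define r2 where "r2 = min r1 t0 / (2 * (L + 1))"
  have r2: "0 < r2" using r1 t0 L by (simp add: r2_def)
  have "L + 1 \<noteq> 0" using L by simp
  then have r2': "(L + 1) * r2 = min r1 t0 / 2" unfolding r2_def by (metis mult.commute nonzero_mult_div_cancel_left times_divide_eq_right mult_divide_mult_cancel_left)
  then have Lr2: "L * r2 + r2 = min r1 t0 / 2" by (simp add: algebra_simps)
  have Lr2p: "0 < L * r2" using L r2 by simp
  have hz: "height z = 0" using z r frontier_iff[of z] by simp
  have Lr2t: "L * r2 < t0" and Lr2r: "L * r2 + r2 < r1" using Lr2 r2 t0 r1 by (simp_all add: min_def split: if_splits)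
  have r2r1: "r2 < r1" using Lr2r Lr2p by linarith
  have hx: "\<bar>height x\<bar> \<le> L * r2" if x: "x \<in> ball z r2" for x
  proof -
    have "\<bar>height x - height z\<bar> \<le> L * dist x z" using x r2r1 r1 by (intro Lh) auto
    also have "\<dots> \<le> L * r2" using x L by (intro mult_left_mono) (auto simp: dist_commute)
    finally show ?thesis using hz by simp
  qed
  have compF: "compact (frontier D)" using bD by (simp add: compact_frontier_bounded)
  obtain C\<theta> where C\<theta>: "\<And>x. x \<in> frontier D \<Longrightarrow> \<bar>\<theta> x\<bar> \<le> C\<theta>"
  proof -
    have "bounded (\<theta> ` frontier D)" using compact_continuous_image[OF th_cont compF] by (rule compact_imp_bounded)
    then show thesis using that unfolding bounded_iff by (metis imageI real_norm_def)
  qed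
  have C\<theta>0: "0 \<le> C\<theta>" using C\<theta>[OF z] by linarith
  have K0: "0 \<le> K" using K[of z 0] z by (force simp: frontier_def)
  \<comment> \<open>A common exponential rate: \<open>\<tau> / (L + 1)\<close> comes from the decay
    of \<open>u\<close>, since a point at height \<open>h t\<close> is the centre of a ball of
    radius \<open>h t / (L + 1)\<close> in \<open>D\<close>; \<open>\<kappa>0 / L\<close> comes from
    the profile, since the normal has product at least \<open>1 / L\<close> with
    \<open>e\<close>.\<close>
  define c1 where "c1 = min (\<tau> / (L + 1)) (\<kappa>0 / L)"
  have c1: "0 < c1" "c1 \<le> \<tau> / (L + 1)" "c1 \<le> \<kappa>0 / L" using tau ka L by (auto simp: c1_def)
  show thesis
  proof (rule that[of r2])
    show "0 < r2" "r2 < r" using r2 r2r1 r1 by auto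
    fix \<zeta> :: "real^'n \<Rightarrow> real" and c :: real
    assume chi_cont: "continuous_on UNIV \<zeta>" and chi1: "\<And>x. \<bar>\<zeta> x\<bar> \<le> 1" and chi0: "\<And>x. x \<notin> ball z r2 \<Longrightarrow> \<zeta> x = 0"
      and c: "is_hausdorff_ratio TYPE('n) c"
    have c0: "0 < c" using c by (simp add: is_hausdorff_ratio_def)
    have oS: "open S" by (rule open_boundary_collar[OF D])
    have SD: "S \<subseteq> D" by (auto simp: boundary_collar_def)
    define F where "F j x = (if x \<in> S then \<zeta> x * u j x * \<mu> x else 0)" for j x
    have Fm [measurable]: "F j \<in> borel_measurable borel" for j
      unfolding F_def[abs_def]
    proof (rule borel_measurable_continuous_on_if)
      show "continuous_on S (\<lambda>x. \<zeta> x * u j x * \<mu> x)"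
        using SD closure_subset[of D]
        by (intro continuous_on_mult mu_cont continuous_on_subset[OF chi_cont] continuous_on_subset[OF u_cont]) auto
    qed (use oS in auto)
    \<comment> \<open>Like \<open>\<theta>'\<close>, \<open>\<kappa>'\<close> and \<open>u'\<close>
      below, extended by 0 from the set where it is continuous, so as to be Borel measurable on the
      whole space.\<close>
    define ne where "ne x = (if x \<in> ball z r then normal x \<bullet> e else 0)" for x
    have [measurable]: "ne \<in> borel_measurable borel"
      unfolding ne_def[abs_def] by (rule borel_measurable_continuous_on_if) (auto intro!: continuous_intros normal_cont)
    define \<theta>' where "\<theta>' x = (if x \<in> frontier D then \<theta> x else 0)" for x
    define \<kappa>' where "\<kappa>' x = (if x \<in> frontier D then \<kappa> x else 0)" for x
    define u' where "u' j x = (if x \<in> frontier D then u j x else 0)" for j x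
    have ucF: "continuous_on (frontier D) (u j)" for j
      by (rule continuous_on_subset[OF u_cont]) (simp add: frontier_def)
    have [measurable]: "\<theta>' \<in> borel_measurable borel" "\<kappa>' \<in> borel_measurable borel" "u' j \<in> borel_measurable borel" for j
      unfolding \<theta>'_def[abs_def] \<kappa>'_def[abs_def] u'_def[abs_def]
      by (rule measurable_on_frontier th_cont ka_cont ucF)+
    have [measurable]: "\<zeta> \<in> borel_measurable borel" by (rule borel_measurable_continuous_onI[OF chi_cont])
    let ?X = "\<lambda>j p. foot (fst p) + (h j * snd p) *\<^sub>R e"
    define \<Phi> where "\<Phi> j p = F j (?X j p) / h j ^ k" for j and p :: "(real^'n) \<times> real"
    define A where "A j q = \<zeta> q * u' j q * (\<theta>' q * ne q ^ k / fact k)" for j q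
    define \<Psi> where "\<Psi> j p = A j (foot (fst p)) * (indicator {0<..} (snd p) * (snd p ^ k * exp (- (\<kappa>' (foot (fst p)) * ne (foot (fst p))) * snd p)))"
      for j and p :: "(real^'n) \<times> real"
    have Am [measurable]: "A j \<in> borel_measurable borel" for j unfolding A_def[abs_def] by measurable
    have \<Phi>m [measurable]: "\<Phi> j \<in> borel_measurable (borel \<Otimes>\<^sub>M borel)" for j unfolding \<Phi>_def[abs_def] by measurable
    have \<Psi>m [measurable]: "\<Psi> j \<in> borel_measurable (borel \<Otimes>\<^sub>M borel)" for j unfolding \<Psi>_def[abs_def] by measurable
    define M where "M = Kd * C + K * (C\<theta> / fact k)"
    have M0: "0 \<le> Kd * C" "0 \<le> K * (C\<theta> / fact k)" "0 \<le> M" using Kd C K0 C\<theta>0 by (auto simp: M_def)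
    define w where "w p = M * (indicator (cball z r1) (foot (fst p)) * (indicator {0<..} (snd p) * (snd p ^ k * exp (- c1 * snd p))))"
      for p :: "(real^'n) \<times> real"
    have wm [measurable]: "w \<in> borel_measurable (borel \<Otimes>\<^sub>M borel)" unfolding w_def[abs_def]
    proof (intro borel_measurable_times borel_measurable_const)
      show "(\<lambda>p::(real^'n) \<times> real. indicator (cball z r1) (foot (fst p)) :: real) \<in> borel_measurable (borel \<Otimes>\<^sub>M borel)"
        by (rule measurable_compose[where g = "indicator (cball z r1)" and N = borel]) (measurable, simp)
      show "(\<lambda>p::(real^'n) \<times> real. indicator {0<..} (snd p) :: real) \<in> borel_measurable (borel \<Otimes>\<^sub>M borel)"
        by (rule measurable_compose[where g = "indicator {0<..}" and N = borel]) (measurable, simp, intro open_Collect_less continuous_intros)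
    qed measurable
    have w_int: "integrable (slab_measure e) w"
    proof (rule integrableI_nonneg)
      show "w \<in> borel_measurable (slab_measure e)" by measurable
      show "AE p in slab_measure e. 0 \<le> w p" using M0 by (intro AE_I2) (auto simp: w_def split: split_indicator)
      have "(\<integral>\<^sup>+p. ennreal (w p) \<partial>slab_measure e)
        = (\<integral>\<^sup>+y. indicator {0..1} (e \<bullet> y) * (\<integral>\<^sup>+t. ennreal (w (y, t)) \<partial>lborel) \<partial>lborel)"
        by (rule nn_integral_slab_measure) measurable
      also have "\<dots> \<le> (\<integral>\<^sup>+y. ennreal (M * (fact k / c1 ^ (k + 1))) * indicator (cball (0::real^'n) (2 * (norm z + r1) + 1)) y \<partial>lborel)"
      proof (rule nn_integral_mono)
        fix y :: "real^'n"
        show "indicator {0..1} (e \<bullet> y) * (\<integral>\<^sup>+t. ennreal (w (y, t)) \<partial>lborel)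
          \<le> ennreal (M * (fact k / c1 ^ (k + 1))) * indicator (cball 0 (2 * (norm z + r1) + 1)) y"
        proof (cases "e \<bullet> y \<in> {0..1} \<and> foot y \<in> cball z r1")
          case True
          then have y: "y \<in> cball 0 (2 * (norm z + r1) + 1)" using slab_foot_bounded[of r1] by auto
          have "(\<integral>\<^sup>+t. ennreal (w (y, t)) \<partial>lborel) = (\<integral>\<^sup>+t. ennreal M * ennreal (indicator {0<..} t * (t ^ k * exp (- c1 * t))) \<partial>lborel)"
            using True M0(3) by (intro nn_integral_cong) (auto simp: w_def ennreal_mult split: split_indicator)
          also have "\<dots> = ennreal M * ennreal (fact k / c1 ^ (k + 1))"
            by (subst nn_integral_cmult) (simp, simp only: nn_integral_gamma[OF c1(1)])
          also have "\<dots> = ennreal (M * (fact k / c1 ^ (k + 1)))" using M0(3) c1(1) by (intro ennreal_mult[symmetric]) auto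
          finally show ?thesis using True y by simp
        next
          case False
          then have "e \<bullet> y \<notin> {0..1} \<or> (\<forall>t. w (y, t) = 0)" by (auto simp: w_def)
          then show ?thesis by (auto split: split_indicator)
        qed
      qed
      also have "\<dots> < \<infinity>"
        using emeasure_bounded_finite[OF bounded_cball, of "0::real^'n" "2 * (norm z + r1) + 1"]
        by (subst nn_integral_cmult_indicator) (auto simp: ennreal_mult_less_top)
      finally show "(\<integral>\<^sup>+p. ennreal (w p) \<partial>slab_measure e) < \<infinity>" .
    qed
    have ne_eq: "ne q = 1 / norm (slope q)" "0 < ne q" "ne q \<le> 1" if "q \<in> ball z r" for q
      using normal_e[OF that] normal_e_pos[OF that] norm_slope_ge_1[OF that] that by (auto simp: ne_def divide_le_eq)
    have \<Phi>0: "\<Phi> j (y, t) = 0" if "\<not> (0 < t \<and> foot y \<in> ball z r1 \<and> ?X j (y, t) \<in> S \<and> ?X j (y, t) \<in> ball z r2)" for j y t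
    proof (rule ccontr)
      let ?x = "?X j (y, t)"
      assume "\<Phi> j (y, t) \<noteq> 0"
      then have x: "?x \<in> S" "?x \<in> ball z r2"
        using chi0[of ?x] by (auto simp: \<Phi>_def F_def split: if_splits)
      have hgt: "height ?x = h j * t" by (simp add: height_add height_foot)
      have "0 < height ?x" using x SD mem_D[of ?x] r2r1 r1 by auto
      then have t: "0 < t" using hgt h(1)[of j] by (simp add: zero_less_mult_iff)
      have "dist z (foot y) \<le> dist z ?x + dist ?x (foot y)" by (rule dist_triangle)
      also have "dist ?x (foot y) = \<bar>height ?x\<bar>" using e hgt by (simp add: dist_norm)
      finally have "foot y \<in> ball z r1" using x(2) hx[OF x(2)] Lr2r by simp
      then show False using that x t by blast
    qed
    have \<Phi>_le: "\<bar>\<Phi> j (y, t)\<bar> \<le> Kd * C * (t ^ k * exp (- c1 * t))" if t: "0 < t" "foot y \<in> ball z r1" for j y t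
    proof (cases "?X j (y, t) \<in> S \<and> ?X j (y, t) \<in> ball z r2")
      case False
      then show ?thesis using \<Phi>0[of t y j] M0(1) t by simp
    next
      case True
      let ?x = "?X j (y, t)"
      have hj: "0 < h j" by (rule h)
      have hgt: "height ?x = h j * t" by (simp add: height_add height_foot)
      have htL: "h j * t \<le> L * r2" using hx[of ?x] True hgt by simp
      \<comment> \<open>\<open>height\<close> is \<open>L\<close>-Lipschitz, so it cannot drop from
        \<open>h t\<close> to 0 within this radius; \<open>htL\<close> also makes the radius at most
        \<open>r2\<close>, so the ball stays in the patch.\<close>
      let ?\<rho> = "h j * t / (L + 1)"
      have \<rho>: "0 < ?\<rho>" using hj t L by simp
      have \<rho>r: "?\<rho> \<le> r2"
      proof -
        have "h j * t \<le> (L + 1) * r2" using htL r2 by (simp add: distrib_right)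
        then show ?thesis using L by (simp add: divide_le_eq mult.commute)
      qed
      have r22: "2 * r2 \<le> r1" using Lr2r mult_right_mono[OF L less_imp_le[OF r2]] by linarith
      have "ball ?x ?\<rho> \<subseteq> D"
      proof
        fix y' assume y': "y' \<in> ball ?x ?\<rho>"
        have "dist z y' \<le> dist z ?x + dist ?x y'" by (rule dist_triangle)
        also have "\<dots> < r2 + r2" using True y' \<rho>r by (intro add_strict_mono) auto
        finally have y'b: "y' \<in> cball z r1" using r22 by simp
        have xb: "?x \<in> cball z r1" using True r2r1 by simp
        have "L * dist ?x y' < L * ?\<rho>" using y' L unfolding mem_ball by (intro mult_strict_left_mono) auto
        also have "L * ?\<rho> \<le> h j * t"
        proof -
          have "L * ?\<rho> = (L / (L + 1)) * (h j * t)" by simp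
          also have "\<dots> \<le> 1 * (h j * t)" using L hj t by (intro mult_right_mono) auto
          finally show ?thesis by simp
        qed
        finally have "0 < height y'" using Lh[OF xb y'b] hgt by linarith
        then show "y' \<in> D" using mem_D[of y'] y'b r1 by auto
      qed
      then have "\<bar>u j ?x\<bar> \<le> Kd * exp (- (\<tau> * ?\<rho> / h j))" by (rule decay[OF \<rho>])
      also have "\<tau> * ?\<rho> / h j = \<tau> / (L + 1) * t" using hj by simp
      also have "Kd * exp (- (\<tau> / (L + 1) * t)) \<le> Kd * exp (- c1 * t)"
        using Kd mult_right_mono[OF c1(2) less_imp_le[OF t(1)]] by (intro mult_left_mono) auto
      finally have ub: "\<bar>u j ?x\<bar> \<le> Kd * exp (- c1 * t)" .
      have pf: "foot y \<in> frontier D \<inter> cball z r1" using t r1 foot_frontier[of y] by auto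
      have "\<bar>\<mu> (foot y + (h j * t) *\<^sub>R e)\<bar> \<le> C * (h j * t) ^ k"
        using hj t htL Lr2t by (intro mb[OF pf]) auto
      then have mub: "\<bar>\<mu> ?x\<bar> / h j ^ k \<le> C * t ^ k" using hj by (simp add: divide_le_eq power_mult_distrib mult_ac)
      have "\<bar>\<Phi> j (y, t)\<bar> = \<bar>\<zeta> ?x\<bar> * (\<bar>u j ?x\<bar> * (\<bar>\<mu> ?x\<bar> / h j ^ k))"
        using True hj by (simp add: \<Phi>_def F_def abs_mult)
      also have "\<dots> \<le> 1 * ((Kd * exp (- c1 * t)) * (C * t ^ k))"
        using chi1 ub mub Kd C t hj by (intro mult_mono) (auto intro!: mult_nonneg_nonneg divide_nonneg_nonneg)
      finally show ?thesis by (simp add: mult_ac)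
    qed
    have A0: "A j (foot y) = 0" if "foot y \<notin> ball z r2" for j y using chi0[OF that] by (simp add: A_def)
    have A_le: "\<bar>A j (foot y)\<bar> \<le> K * (C\<theta> / fact k)" if "foot y \<in> ball z r" for j y
    proof -
      have f: "foot y \<in> frontier D" by (rule foot_frontier[OF that])
      have 1: "\<bar>u' j (foot y)\<bar> \<le> K" using K[of "foot y" j] f by (simp add: u'_def frontier_def)
      have "\<bar>\<theta>' (foot y)\<bar> \<le> C\<theta>" using C\<theta>[OF f] f by (simp add: \<theta>'_def)
      moreover have "\<bar>ne (foot y) ^ k\<bar> \<le> 1" using ne_eq[OF that] by (simp add: power_le_one)
      ultimately have "\<bar>\<theta>' (foot y)\<bar> * \<bar>ne (foot y) ^ k\<bar> \<le> C\<theta> * 1" by (intro mult_mono) (auto simp: C\<theta>0)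
      then have 2: "\<bar>\<theta>' (foot y) * ne (foot y) ^ k / fact k\<bar> \<le> C\<theta> / fact k" by (simp add: abs_mult divide_right_mono)
      have "\<bar>\<zeta> (foot y)\<bar> * \<bar>u' j (foot y)\<bar> \<le> 1 * K" using chi1 1 by (intro mult_mono) auto
      then have "\<bar>\<zeta> (foot y) * u' j (foot y)\<bar> * \<bar>\<theta>' (foot y) * ne (foot y) ^ k / fact k\<bar> \<le> K * (C\<theta> / fact k)"
        using 2 K0 by (intro mult_mono) (auto simp: abs_mult)
      then show ?thesis by (simp only: A_def abs_mult)
    qed
    have kn: "c1 \<le> \<kappa>' (foot y) * ne (foot y)" if "foot y \<in> ball z r2" for y
    proof -
      have b: "foot y \<in> ball z r" "foot y \<in> cball z r1" using that r2r1 r1 by auto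
      have f: "foot y \<in> frontier D" by (rule foot_frontier[OF b(1)])
      have "1 / L \<le> ne (foot y)" unfolding ne_eq(1)[OF b(1)]
        using Ls[OF b(2)] norm_slope_ge_1[OF b(1)] L by (intro divide_left_mono) (auto intro!: mult_pos_pos)
      then have "\<kappa>0 * (1 / L) \<le> \<kappa>' (foot y) * ne (foot y)"
        using ka f L by (intro mult_mono) (auto simp: \<kappa>'_def intro: order_trans less_imp_le)
      then show ?thesis using c1(3) by simp
    qed
    have \<Psi>_le: "\<bar>\<Psi> j (y, t)\<bar> \<le> K * (C\<theta> / fact k) * (t ^ k * exp (- c1 * t))" if t: "0 < t" for j y t
    proof (cases "foot y \<in> ball z r2")
      case False
      then have "\<Psi> j (y, t) = 0" using A0 by (simp add: \<Psi>_def)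
      moreover have "0 \<le> K * (C\<theta> / fact k) * (t ^ k * exp (- c1 * t))"
        by (rule mult_nonneg_nonneg[OF M0(2)]) (use t in simp)
      ultimately show ?thesis by simp
    next
      case True
      then have b: "foot y \<in> ball z r" using r2r1 r1 by auto
      have "\<bar>\<Psi> j (y, t)\<bar> = \<bar>A j (foot y)\<bar> * (t ^ k * exp (- (\<kappa>' (foot y) * ne (foot y)) * t))"
        using t by (simp add: \<Psi>_def abs_mult)
      also have "\<dots> \<le> (K * (C\<theta> / fact k)) * (t ^ k * exp (- c1 * t))"
        using A_le[OF b] kn[OF True] t M0(2) by (intro mult_mono) auto
      finally show ?thesis .
    qed
    have bound: "norm (\<Phi> j p - \<Psi> j p) \<le> w p" and \<Psi>_w: "norm (\<Psi> j p) \<le> w p" and \<Phi>_w: "norm (\<Phi> j p) \<le> w p" for j p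
    proof -
      obtain y t where p: "p = (y, t)" by (cases p)
      have "norm (\<Phi> j p - \<Psi> j p) \<le> w p \<and> norm (\<Psi> j p) \<le> w p \<and> norm (\<Phi> j p) \<le> w p"
      proof (cases "0 < t \<and> foot y \<in> ball z r1")
        case True
        have w: "w p = (Kd * C) * (t ^ k * exp (- c1 * t)) + K * (C\<theta> / fact k) * (t ^ k * exp (- c1 * t))"
          using True by (simp add: w_def p M_def distrib_right)
        have n: "0 \<le> (Kd * C) * (t ^ k * exp (- c1 * t))" "0 \<le> K * (C\<theta> / fact k) * (t ^ k * exp (- c1 * t))"
          by (rule mult_nonneg_nonneg[OF M0(1)] mult_nonneg_nonneg[OF M0(2)], use True in simp)+
        have b: "\<bar>\<Phi> j p\<bar> \<le> Kd * C * (t ^ k * exp (- c1 * t))" "\<bar>\<Psi> j p\<bar> \<le> K * (C\<theta> / fact k) * (t ^ k * exp (- c1 * t))"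
          unfolding p using \<Phi>_le[of t y j] \<Psi>_le[of t j y] True by blast+
        show ?thesis
          using b n abs_triangle_ineq4[of "\<Phi> j p" "\<Psi> j p"] unfolding w real_norm_def by linarith
      next
        case False
        then have "\<Phi> j p = 0" unfolding p by (intro \<Phi>0) blast
        moreover have "\<Psi> j p = 0"
        proof (cases "0 < t")
          case True
          then have "foot y \<notin> ball z r2" using False r2r1 by auto
          then show ?thesis using A0 by (simp add: \<Psi>_def p)
        qed (simp add: \<Psi>_def p)
        moreover have "0 \<le> w p" using M0 by (auto simp: w_def split: split_indicator)
        ultimately show ?thesis by simp
      qed
      then show "norm (\<Phi> j p - \<Psi> j p) \<le> w p" "norm (\<Psi> j p) \<le> w p" "norm (\<Phi> j p) \<le> w p" by auto
    qed
    have ptw: "(\<lambda>j. \<Phi> j p - \<Psi> j p) \<longlonglongrightarrow> 0" for p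
    proof -
      obtain y t where p: "p = (y, t)" by (cases p)
      show ?thesis
      proof (cases "0 < t \<and> foot y \<in> ball z r1")
        case False
        then have "\<Phi> j p = 0" for j unfolding p by (intro \<Phi>0) blast
        moreover have "\<Psi> j p = 0" for j
        proof (cases "0 < t")
          case True
          then have "foot y \<notin> ball z r2" using False r2r1 by auto
          then show ?thesis using A0 by (simp add: \<Psi>_def p)
        qed (simp add: \<Psi>_def p)
        ultimately show ?thesis by simp
      next
        case True
        then have t: "0 < t" and q: "foot y \<in> ball z r" using r1 by auto
        have f: "foot y \<in> frontier D" by (rule foot_frontier[OF q])
        let ?q = "foot y"
        have hr: "filterlim (\<lambda>j. h j * t) (at_right 0) sequentially"
          unfolding filterlim_at using tendsto_mult_left_zero[OF h(2), of t] h(1) t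
          by (auto intro!: always_eventually simp: less_imp_neq[OF h(1), symmetric])
        have inS: "\<forall>\<^sub>F j in sequentially. ?q + (h j * t) *\<^sub>R e \<in> S"
          using line_in_collar[OF q f eps] hr unfolding filterlim_iff by blast
        have l1: "(\<lambda>j. \<zeta> (?q + (h j * t) *\<^sub>R e)) \<longlonglongrightarrow> \<zeta> ?q"
        proof -
          have "(\<lambda>j. ?q + (h j * t) *\<^sub>R e) \<longlonglongrightarrow> ?q + (0 * t) *\<^sub>R e" by (intro tendsto_intros h)
          then have "(\<lambda>j. ?q + (h j * t) *\<^sub>R e) \<longlonglongrightarrow> ?q" by simp
          moreover have "isCont \<zeta> ?q" using chi_cont by (simp add: continuous_on_eq_continuous_at)
          ultimately show ?thesis by (rule isCont_tendsto_compose[rotated])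
        qed
        have l2: "(\<lambda>j. \<mu> (?q + (h j * t) *\<^sub>R e) / h j ^ k) \<longlonglongrightarrow> \<theta> ?q * (normal ?q \<bullet> e) ^ k / fact k * t ^ k"
        proof -
          have "(\<lambda>j. \<mu> (?q + (h j * t) *\<^sub>R e) / (h j * t) ^ k * t ^ k) \<longlonglongrightarrow> \<theta> ?q * (normal ?q \<bullet> e) ^ k / fact k * t ^ k"
            by (intro tendsto_mult_right filterlim_compose[OF mu_lim[OF q f] hr])
          moreover have "\<mu> (?q + (h j * t) *\<^sub>R e) / (h j * t) ^ k * t ^ k = \<mu> (?q + (h j * t) *\<^sub>R e) / h j ^ k" for j
            using t h(1)[of j] by (simp add: power_mult_distrib)
          ultimately show ?thesis by simp
        qed
        let ?E = "exp (- (\<kappa> ?q * (normal ?q \<bullet> e)) * t)"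
        let ?m = "\<theta> ?q * (normal ?q \<bullet> e) ^ k / fact k * t ^ k"
        let ?c = "\<lambda>j. \<zeta> (?q + (h j * t) *\<^sub>R e) * (\<mu> (?q + (h j * t) *\<^sub>R e) / h j ^ k)"
        have l3: "(\<lambda>j. ?c j * (u j (?q + (h j * t) *\<^sub>R e) - u j ?q * ?E)) \<longlonglongrightarrow> (\<zeta> ?q * ?m) * 0"
          by (intro tendsto_mult l1 l2 profile[OF q f t])
        \<comment> \<open>The boundary values \<open>u j ?q\<close> are bounded but need not
          converge. Therefore the difference is split: in one summand the profile error tends to 0,
          in the other the coefficient error does.\<close>
        have l4: "(\<lambda>j. (?c j - \<zeta> ?q * ?m) * (u j ?q * ?E)) \<longlonglongrightarrow> 0"
        proof (rule tendsto_0_le[where K = "K * ?E"])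
          have "(\<lambda>j. ?c j - \<zeta> ?q * ?m) \<longlonglongrightarrow> \<zeta> ?q * ?m - \<zeta> ?q * ?m" by (intro tendsto_intros l1 l2)
          then show "(\<lambda>j. ?c j - \<zeta> ?q * ?m) \<longlonglongrightarrow> 0" by simp
          have "\<bar>u j ?q\<bar> \<le> K" for j using K[of ?q j] f by (simp add: frontier_def)
          then show "\<forall>\<^sub>F j in sequentially. norm ((?c j - \<zeta> ?q * ?m) * (u j ?q * ?E)) \<le> norm (?c j - \<zeta> ?q * ?m) * (K * ?E)"
            by (intro always_eventually allI) (simp add: abs_mult mult_left_mono mult_right_mono)
        qed
        have "(\<lambda>j. ?c j * (u j (?q + (h j * t) *\<^sub>R e) - u j ?q * ?E) + (?c j - \<zeta> ?q * ?m) * (u j ?q * ?E)) \<longlonglongrightarrow> (\<zeta> ?q * ?m) * 0 + 0"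
          by (rule tendsto_add[OF l3 l4])
        then have lim0: "(\<lambda>j. ?c j * (u j (?q + (h j * t) *\<^sub>R e) - u j ?q * ?E) + (?c j - \<zeta> ?q * ?m) * (u j ?q * ?E)) \<longlonglongrightarrow> 0" by simp
        have "\<forall>\<^sub>F j in sequentially. ?c j * (u j (?q + (h j * t) *\<^sub>R e) - u j ?q * ?E) + (?c j - \<zeta> ?q * ?m) * (u j ?q * ?E) = \<Phi> j p - \<Psi> j p"
          using inS
        proof eventually_elim
          case (elim j)
          have 1: "\<Phi> j p = ?c j * u j (?q + (h j * t) *\<^sub>R e)" using elim by (simp add: \<Phi>_def F_def p)
          have 2: "\<Psi> j p = (\<zeta> ?q * ?m) * (u j ?q * ?E)"
            using t f q by (simp add: \<Psi>_def A_def p u'_def \<theta>'_def \<kappa>'_def ne_def)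
          show ?case unfolding 1 2 by (simp only: right_diff_distrib left_diff_distrib)
        qed
        from Lim_transform_eventually[OF lim0 this] show ?thesis .
      qed
    qed
    have \<Psi>_int: "integrable (slab_measure e) (\<Psi> j)" for j
      by (rule Bochner_Integration.integrable_bound[OF w_int]) (use \<Psi>_w in \<open>auto intro!: AE_I2 intro: order_trans[OF _ abs_ge_self]\<close>)
    have \<Phi>_int: "integrable (slab_measure e) (\<Phi> j)" for j
      by (rule Bochner_Integration.integrable_bound[OF w_int]) (use \<Phi>_w in \<open>auto intro!: AE_I2 intro: order_trans[OF _ abs_ge_self]\<close>)
    have "(\<lambda>j. LINT p|slab_measure e. \<Phi> j p - \<Psi> j p) \<longlonglongrightarrow> (LINT p|slab_measure e. 0)"
      by (rule integral_dominated_convergence[OF _ _ w_int]) (use ptw bound in \<open>auto intro!: AE_I2\<close>)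
    then have main: "(\<lambda>j. LINT p|slab_measure e. \<Phi> j p - \<Psi> j p) \<longlonglongrightarrow> 0" by simp
    have volume: "(LINT p|slab_measure e. \<Phi> j p) = (LINT x|lborel. (if x \<in> S then \<zeta> x * u j x * \<mu> x else 0)) / h j ^ (k + 1)" for j
    proof -
      have "(LINT x|lborel. F j x) = h j * (LINT p|slab_measure e. F j (fst p + (- height (fst p) + h j * snd p) *\<^sub>R e))"
        by (rule lborel_integral_slab[OF _ _ e h(1)]) measurable
      also have "(\<lambda>p. F j (fst p + (- height (fst p) + h j * snd p) *\<^sub>R e)) = (\<lambda>p. F j (?X j p))"
        by (simp add: foot_def algebra_simps)
      finally have "(LINT x|lborel. F j x) / h j ^ (k + 1) = (LINT p|slab_measure e. F j (?X j p)) / h j ^ k"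
        using h(1)[of j] by simp
      also have "\<dots> = (LINT p|slab_measure e. \<Phi> j p)" unfolding \<Phi>_def by simp
      finally show ?thesis by (simp add: F_def)
    qed
    have surface: "(LINT p|slab_measure e. \<Psi> j p)
       = (1 / c) * (LINT x|hausdorff_measure (CARD('n) - 1). (if x \<in> frontier D then \<zeta> x * u j x * weight x else 0))" for j
    proof -
      define g where "g x = \<zeta> x * u' j x * (\<theta>' x / \<kappa>' x ^ (k + 1))" for x
      have g_eq: "g x = (if x \<in> frontier D then \<zeta> x * u j x * weight x else 0)" for x
        by (simp add: g_def u'_def \<theta>'_def \<kappa>'_def weight_def)
      have gm: "g \<in> borel_measurable borel" unfolding g_def[abs_def] by measurable
      have g0: "g x = 0" if "x \<notin> frontier D \<inter> ball z r" for x
        using that chi0[of x] r2r1 r1 by (auto simp: g_eq)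
      have "(LINT p|slab_measure e. \<Psi> j p) = (LINT y|lborel. indicator {0..1} (e \<bullet> y) * (LINT t|lborel. \<Psi> j (y, t)))"
        by (rule integral_slab_measure[OF \<Psi>_int]) measurable
      also have "\<dots> = (LINT y|lborel. area_density y * g (foot y))"
      proof (rule Bochner_Integration.integral_cong[OF refl])
        fix y :: "real^'n"
        show "indicator {0..1} (e \<bullet> y) * (LINT t|lborel. \<Psi> j (y, t)) = area_density y * g (foot y)"
        proof (cases "foot y \<in> ball z r2")
          case False
          then have "A j (foot y) = 0" "g (foot y) = 0" using A0 chi0 by (auto simp: g_def)
          then show ?thesis by (simp add: \<Psi>_def)
        next
          case True
          then have q: "foot y \<in> ball z r" using r2r1 r1 by auto
          let ?b = "\<kappa>' (foot y) * ne (foot y)"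
          have b: "0 < ?b" using kn[OF True] c1(1) by linarith
          have "(LINT t|lborel. \<Psi> j (y, t)) = A j (foot y) * (LINT t|lborel. indicator {0<..} t * (t ^ k * exp (- ?b * t)))"
            by (simp add: \<Psi>_def)
          also have "\<dots> = A j (foot y) * (fact k / ?b ^ (k + 1))" by (simp only: integral_gamma[OF b])
          \<comment> \<open>The powers of \<open>ne\<close> leave exactly \<open>1 / ne\<close>, and
            this is the length of the slope, that is, the area density: the direction
            \<open>e\<close> drops out.\<close>
          also have "\<dots> = g (foot y) / ne (foot y)"
          proof -
            have n0: "ne (foot y) \<noteq> 0" using ne_eq(2)[OF q] by simp
            then show ?thesis by (simp add: A_def g_def power_mult_distrib mult_ac)
          qed
          also have "\<dots> = norm (slope (foot y)) * g (foot y)" by (simp add: ne_eq(1)[OF q])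
          finally show ?thesis using q by (simp add: area_density_def)
        qed
      qed
      also have "\<dots> = (1 / c) * (LINT y|lborel. c * area_density y * g (foot y))"
        using c0 by (simp add: mult.assoc)
      also have "(LINT y|lborel. c * area_density y * g (foot y)) = (LINT x|hausdorff_measure (CARD('n) - 1). g x)"
        by (rule integral_hausdorff_patch(1)[OF c gm g0, symmetric])
      finally show ?thesis by (simp add: g_eq[abs_def])
    qed
    have "(LINT p|slab_measure e. \<Phi> j p - \<Psi> j p) = (LINT x|lborel. (if x \<in> S then \<zeta> x * u j x * \<mu> x else 0)) / h j ^ (k + 1)
       - (1 / c) * (LINT x|hausdorff_measure (CARD('n) - 1). (if x \<in> frontier D then \<zeta> x * u j x * weight x else 0))" for j
      by (simp only: Bochner_Integration.integral_diff[OF \<Phi>_int \<Psi>_int] volume surface)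
    with main show "(\<lambda>j. (LINT x|lborel. (if x \<in> S then \<zeta> x * u j x * \<mu> x else 0)) / h j ^ (k + 1)
         - (1 / c) * (LINT x|hausdorff_measure (CARD('n) - 1). (if x \<in> frontier D then \<zeta> x * u j x * weight x else 0))) \<longlonglongrightarrow> 0"
      by simp
  qed
qed

end

section \<open>The small diffusion limit\<close>

lemma Ck_closure_mono: "Ck_closure m S g \<Longrightarrow> l \<le> m \<Longrightarrow> Ck_closure l S g"
  unfolding Ck_closure_def using Ck_on_mono[of m S g l S] by auto

lemma continuous_on_locally_ball:
  fixes g :: "'a::metric_space \<Rightarrow> 'b::topological_space"
  assumes "\<And>z. z \<in> F \<Longrightarrow> \<exists>r>0. continuous_on (F \<inter> ball z r) g"
  shows "continuous_on F g"
  unfolding continuous_on_def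
proof
  fix z assume z: "z \<in> F"
  obtain r where r: "0 < r" "continuous_on (F \<inter> ball z r) g" using assms[OF z] by blast
  have "(g \<longlongrightarrow> g z) (at z within (F \<inter> ball z r))" using r z unfolding continuous_on_def by auto
  moreover have "at z within (F \<inter> ball z r) = at z within F"
    by (rule at_within_nhd[of z "ball z r"]) (use r in auto)
  ultimately show "(g \<longlongrightarrow> g z) (at z within F)" by simp
qed

lemma ball_subset_infdist_frontier:
  fixes x :: "'a::real_normed_vector"
  assumes "x \<in> D" "\<rho> \<le> infdist x (frontier D)"
  shows "ball x \<rho> \<subseteq> D"
proof (rule ccontr)
  assume n: "\<not> ball x \<rho> \<subseteq> D"
  then have "0 < \<rho>" by (metis ball_empty empty_subsetI not_less)
  then have "ball x \<rho> \<inter> D \<noteq> {}" using assms(1) centre_in_ball[of x \<rho>] by blast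
  moreover have "ball x \<rho> - D \<noteq> {}" using n by blast
  ultimately have "ball x \<rho> \<inter> frontier D \<noteq> {}" by (rule connected_Int_frontier[OF connected_ball])
  then obtain y where "y \<in> ball x \<rho>" "y \<in> frontier D" by blast
  then show False using infdist_le[of y "frontier D" x] assms(2) by simp
qed

lemma exp_inverse_flat:
  assumes "0 < c" "\<And>j. 0 < h j" "h \<longlonglongrightarrow> 0"
  shows "(\<lambda>j. exp (- (c / h j)) / h j ^ k) \<longlonglongrightarrow> (0::real)"
proof -
  have "filterlim h (at_right 0) sequentially"
    using assms(2,3) by (auto simp: filterlim_at less_imp_neq[OF assms(2), symmetric])
  then have "filterlim (\<lambda>j. inverse (h j)) at_top sequentially"
    by (rule filterlim_compose[OF filterlim_inverse_at_top_right])
  then have "filterlim (\<lambda>j. c * inverse (h j)) at_top sequentially"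
    by (rule filterlim_tendsto_pos_mult_at_top[OF tendsto_const assms(1)])
  then have "(\<lambda>j. 1 / c ^ k * ((c * inverse (h j)) ^ k / exp (c * inverse (h j)))) \<longlonglongrightarrow> 1 / c ^ k * 0"
    by (intro tendsto_mult tendsto_const filterlim_compose[OF tendsto_power_div_exp_0])
  moreover have "1 / c ^ k * ((c * inverse (h j)) ^ k / exp (c * inverse (h j))) = exp (- (c / h j)) / h j ^ k" for j
    using assms(1) by (simp add: exp_minus power_mult_distrib field_simps)
  ultimately show ?thesis by simp
qed

text \<open>The hypotheses in the form in which the analysis uses them: operator in nondivergence
  form with bounded drift, \<open>\<mu>\<close> of class \<open>k\<close> for either parity,
  coefficients merely continuous up to the boundary. Regularity needed for iterating the adjoint is
  required only when the weight is identified.\<close>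

locale jump_diffusion =
  fixes D :: "(real^'n::finite) set" and \<alpha> \<epsilon> B :: real and M :: "(real^'n) measure"
    and \<mu> V f :: "real^'n \<Rightarrow> real" and a :: "real^'n \<Rightarrow> real^'n^'n" and \<beta> n :: "real^'n \<Rightarrow> real^'n"
    and k :: nat and \<phi> :: "real \<Rightarrow> real^'n \<Rightarrow> real"
  assumes D: "open D" "bounded D" "D \<noteq> {}" and bdry: "Ck_holder_boundary 2 \<alpha> D"
    and M: "prob_space M" "sets M = sets (restrict_space borel D)"
    and V_cont: "continuous_on (closure D) V" and V_pos: "\<And>x. x \<in> closure D \<Longrightarrow> 0 < V x"
    and a_cont: "\<And>i j. continuous_on (closure D) (\<lambda>x. a x $ i $ j)"
    and pd: "\<And>x. x \<in> closure D \<Longrightarrow> transpose (a x) = a x \<and> (\<forall>v. v \<noteq> 0 \<longrightarrow> 0 < v \<bullet> (a x *v v))"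
    and drift: "\<And>x. x \<in> D \<Longrightarrow> norm (\<beta> x) \<le> B" and eps: "0 < \<epsilon>"
    and mu_nonneg: "\<And>x. x \<in> boundary_collar D \<epsilon> \<Longrightarrow> 0 \<le> \<mu> x"
    and mu_density: "restrict_space M (boundary_collar D \<epsilon>)
      = density (restrict_space lborel (boundary_collar D \<epsilon>)) (\<lambda>x. ennreal (\<mu> x))"
    and mu_Ck: "Ck_closure k (boundary_collar D \<epsilon>) \<mu>"
    and mu_vanish: "\<And>is x. length is < k \<Longrightarrow> x \<in> frontier D \<Longrightarrow> boundary_value (boundary_collar D \<epsilon>) (partials is \<mu>) x = 0"
    and mu_order: "\<exists>is. length is = k \<and> (\<exists>x\<in>frontier D. boundary_value (boundary_collar D \<epsilon>) (partials is \<mu>) x \<noteq> 0)"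
    and normal: "\<And>x. x \<in> frontier D \<Longrightarrow> inward_unit_normal D x (n x)"
    and f_cont: "continuous_on (frontier D) f"
    and phi_C2: "\<And>\<delta>. 0 < \<delta> \<Longrightarrow> twice_diff_on D (\<phi> \<delta>)"
    and phi_cont: "\<And>\<delta>. 0 < \<delta> \<Longrightarrow> continuous_on (closure D) (\<phi> \<delta>)"
    and phi_eq: "\<And>\<delta> x. 0 < \<delta> \<Longrightarrow> x \<in> D \<Longrightarrow> \<delta> * nondiv_op a \<beta> (\<phi> \<delta>) x = V x * (\<phi> \<delta> x - (LINT y|M. \<phi> \<delta> y))"
    and phi_frontier: "\<And>\<delta> p. 0 < \<delta> \<Longrightarrow> p \<in> frontier D \<Longrightarrow> \<phi> \<delta> p = f p"
begin

abbreviation (input) "S \<equiv> boundary_collar D \<epsilon>"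
abbreviation (input) "H \<equiv> hausdorff_measure (CARD('n) - 1) :: (real^'n) measure"

text \<open>Well defined by \<open>rank_one_partials\<close>: a derivative along the boundary of a derivative of order less
  than \<open>k\<close> vanishes, so only normal derivatives survive.\<close>
definition jet :: "real^'n \<Rightarrow> real" where
  "jet p = (SOME t. \<forall>is. length is = k \<longrightarrow> boundary_value S (partials is \<mu>) p = t * prod_list (map (\<lambda>j. n p $ j) is))"

definition rate :: "real^'n \<Rightarrow> real" where "rate p = sqrt (2 * V p / (n p \<bullet> (a p *v n p)))"

definition weight :: "real^'n \<Rightarrow> real" where "weight p = jet p / rate p ^ (k + 1)"

definition mean :: "real \<Rightarrow> real" where "mean \<delta> = (LINT y|M. \<phi> \<delta> y)"

definition defect :: "real \<Rightarrow> real^'n \<Rightarrow> real" where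
  "defect \<delta> x = 1 / (1 + \<bar>mean \<delta>\<bar>) * (\<phi> \<delta> x + (- mean \<delta>))"

lemma compact_F: "compact (frontier D)" using D by (simp add: compact_frontier_bounded)

lemma compact_cl: "compact (closure D)" using D by (simp add: compact_closure)

lemma F_cl: "frontier D \<subseteq> closure D" by (auto simp: frontier_def)

lemma D_cl: "D \<subseteq> closure D" by (rule closure_subset)

lemma F_nonempty: "frontier D \<noteq> {}" using D not_bounded_UNIV frontier_eq_empty by metis

lemma SD: "S \<subseteq> D" by (auto simp: boundary_collar_def)

lemma open_S: "open S" by (rule open_boundary_collar[OF D(1)])

lemma F_S: "p \<in> frontier D \<Longrightarrow> p \<in> closure S" "p \<in> frontier D \<Longrightarrow> p \<notin> S"
  using frontier_collar_closure[OF D(1) eps] by auto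

lemma V_lower: obtains Vm where "0 < Vm" "\<And>x. x \<in> closure D \<Longrightarrow> Vm \<le> V x"
proof -
  have "closure D \<noteq> {}" using D by simp
  from continuous_attains_inf[OF compact_cl this V_cont] show thesis using that V_pos by metis
qed

lemma a_upper: obtains A where "0 \<le> A" "\<And>x i. x \<in> closure D \<Longrightarrow> a x $ i $ i \<le> A"
proof -
  let ?g = "\<lambda>x. \<Sum>i\<in>UNIV. \<bar>a x $ i $ i\<bar>"
  have "closure D \<noteq> {}" using D by simp
  moreover have "continuous_on (closure D) ?g" by (intro continuous_intros a_cont)
  ultimately have "\<exists>y\<in>closure D. \<forall>x\<in>closure D. ?g x \<le> ?g y" by (rule continuous_attains_sup[OF compact_cl])
  then obtain y where y: "\<And>x. x \<in> closure D \<Longrightarrow> ?g x \<le> ?g y" by blast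
  have "a x $ i $ i \<le> ?g y" if "x \<in> closure D" for x i
  proof -
    have "\<bar>a x $ i $ i\<bar> \<le> ?g x" by (rule member_le_sum[where f = "\<lambda>i. \<bar>a x $ i $ i\<bar>"]) auto
    then show ?thesis using y[OF that] by linarith
  qed
  moreover have "0 \<le> ?g y" by (intro sum_nonneg) auto
  ultimately show thesis using that by blast
qed

lemma bounded_on_F:
  assumes "continuous_on (frontier D) (g :: _ \<Rightarrow> real)"
  obtains C where "0 \<le> C" "\<And>p. p \<in> frontier D \<Longrightarrow> \<bar>g p\<bar> \<le> C"
proof -
  have "bounded (g ` frontier D)" using compact_continuous_image[OF assms compact_F] by (rule compact_imp_bounded)
  then obtain C where "0 < C" "\<And>y. y \<in> g ` frontier D \<Longrightarrow> norm y \<le> C" unfolding bounded_pos by blast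
  then show thesis using that[of C] by auto
qed

lemma patch:
  assumes "z \<in> frontier D"
  obtains r i s \<gamma> where "s \<in> {-1, 1}" "graph_patch D z r (s *\<^sub>R axis i 1) \<gamma>"
  using graph_patch_exists[OF D(1) bdry assms] by metis

lemma n_cont: "continuous_on (frontier D) n"
proof (rule continuous_on_locally_ball)
  fix z assume z: "z \<in> frontier D"
  obtain r i s \<gamma> where "s \<in> {-1, 1}" "graph_patch D z r (s *\<^sub>R axis i 1) \<gamma>" by (rule patch[OF z])
  then interpret P: graph_patch D z r "s *\<^sub>R axis i 1" \<gamma> by simp
  have "continuous_on (frontier D \<inter> ball z r) P.normal"
    by (rule continuous_on_subset[OF P.normal_cont]) auto
  moreover have "P.normal x = n x" if "x \<in> frontier D \<inter> ball z r" for x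
    using P.inward_unit_normal_unique[of x "n x"] normal that by simp
  ultimately have "continuous_on (frontier D \<inter> ball z r) n" by (rule continuous_on_eq)
  then show "\<exists>r>0. continuous_on (frontier D \<inter> ball z r) n" using P.r by blast
qed

lemma norm_n: "p \<in> frontier D \<Longrightarrow> norm (n p) = 1" using normal by (auto simp: inward_unit_normal_def)

lemma form_pos: "p \<in> frontier D \<Longrightarrow> 0 < n p \<bullet> (a p *v n p)"
  using pd[of p] norm_n[of p] F_cl by (metis norm_zero subsetD zero_neq_one)

lemma form_cont:
  assumes "T \<subseteq> closure D" "continuous_on T \<nu>"
  shows "continuous_on T (\<lambda>x. \<nu> x \<bullet> (a x *v \<nu> x))"
  unfolding inner_vec_def matrix_vector_mult_def using assms
  by (auto intro!: continuous_intros continuous_on_subset[OF a_cont])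

lemma rate_cont: "continuous_on (frontier D) rate"
  unfolding rate_def using form_pos
  by (intro continuous_intros form_cont F_cl n_cont continuous_on_subset[OF V_cont F_cl]) force

lemma rate_sq: "p \<in> frontier D \<Longrightarrow> 1/2 * (rate p)\<^sup>2 * (n p \<bullet> (a p *v n p)) = V p"
  and rate_pos: "p \<in> frontier D \<Longrightarrow> 0 < rate p"
  using form_pos[of p] V_pos[of p] F_cl by (auto simp: rate_def)

lemma rate_lower: obtains \<kappa>0 where "0 < \<kappa>0" "\<And>p. p \<in> frontier D \<Longrightarrow> \<kappa>0 \<le> rate p"
  using continuous_attains_inf[OF compact_F F_nonempty rate_cont] rate_pos by metis

section \<open>Leading behaviour of the density at the boundary\<close>

lemma mu_ext: "length is \<le> k \<Longrightarrow> extends_to_closure S (partials is \<mu>)"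
  using mu_Ck unfolding Ck_closure_def extends_to_closure_def by blast

lemma mu_bv_cont:
  assumes "length is \<le> k"
  shows "continuous_on (frontier D) (boundary_value S (partials is \<mu>))"
proof -
  obtain g where g: "continuous_on (closure S) g"
    "\<And>p. p \<in> closure S \<Longrightarrow> p \<notin> S \<Longrightarrow> boundary_value S (partials is \<mu>) p = g p"
    using extends_boundary_value[OF mu_ext[OF assms]] by metis
  have "continuous_on (frontier D) g" by (rule continuous_on_subset[OF g(1)]) (use F_S in auto)
  moreover have "boundary_value S (partials is \<mu>) p = g p" if "p \<in> frontier D" for p using g(2) F_S that by auto
  ultimately show ?thesis by (simp cong: continuous_on_cong)
qed

lemma prod_list_map_cmult: "prod_list (map (\<lambda>j. c * g j) js) = c ^ length js * prod_list (map g js)"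
  for c :: real
  by (induction js) auto

lemma jet:
  assumes p: "p \<in> frontier D" and len: "length is = k"
  shows "boundary_value S (partials is \<mu>) p = jet p * prod_list (map (\<lambda>j. n p $ j) is)"
proof -
  obtain r i s \<gamma> where s: "s \<in> {-1, 1::real}" "graph_patch D p r (s *\<^sub>R axis i 1) \<gamma>" by (rule patch[OF p])
  then interpret P: graph_patch D p r "s *\<^sub>R axis i 1" \<gamma> by simp
  have pb: "p \<in> ball p r" using P.r by simp
  have np: "n p = P.normal p" by (rule P.inward_unit_normal_unique[OF pb p normal[OF p]])
  let ?c = "norm (P.slope p)"
  have c: "1 \<le> ?c" by (rule P.norm_slope_ge_1[OF pb])
  have sl: "P.slope p $ j * s = (?c * s) * n p $ j" for j
  proof -
    have "?c \<noteq> 0" using c by linarith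
    then show ?thesis unfolding np P.normal_def by simp
  qed
  \<comment> \<open>The witness is the pure derivative in direction \<open>i\<close> times a power
    of \<open>?c * s\<close>, because the slope is \<open>?c\<close> times the unit normal and
    \<open>s\<close> has square 1.\<close>
  have "\<exists>t. \<forall>is. length is = k \<longrightarrow> boundary_value S (partials is \<mu>) p = t * prod_list (map (\<lambda>j. n p $ j) is)"
  proof (intro exI allI impI)
    fix js :: "'n list" assume js: "length js = k"
    have "boundary_value S (partials (js @ replicate 0 i) \<mu>) p =
      prod_list (map (\<lambda>j. P.slope p $ j * s) js) * boundary_value S (partials (replicate k i) \<mu>) p"
      by (rule P.rank_one_partials[OF pb p eps refl s(1) mu_Ck mu_vanish]) (use js in auto)
    then show "boundary_value S (partials js \<mu>) p
      = ((?c * s) ^ k * boundary_value S (partials (replicate k i) \<mu>) p) * prod_list (map (\<lambda>j. n p $ j) js)"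
      unfolding sl prod_list_map_cmult js by (simp add: mult_ac)
  qed
  from someI_ex[OF this] show ?thesis using len unfolding jet_def by blast
qed

lemma prod_list_replicate_real: "prod_list (map g (replicate m i)) = (g i ^ m :: real)"
  by (induction m) auto

lemma normal_axis:
  assumes P: "graph_patch D z r (s *\<^sub>R axis i 1) \<gamma>" and s: "s \<in> {-1, 1}" and p: "p \<in> ball z r" "p \<in> frontier D"
  shows "n p \<bullet> (s *\<^sub>R axis i 1) = s * n p $ i" "n p $ i \<noteq> 0"
    "graph_patch.normal (s *\<^sub>R axis i 1) \<gamma> p = n p"
proof -
  interpret P: graph_patch D z r "s *\<^sub>R axis i 1" \<gamma> by (rule P)
  show np: "P.normal p = n p" using P.inward_unit_normal_unique[OF p normal[OF p(2)]] by simp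
  show e: "n p \<bullet> (s *\<^sub>R axis i 1) = s * n p $ i" by (simp add: inner_axis)
  show "n p $ i \<noteq> 0" using P.normal_e_pos[OF p(1)] unfolding np e by auto
qed

text \<open>Within a patch the normal has a nonzero component in the graph direction
  \<open>i\<close>, so \<open>jet\<close> is there a quotient of continuous functions.\<close>

lemma jet_cont: "continuous_on (frontier D) jet"
proof (rule continuous_on_locally_ball)
  fix z assume z: "z \<in> frontier D"
  obtain r i s \<gamma> where s: "s \<in> {-1, 1::real}" and P: "graph_patch D z r (s *\<^sub>R axis i 1) \<gamma>" by (rule patch[OF z])
  let ?g = "\<lambda>p. boundary_value S (partials (replicate k i) \<mu>) p / n p $ i ^ k"
  have "continuous_on (frontier D \<inter> ball z r) ?g"
    using normal_axis(2)[OF P s]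
    by (intro continuous_intros continuous_on_subset[OF mu_bv_cont] continuous_on_subset[OF n_cont]) auto
  moreover have "?g p = jet p" if "p \<in> frontier D \<inter> ball z r" for p
    using jet[of p "replicate k i"] normal_axis(2)[OF P s, of p] that by (simp only: prod_list_replicate_real length_replicate) auto
  ultimately have "continuous_on (frontier D \<inter> ball z r) jet" by (rule continuous_on_eq)
  then show "\<exists>r>0. continuous_on (frontier D \<inter> ball z r) jet" using graph_patch.r[OF P] by blast
qed

lemma mu_derivative_along:
  assumes s: "s \<in> {-1, 1::real}" and j: "j < k" and x: "p + t *\<^sub>R (s *\<^sub>R axis i 1) \<in> S"
  shows "((\<lambda>t. s ^ j * partials (replicate j i) \<mu> (p + t *\<^sub>R (s *\<^sub>R axis i 1))) has_real_derivative
    s ^ Suc j * partials (replicate (Suc j) i) \<mu> (p + t *\<^sub>R (s *\<^sub>R axis i 1))) (at t)"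
proof -
  have "partials (replicate j i) \<mu> differentiable (at (p + t *\<^sub>R (s *\<^sub>R axis i 1)))"
    using mu_Ck j x unfolding Ck_closure_def Ck_on_def by (simp add: length_replicate)
  from DERIV_cmult[OF has_real_derivative_along[OF this], of "s ^ j"] show ?thesis
    by (simp add: partials_Cons mult_ac)
qed

lemma mu_lim:
  assumes P: "graph_patch D z r (s *\<^sub>R axis i 1) \<gamma>" and s: "s \<in> {-1, 1}" and p: "p \<in> ball z r" "p \<in> frontier D"
  shows "((\<lambda>t. \<mu> (p + t *\<^sub>R (s *\<^sub>R axis i 1)) / t ^ k) \<longlongrightarrow> jet p * (n p \<bullet> (s *\<^sub>R axis i 1)) ^ k / fact k) (at_right 0)"
proof -
  interpret P: graph_patch D z r "s *\<^sub>R axis i 1" \<gamma> by (rule P)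
  let ?e = "s *\<^sub>R axis i 1 :: real^'n"
  \<comment> \<open>The derivative of order \<open>j\<close> along the line, with the orientation
    \<open>s\<close> of \<open>e\<close> from the chain rule.\<close>
  let ?g = "\<lambda>j t. s ^ j * partials (replicate j i) \<mu> (p + t *\<^sub>R ?e)"
  obtain t0 where t0: "0 < t0" "\<And>t. 0 < t \<Longrightarrow> t < t0 \<Longrightarrow> p + t *\<^sub>R ?e \<in> S"
    using P.line_in_collar[OF p eps] unfolding eventually_at_right_field by auto
  have l: "(?g j \<longlongrightarrow> s ^ j * boundary_value S (partials (replicate j i) \<mu>) p) (at_right 0)" if "j \<le> k" for j
    by (intro tendsto_mult_left P.tendsto_along_line[OF p eps] boundary_value_tendsto mu_ext F_S p) (use that in simp)
  have "((\<lambda>t. ?g 0 t / t ^ k) \<longlongrightarrow> (jet p * (n p \<bullet> ?e) ^ k) / fact k) (at_right 0)"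
  proof (rule line_taylor_limit[OF t0(1), of k ?g])
    show "(?g j has_real_derivative ?g (Suc j) t) (at t)" if "j < k" "0 < t" "t < t0" for j t
      by (rule mu_derivative_along[OF s that(1) t0(2)[OF that(2,3)]])
    show "(?g j \<longlongrightarrow> 0) (at_right 0)" if "j < k" for j
      using l[of j] mu_vanish[of "replicate j i" p] that p by simp
    have "s ^ k * boundary_value S (partials (replicate k i) \<mu>) p = jet p * (n p \<bullet> ?e) ^ k"
      unfolding jet[OF p(2) length_replicate] normal_axis(1)[OF P s p]
      by (simp only: prod_list_replicate_real power_mult_distrib mult_ac)
    then show "(?g k \<longlongrightarrow> jet p * (n p \<bullet> ?e) ^ k) (at_right 0)" using l[of k] by simp
  qed
  then show ?thesis by simp
qed

text \<open>The leading Taylor coefficient along a line entering \<open>D\<close> is a limit of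
  nonnegative quotients, and it is \<open>jet\<close> times a positive power of
  \<open>n \<bullet> e\<close>.\<close>

lemma jet_nonneg:
  assumes p: "p \<in> frontier D"
  shows "0 \<le> jet p"
proof -
  obtain r i s \<gamma> where s: "s \<in> {-1, 1::real}" and P: "graph_patch D p r (s *\<^sub>R axis i 1) \<gamma>" by (rule patch[OF p])
  interpret P: graph_patch D p r "s *\<^sub>R axis i 1" \<gamma> by (rule P)
  have pb: "p \<in> ball p r" using P.r by simp
  let ?e = "s *\<^sub>R axis i 1 :: real^'n"
  have "\<forall>\<^sub>F t in at_right 0. 0 \<le> \<mu> (p + t *\<^sub>R ?e) / t ^ k"
    using P.line_in_collar[OF pb p eps] eventually_at_right_less[of "0::real"]
    by eventually_elim (auto intro!: divide_nonneg_nonneg mu_nonneg)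
  then have "0 \<le> jet p * (n p \<bullet> ?e) ^ k / fact k"
    by (rule tendsto_lowerbound[OF mu_lim[OF P s pb p]]) simp
  then have "0 \<le> jet p * (n p \<bullet> ?e) ^ k"
    using fact_gt_zero[of k, where ?'a = real] by (simp only: zero_le_divide_iff) linarith
  moreover have "0 < (n p \<bullet> ?e) ^ k"
    using P.normal_e_pos[OF pb] unfolding normal_axis(3)[OF P s pb p] by simp
  ultimately show ?thesis by (meson less_le_not_le mult_less_0_iff not_le)
qed

lemma mu_bound:
  assumes P: "graph_patch D z r (s *\<^sub>R axis i 1) \<gamma>" and s: "s \<in> {-1, 1}" and r1: "0 < r1" "r1 < r"
  shows "\<exists>C t0. 0 < t0 \<and> 0 \<le> C \<and>
      (\<forall>p\<in>frontier D \<inter> cball z r1. \<forall>t. 0 < t \<longrightarrow> t < t0 \<longrightarrow> \<bar>\<mu> (p + t *\<^sub>R (s *\<^sub>R axis i 1))\<bar> \<le> C * t ^ k)"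
proof -
  interpret P: graph_patch D z r "s *\<^sub>R axis i 1" \<gamma> by (rule P)
  let ?e = "s *\<^sub>R axis i 1 :: real^'n"
  \<comment> \<open>Within this distance the segments from feet in the smaller ball stay both in the
    patch and in the collar, uniformly in the foot.\<close>
  define t0 where "t0 = min \<epsilon> (r - r1)"
  have t0: "0 < t0" using eps r1 by (simp add: t0_def)
  have inS: "p + t *\<^sub>R ?e \<in> S" if p: "p \<in> frontier D \<inter> cball z r1" and t: "0 < t" "t < t0" for p t
  proof -
    have pr: "p \<in> ball z r" using p r1 by auto
    have d: "dist (p + t *\<^sub>R ?e) p = t" using P.e t by (simp add: dist_norm abs_mult)
    have "dist z (p + t *\<^sub>R ?e) \<le> dist z p + t" using dist_triangle[of z "p + t *\<^sub>R ?e" p] d by (simp add: dist_commute)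
    then have b: "p + t *\<^sub>R ?e \<in> ball z r" using p t by (auto simp: t0_def)
    have "P.height p = 0" using P.frontier_iff[OF pr] p by simp
    then have "p + t *\<^sub>R ?e \<in> D" using P.mem_D[OF b] t P.height_add[of p t] by simp
    then show ?thesis by (rule mem_boundary_collar[of _ _ p]) (use p t d in \<open>auto simp: t0_def\<close>)
  qed
  obtain g where g: "continuous_on (closure S) g" "\<And>x. x \<in> S \<Longrightarrow> g x = partials (replicate k i) \<mu> x"
    using mu_ext[of "replicate k i"] unfolding extends_to_closure_def by auto
  have "bounded S" using D(2) SD by (rule bounded_subset)
  then have "bounded (g ` closure S)" using compact_continuous_image[OF g(1)] by (simp add: compact_closure compact_imp_bounded)
  then obtain C where C: "0 < C" "\<And>x. x \<in> closure S \<Longrightarrow> \<bar>g x\<bar> \<le> C" unfolding bounded_pos by auto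
  have Cb: "\<bar>partials (replicate k i) \<mu> x\<bar> \<le> C" if "x \<in> S" for x using C(2)[of x] g(2)[OF that] that closure_subset by auto
  have "\<bar>\<mu> (p + t *\<^sub>R ?e)\<bar> \<le> C * t ^ k" if p: "p \<in> frontier D \<inter> cball z r1" and t: "0 < t" "t < t0" for p t
  proof -
    let ?g = "\<lambda>j t. s ^ j * partials (replicate j i) \<mu> (p + t *\<^sub>R ?e)"
    have pr: "p \<in> ball z r" "p \<in> frontier D" using p r1 by auto
    have "\<bar>?g 0 t\<bar> \<le> C * t ^ k"
    proof (rule line_taylor_bound[of k t0 ?g, OF _ _ _ t])
      show "(?g j has_real_derivative ?g (Suc j) t) (at t)" if "j < k" "0 < t" "t < t0" for j t
        by (rule mu_derivative_along[OF s that(1) inS[OF p that(2,3)]])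
      show "(?g j \<longlongrightarrow> 0) (at_right 0)" if j: "j < k" for j
      proof -
        have "(?g j \<longlongrightarrow> s ^ j * boundary_value S (partials (replicate j i) \<mu>) p) (at_right 0)"
          by (intro tendsto_mult_left P.tendsto_along_line[OF pr eps] boundary_value_tendsto mu_ext F_S pr) (use j in simp)
        then show ?thesis using mu_vanish[of "replicate j i" p] j pr by simp
      qed
      show "\<bar>?g k t\<bar> \<le> C" if "0 < t" "t < t0" for t
        using Cb[OF inS[OF p that]] s by (auto simp: abs_mult power_abs)
    qed
    then show ?thesis by simp
  qed
  then show ?thesis using t0 C(1) less_imp_le by blast
qed

section \<open>Uniform estimates for the normalised solution\<close>

lemma defect_C2: "0 < \<delta> \<Longrightarrow> twice_diff_on D (defect \<delta>)"
  unfolding defect_def[abs_def] by (intro twice_diff_on_cmult twice_diff_on_add twice_diff_on_const phi_C2 D)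

lemma defect_cont: "0 < \<delta> \<Longrightarrow> continuous_on (closure D) (defect \<delta>)"
  unfolding defect_def[abs_def] by (intro continuous_intros phi_cont)

lemma defect_eq:
  assumes \<delta>: "0 < \<delta>" and x: "x \<in> D"
  shows "\<delta> * nondiv_op a \<beta> (defect \<delta>) x = V x * defect \<delta> x"
proof -
  let ?c = "1 / (1 + \<bar>mean \<delta>\<bar>)"
  have "nondiv_op a \<beta> (defect \<delta>) x = ?c * nondiv_op a \<beta> (\<lambda>x. \<phi> \<delta> x + (- mean \<delta>)) x"
    unfolding defect_def[abs_def]
    by (rule nondiv_op_cmult[OF D(1) x twice_diff_on_add[OF D(1) phi_C2[OF \<delta>] twice_diff_on_const]])
  also have "nondiv_op a \<beta> (\<lambda>x. \<phi> \<delta> x + (- mean \<delta>)) x = nondiv_op a \<beta> (\<phi> \<delta>) x"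
    by (subst nondiv_op_add[OF D(1) x phi_C2[OF \<delta>] twice_diff_on_const]) (simp add: nondiv_op_const)
  finally have "\<delta> * nondiv_op a \<beta> (defect \<delta>) x = ?c * (\<delta> * nondiv_op a \<beta> (\<phi> \<delta>) x)" by simp
  also have "\<dots> = ?c * (V x * (\<phi> \<delta> x - mean \<delta>))" unfolding phi_eq[OF \<delta> x] mean_def ..
  finally show ?thesis by (simp add: defect_def)
qed

lemma defect_frontier: "0 < \<delta> \<Longrightarrow> p \<in> frontier D \<Longrightarrow> defect \<delta> p = (f p - mean \<delta>) / (1 + \<bar>mean \<delta>\<bar>)"
  by (simp add: defect_def phi_frontier)

lemma defect_sign:
  assumes "0 < \<delta>"
  shows "twice_diff_on D (\<lambda>x. s * defect \<delta> x)" "continuous_on (closure D) (\<lambda>x. s * defect \<delta> x)"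
    "x \<in> D \<Longrightarrow> V x * (s * defect \<delta> x) = \<delta> * nondiv_op a \<beta> (\<lambda>x. s * defect \<delta> x) x"
proof -
  show "twice_diff_on D (\<lambda>x. s * defect \<delta> x)" by (rule twice_diff_on_cmult[OF D(1) defect_C2[OF assms]])
  show "continuous_on (closure D) (\<lambda>x. s * defect \<delta> x)" by (intro continuous_intros defect_cont assms)
  show "V x * (s * defect \<delta> x) = \<delta> * nondiv_op a \<beta> (\<lambda>x. s * defect \<delta> x) x" if "x \<in> D"
    using defect_eq[OF assms that] unfolding nondiv_op_cmult[OF D(1) that defect_C2[OF assms]] by simp
qed

text \<open>If \<open>C\<close> bounds \<open>f\<close>, then \<open>C + 1\<close> bounds the
  normalised boundary data for every value of the mean, and a nonnegative constant is a
  supersolution because \<open>V > 0\<close>.\<close>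

lemma defect_bounded: obtains K where "0 \<le> K" "\<And>\<delta> x. 0 < \<delta> \<Longrightarrow> x \<in> closure D \<Longrightarrow> \<bar>defect \<delta> x\<bar> \<le> K"
proof -
  obtain C where C: "0 \<le> C" "\<And>p. p \<in> frontier D \<Longrightarrow> \<bar>f p\<bar> \<le> C" using bounded_on_F[OF f_cont] by metis
  have fr: "\<bar>defect \<delta> p\<bar> \<le> C + 1" if "0 < \<delta>" "p \<in> frontier D" for \<delta> p
  proof -
    have "\<bar>f p - mean \<delta>\<bar> \<le> C + \<bar>mean \<delta>\<bar>" using C(2)[OF that(2)] by linarith
    also have "\<dots> \<le> (C + 1) * (1 + \<bar>mean \<delta>\<bar>)" using C(1) by (simp add: algebra_simps)
    finally have "\<bar>f p - mean \<delta>\<bar> / (1 + \<bar>mean \<delta>\<bar>) \<le> C + 1" by (simp add: divide_le_eq)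
    then show ?thesis by (simp add: defect_frontier[OF that])
  qed
  have int: "s * defect \<delta> x \<le> C + 1" if \<delta>: "0 < \<delta>" and x: "x \<in> D" and s: "s \<in> {-1, 1}" for \<delta> x s
  proof (rule comparison_principle[where u = "\<lambda>x. s * defect \<delta> x" and \<Psi> = "\<lambda>x. C + 1" and W = D and a = a and \<beta> = \<beta> and V = V and \<delta> = \<delta>])
    show "open D" "bounded D" "0 < \<delta>" "x \<in> D" using D \<delta> x by auto
    show "continuous_on (closure D) (\<lambda>x. s * defect \<delta> x)" "twice_diff_on D (\<lambda>x. s * defect \<delta> x)"
      by (rule defect_sign[OF \<delta>])+
    show "continuous_on (closure D) (\<lambda>x. C + 1)" "twice_diff_on D (\<lambda>x. C + 1)" by (auto intro: twice_diff_on_const)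
    show "V y * (s * defect \<delta> y) \<le> \<delta> * nondiv_op a \<beta> (\<lambda>x. s * defect \<delta> x) y" if "y \<in> D" for y
      using defect_sign(3)[OF \<delta> that, of s] by simp
    show "\<delta> * nondiv_op a \<beta> (\<lambda>x. C + 1) y \<le> V y * (C + 1)" if "y \<in> D" for y
      using V_pos[of y] D_cl that C(1) unfolding nondiv_op_const by (auto intro!: mult_nonneg_nonneg less_imp_le)
    show "s * defect \<delta> y \<le> C + 1" if "y \<in> frontier D" for y using fr[OF \<delta> that] s by auto
    show "transpose (a y) = a y \<and> (\<forall>v. v \<noteq> 0 \<longrightarrow> 0 < v \<bullet> (a y *v v))" if "y \<in> D" for y
      by (rule pd) (use that D_cl in auto)
    show "0 < V y" if "y \<in> D" for y by (rule V_pos) (use that D_cl in auto)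
  qed
  have "\<bar>defect \<delta> x\<bar> \<le> C + 1" if \<delta>: "0 < \<delta>" and x: "x \<in> closure D" for \<delta> x
  proof (cases "x \<in> D")
    case True
    then show ?thesis using int[OF \<delta> True, of 1] int[OF \<delta> True, of "-1"] by auto
  next
    case False
    then have "x \<in> frontier D" using x D(1) by (auto simp: frontier_def interior_open)
    then show ?thesis by (rule fr[OF \<delta>])
  qed
  then show thesis using that[of "C + 1"] C(1) by auto
qed

text \<open>One pair of constants serves all balls in \<open>D\<close>, also those whose radius is
  comparable to \<open>h\<close>; this is what bounds the integrand inside the boundary
  layer.\<close>

lemma defect_decay:
  obtains Kd \<tau> where "0 \<le> Kd" "0 < \<tau>"
    "\<And>h x \<rho>. 0 < h \<Longrightarrow> h \<le> 1 \<Longrightarrow> 0 < \<rho> \<Longrightarrow> ball x \<rho> \<subseteq> D \<Longrightarrow> \<bar>defect (h\<^sup>2) x\<bar> \<le> Kd * exp (- (\<tau> * \<rho> / h))"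
proof -
  obtain K where K: "0 \<le> K" "\<And>\<delta> x. 0 < \<delta> \<Longrightarrow> x \<in> closure D \<Longrightarrow> \<bar>defect \<delta> x\<bar> \<le> K" using defect_bounded by metis
  obtain A where A: "0 \<le> A" "\<And>x i. x \<in> closure D \<Longrightarrow> a x $ i $ i \<le> A" using a_upper by metis
  obtain Vm where Vm: "0 < Vm" "\<And>x. x \<in> closure D \<Longrightarrow> Vm \<le> V x" using V_lower by metis
  define B' where "B' = max B 0"
  \<comment> \<open>For \<open>h \<le> 1\<close> and \<open>\<sigma> \<le> 1\<close> the smallness
    condition of \<open>interior_decay\<close> is bounded by \<open>\<sigma> (A / 2 + B')\<close>,
    hence by \<open>Vm\<close>.\<close>
  define \<sigma> where "\<sigma> = min 1 (Vm / (A / 2 + B' + 1))"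
  have B': "0 \<le> B'" "B \<le> B'" by (auto simp: B'_def)
  have q: "0 < A / 2 + B' + 1" using A(1) B' by linarith
  have \<sigma>: "0 < \<sigma>" "\<sigma> \<le> 1" "\<sigma> \<le> Vm / (A / 2 + B' + 1)" using q Vm(1) by (auto simp: \<sigma>_def)
  then have \<sigma>q: "\<sigma> * (A / 2 + B' + 1) \<le> Vm" using pos_le_divide_eq[OF q] by blast
  let ?N = "real CARD('n)"
  have main: "s * defect (h\<^sup>2) x \<le> 2 * ?N * K * exp (- (\<sigma> / ?N * \<rho> / h))"
    if h: "0 < h" "h \<le> 1" and \<rho>: "0 < \<rho>" "ball x \<rho> \<subseteq> D" and s: "s \<in> {-1, 1}" for h x \<rho> s
  proof -
    have h2: "0 < h\<^sup>2" using h by simp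
    have cb: "cball x \<rho> \<subseteq> closure D" using closure_mono[OF \<rho>(2)] \<rho>(1) by simp
    have bc: "y \<in> D" "y \<in> closure D" if "y \<in> ball x \<rho>" for y using that \<rho>(2) D_cl by auto
    have "s * defect (h\<^sup>2) x \<le> 2 * ?N * K * exp (- (\<sigma> * \<rho> / (h * ?N)))"
    proof (rule interior_decay[where u = "\<lambda>x. s * defect (h\<^sup>2) x" and a = a and \<beta> = \<beta> and A = A and B = B' and Vm = Vm and V = V])
      show "0 < \<rho>" "0 < h" "0 < \<sigma>" "0 < Vm" "0 \<le> K" using \<rho> h \<sigma> Vm K by auto
      show "continuous_on (cball x \<rho>) (\<lambda>x. s * defect (h\<^sup>2) x)" by (rule continuous_on_subset[OF defect_sign(2)[OF h2] cb])
      show "twice_diff_on (ball x \<rho>) (\<lambda>x. s * defect (h\<^sup>2) x)" by (rule twice_diff_on_subset[OF defect_sign(1)[OF h2] \<rho>(2)])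
      have "A / 2 * \<sigma>\<^sup>2 \<le> A / 2 * \<sigma>" using A \<sigma> by (intro mult_left_mono) (auto simp: power2_eq_square mult_left_le)
      moreover have "h * B' * \<sigma> \<le> 1 * B' * \<sigma>" using h B' \<sigma> by (intro mult_right_mono) auto
      ultimately show "A / 2 * \<sigma>\<^sup>2 + h * B' * \<sigma> \<le> Vm" using \<sigma>q \<sigma>(1) by (simp add: algebra_simps)
      show "s * defect (h\<^sup>2) y \<le> K" if "y \<in> cball x \<rho>" for y using K(2)[OF h2, of y] that cb s by auto
      show "V y * (s * defect (h\<^sup>2) y) \<le> h\<^sup>2 * nondiv_op a \<beta> (\<lambda>x. s * defect (h\<^sup>2) x) y" if "y \<in> ball x \<rho>" for y
        using defect_sign(3)[OF h2 bc(1)[OF that], of s] by simp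
      show "transpose (a y) = a y \<and> (\<forall>v. v \<noteq> 0 \<longrightarrow> 0 < v \<bullet> (a y *v v))" if "y \<in> ball x \<rho>" for y by (rule pd[OF bc(2)[OF that]])
      show "a y $ i $ i \<le> A" if "y \<in> ball x \<rho>" for y i by (rule A(2)[OF bc(2)[OF that]])
      show "norm (\<beta> y) \<le> B'" if "y \<in> ball x \<rho>" for y using drift[OF bc(1)[OF that]] B' by linarith
      show "Vm \<le> V y" if "y \<in> ball x \<rho>" for y by (rule Vm(2)[OF bc(2)[OF that]])
    qed
    then show ?thesis by (simp add: mult_ac)
  qed
  show thesis
  proof (rule that[of "2 * ?N * K" "\<sigma> / ?N"])
    show "0 \<le> 2 * ?N * K" "0 < \<sigma> / ?N" using K \<sigma> by auto
    show "\<bar>defect (h\<^sup>2) x\<bar> \<le> 2 * ?N * K * exp (- (\<sigma> / ?N * \<rho> / h))"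
      if "0 < h" "h \<le> 1" "0 < \<rho>" "ball x \<rho> \<subseteq> D" for h x \<rho>
      using main[OF that, of 1] main[OF that, of "-1"] by auto
  qed
qed

lemma defect_profile:
  assumes P: "graph_patch D z r (s *\<^sub>R axis i 1) \<gamma>" and s: "s \<in> {-1, 1}" and p: "p \<in> ball z r" "p \<in> frontier D"
    and h: "\<And>j. 0 < h j" "h \<longlonglongrightarrow> 0" and t: "0 < t"
  shows "(\<lambda>j. defect ((h j)\<^sup>2) (p + (h j * t) *\<^sub>R (s *\<^sub>R axis i 1))
      - defect ((h j)\<^sup>2) p * exp (- (rate p * (n p \<bullet> (s *\<^sub>R axis i 1))) * t)) \<longlonglongrightarrow> 0"
proof -
  interpret P: graph_patch D z r "s *\<^sub>R axis i 1" \<gamma> by (rule P)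
  let ?e = "s *\<^sub>R axis i 1 :: real^'n"
  have np: "P.normal p = n p" by (rule normal_axis(3)[OF P s p])
  obtain K where K: "0 \<le> K" "\<And>\<delta> x. 0 < \<delta> \<Longrightarrow> x \<in> closure D \<Longrightarrow> \<bar>defect \<delta> x\<bar> \<le> K" using defect_bounded by metis
  obtain A where A: "0 \<le> A" "\<And>x i. x \<in> closure D \<Longrightarrow> a x $ i $ i \<le> A" using a_upper by metis
  obtain Vm where Vm: "0 < Vm" "\<And>x. x \<in> closure D \<Longrightarrow> Vm \<le> V x" using V_lower by metis
  have h2: "0 < (h j)\<^sup>2" for j using h(1)[of j] by simp
  interpret L: boundary_layer D a \<beta> V p "n p" A "max B 0" Vm K "rate p" h "\<lambda>j. defect ((h j)\<^sup>2)"
  proof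
    show "open D" "bounded D" "p \<in> frontier D" "norm (n p) = 1" "0 \<le> A" "0 \<le> max B 0" "0 < Vm" "0 < rate p"
      using D p norm_n A Vm rate_pos by auto
    show "0 < h j" "h \<longlonglongrightarrow> 0" for j by (rule h)+
    show "transpose (a x) = a x \<and> (\<forall>v. v \<noteq> 0 \<longrightarrow> 0 < v \<bullet> (a x *v v))" if "x \<in> D" for x using pd that D_cl by blast
    show "a x $ i $ i \<le> A" if "x \<in> D" for x i using A(2) that D_cl by blast
    show "norm (\<beta> x) \<le> max B 0" if "x \<in> D" for x using drift[OF that] by linarith
    show "Vm \<le> V x" if "x \<in> D" for x using Vm(2) that D_cl by blast
    have "continuous_on (closure D) (\<lambda>x. 1/2 * (rate p)\<^sup>2 * (n p \<bullet> (a x *v n p)) - V x)"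
      by (intro continuous_intros form_cont V_cont) auto
    then have "((\<lambda>x. 1/2 * (rate p)\<^sup>2 * (n p \<bullet> (a x *v n p)) - V x) \<longlongrightarrow> 1/2 * (rate p)\<^sup>2 * (n p \<bullet> (a p *v n p)) - V p) (at p within closure D)"
      using p F_cl unfolding continuous_on_def by blast
    then show "((\<lambda>x. 1/2 * (rate p)\<^sup>2 * (n p \<bullet> (a x *v n p)) - V x) \<longlongrightarrow> 0) (at p within D)"
      unfolding rate_sq[OF p(2)] using D_cl by (auto intro: tendsto_within_subset)
    show "\<exists>\<rho>>0. \<forall>x\<in>closure D. dist x p < \<rho> \<longrightarrow> - \<eta> * dist x p \<le> n p \<bullet> (x - p)" if "0 < \<eta>" for \<eta>
      using P.normal_above(1)[OF p that] unfolding np .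
    show "\<exists>\<rho>>0. \<forall>x\<in>frontier D. dist x p < \<rho> \<longrightarrow> \<bar>n p \<bullet> (x - p)\<bar> \<le> \<eta> * dist x p" if "0 < \<eta>" for \<eta>
      using P.normal_above(2)[OF p that] unfolding np .
    show "continuous_on (closure D) (defect ((h j)\<^sup>2))" "twice_diff_on D (defect ((h j)\<^sup>2))" for j
      by (rule defect_cont[OF h2] defect_C2[OF h2])+
    show "\<bar>defect ((h j)\<^sup>2) x\<bar> \<le> K" if "x \<in> closure D" for j x by (rule K(2)[OF h2 that])
    show "(h j)\<^sup>2 * nondiv_op a \<beta> (defect ((h j)\<^sup>2)) x = V x * defect ((h j)\<^sup>2) x" if "x \<in> D" for j x
      by (rule defect_eq[OF h2 that])
    fix \<eta> :: real assume \<eta>: "0 < \<eta>"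
    \<comment> \<open>The normalisation divides differences of boundary values by a number at least
      1, so continuity of \<open>f\<close> at \<open>p\<close> gives equicontinuity in
      \<open>j\<close>.\<close>
    obtain \<rho> where \<rho>: "0 < \<rho>" "\<And>x. x \<in> frontier D \<Longrightarrow> dist x p < \<rho> \<Longrightarrow> \<bar>f x - f p\<bar> < \<eta>"
      using f_cont p \<eta> unfolding continuous_on_iff dist_real_def by blast
    have "\<bar>defect ((h j)\<^sup>2) x - defect ((h j)\<^sup>2) p\<bar> \<le> \<eta>" if x: "x \<in> frontier D" "dist x p < \<rho>" for j x
    proof -
      have eq: "defect ((h j)\<^sup>2) x - defect ((h j)\<^sup>2) p = (f x - f p) / (1 + \<bar>mean ((h j)\<^sup>2)\<bar>)"
        unfolding defect_frontier[OF h2 x(1)] defect_frontier[OF h2 p(2)] by (simp add: diff_divide_distrib[symmetric])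
      have "\<bar>defect ((h j)\<^sup>2) x - defect ((h j)\<^sup>2) p\<bar> = \<bar>f x - f p\<bar> / (1 + \<bar>mean ((h j)\<^sup>2)\<bar>)" unfolding eq by simp
      also have "\<dots> \<le> \<bar>f x - f p\<bar> / 1" by (intro divide_left_mono) auto
      finally have "\<bar>defect ((h j)\<^sup>2) x - defect ((h j)\<^sup>2) p\<bar> \<le> \<bar>f x - f p\<bar>" by simp
      then show ?thesis using less_imp_le[OF \<rho>(2)[OF x]] by (rule order_trans)
    qed
    then show "\<exists>\<rho>>0. \<forall>j. \<forall>x\<in>frontier D. dist x p < \<rho> \<longrightarrow> \<bar>defect ((h j)\<^sup>2) x - defect ((h j)\<^sup>2) p\<bar> \<le> \<eta>"
      using \<rho>(1) by blast
  qed
  have hr: "filterlim (\<lambda>j. h j * t) (at_right 0) sequentially"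
    unfolding filterlim_at using tendsto_mult_left_zero[OF h(2), of t] h(1) t
    by (auto intro!: always_eventually simp: less_imp_neq[OF h(1), symmetric])
  have "\<forall>\<^sub>F j in sequentially. p + (h j * t) *\<^sub>R ?e \<in> S"
    using P.line_in_collar[OF p eps] hr unfolding filterlim_iff by blast
  then have "\<forall>\<^sub>F j in sequentially. p + h j *\<^sub>R (t *\<^sub>R ?e) \<in> D"
    by eventually_elim (use SD in \<open>auto simp: mult.assoc\<close>)
  from L.profile_limit[OF this] show ?thesis by (simp add: mult_ac)
qed

end

section \<open>From local limits to the limit of the solutions\<close>

context jump_diffusion
begin

lemma sets_H: "sets H = sets borel" by (rule sets_hausdorff_measure)

lemma H_finite: "emeasure H (frontier D) < top"
proof -
  have "\<exists>\<rho>>0. emeasure H (frontier D \<inter> cball z \<rho>) < top" if z: "z \<in> frontier D" for z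
  proof -
    obtain r i s \<gamma> where "s \<in> {-1, 1::real}" and P: "graph_patch D z r (s *\<^sub>R axis i 1) \<gamma>" by (rule patch[OF z])
    show ?thesis
      using graph_patch.hausdorff_patch_finite[OF P, of "r / 2"] graph_patch.r[OF P] by (intro exI[of _ "r / 2"]) auto
  qed
  then obtain R where R: "\<And>z. z \<in> frontier D \<Longrightarrow> 0 < R z"
    "\<And>z. z \<in> frontier D \<Longrightarrow> emeasure H (frontier D \<inter> cball z (R z)) < top" by metis
  have "frontier D \<subseteq> (\<Union>z\<in>frontier D. ball z (R z))" using R(1) by force
  then obtain Z where Z: "Z \<subseteq> frontier D" "finite Z" "frontier D \<subseteq> (\<Union>z\<in>Z. ball z (R z))"
    by (rule compactE_image[OF compact_F open_ball])
  have "emeasure H (frontier D) \<le> emeasure H (\<Union>z\<in>Z. frontier D \<inter> cball z (R z))"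
  proof (rule emeasure_mono)
    show "frontier D \<subseteq> (\<Union>z\<in>Z. frontier D \<inter> cball z (R z))" using Z(3) by force
    show "(\<Union>z\<in>Z. frontier D \<inter> cball z (R z)) \<in> sets H" unfolding sets_H using Z(2) by (intro sets.finite_UN) auto
  qed
  also have "\<dots> \<le> (\<Sum>z\<in>Z. emeasure H (frontier D \<inter> cball z (R z)))"
    by (rule emeasure_subadditive_finite[OF Z(2)]) (auto simp: sets_H)
  also have "\<dots> < top" using Z(1,2) R(2) by auto
  finally show ?thesis .
qed

lemma H_pos:
  assumes p: "p \<in> frontier D" and U: "open U" "p \<in> U"
  shows "0 < measure H (frontier D \<inter> U)"
proof -
  obtain r i s \<gamma> where "s \<in> {-1, 1::real}" and P: "graph_patch D p r (s *\<^sub>R axis i 1) \<gamma>" by (rule patch[OF p])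
  have "0 < emeasure H (frontier D \<inter> U \<inter> ball p r)"
    by (rule graph_patch.hausdorff_patch_pos[OF P _ p U]) (use graph_patch.r[OF P] in simp)
  also have "\<dots> \<le> emeasure H (frontier D \<inter> U)" using U(1) by (intro emeasure_mono) (auto simp: sets_H)
  finally have "0 < emeasure H (frontier D \<inter> U)" .
  moreover have "emeasure H (frontier D \<inter> U) \<le> emeasure H (frontier D)" by (intro emeasure_mono) (auto simp: sets_H)
  ultimately show ?thesis using H_finite by (simp add: measure_def enn2real_positive_iff)
qed

lemma integrable_F:
  assumes g: "continuous_on (frontier D) g"
  shows "integrable H (\<lambda>x. if x \<in> frontier D then g x else 0 :: real)"
proof -
  obtain C where C: "0 \<le> C" "\<And>p. p \<in> frontier D \<Longrightarrow> \<bar>g p\<bar> \<le> C" using bounded_on_F[OF g] by metis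
  have "integrable H (\<lambda>x. C * indicator (frontier D) x)"
    using H_finite by (intro integrable_mult_right integrable_real_indicator) (auto simp: sets_H)
  then show ?thesis
  proof (rule Bochner_Integration.integrable_bound)
    show "(\<lambda>x. if x \<in> frontier D then g x else 0) \<in> borel_measurable H"
      unfolding measurable_cong_sets[OF sets_H refl] by (rule borel_measurable_continuous_on_if) (use g in auto)
    show "AE x in H. norm (if x \<in> frontier D then g x else 0) \<le> norm (C * indicator (frontier D) x)"
      using C by (intro AE_I2) (auto split: split_indicator intro: order_trans[OF _ abs_ge_self])
  qed
qed

lemma weight_cont: "continuous_on (frontier D) weight"
  unfolding weight_def using rate_pos by (intro continuous_intros jet_cont rate_cont) force

lemma weight_nonneg: "p \<in> frontier D \<Longrightarrow> 0 \<le> weight p"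
  unfolding weight_def using jet_nonneg rate_pos by (intro divide_nonneg_nonneg) (auto intro: less_imp_le)

text \<open>The nonvanishing derivative of order \<open>k\<close> makes the continuous nonnegative
  weight positive near some boundary point, and every such neighbourhood has positive surface
  measure.\<close>

lemma weight_integral_pos: "0 < (LINT x|H. (if x \<in> frontier D then weight x else 0))"
proof -
  obtain "is" p where len: "length is = k" and p: "p \<in> frontier D" and nz: "boundary_value S (partials is \<mu>) p \<noteq> 0"
    using mu_order by blast
  have "jet p \<noteq> 0" using nz unfolding jet[OF p len] by auto
  then have w: "0 < weight p" using jet_nonneg[OF p] rate_pos[OF p] by (simp add: weight_def)
  then obtain d where d: "0 < d" "\<And>x. x \<in> frontier D \<Longrightarrow> dist x p < d \<Longrightarrow> dist (weight x) (weight p) < weight p / 2"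
    using weight_cont p unfolding continuous_on_iff by (metis half_gt_zero)
  have "0 < weight p / 2 * measure H (frontier D \<inter> ball p d)"
    using w H_pos[OF p, of "ball p d"] d(1) by simp
  also have "\<dots> = (LINT x|H. weight p / 2 * indicator (frontier D \<inter> ball p d) x)" by (simp add: sets_H)
  also have "\<dots> \<le> (LINT x|H. (if x \<in> frontier D then weight x else 0))"
  proof (rule integral_mono)
    have "emeasure H (frontier D \<inter> ball p d) \<le> emeasure H (frontier D)" by (intro emeasure_mono) (auto simp: sets_H)
    then show "integrable H (\<lambda>x. weight p / 2 * indicator (frontier D \<inter> ball p d) x)"
      using H_finite by (intro integrable_mult_right integrable_real_indicator) (auto simp: sets_H)
    show "integrable H (\<lambda>x. if x \<in> frontier D then weight x else 0)" by (rule integrable_F[OF weight_cont])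
    show "weight p / 2 * indicator (frontier D \<inter> ball p d) x \<le> (if x \<in> frontier D then weight x else 0)" for x
    proof (cases "x \<in> frontier D \<inter> ball p d")
      case True
      then have "dist (weight x) (weight p) < weight p / 2" by (intro d(2)) (auto simp: dist_commute)
      then have "weight p / 2 \<le> weight x" unfolding dist_real_def by linarith
      then show ?thesis using True by simp
    next
      case False
      then show ?thesis using weight_nonneg[of x] by auto
    qed
  qed
  finally show ?thesis .
qed

lemma space_M: "space M = D"
  using sets_eq_imp_space_eq[OF M(2)] by (simp add: space_restrict_space)

lemma measurable_M: "continuous_on (closure D) g \<Longrightarrow> g \<in> borel_measurable M"
  unfolding measurable_cong_sets[OF M(2) refl]
  by (rule borel_measurable_continuous_on_restrict[OF continuous_on_subset[OF _ D_cl]])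

lemma S_sets_M: "S \<in> sets M"
  unfolding M(2) sets_restrict_space using SD open_S by (intro image_eqI[of _ _ S]) auto

lemma integrable_M:
  assumes "g \<in> borel_measurable M" "\<And>x. x \<in> D \<Longrightarrow> \<bar>g x :: real\<bar> \<le> C"
  shows "integrable M g"
proof -
  interpret prob_space M by (rule M)
  show ?thesis by (rule integrable_const_bound[of _ C]) (use assms in \<open>auto intro!: AE_I2 simp: space_M\<close>)
qed

lemma integrable_M_cont:
  assumes g: "continuous_on (closure D) (g :: _ \<Rightarrow> real)"
  shows "integrable M g"
proof -
  have "bounded (g ` closure D)" by (rule compact_imp_bounded[OF compact_continuous_image[OF g compact_cl]])
  then obtain C where "\<And>x. x \<in> closure D \<Longrightarrow> \<bar>g x\<bar> \<le> C" unfolding bounded_iff by auto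
  then show ?thesis using D_cl by (intro integrable_M[where C = C] measurable_M[OF g]) auto
qed

lemma integral_collar:
  fixes g :: "real^'n \<Rightarrow> real"
  assumes g: "continuous_on (closure D) g"
  shows "(LINT x|M. (if x \<in> S then g x else 0)) = (LINT x|lborel. (if x \<in> S then g x * \<mu> x else 0))"
proof -
  have s: "sets (restrict_space lborel S) = sets (restrict_space borel S)" by (rule sets_restrict_space_cong) simp
  have gm: "g \<in> borel_measurable (restrict_space lborel S)" and mm: "\<mu> \<in> borel_measurable (restrict_space lborel S)"
    unfolding measurable_cong_sets[OF s refl]
    using SD D_cl mu_Ck closure_subset[of S]
    by (auto intro!: borel_measurable_continuous_on_restrict intro: continuous_on_subset[OF g] continuous_on_subset simp: Ck_closure_def)
  have "(LINT x|M. (if x \<in> S then g x else 0)) = (LINT x|M. indicator S x *\<^sub>R g x)"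
    by (intro Bochner_Integration.integral_cong) auto
  also have "\<dots> = integral\<^sup>L (restrict_space M S) g"
    using S_sets_M SD by (intro integral_restrict_space[symmetric]) (simp add: space_M Int_absorb2)
  also have "\<dots> = (LINT x|restrict_space lborel S. \<mu> x *\<^sub>R g x)"
    unfolding mu_density by (rule integral_density[OF gm mm]) (use mu_nonneg in \<open>auto intro!: AE_I2 simp: space_restrict_space\<close>)
  also have "\<dots> = (LINT x|lborel. indicator S x *\<^sub>R (\<mu> x *\<^sub>R g x))"
    by (rule integral_restrict_space) (use open_S in simp)
  also have "\<dots> = (LINT x|lborel. (if x \<in> S then g x * \<mu> x else 0))"
    by (intro Bochner_Integration.integral_cong) auto
  finally show ?thesis .
qed

lemma integral_defect: assumes "0 < \<delta>" shows "(LINT x|M. defect \<delta> x) = 0"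
proof -
  interpret prob_space M by (rule M)
  have "(LINT x|M. defect \<delta> x) = 1 / (1 + \<bar>mean \<delta>\<bar>) * (LINT x|M. \<phi> \<delta> x + (- mean \<delta>))"
    unfolding defect_def by simp
  also have "(LINT x|M. \<phi> \<delta> x + (- mean \<delta>)) = mean \<delta> + (LINT x|M. - mean \<delta>)"
    unfolding mean_def[of \<delta>]
    by (rule Bochner_Integration.integral_add) (use integrable_M_cont[OF phi_cont[OF assms]] in simp_all)
  also have "\<dots> = 0" by (simp add: prob_space)
  finally show ?thesis by simp
qed

lemma patch_defect_limit:
  assumes z: "z \<in> frontier D" and h: "\<And>j. 0 < h j" "\<And>j. h j \<le> 1" "h \<longlonglongrightarrow> 0"
    and c: "is_hausdorff_ratio TYPE('n) c"
  shows "\<exists>R>0. \<forall>\<zeta>. continuous_on UNIV \<zeta> \<longrightarrow> (\<forall>x. \<bar>\<zeta> x\<bar> \<le> 1) \<longrightarrow> (\<forall>x. x \<notin> ball z R \<longrightarrow> \<zeta> x = 0) \<longrightarrow>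
      (\<lambda>j. (LINT x|lborel. (if x \<in> S then \<zeta> x * defect ((h j)\<^sup>2) x * \<mu> x else 0)) / h j ^ (k + 1)
         - (1 / c) * (LINT x|H. (if x \<in> frontier D then \<zeta> x * defect ((h j)\<^sup>2) x * weight x else 0))) \<longlonglongrightarrow> 0"
proof -
  obtain r i s \<gamma> where s: "s \<in> {-1, 1::real}" and P: "graph_patch D z r (s *\<^sub>R axis i 1) \<gamma>" by (rule patch[OF z])
  interpret P: graph_patch D z r "s *\<^sub>R axis i 1" \<gamma> by (rule P)
  let ?e = "s *\<^sub>R axis i 1 :: real^'n"
  obtain K where K: "0 \<le> K" "\<And>\<delta> x. 0 < \<delta> \<Longrightarrow> x \<in> closure D \<Longrightarrow> \<bar>defect \<delta> x\<bar> \<le> K" using defect_bounded by metis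
  obtain \<kappa>0 where \<kappa>0: "0 < \<kappa>0" "\<And>p. p \<in> frontier D \<Longrightarrow> \<kappa>0 \<le> rate p" using rate_lower by metis
  obtain Kd \<tau> where Kd: "0 \<le> Kd" "0 < \<tau>"
    "\<And>h x \<rho>. 0 < h \<Longrightarrow> h \<le> 1 \<Longrightarrow> 0 < \<rho> \<Longrightarrow> ball x \<rho> \<subseteq> D \<Longrightarrow> \<bar>defect (h\<^sup>2) x\<bar> \<le> Kd * exp (- (\<tau> * \<rho> / h))"
    using defect_decay by metis
  have h2: "0 < (h j)\<^sup>2" for j using h(1)[of j] by simp
  interpret Q: patch_limit D z r ?e \<gamma> \<epsilon> \<mu> k jet rate \<kappa>0 h "\<lambda>j. defect ((h j)\<^sup>2)" K Kd \<tau>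
  proof
    show "bounded D" "z \<in> frontier D" "0 < \<epsilon>" "0 < \<kappa>0" "0 \<le> Kd" "0 < \<tau>" using D z eps \<kappa>0 Kd by auto
    show "0 < h j" "h \<longlonglongrightarrow> 0" for j by (rule h)+
    show "continuous_on S \<mu>" using mu_Ck closure_subset[of S] unfolding Ck_closure_def by (auto intro: continuous_on_subset)
    show "continuous_on (frontier D) jet" "continuous_on (frontier D) rate" by (rule jet_cont rate_cont)+
    show "\<kappa>0 \<le> rate p" if "p \<in> frontier D" for p by (rule \<kappa>0(2)[OF that])
    show "continuous_on (closure D) (defect ((h j)\<^sup>2))" for j by (rule defect_cont[OF h2])
    show "\<bar>defect ((h j)\<^sup>2) x\<bar> \<le> K" if "x \<in> closure D" for j x by (rule K(2)[OF h2 that])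
    show "\<bar>defect ((h j)\<^sup>2) x\<bar> \<le> Kd * exp (- (\<tau> * \<rho> / h j))" if "0 < \<rho>" "ball x \<rho> \<subseteq> D" for j x \<rho>
      by (rule Kd(3)[OF h(1,2) that])
    show "((\<lambda>t. \<mu> (p + t *\<^sub>R ?e) / t ^ k) \<longlongrightarrow> jet p * (P.normal p \<bullet> ?e) ^ k / fact k) (at_right 0)"
      if "p \<in> ball z r" "p \<in> frontier D" for p
      unfolding normal_axis(3)[OF P s that] by (rule mu_lim[OF P s that])
    show "\<exists>C t0. 0 < t0 \<and> 0 \<le> C \<and>
      (\<forall>p\<in>frontier D \<inter> cball z r1. \<forall>t. 0 < t \<longrightarrow> t < t0 \<longrightarrow> \<bar>\<mu> (p + t *\<^sub>R ?e)\<bar> \<le> C * t ^ k)" if "0 < r1" "r1 < r" for r1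
      by (rule mu_bound[OF P s that])
    show "(\<lambda>j. defect ((h j)\<^sup>2) (p + (h j * t) *\<^sub>R ?e) - defect ((h j)\<^sup>2) p * exp (- (rate p * (P.normal p \<bullet> ?e)) * t)) \<longlonglongrightarrow> 0"
      if "p \<in> ball z r" "p \<in> frontier D" "0 < t" for p t
      unfolding normal_axis(3)[OF P s that(1,2)] by (rule defect_profile[OF P s that(1,2) h(1,3) that(3)])
  qed
  have eq: "Q.weight = weight" by (simp add: fun_eq_iff Q.weight_def weight_def)
  show ?thesis
  proof (rule Q.patch_integral_limit)
    fix R assume R: "0 < R" and lim: "\<And>\<zeta> c. continuous_on UNIV \<zeta> \<Longrightarrow> (\<And>x. \<bar>\<zeta> x\<bar> \<le> 1) \<Longrightarrow> (\<And>x. x \<notin> ball z R \<Longrightarrow> \<zeta> x = 0) \<Longrightarrow>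
      is_hausdorff_ratio TYPE('n) c \<Longrightarrow>
      (\<lambda>j. (LINT x|lborel. (if x \<in> S then \<zeta> x * defect ((h j)\<^sup>2) x * \<mu> x else 0)) / h j ^ (k + 1)
         - (1 / c) * (LINT x|H. (if x \<in> frontier D then \<zeta> x * defect ((h j)\<^sup>2) x * Q.weight x else 0))) \<longlonglongrightarrow> 0"
    show ?thesis
    proof (intro exI[of _ R] conjI allI impI)
      show "0 < R" by (rule R)
      fix \<zeta> :: "real^'n \<Rightarrow> real"
      assume a: "continuous_on UNIV \<zeta>" "\<forall>x. \<bar>\<zeta> x\<bar> \<le> 1" "\<forall>x. x \<notin> ball z R \<longrightarrow> \<zeta> x = 0"
      show "(\<lambda>j. (LINT x|lborel. (if x \<in> S then \<zeta> x * defect ((h j)\<^sup>2) x * \<mu> x else 0)) / h j ^ (k + 1)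
         - (1 / c) * (LINT x|H. (if x \<in> frontier D then \<zeta> x * defect ((h j)\<^sup>2) x * weight x else 0))) \<longlonglongrightarrow> 0"
        by (rule lim[OF a(1) _ _ c, unfolded eq]) (use a in auto)
    qed
  qed
qed

text \<open>Localisation requires continuous cutoffs that sum to 1 near the boundary and never
  exceed 1; normalised tent functions over a finite subcover have these properties.\<close>

lemma partition:
  assumes R: "\<And>z. z \<in> frontier D \<Longrightarrow> 0 < R z"
  obtains Z \<zeta> \<rho> where "finite Z" "Z \<subseteq> frontier D" "0 < \<rho>"
    "\<And>z. z \<in> Z \<Longrightarrow> continuous_on UNIV (\<zeta> z)" "\<And>z x. z \<in> Z \<Longrightarrow> \<bar>\<zeta> z x\<bar> \<le> (1::real)"
    "\<And>z x. z \<in> Z \<Longrightarrow> x \<notin> ball z (R z) \<Longrightarrow> \<zeta> z x = 0"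
    "\<And>x. 0 \<le> (\<Sum>z\<in>Z. \<zeta> z x)" "\<And>x. (\<Sum>z\<in>Z. \<zeta> z x) \<le> 1"
    "\<And>x. infdist x (frontier D) < \<rho> \<Longrightarrow> (\<Sum>z\<in>Z. \<zeta> z x) = 1"
proof -
  have "frontier D \<subseteq> (\<Union>z\<in>frontier D. ball z (R z))" using R by force
  then obtain Z where Z: "Z \<subseteq> frontier D" "finite Z" "frontier D \<subseteq> (\<Union>z\<in>Z. ball z (R z))"
    by (rule compactE_image[OF compact_F open_ball])
  define g where "g z x = max 0 (R z - dist z x)" for z x
  define T where "T x = (\<Sum>z\<in>Z. g z x)" for x
  have g0: "0 \<le> g z x" for z x by (simp add: g_def)
  have g_cont: "continuous_on A (g z)" for z A unfolding g_def by (intro continuous_intros)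
  have T_cont: "continuous_on A T" for A unfolding T_def by (intro continuous_intros g_cont)
  have T_pos: "0 < T x" if x: "x \<in> frontier D" for x
  proof -
    obtain z where z: "z \<in> Z" "x \<in> ball z (R z)" using Z(3) x by blast
    have "0 < g z x" using z(2) by (simp add: g_def)
    then show ?thesis unfolding T_def using z(1) Z(2) g0 by (intro sum_pos2[of Z z]) auto
  qed
  obtain y where y: "y \<in> frontier D" "\<And>x. x \<in> frontier D \<Longrightarrow> T y \<le> T x"
    using continuous_attains_inf[OF compact_F F_nonempty T_cont] by blast
  define m where "m = T y / 2"
  have m: "0 < m" "\<And>x. x \<in> frontier D \<Longrightarrow> m < T x" using T_pos[OF y(1)] y(2) unfolding m_def by force+
  \<comment> \<open>Dividing by \<open>max (T x) m\<close> instead of \<open>T x\<close> keeps the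
    cutoffs continuous where all tents vanish; the sum is 1 wherever \<open>T\<close> exceeds
    \<open>m\<close>, which includes a neighbourhood of the boundary.\<close>
  define \<zeta> where "\<zeta> z x = g z x / max (T x) m" for z x
  have d: "0 < max (T x) m" for x using m by simp
  have sum: "(\<Sum>z\<in>Z. \<zeta> z x) = T x / max (T x) m" for x
    by (simp add: \<zeta>_def T_def sum_divide_distrib)
  have T0: "0 \<le> T x" for x unfolding T_def by (intro sum_nonneg g0)
  have "open {x. m < T x}" by (intro open_Collect_less continuous_intros T_cont)
  moreover have "frontier D \<subseteq> {x. m < T x}" using m by auto
  ultimately obtain \<rho> where \<rho>: "0 < \<rho>" "(\<Union>x\<in>frontier D. ball x \<rho>) \<subseteq> {x. m < T x}"
    by (rule compact_subset_open_imp_ball_epsilon_subset[OF compact_F])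
  show thesis
  proof (rule that[of Z \<rho> \<zeta>])
    show "finite Z" "Z \<subseteq> frontier D" "0 < \<rho>" by fact+
    show "continuous_on UNIV (\<zeta> z)" for z
      unfolding \<zeta>_def using d by (intro continuous_intros g_cont T_cont) (metis less_irrefl)
    show "\<bar>\<zeta> z x\<bar> \<le> 1" if z: "z \<in> Z" for z x
    proof -
      have "g z x \<le> T x" unfolding T_def using z Z(2) g0 by (intro member_le_sum) auto
      then have "g z x \<le> max (T x) m" by simp
      then show ?thesis unfolding \<zeta>_def using g0[of z x] d[of x] by (simp add: abs_mult)
    qed
    show "\<zeta> z x = 0" if "x \<notin> ball z (R z)" for z x using that by (simp add: \<zeta>_def g_def)
    show "0 \<le> (\<Sum>z\<in>Z. \<zeta> z x)" for x unfolding sum using T0[of x] d[of x] by (intro divide_nonneg_nonneg) (auto intro: less_imp_le)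
    show "(\<Sum>z\<in>Z. \<zeta> z x) \<le> 1" for x unfolding sum using d[of x] by (simp add: divide_le_eq)
    show "(\<Sum>z\<in>Z. \<zeta> z x) = 1" if x: "infdist x (frontier D) < \<rho>" for x
    proof -
      obtain p where p: "p \<in> frontier D" "infdist x (frontier D) = dist x p"
        using infdist_attains_inf[OF frontier_closed F_nonempty] by metis
      then have "x \<in> (\<Union>x\<in>frontier D. ball x \<rho>)" using x by (auto simp: dist_commute)
      then have "m < T x" using \<rho>(2) by blast
      then show ?thesis unfolding sum using m(1) by simp
    qed
  qed
qed

definition surface_sum :: "(real^'n \<Rightarrow> real) \<Rightarrow> real" where
  "surface_sum g = (LINT x|H. (if x \<in> frontier D then g x * weight x else 0))"

text \<open>The integral of the defect against \<open>M\<close> is 0, and away from the boundary the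
  defect is exponentially small. So the localised collar integrals sum to \<open>o(h^(k+1))\<close>;
  exchanging each of them for its surface integral leaves only the surface integral of the
  defect.\<close>

lemma defect_surface_limit:
  assumes h: "\<And>j. 0 < h j" "\<And>j. h j \<le> 1" "h \<longlonglongrightarrow> 0"
  shows "(\<lambda>j. surface_sum (defect ((h j)\<^sup>2))) \<longlonglongrightarrow> 0"
proof -
  obtain c where c: "is_hausdorff_ratio TYPE('n) c" by (rule is_hausdorff_ratio_exists)
  have c0: "0 < c" using c by (simp add: is_hausdorff_ratio_def)
  have h2: "0 < (h j)\<^sup>2" for j using h(1)[of j] by simp
  let ?U = "\<lambda>j. defect ((h j)\<^sup>2)"
  define good where "good z R \<longleftrightarrow> 0 < R \<and> (\<forall>\<zeta>. continuous_on UNIV \<zeta> \<longrightarrow> (\<forall>x. \<bar>\<zeta> x\<bar> \<le> 1) \<longrightarrow> (\<forall>x. x \<notin> ball z R \<longrightarrow> \<zeta> x = 0) \<longrightarrow>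
      (\<lambda>j. (LINT x|lborel. (if x \<in> S then \<zeta> x * ?U j x * \<mu> x else 0)) / h j ^ (k + 1)
         - (1 / c) * (LINT x|H. (if x \<in> frontier D then \<zeta> x * ?U j x * weight x else 0))) \<longlonglongrightarrow> 0)" for z R
  have "\<exists>R. good z R" if "z \<in> frontier D" for z unfolding good_def by (rule patch_defect_limit[OF that h c])
  then obtain R where good: "\<And>z. z \<in> frontier D \<Longrightarrow> good z (R z)" by metis
  have R1: "0 < R z" if "z \<in> frontier D" for z using good[OF that] unfolding good_def by blast
  obtain Z \<zeta> \<rho> where Z: "finite Z" "Z \<subseteq> frontier D" and \<rho>: "0 < \<rho>"
    and \<zeta>_cont: "\<And>z. z \<in> Z \<Longrightarrow> continuous_on UNIV (\<zeta> z)" and \<zeta>1: "\<And>z x. z \<in> Z \<Longrightarrow> \<bar>\<zeta> z x\<bar> \<le> (1::real)"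
    and \<zeta>0: "\<And>z x. z \<in> Z \<Longrightarrow> x \<notin> ball z (R z) \<Longrightarrow> \<zeta> z x = 0"
    and sum: "\<And>x. 0 \<le> (\<Sum>z\<in>Z. \<zeta> z x)" "\<And>x. (\<Sum>z\<in>Z. \<zeta> z x) \<le> 1"
    "\<And>x. infdist x (frontier D) < \<rho> \<Longrightarrow> (\<Sum>z\<in>Z. \<zeta> z x) = 1"
    by (rule partition[of R]) (use R1 in blast)+
  obtain Kd \<tau> where Kd: "0 \<le> Kd" "0 < \<tau>"
    "\<And>h x \<rho>. 0 < h \<Longrightarrow> h \<le> 1 \<Longrightarrow> 0 < \<rho> \<Longrightarrow> ball x \<rho> \<subseteq> D \<Longrightarrow> \<bar>defect (h\<^sup>2) x\<bar> \<le> Kd * exp (- (\<tau> * \<rho> / h))"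
    using defect_decay by metis
  define I where "I z j = (LINT x|lborel. (if x \<in> S then \<zeta> z x * ?U j x * \<mu> x else 0))" for z j
  define L where "L z j = (LINT x|H. (if x \<in> frontier D then \<zeta> z x * ?U j x * weight x else 0))" for z j
  \<comment> \<open>What the cutoffs do not see. It vanishes within distance \<open>\<rho>0\<close>
    of the boundary, and elsewhere it is bounded by the defect at the centre of a ball of radius
    \<open>\<rho>0\<close> in \<open>D\<close>.\<close>
  define rest where "rest j x = ?U j x - (\<Sum>z\<in>Z. if x \<in> S then \<zeta> z x * ?U j x else 0)" for j x
  have \<zeta>U: "continuous_on (closure D) (\<lambda>x. \<zeta> z x * ?U j x)" if "z \<in> Z" for z j
    by (intro continuous_intros continuous_on_subset[OF \<zeta>_cont[OF that]] defect_cont[OF h2]) auto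
  have Uint: "integrable M (?U j)" for j by (rule integrable_M_cont[OF defect_cont[OF h2]])
  have zint: "integrable M (\<lambda>x. if x \<in> S then \<zeta> z x * ?U j x else 0)" if "z \<in> Z" for z j
  proof -
    have "integrable M (\<lambda>x. indicator S x *\<^sub>R (\<zeta> z x * ?U j x))"
      by (rule integrable_mult_indicator[OF S_sets_M integrable_M_cont[OF \<zeta>U[OF that]]])
    moreover have "(\<lambda>x. indicator S x *\<^sub>R (\<zeta> z x * ?U j x)) = (\<lambda>x. if x \<in> S then \<zeta> z x * ?U j x else 0)"
      by (auto simp: fun_eq_iff)
    ultimately show ?thesis by simp
  qed
  have split: "(LINT x|M. rest j x) = - (\<Sum>z\<in>Z. I z j)" for j
  proof -
    have "(LINT x|M. rest j x) = (LINT x|M. ?U j x) - (LINT x|M. (\<Sum>z\<in>Z. if x \<in> S then \<zeta> z x * ?U j x else 0))"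
      unfolding rest_def by (intro Bochner_Integration.integral_diff Uint Bochner_Integration.integrable_sum zint)
    also have "(LINT x|M. (\<Sum>z\<in>Z. if x \<in> S then \<zeta> z x * ?U j x else 0)) = (\<Sum>z\<in>Z. I z j)"
      unfolding I_def by (subst Bochner_Integration.integral_sum) (auto intro!: zint sum.cong integral_collar \<zeta>U)
    finally show ?thesis using integral_defect[OF h2] by simp
  qed
  define \<rho>0 where "\<rho>0 = min \<epsilon> \<rho>"
  have \<rho>0: "0 < \<rho>0" using eps \<rho> by (simp add: \<rho>0_def)
  have rest_le: "\<bar>rest j x\<bar> \<le> Kd * exp (- (\<tau> * \<rho>0 / h j))" if x: "x \<in> D" for j x
  proof (cases "infdist x (frontier D) < \<rho>0")
    case True
    then have "x \<in> S" "infdist x (frontier D) < \<rho>" using x by (auto simp: boundary_collar_def \<rho>0_def)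
    then have "rest j x = 0" using sum(3)[of x] by (simp add: rest_def sum_distrib_right[symmetric])
    then show ?thesis using Kd(1) by simp
  next
    case False
    then have b: "ball x \<rho>0 \<subseteq> D" by (intro ball_subset_infdist_frontier[OF x]) simp
    have "rest j x = (1 - (if x \<in> S then \<Sum>z\<in>Z. \<zeta> z x else 0)) * ?U j x"
      by (simp add: rest_def sum_distrib_right[symmetric] left_diff_distrib)
    moreover have "\<bar>1 - (if x \<in> S then \<Sum>z\<in>Z. \<zeta> z x else 0)\<bar> \<le> 1" using sum(1,2)[of x] by auto
    ultimately have "\<bar>rest j x\<bar> \<le> 1 * \<bar>?U j x\<bar>" unfolding abs_mult by (metis abs_ge_zero abs_mult mult_right_mono)
    then show ?thesis using Kd(3)[OF h(1,2) \<rho>0 b, of j] by simp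
  qed
  have sum_I: "\<bar>\<Sum>z\<in>Z. I z j\<bar> \<le> Kd * exp (- (\<tau> * \<rho>0 / h j))" for j
  proof -
    interpret prob_space M by (rule M)
    have r: "integrable M (rest j)" unfolding rest_def
      by (intro Bochner_Integration.integrable_diff Uint Bochner_Integration.integrable_sum zint)
    have "\<bar>LINT x|M. rest j x\<bar> \<le> (LINT x|M. \<bar>rest j x\<bar>)" by (rule integral_abs_bound)
    also have "\<dots> \<le> (LINT x|M. Kd * exp (- (\<tau> * \<rho>0 / h j)))"
      using rest_le r by (intro integral_mono_AE) (auto intro!: AE_I2 simp: space_M)
    also have "\<dots> = Kd * exp (- (\<tau> * \<rho>0 / h j))" by (simp add: prob_space)
    finally show ?thesis by (simp add: split)
  qed
  have "(\<lambda>j. (\<Sum>z\<in>Z. I z j) / h j ^ (k + 1)) \<longlonglongrightarrow> 0"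
  proof (rule tendsto_0_le[where K = Kd])
    show "(\<lambda>j. exp (- (\<tau> * \<rho>0 / h j)) / h j ^ (k + 1)) \<longlonglongrightarrow> 0"
      by (rule exp_inverse_flat[OF _ h(1,3)]) (use Kd \<rho>0 in simp)
    have "\<bar>(\<Sum>z\<in>Z. I z j) / h j ^ (k + 1)\<bar> \<le> \<bar>exp (- (\<tau> * \<rho>0 / h j)) / h j ^ (k + 1)\<bar> * Kd" for j
    proof -
      have p: "0 < h j ^ (k + 1)" using h(1)[of j] by simp
      have "\<bar>(\<Sum>z\<in>Z. I z j) / h j ^ (k + 1)\<bar> = \<bar>\<Sum>z\<in>Z. I z j\<bar> / h j ^ (k + 1)" using p by (simp only: abs_divide abs_of_pos)
      also have "\<dots> \<le> Kd * exp (- (\<tau> * \<rho>0 / h j)) / h j ^ (k + 1)" using p sum_I by (intro divide_right_mono) auto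
      also have "\<dots> = \<bar>exp (- (\<tau> * \<rho>0 / h j)) / h j ^ (k + 1)\<bar> * Kd" using p by (simp only: abs_divide abs_of_pos abs_exp_cancel) (simp add: mult.commute)
      finally show ?thesis .
    qed
    then show "\<forall>\<^sub>F j in sequentially. norm ((\<Sum>z\<in>Z. I z j) / h j ^ (k + 1)) \<le> norm (exp (- (\<tau> * \<rho>0 / h j)) / h j ^ (k + 1)) * Kd"
      unfolding real_norm_def by (intro always_eventually allI)
  qed
  moreover have "(\<lambda>j. \<Sum>z\<in>Z. I z j / h j ^ (k + 1) - (1 / c) * L z j) \<longlonglongrightarrow> (\<Sum>z\<in>Z. 0)"
  proof (rule tendsto_sum)
    fix z assume z: "z \<in> Z"
    have "z \<in> frontier D" using z Z(2) by blast
    from good[OF this] show "(\<lambda>j. I z j / h j ^ (k + 1) - (1 / c) * L z j) \<longlonglongrightarrow> 0"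
      unfolding good_def I_def L_def using \<zeta>_cont[OF z] \<zeta>1[OF z] \<zeta>0[OF z] by blast
  qed
  \<comment> \<open>The negligible sum minus the sum of the patch errors isolates
    \<open>1 / c\<close> times the surface terms, and \<open>c\<close> restores them.\<close>
  ultimately have "(\<lambda>j. c * ((\<Sum>z\<in>Z. I z j) / h j ^ (k + 1) - (\<Sum>z\<in>Z. I z j / h j ^ (k + 1) - (1 / c) * L z j))) \<longlonglongrightarrow> c * (0 - (\<Sum>z\<in>Z. 0))"
    by (intro tendsto_mult tendsto_const tendsto_diff)
  moreover have "c * ((\<Sum>z\<in>Z. I z j) / h j ^ (k + 1) - (\<Sum>z\<in>Z. I z j / h j ^ (k + 1) - (1 / c) * L z j)) = surface_sum (?U j)" for j
  proof -
    have "c * ((\<Sum>z\<in>Z. I z j) / h j ^ (k + 1) - (\<Sum>z\<in>Z. I z j / h j ^ (k + 1) - (1 / c) * L z j)) = (\<Sum>z\<in>Z. L z j)"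
      using c0 by (simp add: sum_subtractf sum_divide_distrib sum_distrib_left)
    also have "\<dots> = (LINT x|H. (\<Sum>z\<in>Z. if x \<in> frontier D then \<zeta> z x * ?U j x * weight x else 0))"
      unfolding L_def
    proof (rule Bochner_Integration.integral_sum[symmetric])
      fix z assume z: "z \<in> Z"
      show "integrable H (\<lambda>x. if x \<in> frontier D then \<zeta> z x * ?U j x * weight x else 0)"
        by (intro integrable_F continuous_on_mult weight_cont continuous_on_subset[OF \<zeta>_cont[OF z]]
            continuous_on_subset[OF defect_cont[OF h2] F_cl]) auto
    qed
    also have "\<dots> = surface_sum (?U j)"
      unfolding surface_sum_def
    proof (rule Bochner_Integration.integral_cong[OF refl])
      fix x
      show "(\<Sum>z\<in>Z. if x \<in> frontier D then \<zeta> z x * ?U j x * weight x else 0) = (if x \<in> frontier D then ?U j x * weight x else 0)"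
        using sum(3)[of x] \<rho> by (cases "x \<in> frontier D") (simp_all add: sum_distrib_right[symmetric] mult.assoc)
    qed
    finally show ?thesis .
  qed
  ultimately show ?thesis by simp
qed

text \<open>The distance \<open>d\<close> of \<open>m j\<close> from \<open>F / W\<close> satisfies
  \<open>W d = q (1 + |m j|)\<close>, which is at most \<open>q (1 + |F / W|) + q d\<close>, where
  \<open>q\<close> is the modulus of the given quotient. Once \<open>q < W / 2\<close>, the last
  term is absorbed on the left.\<close>

lemma mean_limit_aux:
  fixes m :: "nat \<Rightarrow> real"
  assumes W: "0 < W" and q: "(\<lambda>j. (F - m j * W) / (1 + \<bar>m j\<bar>)) \<longlonglongrightarrow> 0"
  shows "m \<longlonglongrightarrow> F / W"
proof -
  let ?c = "F / W"
  let ?q = "\<lambda>j. \<bar>(F - m j * W) / (1 + \<bar>m j\<bar>)\<bar>"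
  have q0: "?q \<longlonglongrightarrow> 0" using tendsto_rabs[OF q] by simp
  have "\<forall>\<^sub>F j in sequentially. ?q j < W / 2" using order_tendstoD(2)[OF q0, of "W / 2"] W by simp
  then have "\<forall>\<^sub>F j in sequentially. norm (m j - ?c) \<le> norm (?q j) * (2 / W * (1 + \<bar>?c\<bar>))"
  proof eventually_elim
    case (elim j)
    let ?d = "\<bar>m j - ?c\<bar>"
    have "\<bar>F - m j * W\<bar> = ?q j * (1 + \<bar>m j\<bar>)" by (simp add: abs_divide abs_of_pos add_pos_nonneg)
    moreover have "F - m j * W = - (W * (m j - ?c))" using W by (simp add: field_simps)
    then have "\<bar>F - m j * W\<bar> = W * ?d" using W by (simp only: abs_minus_cancel abs_mult abs_of_pos)
    ultimately have "W * ?d = ?q j * (1 + \<bar>m j\<bar>)" by simp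
    also have "\<dots> \<le> ?q j * ((1 + \<bar>?c\<bar>) + ?d)" by (intro mult_left_mono) (linarith, simp)
    also have "\<dots> \<le> ?q j * (1 + \<bar>?c\<bar>) + W / 2 * ?d" unfolding distrib_left using elim by (intro add_left_mono mult_right_mono) auto
    also have "W * ?d = W / 2 * ?d + W / 2 * ?d" by (metis distrib_right field_sum_of_halves)
    finally have le: "W / 2 * ?d \<le> ?q j * (1 + \<bar>?c\<bar>)" by (rule add_le_imp_le_right)
    have "?d = 2 / W * (W / 2 * ?d)" using W by simp
    also have "\<dots> \<le> 2 / W * (?q j * (1 + \<bar>?c\<bar>))" using W by (intro mult_left_mono[OF le]) auto
    also have "\<dots> = ?q j * (2 / W * (1 + \<bar>?c\<bar>))" by (simp only: mult_ac)
    finally show ?case unfolding real_norm_def abs_idempotent .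
  qed
  then have "(\<lambda>j. m j - ?c) \<longlonglongrightarrow> 0" by (rule tendsto_0_le[OF q0])
  then show ?thesis by (rule LIM_zero_cancel)
qed

lemma mean_limit:
  assumes h: "\<And>j. 0 < h j" "\<And>j. h j \<le> 1" "h \<longlonglongrightarrow> 0"
  shows "(\<lambda>j. mean ((h j)\<^sup>2)) \<longlonglongrightarrow> surface_sum f / surface_sum (\<lambda>x. 1)"
proof (rule mean_limit_aux)
  show "0 < surface_sum (\<lambda>x. 1)" using weight_integral_pos by (simp only: surface_sum_def mult_1_left)
  have h2: "0 < (h j)\<^sup>2" for j using h(1)[of j] by simp
  have "surface_sum (defect ((h j)\<^sup>2)) = (surface_sum f - mean ((h j)\<^sup>2) * surface_sum (\<lambda>x. 1)) / (1 + \<bar>mean ((h j)\<^sup>2)\<bar>)" for j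
  proof -
    let ?m = "mean ((h j)\<^sup>2)"
    have "surface_sum (defect ((h j)\<^sup>2)) = (LINT x|H. ((if x \<in> frontier D then f x * weight x else 0) - ?m * (if x \<in> frontier D then 1 * weight x else 0)) / (1 + \<bar>?m\<bar>))"
      unfolding surface_sum_def
      by (intro Bochner_Integration.integral_cong) (auto simp: defect_frontier[OF h2] left_diff_distrib)
    also have "\<dots> = (surface_sum f - ?m * surface_sum (\<lambda>x. 1)) / (1 + \<bar>?m\<bar>)"
    proof -
      have "integrable H (\<lambda>x. if x \<in> frontier D then f x * weight x else 0)" "integrable H (\<lambda>x. ?m * (if x \<in> frontier D then 1 * weight x else 0))"
        by (intro integrable_F integrable_mult_right continuous_intros f_cont weight_cont)+
      from Bochner_Integration.integral_diff[OF this] show ?thesis unfolding surface_sum_def by simp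
    qed
    finally show ?thesis .
  qed
  then show "(\<lambda>j. (surface_sum f - mean ((h j)\<^sup>2) * surface_sum (\<lambda>x. 1)) / (1 + \<bar>mean ((h j)\<^sup>2)\<bar>)) \<longlonglongrightarrow> 0"
    using defect_surface_limit[OF h] by simp
qed

lemma solution_limit:
  assumes x: "x \<in> D"
  shows "((\<lambda>\<delta>. \<phi> \<delta> x) \<longlongrightarrow> surface_sum f / surface_sum (\<lambda>x. 1)) (at_right 0)"
proof (rule tendsto_at_right_sequentially[of 0 1])
  fix d :: "nat \<Rightarrow> real" assume d: "\<And>j. 0 < d j" "\<And>j. d j < 1" "d \<longlonglongrightarrow> 0"
  define h where "h j = sqrt (d j)" for j
  have h: "0 < h j" "h j \<le> 1" "(h j)\<^sup>2 = d j" for j using d(1,2)[of j] by (auto simp: h_def)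
  have h0: "h \<longlonglongrightarrow> 0" using tendsto_real_sqrt[OF d(3)] by (simp add: h_def[abs_def])
  let ?c = "surface_sum f / surface_sum (\<lambda>x. 1)"
  have m: "(\<lambda>j. mean (d j)) \<longlonglongrightarrow> ?c" using mean_limit[OF h(1,2) h0] unfolding h(3) .
  obtain Kd \<tau> where Kd: "0 \<le> Kd" "0 < \<tau>"
    "\<And>h x \<rho>. 0 < h \<Longrightarrow> h \<le> 1 \<Longrightarrow> 0 < \<rho> \<Longrightarrow> ball x \<rho> \<subseteq> D \<Longrightarrow> \<bar>defect (h\<^sup>2) x\<bar> \<le> Kd * exp (- (\<tau> * \<rho> / h))"
    using defect_decay by metis
  obtain \<rho> where \<rho>: "0 < \<rho>" "ball x \<rho> \<subseteq> D" using D(1) x unfolding open_contains_ball by blast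
  have "(\<lambda>j. defect (d j) x) \<longlonglongrightarrow> 0"
  proof (rule tendsto_0_le[where K = Kd])
    show "(\<lambda>j. exp (- (\<tau> * \<rho> / h j)) / h j ^ 0) \<longlonglongrightarrow> 0" by (rule exp_inverse_flat[OF _ h(1) h0]) (use Kd \<rho> in simp)
    show "\<forall>\<^sub>F j in sequentially. norm (defect (d j) x) \<le> norm (exp (- (\<tau> * \<rho> / h j)) / h j ^ 0) * Kd"
      using Kd(3)[OF h(1,2) \<rho>] unfolding h(3) by (intro always_eventually allI) (simp add: mult.commute)
  qed
  \<comment> \<open>Undoing the normalisation is harmless because the means are already known to
    converge.\<close>
  then have "(\<lambda>j. (1 + \<bar>mean (d j)\<bar>) * defect (d j) x + mean (d j)) \<longlonglongrightarrow> (1 + \<bar>?c\<bar>) * 0 + ?c"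
    by (intro tendsto_intros m)
  moreover have "(1 + \<bar>mean (d j)\<bar>) * defect (d j) x + mean (d j) = \<phi> (d j) x" for j
  proof -
    have "1 + \<bar>mean (d j)\<bar> \<noteq> 0" by linarith
    then show ?thesis by (simp add: defect_def)
  qed
  ultimately show "(\<lambda>j. \<phi> (d j) x) \<longlonglongrightarrow> ?c" by simp
qed simp

end

section \<open>Identification of the weight through iterates of the adjoint\<close>

lemma normal_jet_adjoint_power:
  assumes S: "open S" and F: "F \<subseteq> closure S - S"
    and a: "\<And>i j. 2 \<le> k \<Longrightarrow> Cext (k - 1) S (\<lambda>x. a x $ i $ j)"
    and b: "\<And>i. 2 \<le> k \<Longrightarrow> Cext (k - 1) S (\<lambda>x. b x $ i)"
    and v: "normal_jet k S F \<nu> v \<theta>"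
    and q: "\<And>p. p \<in> F \<Longrightarrow> (\<Sum>i\<in>UNIV. \<Sum>j\<in>UNIV. \<nu> p $ i * \<nu> p $ j * boundary_value S (\<lambda>x. a x $ i $ j) p) = q p"
    and l: "2 * l \<le> k"
  shows "normal_jet (k - 2 * l) S F \<nu> ((adjoint_op a b ^^ l) v) (\<lambda>p. (1/2 * q p) ^ l * \<theta> p)"
  using l
proof (induction l)
  case 0
  then show ?case using v by simp
next
  case (Suc l)
  define m where "m = k - 2 * Suc l"
  \<comment> \<open>Each application lowers the order of the jet by two; with \<open>Suc m\<close>
    left to differentiate, regularity of order \<open>k - 1\<close> of the coefficients suffices at
    every stage.\<close>
  have m: "k - 2 * l = Suc (Suc m)" "2 \<le> k" "Suc m \<le> k - 1" using Suc.prems by (auto simp: m_def)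
  have "normal_jet (Suc (Suc m)) S F \<nu> ((adjoint_op a b ^^ l) v) (\<lambda>p. (1/2 * q p) ^ l * \<theta> p)"
    using Suc unfolding m(1) by simp
  then have "normal_jet m S F \<nu> (adjoint_op a b ((adjoint_op a b ^^ l) v))
    (\<lambda>p. 1/2 * (\<Sum>i\<in>UNIV. \<Sum>j\<in>UNIV. \<nu> p $ i * \<nu> p $ j * boundary_value S (\<lambda>x. a x $ i $ j) p) * ((1/2 * q p) ^ l * \<theta> p))"
    by (rule normal_jet_adjoint[OF S F Cext_mono[OF a[OF m(2)] m(3)] Cext_mono[OF b[OF m(2)] m(3)]])
  then have "normal_jet m S F \<nu> (adjoint_op a b ((adjoint_op a b ^^ l) v)) (\<lambda>p. (1/2 * q p) ^ Suc l * \<theta> p)"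
    by (rule normal_jet_theta_cong) (simp add: q)
  then show ?case by (simp add: m_def)
qed

lemma powr_neg_half:
  assumes "0 < (x::real)"
  shows "x powr (- (real k + 1) / 2) = 1 / sqrt x ^ (k + 1)"
proof -
  have "sqrt x ^ (k + 1) = (x powr (1 / 2)) powr real (k + 1)"
    using assms by (subst powr_realpow) (auto simp: powr_half_sqrt)
  also have "\<dots> = x powr ((real k + 1) / 2)" by (simp add: powr_powr add.commute)
  finally have "sqrt x ^ (k + 1) = x powr ((real k + 1) / 2)" .
  moreover have "- (real k + 1) / 2 = - ((real k + 1) / 2)" by (rule minus_divide_left[symmetric])
  ultimately show ?thesis by (simp only: powr_minus_divide)
qed

lemma extends_to_closure_bounded:
  assumes "bounded S" "extends_to_closure S g"
  shows "\<exists>C. \<forall>x\<in>S. \<bar>g x\<bar> \<le> C"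
proof -
  obtain h where h: "continuous_on (closure S) h" "\<And>x. x \<in> S \<Longrightarrow> h x = g x"
    using assms(2) unfolding extends_to_closure_def by blast
  have "compact (closure S)" using assms(1) by (simp add: compact_closure)
  then have "bounded (h ` closure S)" using compact_continuous_image[OF h(1)] compact_imp_bounded by blast
  then obtain C where "\<forall>x\<in>closure S. \<bar>h x\<bar> \<le> C" unfolding bounded_iff by auto
  then show ?thesis using h(2) closure_subset[of S] by (metis subsetD)
qed

context jump_diffusion
begin

abbreviation (input) "q p \<equiv> n p \<bullet> (a p *v n p)"

lemma F_S_subset: "frontier D \<subseteq> closure S - S" using F_S by auto

lemma boundary_value_cont:
  assumes "continuous_on (closure S) g" "p \<in> frontier D"
  shows "boundary_value S g p = g p"
proof (rule boundary_value_eqI[OF _ F_S[OF assms(2)]])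
  have "(g \<longlongrightarrow> g p) (at p within closure S)" using assms F_S(1) unfolding continuous_on_def by blast
  then show "(g \<longlongrightarrow> g p) (at p within S)" by (rule tendsto_within_subset) (rule closure_subset)
qed

lemma jet_normal: "normal_jet k S (frontier D) n \<mu> jet"
  by (rule normal_jetI[OF Ck_closure_Cext[OF mu_Ck] mu_vanish jet])

lemma adjoint_jet:
  assumes a: "\<And>i j. 2 \<le> k \<Longrightarrow> Cext (k - 1) D (\<lambda>x. a x $ i $ j)"
    and b: "\<And>i. 2 \<le> k \<Longrightarrow> Cext (k - 1) D (\<lambda>x. b x $ i)" and l: "2 * l \<le> k"
  shows "normal_jet (k - 2 * l) S (frontier D) n ((adjoint_op a b ^^ l) \<mu>) (\<lambda>p. (1/2 * q p) ^ l * jet p)"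
proof (rule normal_jet_adjoint_power[OF open_S F_S_subset _ _ jet_normal _ l])
  show "Cext (k - 1) S (\<lambda>x. a x $ i $ j)" if "2 \<le> k" for i j by (rule Cext_subset[OF SD a[OF that]])
  show "Cext (k - 1) S (\<lambda>x. b x $ i)" if "2 \<le> k" for i by (rule Cext_subset[OF SD b[OF that]])
  fix p assume p: "p \<in> frontier D"
  have "boundary_value S (\<lambda>x. a x $ i $ j) p = a p $ i $ j" for i j
    by (rule boundary_value_cont[OF continuous_on_subset[OF a_cont closure_mono[OF SD]] p])
  then show "(\<Sum>i\<in>UNIV. \<Sum>j\<in>UNIV. n p $ i * n p $ j * boundary_value S (\<lambda>x. a x $ i $ j) p) = q p"
    by (simp add: inner_vec_def matrix_vector_mult_def sum_distrib_left mult_ac)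
qed

text \<open>Here \<open>k + 1 = 2 l + 1\<close>, and \<open>(2 V / q)\<close> to the power
  \<open>k + 1\<close> under the root splits into an integral power and one square root. The factors
  \<open>2^l\<close> and \<open>q^l\<close> come from the adjoint, \<open>sqrt q\<close> is the
  explicit factor in the formula, and \<open>sqrt 2\<close> is left over.\<close>

lemma even_weight:
  assumes p: "p \<in> frontier D" and k: "k = 2 * l"
  shows "sqrt (q p) * V p powr (- (real k + 1) / 2) * ((1/2 * q p) ^ l * jet p) = sqrt 2 * weight p"
proof -
  have V: "0 < V p" and q: "0 < q p" using V_pos p F_cl form_pos by auto
  have odd_power: "sqrt x ^ (k + 1) = x ^ l * sqrt x" if "0 \<le> x" for x
    using that by (simp add: k power_mult)
  have two: "sqrt 2 ^ (k + 1) = 2 ^ l * sqrt (2::real)" by (rule odd_power) simp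
  have r: "rate p ^ (k + 1) = (2 ^ l * sqrt 2) * sqrt (V p) ^ (k + 1) / (q p ^ l * sqrt (q p))"
    unfolding rate_def real_sqrt_divide real_sqrt_mult power_divide power_mult_distrib
    by (simp only: two odd_power[OF less_imp_le[OF q]])
  show ?thesis
    unfolding powr_neg_half[OF V] weight_def r using q V by (simp add: power_divide field_simps)
qed

text \<open>Here \<open>k + 1 = 2 (l + 1)\<close>, so all powers are integral. The conormal
  derivative supplies one more factor \<open>q\<close> than the adjoint powers, without the
  accompanying half; hence the 2.\<close>

lemma odd_weight:
  assumes p: "p \<in> frontier D" and k: "k = 2 * l + 1"
  shows "V p powr (- (real k + 1) / 2) * ((1/2 * q p) ^ l * jet p * q p) = 2 * weight p"
proof -
  have V: "0 < V p" and q: "0 < q p" using V_pos p F_cl form_pos by auto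
  have even_power: "sqrt x ^ (k + 1) = x ^ (l + 1)" if "0 \<le> x" for x
  proof -
    have "sqrt x ^ (k + 1) = (sqrt x ^ 2) ^ (l + 1)" unfolding k by (simp only: power_mult[symmetric]) (simp add: algebra_simps)
    then show ?thesis using that by simp
  qed
  have r: "rate p ^ (k + 1) = (2 * V p / q p) ^ (l + 1)" unfolding rate_def using V q by (intro even_power) simp
  show ?thesis
    unfolding powr_neg_half[OF V] weight_def r even_power[OF less_imp_le[OF V]]
    using q V by (simp add: power_divide power_mult_distrib field_simps)
qed

lemma boundary_gradient_jet:
  assumes v: "normal_jet (Suc 0) S (frontier D) n v \<theta>" and p: "p \<in> frontier D"
  shows "(a p *v boundary_gradient S v p) \<bullet> n p = \<theta> p * q p"
proof -
  have "boundary_gradient S v p = \<theta> p *\<^sub>R n p"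
    using v p by (simp add: boundary_gradient_def vec_eq_iff)
  then show ?thesis by (simp add: matrix_vector_mult_scaleR inner_commute)
qed

lemma boundary_integral_surface:
  assumes "\<And>p. p \<in> frontier D \<Longrightarrow> g p = C * (F p * weight p)"
  shows "boundary_integral D g = C * surface_sum F"
proof -
  have "boundary_integral D g = (LINT x|H. C * (if x \<in> frontier D then F x * weight x else 0))"
    unfolding boundary_integral_def set_lebesgue_integral_def
    by (intro Bochner_Integration.integral_cong) (auto simp: assms)
  then show ?thesis by (simp add: surface_sum_def)
qed

text \<open>Any positive multiple of the weight gives the same quotient, so the constants
  \<open>sqrt 2\<close> and 2 of the two parities disappear.\<close>

lemma boundary_ratio:
  assumes w: "\<And>p. p \<in> frontier D \<Longrightarrow> w p = C * weight p" and g: "\<And>p. p \<in> frontier D \<Longrightarrow> g p = f p * w p" and C: "0 < C"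
  shows "boundary_integral D w \<noteq> 0 \<and> surface_sum f / surface_sum (\<lambda>x. 1) = boundary_integral D g / boundary_integral D w"
proof -
  have "0 < surface_sum (\<lambda>x. 1)" using weight_integral_pos by (simp only: surface_sum_def mult_1_left)
  moreover have "boundary_integral D w = C * surface_sum (\<lambda>x. 1)" by (rule boundary_integral_surface) (simp add: w)
  moreover have "boundary_integral D g = C * surface_sum f" by (rule boundary_integral_surface) (simp add: g w)
  ultimately show ?thesis using C by simp
qed

theorem limit_formula:
  assumes a: "\<And>i j. 2 \<le> k \<Longrightarrow> Cext (k - 1) D (\<lambda>x. a x $ i $ j)"
    and b: "\<And>i. 2 \<le> k \<Longrightarrow> Cext (k - 1) D (\<lambda>x. b x $ i)"
  defines "\<phi>0 \<equiv> surface_sum f / surface_sum (\<lambda>x. 1)"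
  shows "even k \<longrightarrow>
      (let w = (\<lambda>x. sqrt (n x \<bullet> (a x *v n x)) * V x powr (- (real k + 1) / 2) *
                    boundary_value S ((adjoint_op a b ^^ (k div 2)) \<mu>) x)
       in boundary_integral D w \<noteq> 0 \<and>
          \<phi>0 = boundary_integral D (\<lambda>x. f x * w x) / boundary_integral D w)" (is "even k \<longrightarrow> ?E")
    and "odd k \<longrightarrow>
      (let w = (\<lambda>x. V x powr (- (real k + 1) / 2) *
                    ((a x *v boundary_gradient S ((adjoint_op a b ^^ ((k - 1) div 2)) \<mu>) x) \<bullet> n x))
       in boundary_integral D w \<noteq> 0 \<and>
          \<phi>0 = boundary_integral D (\<lambda>x. f x * w x) / boundary_integral D w)" (is "odd k \<longrightarrow> ?O")
    and "k = 0 \<longrightarrow>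
      \<phi>0 = boundary_integral D (\<lambda>x. f x * sqrt (n x \<bullet> (a x *v n x)) * (\<mu> x / sqrt (V x))) /
           boundary_integral D (\<lambda>x. sqrt (n x \<bullet> (a x *v n x)) * (\<mu> x / sqrt (V x)))"
    and "k = 1 \<longrightarrow>
      \<phi>0 = boundary_integral D (\<lambda>x. f x * (1 / V x) * ((a x *v boundary_gradient S \<mu> x) \<bullet> n x)) /
           boundary_integral D (\<lambda>x. (1 / V x) * ((a x *v boundary_gradient S \<mu> x) \<bullet> n x))"
proof -
  show "even k \<longrightarrow> ?E"
  proof
    assume "even k"
    then obtain l where l: "k = 2 * l" by blast
    have bv: "boundary_value S ((adjoint_op a b ^^ (k div 2)) \<mu>) p = (1/2 * q p) ^ l * jet p" if "p \<in> frontier D" for p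
      using adjoint_jet[OF a b, of l] that by (simp add: l)
    show ?E
      unfolding Let_def \<phi>0_def
      by (rule boundary_ratio[where C = "sqrt 2"]) (simp_all only: bv even_weight[OF _ l], simp)
  qed
  show "odd k \<longrightarrow> ?O"
  proof
    assume "odd k"
    then obtain l where l: "k = 2 * l + 1" by (rule oddE)
    have j: "normal_jet (Suc 0) S (frontier D) n ((adjoint_op a b ^^ ((k - 1) div 2)) \<mu>) (\<lambda>p. (1/2 * q p) ^ l * jet p)"
      using adjoint_jet[OF a b, of l] by (simp add: l)
    show ?O
      unfolding Let_def \<phi>0_def
    proof (rule boundary_ratio[where C = 2])
      fix p assume p: "p \<in> frontier D"
      show "V p powr (- (real k + 1) / 2) * ((a p *v boundary_gradient S ((adjoint_op a b ^^ ((k - 1) div 2)) \<mu>) p) \<bullet> n p)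
        = 2 * weight p"
        unfolding boundary_gradient_jet[OF j p] by (rule odd_weight[OF p l])
    qed simp_all
  qed
  show "k = 0 \<longrightarrow>
      \<phi>0 = boundary_integral D (\<lambda>x. f x * sqrt (n x \<bullet> (a x *v n x)) * (\<mu> x / sqrt (V x))) /
           boundary_integral D (\<lambda>x. sqrt (n x \<bullet> (a x *v n x)) * (\<mu> x / sqrt (V x)))"
  proof
    assume k: "k = 0"
    \<comment> \<open>For \<open>k = 0\<close> the hypothesis on \<open>\<mu>\<close> includes
      continuity on the closed collar, so its actual values on the boundary are its boundary
      values.\<close>
    have mu: "\<mu> p = jet p" if "p \<in> frontier D" for p
      using jet[OF that, of "[]"] boundary_value_cont[of \<mu> p] mu_Ck that by (simp add: k Ck_closure_def)
    have w: "sqrt (n p \<bullet> (a p *v n p)) * (\<mu> p / sqrt (V p)) = sqrt 2 * weight p" if "p \<in> frontier D" for p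
      using even_weight[OF that, of 0] powr_neg_half[of "V p" 0] V_pos[of p] F_cl that mu[OF that] by (auto simp: k)
    show "\<phi>0 = boundary_integral D (\<lambda>x. f x * sqrt (n x \<bullet> (a x *v n x)) * (\<mu> x / sqrt (V x))) /
           boundary_integral D (\<lambda>x. sqrt (n x \<bullet> (a x *v n x)) * (\<mu> x / sqrt (V x)))"
      unfolding \<phi>0_def by (rule conjunct2[OF boundary_ratio[OF w]]) (simp_all add: mult.assoc)
  qed
  show "k = 1 \<longrightarrow>
      \<phi>0 = boundary_integral D (\<lambda>x. f x * (1 / V x) * ((a x *v boundary_gradient S \<mu> x) \<bullet> n x)) /
           boundary_integral D (\<lambda>x. (1 / V x) * ((a x *v boundary_gradient S \<mu> x) \<bullet> n x))"
  proof
    assume k: "k = 1"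
    have j: "normal_jet (Suc 0) S (frontier D) n \<mu> jet" using jet_normal by (simp add: k)
    have w: "(1 / V p) * ((a p *v boundary_gradient S \<mu> p) \<bullet> n p) = 2 * weight p" if p: "p \<in> frontier D" for p
    proof -
      have V: "0 < V p" using V_pos p F_cl by blast
      show ?thesis
        using odd_weight[OF p, of 0] powr_neg_half[OF V, of 1] V boundary_gradient_jet[OF j p]
        by (simp add: k power2_eq_square)
    qed
    show "\<phi>0 = boundary_integral D (\<lambda>x. f x * (1 / V x) * ((a x *v boundary_gradient S \<mu> x) \<bullet> n x)) /
           boundary_integral D (\<lambda>x. (1 / V x) * ((a x *v boundary_gradient S \<mu> x) \<bullet> n x))"
      unfolding \<phi>0_def by (rule conjunct2[OF boundary_ratio[OF w]]) (simp_all add: mult.assoc)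
  qed
qed

end

theorem theorem1:
  fixes D :: "(real^'n::finite) set"
    and \<alpha> \<epsilon> :: real
    and M :: "(real^'n) measure"
    and \<mu> V f :: "real^'n \<Rightarrow> real"
    and a :: "real^'n \<Rightarrow> real^'n^'n"
    and b n :: "real^'n \<Rightarrow> real^'n"
    and k :: nat
    and \<phi> :: "real \<Rightarrow> real^'n \<Rightarrow> real"
  defines "D\<epsilon> \<equiv> boundary_collar D \<epsilon>"
  assumes "open D" "connected D" "D \<noteq> {}" "bounded D"
    and "0 < \<alpha>" "\<alpha> \<le> 1"
    and "Ck_holder_boundary 2 \<alpha> D"
    and "prob_space M" "sets M = sets (restrict_space borel D)"
    and "\<forall>x\<in>closure D. 0 < V x"
    and "\<forall>x\<in>closure D. transpose (a x) = a x \<and> (\<forall>v. v \<noteq> 0 \<longrightarrow> 0 < v \<bullet> (a x *v v))"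
    and "0 < \<epsilon>"
    and "\<forall>x\<in>D\<epsilon>. 0 \<le> \<mu> x"
    and "restrict_space M D\<epsilon> = density (restrict_space lborel D\<epsilon>) (\<lambda>x. ennreal (\<mu> x))"
    \<comment> \<open>regularity of the density\<close>
    and "even k \<Longrightarrow> Ck_closure k D\<epsilon> \<mu>"
    and "odd k \<Longrightarrow> Ck_closure (k + 1) D\<epsilon> \<mu>"
    \<comment> \<open>order of vanishing of the density at the boundary\<close>
    and "\<forall>is. length is < k \<longrightarrow> (\<forall>x\<in>frontier D. boundary_value D\<epsilon> (partials is \<mu>) x = 0)"
    and "\<exists>is. length is = k \<and> (\<exists>x\<in>frontier D. boundary_value D\<epsilon> (partials is \<mu>) x \<noteq> 0)"
    \<comment> \<open>regularity of the jump rate\<close>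
    and "k = 0 \<or> k = 2 \<Longrightarrow> Ck_holder_closure 2 \<alpha> D V"
    and "even k \<and> k \<ge> 4 \<Longrightarrow> Ck_closure k D V"
    and "odd k \<Longrightarrow> Ck_closure (k + 1) D V"
    \<comment> \<open>regularity of the coefficients\<close>
    and "k \<le> 2 \<Longrightarrow> (\<forall>i j. Ck_holder_closure 1 \<alpha> D (\<lambda>x. a x $ i $ j)) \<and>
                    (\<forall>i. Ck_holder_closure 1 \<alpha> D (\<lambda>x. b x $ i))"
    and "even k \<and> k \<ge> 4 \<Longrightarrow> (\<forall>i j. Ck_closure (k - 1) D (\<lambda>x. a x $ i $ j)) \<and>
                    (\<forall>i. Ck_closure (k - 1) D (\<lambda>x. b x $ i))"
    and "odd k \<and> k \<ge> 3 \<Longrightarrow> (\<forall>i j. Ck_closure k D (\<lambda>x. a x $ i $ j)) \<and>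
                    (\<forall>i. Ck_closure k D (\<lambda>x. b x $ i))"
    and "\<forall>x\<in>frontier D. inward_unit_normal D x (n x)"
    and "continuous_on (frontier D) f"
    and "\<forall>\<delta>>0. dirichlet_solution D a b V M f \<delta> (\<phi> \<delta>)"
  shows "\<exists>\<phi>0. (\<forall>x\<in>D. ((\<lambda>\<delta>. \<phi> \<delta> x) \<longlongrightarrow> \<phi>0) (at_right 0)) \<and>
    (even k \<longrightarrow>
      (let w = (\<lambda>x. sqrt (n x \<bullet> (a x *v n x)) * V x powr (- (real k + 1) / 2) *
                    boundary_value D\<epsilon> ((adjoint_op a b ^^ (k div 2)) \<mu>) x)
       in boundary_integral D w \<noteq> 0 \<and>
          \<phi>0 = boundary_integral D (\<lambda>x. f x * w x) / boundary_integral D w)) \<and>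
    (odd k \<longrightarrow>
      (let w = (\<lambda>x. V x powr (- (real k + 1) / 2) *
                    ((a x *v boundary_gradient D\<epsilon> ((adjoint_op a b ^^ ((k - 1) div 2)) \<mu>) x) \<bullet> n x))
       in boundary_integral D w \<noteq> 0 \<and>
          \<phi>0 = boundary_integral D (\<lambda>x. f x * w x) / boundary_integral D w)) \<and>
    (k = 0 \<longrightarrow>
      \<phi>0 = boundary_integral D (\<lambda>x. f x * sqrt (n x \<bullet> (a x *v n x)) * (\<mu> x / sqrt (V x))) /
           boundary_integral D (\<lambda>x. sqrt (n x \<bullet> (a x *v n x)) * (\<mu> x / sqrt (V x)))) \<and>
    (k = 1 \<longrightarrow>
      \<phi>0 = boundary_integral D (\<lambda>x. f x * (1 / V x) * ((a x *v boundary_gradient D\<epsilon> \<mu> x) \<bullet> n x)) /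
           boundary_integral D (\<lambda>x. (1 / V x) * ((a x *v boundary_gradient D\<epsilon> \<mu> x) \<bullet> n x)))"
proof -
  note D = assms(2,4,5) and k_le_2 = assms(23) and k_even = assms(24) and k_odd = assms(25)
  let ?S = "boundary_collar D \<epsilon>"
  \<comment> \<open>One derivative of the coefficients is needed to pass to nondivergence form,
    \<open>k - 1\<close> of them for the iterates of the adjoint; the three regularity cases all
    provide the maximum.\<close>
  define c where "c = max 1 (k - 1)"
  have coeff: "Ck_closure c D (\<lambda>x. a x $ i $ j) \<and> Ck_closure c D (\<lambda>x. b x $ i)" for i j
  proof -
    have "k \<le> 2 \<or> (even k \<and> k \<ge> 4) \<or> (odd k \<and> k \<ge> 3)" by presburger
    then consider "k \<le> 2" | "even k \<and> k \<ge> 4" | "odd k \<and> k \<ge> 3" by blast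
    then show ?thesis
    proof cases
      case 1
      then have "c = 1" by (auto simp: c_def)
      then show ?thesis using k_le_2[OF 1] by (simp add: Ck_holder_closure_def)
    next
      case 2
      then have "c = k - 1" by (auto simp: c_def)
      then show ?thesis using k_even[OF 2] by simp
    next
      case 3
      then have "c \<le> k" by (auto simp: c_def)
      then show ?thesis using k_odd[OF 3] Ck_closure_mono by blast
    qed
  qed
  have coeff1: "Ck_closure 1 D (\<lambda>x. a x $ i $ j)" "Ck_closure 1 D (\<lambda>x. b x $ i)" for i j
    using coeff[of i j] Ck_closure_mono[of c D _ 1] by (auto simp: c_def)
  have a_diff: "(\<lambda>x. a x $ i $ j) differentiable (at x)" if "x \<in> D" for i j x
    using coeff1(1)[of i j] that unfolding Ck_closure_def Ck_on_def by (metis One_nat_def less_one list.size(3) partials_Nil)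
  \<comment> \<open>Expanding the divergence adds half the column divergences of \<open>a\<close> to
    the drift. They extend continuously to the compact closure, which makes \<open>\<beta>\<close>
    bounded.\<close>
  define \<beta> where "\<beta> = (\<lambda>x. b x + (\<chi> j. 1/2 * (\<Sum>i\<in>UNIV. partial i (\<lambda>y. a y $ i $ j) x)))"
  have "\<exists>C. \<forall>x\<in>D. \<bar>\<beta> x $ j\<bar> \<le> C" for j
  proof (rule extends_to_closure_bounded[OF D(3)])
    have "Cext 0 D (partial i (\<lambda>y. a y $ i $ j))" for i
      using Ck_closure_Cext[OF coeff1(1)[of i j]] by simp
    then have "Cext 0 D (\<lambda>x. b x $ j + 1/2 * (\<Sum>i\<in>UNIV. partial i (\<lambda>y. a y $ i $ j) x))"
      using Ck_closure_Cext[OF coeff1(2)[of j]]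
      by (intro Cext_add Cext_mult Cext_sum Cext_const D(1)) auto
    then show "extends_to_closure D (\<lambda>x. \<beta> x $ j)" by (simp add: \<beta>_def)
  qed
  then obtain C where C: "\<And>j x. x \<in> D \<Longrightarrow> \<bar>\<beta> x $ j\<bar> \<le> C j" by metis
  have drift: "norm (\<beta> x) \<le> (\<Sum>j\<in>UNIV. C j)" if "x \<in> D" for x
    using norm_le_l1_cart[of "\<beta> x"] sum_mono[of UNIV "\<lambda>j. \<bar>\<beta> x $ j\<bar>" C] C[OF that] by force
  have V_cont: "continuous_on (closure D) V"
  proof -
    have "(k = 0 \<or> k = 2) \<or> (even k \<and> k \<ge> 4) \<or> odd k" by presburger
    then consider "k = 0 \<or> k = 2" | "even k \<and> k \<ge> 4" | "odd k" by blast
    then show ?thesis using assms(20-22) by cases (auto simp: Ck_holder_closure_def Ck_closure_def)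
  qed
  have mu_Ck: "Ck_closure k ?S \<mu>"
    using assms(16,17) Ck_closure_mono[of "k + 1" ?S \<mu> k] unfolding D\<epsilon>_def by (cases "even k") auto
  have sol: "dirichlet_solution D a b V M f \<delta> (\<phi> \<delta>)" if "0 < \<delta>" for \<delta> using assms(28) that by blast
  interpret J: jump_diffusion D \<alpha> \<epsilon> "\<Sum>j\<in>UNIV. C j" M \<mu> V f a \<beta> n k \<phi>
  proof (rule jump_diffusion.intro)
    show "open D" "bounded D" "D \<noteq> {}" "Ck_holder_boundary 2 \<alpha> D" "prob_space M"
      "sets M = sets (restrict_space borel D)" "0 < \<epsilon>" "continuous_on (frontier D) f"
      by (rule assms)+
    show "continuous_on (closure D) V" "Ck_closure k ?S \<mu>" by (rule V_cont mu_Ck)+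
    show "0 < V x" if "x \<in> closure D" for x using assms(11) that by blast
    show "continuous_on (closure D) (\<lambda>x. a x $ i $ j)" for i j using coeff1(1) unfolding Ck_closure_def by blast
    show "transpose (a x) = a x \<and> (\<forall>v. v \<noteq> 0 \<longrightarrow> 0 < v \<bullet> (a x *v v))" if "x \<in> closure D" for x using assms(12) that by blast
    show "norm (\<beta> x) \<le> (\<Sum>j\<in>UNIV. C j)" if "x \<in> D" for x by (rule drift[OF that])
    show "0 \<le> \<mu> x" if "x \<in> ?S" for x using assms(14) that unfolding D\<epsilon>_def by blast
    show "restrict_space M ?S = density (restrict_space lborel ?S) (\<lambda>x. ennreal (\<mu> x))"
      using assms(15) unfolding D\<epsilon>_def .
    show "boundary_value ?S (partials is \<mu>) x = 0" if "length is < k" "x \<in> frontier D" for "is" x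
      using assms(18) that unfolding D\<epsilon>_def by blast
    show "\<exists>is. length is = k \<and> (\<exists>x\<in>frontier D. boundary_value ?S (partials is \<mu>) x \<noteq> 0)"
      using assms(19) unfolding D\<epsilon>_def .
    show "inward_unit_normal D x (n x)" if "x \<in> frontier D" for x using assms(26) that by blast
    fix \<delta> :: real assume \<delta>: "0 < \<delta>"
    note sol = sol[OF \<delta>, unfolded dirichlet_solution_def]
    show C2: "twice_diff_on D (\<phi> \<delta>)" using sol twice_diff_on_Ck by blast
    show "continuous_on (closure D) (\<phi> \<delta>)" using sol by blast
    show "\<phi> \<delta> p = f p" if "p \<in> frontier D" for p using sol that by blast
    show "\<delta> * nondiv_op a \<beta> (\<phi> \<delta>) x = V x * (\<phi> \<delta> x - (LINT y|M. \<phi> \<delta> y))" if x: "x \<in> D" for x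
    proof -
      have "\<delta> * diffusion_op a b (\<phi> \<delta>) x + V x * ((LINT y|M. \<phi> \<delta> y) - \<phi> \<delta> x) = 0" using sol x by blast
      moreover have "diffusion_op a b (\<phi> \<delta>) x = nondiv_op a \<beta> (\<phi> \<delta>) x"
        unfolding \<beta>_def by (rule diffusion_op_nondiv[OF D(1) x C2 a_diff])
      ultimately show ?thesis by (simp add: right_diff_distrib)
    qed
  qed
  have ca: "Cext (k - 1) D (\<lambda>x. a x $ i $ j)" and cb: "Cext (k - 1) D (\<lambda>x. b x $ i)" for i j
    using coeff[of i j] Ck_closure_Cext Cext_mono[of c D _ "k - 1"] by (auto simp: c_def)
  show ?thesis
    unfolding D\<epsilon>_def
    using J.solution_limit J.limit_formula[of b, OF ca cb]
    by (intro exI[of _ "J.surface_sum f / J.surface_sum (\<lambda>x. 1)"] conjI) blast+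
qed

end
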